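(* Let $M$ be an $n$-dimensional manifold with a projective structure $[\nabla]$, $n\ge 2$, with Cartan bundle $H\to P\to M$ and Cartan connection $\mathcal A$. Then $(M,[\nabla])$ uniquely defines $n$ conformal structures $[g^a]$, $a=1,\dots,n$, each of split signature $(n,n)$, and each defined on its own natural $2n$-dimensional bundle $P_a=P/(\sim_a)$ obtained from $P$. Precisely: for each fixed $a\in\{1,\dots,n\}$ the leaf space $P_a=P/(\sim_a)$ is $2n$-dimensional, and the bilinear form $\hat g^a$ on $P$ descends to a unique conformal class $[g^a]$ of metrics of split signature $(n,n)$ on $P_a$, i.e. the pullback to $P$ of any representative of $[g^a]$ is $\hat g^a$ multiplied by a positive function.
   Context: A projective structure $[\nabla]$ on $M$ is an equivalence class of torsion-free affine connections, where $\hat\nabla\sim\nabla$ iff there is a 1-form $A$ with $\hat\nabla_XY=\nabla_XY+A(X)Y+A(Y)X$ for all vector fields $X,Y$. For a representative $\nabla$ and a local coframe $(\theta^a)$ with dual frame $(X_a)$, the connection 1-forms are $\Gamma^a_{~b}=\Gamma^a_{~bc}\theta^c$ with $\nabla_{X_a}X_b=\Gamma^c_{~ba}X_c$; the curvature is $\Omega^a_{~b}=d\Gamma^a_{~b}+\Gamma^a_{~c}\wedge\Gamma^c_{~b}=\frac12R^a_{~bcd}\theta^c\wedge\theta^d$; $R_{ab}=R^c_{~acb}$; the projective Schouten tensor is $\mathsf P_{ab}=\frac1{n-1}R_{(ab)}-\frac1{n+1}R_{[ab]}$ (brackets denote (anti)symmetrization with factor $\frac12$), and $\omega_b=\theta^a\mathsf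 P_{ab}$. Let $H\subset \mathbf{SL}(n+1,\mathbb R)$ be the subgroup of matrices $b=\begin{pmatrix}B&0\\ \lambda&\det(B)^{-1}\end{pmatrix}$ with $B\in\mathbf{GL}(n,\mathbb R)$ and $\lambda\in(\mathbb R^n)^*$. The Cartan bundle $H\to P\to M$ is the principal $H$-bundle carrying the $\mathfrak{sl}(n+1,\mathbb R)$-valued Cartan connection $\mathcal A$ which, near every point of $M$, in a suitable coframe and local trivialization (with $b$ the $H$-coordinate), has the form $$\mathcal A=b^{-1}\begin{pmatrix}\Gamma^a_{~b}-\frac1{n+1}\Gamma^c_{~c}\delta^a_{~b}&\theta^a\\-\omega_b&-\frac1{n+1}\Gamma^c_{~c}\end{pmatrix}b+b^{-1}db.$$ Here $\dim P=n^2+2n$. Define 1-forms $\hat\theta^a,\hat\Gamma^a_{~b}$ on $P$ by writing the entries of $\mathcal A$ as $\mathcal A^a_{~n+1}=\hat\theta^a$, $\mathcal A^{n+1}_{~~n+1}=-\frac1{n+1}\hat\Gamma^c_{~c}$, $\mathcal A^a_{~b}=\hat\Gamma^a_{~b}-\frac1{n+1}\hat\Gamma^c_{~c}\delta^a_{~b}$ ($a,b=1,\dots,n$). For each $a=1,\dots,n$ define on $P$ the bilinear form $$\hat g^a=2\Big(\hat\Gamma^a_{~b}-\tfrac2{n+1}\hat\Gamma^c_{~c}\delta^a_{~b}\Big)\hat\theta^b=2\sum_{\mu=1}^{n+1}\mathcal A^a_{~\mu}\mathcal A^\mu_{~n+1},$$ where $2\lambda\mu=\lambda\otimes\mu+\mu\otimes\lambda$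 for 1-forms. Let $\mathcal D_a\subset TP$ be the rank-$n^2$ distribution annihilated by the $2n$ 1-forms $\hat\theta^b$ and $\hat\Gamma^a_{~b}-\frac2{n+1}\hat\Gamma^c_{~c}\delta^a_{~b}$, $b=1,\dots,n$ ($a$ fixed); it is integrable. The equivalence relation $\sim_a$ identifies points of $P$ lying on the same (connected) integral leaf of $\mathcal D_a$. *)

theory Defs
  imports "HOL-Analysis.Analysis"
begin

section \<open>Smooth manifolds\<close>

primrec ck_on :: "nat \<Rightarrow> 'a::real_normed_vector set \<Rightarrow> ('a \<Rightarrow> 'b::real_normed_vector) \<Rightarrow> bool" where
  "ck_on 0 S f \<longleftrightarrow> continuous_on S f"
| "ck_on (Suc k) S f \<longleftrightarrow>
     (\<forall>x\<in>S. f differentiable (at x)) \<and> (\<forall>v. ck_on k S (\<lambda>x. frechet_derivative f (at x) v))"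

text \<open>\<open>C\<^sup>\<infinity>\<close> maps between normed spaces; only used on open sets.\<close>

definition smooth_on :: "'a::real_normed_vector set \<Rightarrow> ('a \<Rightarrow> 'b::real_normed_vector) \<Rightarrow> bool" where
  "smooth_on S f \<longleftrightarrow> (\<forall>k. ck_on k S f)"

text \<open>A chart is a pair of its domain and its coordinate map; the values of the coordinate map
  outside the domain are irrelevant. The dimension of a manifold is that of its model space \<open>'e\<close>.\<close>

type_synonym ('p, 'e) chart = "'p set \<times> ('p \<Rightarrow> 'e)"

record ('p, 'e) mfd =
  mtop :: "'p topology"
  charts :: "('p, 'e) chart set"

abbreviation pts :: "('p, 'e) mfd \<Rightarrow> 'p set" where
  "pts M \<equiv> topspace (mtop M)"

abbreviation chart_inv :: "('p, 'e) chart \<Rightarrow> 'e \<Rightarrow> 'p" where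
  "chart_inv c \<equiv> inv_into (fst c) (snd c)"

definition is_chart :: "'p topology \<Rightarrow> ('p, 'e::euclidean_space) chart \<Rightarrow> bool" where
  "is_chart X c \<longleftrightarrow> openin X (fst c) \<and> open (snd c ` fst c) \<and>
     homeomorphic_map (subtopology X (fst c)) (top_of_set (snd c ` fst c)) (snd c)"

definition compatible :: "('p, 'e::euclidean_space) chart \<Rightarrow> ('p, 'e) chart \<Rightarrow> bool" where
  "compatible c d \<longleftrightarrow>
     smooth_on (snd c ` (fst c \<inter> fst d)) (snd d \<circ> chart_inv c) \<and>
     smooth_on (snd d ` (fst c \<inter> fst d)) (snd c \<circ> chart_inv d)"

definition smooth_manifold :: "('p, 'e::euclidean_space) mfd \<Rightarrow> bool" where
  "smooth_manifold M \<longleftrightarrow>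
     Hausdorff_space (mtop M) \<and> second_countable (mtop M) \<and>
     (\<forall>c\<in>charts M. is_chart (mtop M) c) \<and>
     pts M = (\<Union>c\<in>charts M. fst c) \<and>
     (\<forall>c\<in>charts M. \<forall>d\<in>charts M. compatible c d)"

definition maximal_atlas :: "('p, 'e::euclidean_space) mfd \<Rightarrow> bool" where
  "maximal_atlas M \<longleftrightarrow>
     (\<forall>c. is_chart (mtop M) c \<and> (\<forall>d\<in>charts M. compatible c d) \<longrightarrow> c \<in> charts M)"

definition prod_mfd ::
    "('p, 'e::euclidean_space) mfd \<Rightarrow> ('q, 'f::euclidean_space) mfd \<Rightarrow> ('p \<times> 'q, 'e \<times> 'f) mfd" where
  "prod_mfd M N =
     \<lparr>mtop = prod_topology (mtop M) (mtop N),
      charts = {(fst c \<times> fst d, map_prod (snd c) (snd d)) |c d. c \<in> charts M \<and> d \<in> charts N}\<rparr>"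

definition smooth_map_on ::
    "('p, 'e::euclidean_space) mfd \<Rightarrow> ('q, 'f::euclidean_space) mfd \<Rightarrow> 'p set \<Rightarrow> ('p \<Rightarrow> 'q) \<Rightarrow> bool" where
  "smooth_map_on M N W f \<longleftrightarrow>
     openin (mtop M) W \<and> continuous_map (subtopology (mtop M) W) (mtop N) f \<and>
     (\<forall>c\<in>charts M. \<forall>d\<in>charts N.
        smooth_on (snd c ` (fst c \<inter> W \<inter> f -` fst d)) (snd d \<circ> f \<circ> chart_inv c))"

definition smooth_fun_on ::
    "('p, 'e::euclidean_space) mfd \<Rightarrow> 'p set \<Rightarrow> ('p \<Rightarrow> real) \<Rightarrow> bool" where
  "smooth_fun_on M W f \<longleftrightarrow>
     openin (mtop M) W \<and> (\<forall>c\<in>charts M. smooth_on (snd c ` (fst c \<inter> W)) (f \<circ> chart_inv c))"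


section \<open>Tangent vectors, vector fields, differential forms\<close>

text \<open>A tangent vector at \<open>p\<close> is the family of its components in all the charts around \<open>p\<close>,
  related by the Jacobians of the coordinate changes. The components in the other charts
  are \<open>0\<close> by convention, so that two tangent vectors are equal iff they are equal as functions.\<close>

type_synonym ('p, 'e) tvec = "('p, 'e) chart \<Rightarrow> 'e"

definition charts_at :: "('p, 'e) mfd \<Rightarrow> 'p \<Rightarrow> ('p, 'e) chart set" where
  "charts_at M p = {c \<in> charts M. p \<in> fst c}"

definition tangent_space :: "('p, 'e::euclidean_space) mfd \<Rightarrow> 'p \<Rightarrow> ('p, 'e) tvec set" where
  "tangent_space M p =
     {v. (\<forall>c. c \<notin> charts_at M p \<longrightarrow> v c = 0) \<and>
         (\<forall>c\<in>charts_at M p. \<forall>d\<in>charts_at M p.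
            v d = frechet_derivative (snd d \<circ> chart_inv c) (at (snd c p)) (v c))}"

text \<open>The tangent vector at \<open>p\<close> with components \<open>e\<close> in the chart \<open>c\<close>.\<close>

definition chart_vec ::
    "('p, 'e::euclidean_space) mfd \<Rightarrow> ('p, 'e) chart \<Rightarrow> 'p \<Rightarrow> 'e \<Rightarrow> ('p, 'e) tvec" where
  "chart_vec M c p e =
     (\<lambda>d. if d \<in> charts_at M p
           then frechet_derivative (snd d \<circ> chart_inv c) (at (snd c p)) e else 0)"

text \<open>The derivative of a map into a manifold and of a map into a vector space. The choice of the
  chart of \<open>M\<close> around \<open>p\<close> is immaterial when \<open>v\<close> is tangent to \<open>M\<close> at \<open>p\<close>.\<close>

definition tangent_map ::
    "('p, 'e::euclidean_space) mfd \<Rightarrow> ('q, 'f::euclidean_space) mfd \<Rightarrow> ('p \<Rightarrow> 'q) \<Rightarrow> 'p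
      \<Rightarrow> ('p, 'e) tvec \<Rightarrow> ('q, 'f) tvec" where
  "tangent_map M N f p v =
     (let c = (SOME c. c \<in> charts_at M p)
      in (\<lambda>d. if d \<in> charts_at N (f p)
            then frechet_derivative (snd d \<circ> f \<circ> chart_inv c) (at (snd c p)) (v c) else 0))"

definition vec_deriv ::
    "('p, 'e::euclidean_space) mfd \<Rightarrow> ('p \<Rightarrow> 'v::real_normed_vector) \<Rightarrow> 'p \<Rightarrow> ('p, 'e) tvec \<Rightarrow> 'v" where
  "vec_deriv M f p v =
     (let c = (SOME c. c \<in> charts_at M p)
      in frechet_derivative (f \<circ> chart_inv c) (at (snd c p)) (v c))"

definition velocity :: "('p, 'e::euclidean_space) mfd \<Rightarrow> (real \<Rightarrow> 'p) \<Rightarrow> ('p, 'e) tvec" where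
  "velocity M \<gamma> =
     (\<lambda>c. if c \<in> charts_at M (\<gamma> 0) then vector_derivative (snd c \<circ> \<gamma>) (at 0) else 0)"

definition submersion ::
    "('p, 'e::euclidean_space) mfd \<Rightarrow> ('q, 'f::euclidean_space) mfd \<Rightarrow> ('p \<Rightarrow> 'q) \<Rightarrow> bool" where
  "submersion M N f \<longleftrightarrow> smooth_map_on M N (pts M) f \<and>
     (\<forall>p\<in>pts M. tangent_map M N f p ` tangent_space M p = tangent_space N (f p))"

type_synonym ('p, 'e) vfield = "'p \<Rightarrow> ('p, 'e) tvec"

definition vector_field_on :: "('p, 'e::euclidean_space) mfd \<Rightarrow> 'p set \<Rightarrow> ('p, 'e) vfield \<Rightarrow> bool" where
  "vector_field_on M W X \<longleftrightarrow>
     openin (mtop M) W \<and> (\<forall>p\<in>W. X p \<in> tangent_space M p) \<and>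
     (\<forall>c\<in>charts M. smooth_on (snd c ` (fst c \<inter> W)) (\<lambda>x. X (chart_inv c x) c))"

text \<open>Global vector fields are normalised to be \<open>0\<close> outside \<open>M\<close>, so that they are equal iff they
  are equal as functions.\<close>

definition vector_field :: "('p, 'e::euclidean_space) mfd \<Rightarrow> ('p, 'e) vfield \<Rightarrow> bool" where
  "vector_field M X \<longleftrightarrow> vector_field_on M (pts M) X \<and> (\<forall>p. p \<notin> pts M \<longrightarrow> X p = (\<lambda>c. 0))"

definition lie_bracket ::
    "('p, 'e::euclidean_space) mfd \<Rightarrow> ('p, 'e) vfield \<Rightarrow> ('p, 'e) vfield \<Rightarrow> ('p, 'e) vfield" where
  "lie_bracket M X Y p =
     (\<lambda>c. if c \<in> charts_at M p
           then frechet_derivative (\<lambda>x. Y (chart_inv c x) c) (at (snd c p)) (X p c)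
              - frechet_derivative (\<lambda>x. X (chart_inv c x) c) (at (snd c p)) (Y p c)
           else 0)"

definition one_form_on ::
    "('p, 'e::euclidean_space) mfd \<Rightarrow> 'p set \<Rightarrow> ('p \<Rightarrow> ('p, 'e) tvec \<Rightarrow> 'v::real_normed_vector) \<Rightarrow> bool" where
  "one_form_on M W \<omega> \<longleftrightarrow>
     openin (mtop M) W \<and>
     (\<forall>p\<in>W. \<forall>v\<in>tangent_space M p. \<forall>w\<in>tangent_space M p. \<forall>r s.
        \<omega> p (\<lambda>c. r *\<^sub>R v c + s *\<^sub>R w c) = r *\<^sub>R \<omega> p v + s *\<^sub>R \<omega> p w) \<and>
     (\<forall>c\<in>charts M. \<forall>e. smooth_on (snd c ` (fst c \<inter> W))
        (\<lambda>x. \<omega> (chart_inv c x) (chart_vec M c (chart_inv c x) e)))"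

text \<open>The exterior derivative of a 1-form, with the convention
  \<open>d\<omega>(X, Y) = X(\<omega>(Y)) - Y(\<omega>(X)) - \<omega>([X, Y])\<close>, computed in a chart on vector fields with
  constant components.\<close>

definition ext_deriv ::
    "('p, 'e::euclidean_space) mfd \<Rightarrow> ('p \<Rightarrow> ('p, 'e) tvec \<Rightarrow> real)
      \<Rightarrow> 'p \<Rightarrow> ('p, 'e) tvec \<Rightarrow> ('p, 'e) tvec \<Rightarrow> real" where
  "ext_deriv M \<omega> p v w =
     (let c = (SOME c. c \<in> charts_at M p);
          comp = (\<lambda>e x. \<omega> (chart_inv c x) (chart_vec M c (chart_inv c x) e))
      in frechet_derivative (comp (w c)) (at (snd c p)) (v c)
       - frechet_derivative (comp (v c)) (at (snd c p)) (w c))"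


section \<open>Projective structures\<close>

type_synonym ('p, 'e) conn = "('p, 'e) vfield \<Rightarrow> ('p, 'e) vfield \<Rightarrow> ('p, 'e) vfield"

text \<open>The \<open>\<real>\<close>-linearity in the second argument follows from additivity and the Leibniz rule.\<close>

definition affine_connection :: "('p, 'e::euclidean_space) mfd \<Rightarrow> ('p, 'e) conn \<Rightarrow> bool" where
  "affine_connection M nabla \<longleftrightarrow>
     (\<forall>X Y. vector_field M X \<longrightarrow> vector_field M Y \<longrightarrow> vector_field M (nabla X Y)) \<and>
     (\<forall>X X' Y f f'. vector_field M X \<longrightarrow> vector_field M X' \<longrightarrow> vector_field M Y \<longrightarrow>
        smooth_fun_on M (pts M) f \<longrightarrow> smooth_fun_on M (pts M) f' \<longrightarrow>
        nabla (\<lambda>p c. f p *\<^sub>R X p c + f' p *\<^sub>R X' p c) Y =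
          (\<lambda>p c. f p *\<^sub>R nabla X Y p c + f' p *\<^sub>R nabla X' Y p c)) \<and>
     (\<forall>X Y Y'. vector_field M X \<longrightarrow> vector_field M Y \<longrightarrow> vector_field M Y' \<longrightarrow>
        nabla X (\<lambda>p c. Y p c + Y' p c) = (\<lambda>p c. nabla X Y p c + nabla X Y' p c)) \<and>
     (\<forall>X Y f. vector_field M X \<longrightarrow> vector_field M Y \<longrightarrow> smooth_fun_on M (pts M) f \<longrightarrow>
        nabla X (\<lambda>p c. f p *\<^sub>R Y p c) =
          (\<lambda>p c. vec_deriv M f p (X p) *\<^sub>R Y p c + f p *\<^sub>R nabla X Y p c))"

definition torsion_free :: "('p, 'e::euclidean_space) mfd \<Rightarrow> ('p, 'e) conn \<Rightarrow> bool" where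
  "torsion_free M nabla \<longleftrightarrow>
     (\<forall>X Y. vector_field M X \<longrightarrow> vector_field M Y \<longrightarrow>
        (\<lambda>p c. nabla X Y p c - nabla Y X p c) = lie_bracket M X Y)"

definition projectively_equivalent ::
    "('p, 'e::euclidean_space) mfd \<Rightarrow> ('p, 'e) conn \<Rightarrow> ('p, 'e) conn \<Rightarrow> bool" where
  "projectively_equivalent M nabla nabla' \<longleftrightarrow>
     (\<exists>\<alpha>. one_form_on M (pts M) \<alpha> \<and>
        (\<forall>X Y. vector_field M X \<longrightarrow> vector_field M Y \<longrightarrow>
           (\<forall>p\<in>pts M. nabla' X Y p =
              (\<lambda>c. nabla X Y p c + \<alpha> p (X p) *\<^sub>R Y p c + \<alpha> p (Y p) *\<^sub>R X p c))))"

definition projective_structure :: "('p, 'e::euclidean_space) mfd \<Rightarrow> ('p, 'e) conn set \<Rightarrow> bool" where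
  "projective_structure M \<PP> \<longleftrightarrow>
     (\<exists>nabla. affine_connection M nabla \<and> torsion_free M nabla \<and>
        \<PP> = {nabla'. affine_connection M nabla' \<and> torsion_free M nabla' \<and>
                projectively_equivalent M nabla nabla'})"

definition dual_frames_on ::
    "('p, real^'n) mfd \<Rightarrow> 'p set \<Rightarrow> ('n \<Rightarrow> 'p \<Rightarrow> ('p, real^'n) tvec \<Rightarrow> real)
      \<Rightarrow> ('n \<Rightarrow> ('p, real^'n) vfield) \<Rightarrow> bool" where
  "dual_frames_on M W \<theta> X \<longleftrightarrow>
     (\<forall>a. one_form_on M W (\<theta> a)) \<and> (\<forall>a. vector_field_on M W (X a)) \<and>
     (\<forall>p\<in>W. \<forall>a b. \<theta> a p (X b p) = (if a = b then 1 else 0))"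

text \<open>\<open>G a b c\<close> is the function \<open>\<Gamma>\<^sup>a\<^sub>b\<^sub>c\<close> with \<open>\<nabla>\<^bsub>X\<^sub>c\<^esub> X\<^sub>b = \<Gamma>\<^sup>a\<^sub>b\<^sub>c X\<^sub>a\<close>. The connection acts on globally defined
  vector fields; it is applied to the local ones \<open>X\<^sub>a\<close>, at a point, through global vector fields
  \<open>Y\<^sub>a\<close> that coincide with them near that point.\<close>

definition connection_coeffs_on ::
    "('p, real^'n) mfd \<Rightarrow> 'p set \<Rightarrow> ('p, real^'n) conn \<Rightarrow> ('n \<Rightarrow> ('p, real^'n) vfield)
      \<Rightarrow> ('n \<Rightarrow> 'n \<Rightarrow> 'n \<Rightarrow> 'p \<Rightarrow> real) \<Rightarrow> bool" where
  "connection_coeffs_on M W nabla X G \<longleftrightarrow>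
     (\<forall>p\<in>W. \<exists>Y V. (\<forall>a. vector_field M (Y a)) \<and> openin (mtop M) V \<and> p \<in> V \<and> V \<subseteq> W \<and>
        (\<forall>q\<in>V. \<forall>a. Y a q = X a q) \<and>
        (\<forall>b c. nabla (Y c) (Y b) p = (\<lambda>k. \<Sum>a\<in>UNIV. G a b c p *\<^sub>R X a p k)))"

definition conn_form ::
    "('n::finite \<Rightarrow> 'p \<Rightarrow> ('p, real^'n) tvec \<Rightarrow> real) \<Rightarrow> ('n \<Rightarrow> 'n \<Rightarrow> 'n \<Rightarrow> 'p \<Rightarrow> real)
      \<Rightarrow> 'n \<Rightarrow> 'n \<Rightarrow> 'p \<Rightarrow> ('p, real^'n) tvec \<Rightarrow> real" where
  "conn_form \<theta> G a b p v = (\<Sum>c\<in>UNIV. G a b c p * \<theta> c p v)"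

definition curv_form ::
    "('p, real^'n) mfd \<Rightarrow> ('n \<Rightarrow> 'p \<Rightarrow> ('p, real^'n) tvec \<Rightarrow> real) \<Rightarrow> ('n \<Rightarrow> 'n \<Rightarrow> 'n \<Rightarrow> 'p \<Rightarrow> real)
      \<Rightarrow> 'n \<Rightarrow> 'n \<Rightarrow> 'p \<Rightarrow> ('p, real^'n) tvec \<Rightarrow> ('p, real^'n) tvec \<Rightarrow> real" where
  "curv_form M \<theta> G a b p v w =
     ext_deriv M (conn_form \<theta> G a b) p v w +
     (\<Sum>c\<in>UNIV. conn_form \<theta> G a c p v * conn_form \<theta> G c b p w
               - conn_form \<theta> G a c p w * conn_form \<theta> G c b p v)"

text \<open>\<open>\<Omega>\<^sup>a\<^sub>b = 1/2 R\<^sup>a\<^sub>b\<^sub>c\<^sub>d \<theta>\<^sup>c \<and> \<theta>\<^sup>d\<close> with \<open>R\<close> skew in \<open>c, d\<close> means \<open>R\<^sup>a\<^sub>b\<^sub>c\<^sub>d = \<Omega>\<^sup>a\<^sub>b(X\<^sub>c, X\<^sub>d)\<close>.\<close>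

definition riemann ::
    "('p, real^'n) mfd \<Rightarrow> ('n \<Rightarrow> 'p \<Rightarrow> ('p, real^'n) tvec \<Rightarrow> real) \<Rightarrow> ('n \<Rightarrow> ('p, real^'n) vfield)
      \<Rightarrow> ('n \<Rightarrow> 'n \<Rightarrow> 'n \<Rightarrow> 'p \<Rightarrow> real) \<Rightarrow> 'n \<Rightarrow> 'n \<Rightarrow> 'n \<Rightarrow> 'n \<Rightarrow> 'p \<Rightarrow> real" where
  "riemann M \<theta> X G a b c d p = curv_form M \<theta> G a b p (X c p) (X d p)"

definition ricci ::
    "('p, real^'n) mfd \<Rightarrow> ('n \<Rightarrow> 'p \<Rightarrow> ('p, real^'n) tvec \<Rightarrow> real) \<Rightarrow> ('n \<Rightarrow> ('p, real^'n) vfield)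
      \<Rightarrow> ('n \<Rightarrow> 'n \<Rightarrow> 'n \<Rightarrow> 'p \<Rightarrow> real) \<Rightarrow> 'n \<Rightarrow> 'n \<Rightarrow> 'p \<Rightarrow> real" where
  "ricci M \<theta> X G a b p = (\<Sum>c\<in>UNIV. riemann M \<theta> X G c a c b p)"

definition schouten ::
    "('p, real^'n) mfd \<Rightarrow> ('n \<Rightarrow> 'p \<Rightarrow> ('p, real^'n) tvec \<Rightarrow> real) \<Rightarrow> ('n \<Rightarrow> ('p, real^'n) vfield)
      \<Rightarrow> ('n \<Rightarrow> 'n \<Rightarrow> 'n \<Rightarrow> 'p \<Rightarrow> real) \<Rightarrow> 'n \<Rightarrow> 'n \<Rightarrow> 'p \<Rightarrow> real" where
  "schouten M \<theta> X G a b p =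
     1 / (real CARD('n) - 1) * ((ricci M \<theta> X G a b p + ricci M \<theta> X G b a p) / 2)
   - 1 / (real CARD('n) + 1) * ((ricci M \<theta> X G a b p - ricci M \<theta> X G b a p) / 2)"

definition schouten_form ::
    "('p, real^'n) mfd \<Rightarrow> ('n \<Rightarrow> 'p \<Rightarrow> ('p, real^'n) tvec \<Rightarrow> real) \<Rightarrow> ('n \<Rightarrow> ('p, real^'n) vfield)
      \<Rightarrow> ('n \<Rightarrow> 'n \<Rightarrow> 'n \<Rightarrow> 'p \<Rightarrow> real) \<Rightarrow> 'n \<Rightarrow> 'p \<Rightarrow> ('p, real^'n) tvec \<Rightarrow> real" where
  "schouten_form M \<theta> X G b p v = (\<Sum>a\<in>UNIV. \<theta> a p v * schouten M \<theta> X G a b p)"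


section \<open>The Cartan bundle of a projective structure\<close>

text \<open>\<open>(n + 1) \<times> (n + 1)\<close> matrices are indexed by \<open>'n option\<close>, the index \<open>n + 1\<close> being \<open>None\<close>.\<close>

type_synonym 'n bmat = "real^('n option)^('n option)"

definition block :: "real^'n^'n \<Rightarrow> real^'n \<Rightarrow> real^'n \<Rightarrow> real \<Rightarrow> 'n::finite bmat" where
  "block B u l s =
     (\<chi> i j. case i of
        Some a \<Rightarrow> (case j of Some b \<Rightarrow> B $ a $ b | None \<Rightarrow> u $ a)
      | None \<Rightarrow> (case j of Some b \<Rightarrow> l $ b | None \<Rightarrow> s))"

definition H_group :: "'n::finite bmat set" where
  "H_group = {block B 0 l (inverse (det B)) |B l. invertible B}"

text \<open>The coordinates \<open>(B, \<lambda>)\<close> form a global chart of \<open>H\<close>.\<close>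

definition H_mfd :: "('n::finite bmat, (real^'n^'n) \<times> (real^'n)) mfd" where
  "H_mfd = \<lparr>mtop = top_of_set H_group,
            charts = {(H_group, \<lambda>h. (\<chi> a b. h $ Some a $ Some b, \<chi> a. h $ None $ Some a))}\<rparr>"

definition sl :: "'n::finite bmat set" where
  "sl = {Z. trace Z = 0}"

text \<open>\<open>b\<close> is the \<open>H\<close>-coordinate of an \<open>H\<close>-equivariant diffeomorphism \<open>\<pi>\<inverse>(U) \<rightarrow> U \<times> H\<close> over \<open>U\<close>.\<close>

definition local_trivialization ::
    "('m, 'e::euclidean_space) mfd \<Rightarrow> ('p, 'f::euclidean_space) mfd \<Rightarrow> ('p \<Rightarrow> 'm)
      \<Rightarrow> ('p \<Rightarrow> 'n::finite bmat \<Rightarrow> 'p) \<Rightarrow> 'm set \<Rightarrow> ('p \<Rightarrow> 'n bmat) \<Rightarrow> bool" where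
  "local_trivialization M P \<pi> act U b \<longleftrightarrow>
     (let PU = {p \<in> pts P. \<pi> p \<in> U}; \<Phi> = (\<lambda>p. (\<pi> p, b p))
      in openin (mtop M) U \<and>
         bij_betw \<Phi> PU (U \<times> H_group) \<and>
         smooth_map_on P (prod_mfd M H_mfd) PU \<Phi> \<and>
         smooth_map_on (prod_mfd M H_mfd) P (U \<times> H_group) (inv_into PU \<Phi>) \<and>
         (\<forall>p\<in>PU. \<forall>h\<in>H_group. b (act p h) = b p ** h))"

definition principal_H_bundle ::
    "('m, 'e::euclidean_space) mfd \<Rightarrow> ('p, 'f::euclidean_space) mfd \<Rightarrow> ('p \<Rightarrow> 'm)
      \<Rightarrow> ('p \<Rightarrow> 'n::finite bmat \<Rightarrow> 'p) \<Rightarrow> bool" where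
  "principal_H_bundle M P \<pi> act \<longleftrightarrow>
     smooth_manifold M \<and> smooth_manifold P \<and>
     smooth_map_on P M (pts P) \<pi> \<and> \<pi> ` pts P = pts M \<and>
     smooth_map_on (prod_mfd P H_mfd) P (pts P \<times> H_group) (\<lambda>(p, h). act p h) \<and>
     (\<forall>p\<in>pts P. act p (mat 1) = p) \<and>
     (\<forall>p\<in>pts P. \<forall>h\<in>H_group. \<forall>k\<in>H_group. act (act p h) k = act p (h ** k)) \<and>
     (\<forall>p\<in>pts P. \<forall>h\<in>H_group. \<pi> (act p h) = \<pi> p) \<and>
     (\<forall>x\<in>pts M. \<exists>U b. x \<in> U \<and> local_trivialization M P \<pi> act U b)"

definition cartan_connection ::
    "('p, 'f::euclidean_space) mfd \<Rightarrow> ('p \<Rightarrow> 'n::finite bmat \<Rightarrow> 'p)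
      \<Rightarrow> ('p \<Rightarrow> ('p, 'f) tvec \<Rightarrow> 'n bmat) \<Rightarrow> bool" where
  "cartan_connection P act A \<longleftrightarrow>
     one_form_on P (pts P) A \<and>
     (\<forall>p\<in>pts P. bij_betw (A p) (tangent_space P p) sl) \<and>
     (\<forall>p\<in>pts P. \<forall>h\<in>H_group. \<forall>v\<in>tangent_space P p.
        A (act p h) (tangent_map P P (\<lambda>q. act q h) p v) = matrix_inv h ** A p v ** h) \<and>
     (\<forall>p\<in>pts P. \<forall>\<gamma> Z. (\<forall>t. \<gamma> t \<in> H_group) \<and> \<gamma> 0 = mat 1 \<and> (\<gamma> has_vector_derivative Z) (at 0) \<longrightarrow>
        A p (velocity P (\<lambda>t. act p (\<gamma> t))) = Z)"

text \<open>The matrix of 1-forms on \<open>M\<close> from which the Cartan connection is built.\<close>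

definition cartan_gauge ::
    "('m, real^'n) mfd \<Rightarrow> ('n \<Rightarrow> 'm \<Rightarrow> ('m, real^'n) tvec \<Rightarrow> real) \<Rightarrow> ('n \<Rightarrow> ('m, real^'n) vfield)
      \<Rightarrow> ('n \<Rightarrow> 'n \<Rightarrow> 'n \<Rightarrow> 'm \<Rightarrow> real) \<Rightarrow> 'm \<Rightarrow> ('m, real^'n) tvec \<Rightarrow> 'n bmat" where
  "cartan_gauge M \<theta> X G x v =
     (let t = 1 / (real CARD('n) + 1) * (\<Sum>c\<in>UNIV. conn_form \<theta> G c c x v)
      in block (\<chi> a b. conn_form \<theta> G a b x v - t * (if a = b then 1 else 0))
               (\<chi> a. \<theta> a x v)
               (\<chi> b. - schouten_form M \<theta> X G b x v)
               (- t))"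

definition cartan_bundle ::
    "('m, real^'n) mfd \<Rightarrow> ('m, real^'n) conn set \<Rightarrow> ('p, 'f::euclidean_space) mfd \<Rightarrow> ('p \<Rightarrow> 'm)
      \<Rightarrow> ('p \<Rightarrow> 'n::finite bmat \<Rightarrow> 'p) \<Rightarrow> ('p \<Rightarrow> ('p, 'f) tvec \<Rightarrow> 'n bmat) \<Rightarrow> bool" where
  "cartan_bundle M \<PP> P \<pi> act A \<longleftrightarrow>
     principal_H_bundle M P \<pi> act \<and> cartan_connection P act A \<and>
     (\<forall>x\<in>pts M. \<exists>nabla\<in>\<PP>. \<exists>U \<theta> X G b.
        x \<in> U \<and> dual_frames_on M U \<theta> X \<and> connection_coeffs_on M U nabla X G \<and>
        local_trivialization M P \<pi> act U b \<and>
        (\<forall>p\<in>pts P. \<pi> p \<in> U \<longrightarrow> (\<forall>v\<in>tangent_space P p.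
           A p v = matrix_inv (b p) ** cartan_gauge M \<theta> X G (\<pi> p) (tangent_map P M \<pi> p v) ** b p
                 + matrix_inv (b p) ** vec_deriv P b p v)))"


section \<open>The forms and distributions on the Cartan bundle\<close>

definition hat_theta ::
    "('p \<Rightarrow> ('p, 'f) tvec \<Rightarrow> 'n::finite bmat) \<Rightarrow> 'n \<Rightarrow> 'p \<Rightarrow> ('p, 'f) tvec \<Rightarrow> real" where
  "hat_theta A a p v = A p v $ Some a $ None"

text \<open>Solution of the equations that define \<open>\<Gamma>\<close>-hat, see \<open>hat_Gamma_eqs\<close> below.\<close>

definition hat_Gamma ::
    "('p \<Rightarrow> ('p, 'f) tvec \<Rightarrow> 'n::finite bmat) \<Rightarrow> 'n \<Rightarrow> 'n \<Rightarrow> 'p \<Rightarrow> ('p, 'f) tvec \<Rightarrow> real" where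
  "hat_Gamma A a b p v = A p v $ Some a $ Some b - (if a = b then A p v $ None $ None else 0)"

definition hat_eta ::
    "('p \<Rightarrow> ('p, 'f) tvec \<Rightarrow> 'n::finite bmat) \<Rightarrow> 'n \<Rightarrow> 'n \<Rightarrow> 'p \<Rightarrow> ('p, 'f) tvec \<Rightarrow> real" where
  "hat_eta A a b p v =
     hat_Gamma A a b p v
     - 2 / (real CARD('n) + 1) * (\<Sum>c\<in>UNIV. hat_Gamma A c c p v) * (if a = b then 1 else 0)"

definition hat_g ::
    "('p \<Rightarrow> ('p, 'f) tvec \<Rightarrow> 'n::finite bmat) \<Rightarrow> 'n \<Rightarrow> 'p \<Rightarrow> ('p, 'f) tvec \<Rightarrow> ('p, 'f) tvec \<Rightarrow> real" where
  "hat_g A a p v w =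
     (\<Sum>b\<in>UNIV. hat_eta A a b p v * hat_theta A b p w + hat_theta A b p v * hat_eta A a b p w)"

definition dist_D ::
    "('p, 'f::euclidean_space) mfd \<Rightarrow> ('p \<Rightarrow> ('p, 'f) tvec \<Rightarrow> 'n::finite bmat) \<Rightarrow> 'n
      \<Rightarrow> 'p \<Rightarrow> ('p, 'f) tvec set" where
  "dist_D P A a p =
     {v \<in> tangent_space P p. \<forall>b. hat_theta A b p v = 0 \<and> hat_eta A a b p v = 0}"

lemma sum_option: "(\<Sum>i\<in>UNIV. f i) = f None + (\<Sum>a\<in>UNIV. f (Some a))"
  for f :: "'n::finite option \<Rightarrow> real"
  by (simp add: UNIV_option_conv sum.reindex)

lemma hat_Gamma_trace:
  fixes A :: "'p \<Rightarrow> ('p, 'f) tvec \<Rightarrow> 'n::finite bmat"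
  assumes "A p v \<in> sl"
  shows "(\<Sum>c\<in>UNIV. hat_Gamma A c c p v) = - (real CARD('n) + 1) * A p v $ None $ None"
  using assms by (simp add: sl_def trace_def sum_option hat_Gamma_def sum_subtractf algebra_simps)

lemma hat_Gamma_eqs:
  fixes A :: "'p \<Rightarrow> ('p, 'f) tvec \<Rightarrow> 'n::finite bmat"
  assumes "A p v \<in> sl"
  shows "A p v $ None $ None = - (1 / (real CARD('n) + 1)) * (\<Sum>c\<in>UNIV. hat_Gamma A c c p v)"
    and "A p v $ Some a $ Some b = hat_Gamma A a b p v
           - 1 / (real CARD('n) + 1) * (\<Sum>c\<in>UNIV. hat_Gamma A c c p v) * (if a = b then 1 else 0)"
  unfolding hat_Gamma_trace[of A p v, OF assms] by (simp_all add: hat_Gamma_def field_simps)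

lemma hat_g_eq:
  fixes A :: "'p \<Rightarrow> ('p, 'f) tvec \<Rightarrow> 'n::finite bmat"
  assumes "A p v \<in> sl" "A p w \<in> sl"
  shows "hat_g A a p v w =
    (\<Sum>\<mu>\<in>UNIV. A p v $ Some a $ \<mu> * A p w $ \<mu> $ None + A p w $ Some a $ \<mu> * A p v $ \<mu> $ None)"
proof -
  have eta: "hat_eta A a b p u = A p u $ Some a $ Some b + (if a = b then A p u $ None $ None else 0)"
    if "A p u \<in> sl" for b u
    unfolding hat_eta_def hat_Gamma_trace[of A p u, OF that] by (simp add: hat_Gamma_def field_simps)
  have "hat_g A a p v w = (\<Sum>b\<in>UNIV.
      (A p v $ Some a $ Some b * A p w $ Some b $ None + A p w $ Some a $ Some b * A p v $ Some b $ None)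
      + (if a = b then A p v $ None $ None * A p w $ Some b $ None
                     + A p w $ None $ None * A p v $ Some b $ None else 0))"
    unfolding hat_g_def eta[OF assms(1)] eta[OF assms(2)] hat_theta_def
    by (rule sum.cong) (simp_all add: algebra_simps)
  then show ?thesis
    by (simp add: sum.distrib sum_option algebra_simps)
qed


section \<open>Leaf spaces\<close>

text \<open>A connected immersed submanifold of \<open>P\<close>, of dimension \<open>DIM('k)\<close>, whose tangent spaces are
  the spaces of the distribution \<open>D\<close>. Its topology may be finer than the subspace topology.\<close>

definition integral_manifold ::
    "('p, 'f::euclidean_space) mfd \<Rightarrow> ('p \<Rightarrow> ('p, 'f) tvec set) \<Rightarrow> ('p, 'k::euclidean_space) mfd \<Rightarrow> bool" where
  "integral_manifold P D N \<longleftrightarrow>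
     smooth_manifold N \<and> connected_space (mtop N) \<and> pts N \<noteq> {} \<and>
     smooth_map_on N P (pts N) (\<lambda>p. p) \<and>
     (\<forall>p\<in>pts N. bij_betw (tangent_map N P (\<lambda>p. p) p) (tangent_space N p) (D p))"

text \<open>The type argument fixes the model space of the leaves, hence their dimension.\<close>

definition leaf ::
    "'k::euclidean_space itself \<Rightarrow> ('p, 'f::euclidean_space) mfd \<Rightarrow> ('p \<Rightarrow> ('p, 'f) tvec set)
      \<Rightarrow> 'p set \<Rightarrow> bool" where
  "leaf k P D L \<longleftrightarrow>
     (\<exists>N :: ('p, 'k) mfd. integral_manifold P D N \<and> pts N = L) \<and>
     (\<forall>N :: ('p, 'k) mfd. integral_manifold P D N \<and> L \<subseteq> pts N \<longrightarrow> pts N = L)"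

definition leaf_rel ::
    "('p, 'f::euclidean_space) mfd \<Rightarrow> ('p \<Rightarrow> ('p, 'f) tvec \<Rightarrow> 'n::finite bmat) \<Rightarrow> 'n \<Rightarrow> ('p \<times> 'p) set" where
  "leaf_rel P A a =
     {(p, q). \<exists>L. leaf TYPE(real^'n^'n) P (dist_D P A a) L \<and> p \<in> L \<and> q \<in> L}"

definition quotient_manifold ::
    "('p, 'f::euclidean_space) mfd \<Rightarrow> ('p \<times> 'p) set \<Rightarrow> ('p set, 'e::euclidean_space) mfd \<Rightarrow> bool" where
  "quotient_manifold P R Q \<longleftrightarrow>
     smooth_manifold Q \<and> maximal_atlas Q \<and> pts Q = pts P // R \<and>
     quotient_map (mtop P) (mtop Q) (\<lambda>p. R `` {p}) \<and>
     submersion P Q (\<lambda>p. R `` {p})"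


section \<open>Conformal structures\<close>

type_synonym ('p, 'e) bilin = "'p \<Rightarrow> ('p, 'e) tvec \<Rightarrow> ('p, 'e) tvec \<Rightarrow> real"

definition metric :: "('p, 'e::euclidean_space) mfd \<Rightarrow> ('p, 'e) bilin \<Rightarrow> bool" where
  "metric M g \<longleftrightarrow>
     (\<forall>p\<in>pts M. \<forall>u\<in>tangent_space M p. \<forall>v\<in>tangent_space M p. \<forall>w\<in>tangent_space M p. \<forall>r s.
        g p (\<lambda>c. r *\<^sub>R u c + s *\<^sub>R v c) w = r * g p u w + s * g p v w) \<and>
     (\<forall>p\<in>pts M. \<forall>v\<in>tangent_space M p. \<forall>w\<in>tangent_space M p. g p v w = g p w v) \<and>
     (\<forall>p\<in>pts M. \<forall>v\<in>tangent_space M p. (\<forall>w\<in>tangent_space M p. g p v w = 0) \<longrightarrow> v = (\<lambda>c. 0)) \<and>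
     (\<forall>c\<in>charts M. \<forall>e e'. smooth_on (snd c ` fst c)
        (\<lambda>x. g (chart_inv c x) (chart_vec M c (chart_inv c x) e) (chart_vec M c (chart_inv c x) e')))"

definition conformal_class :: "('p, 'e::euclidean_space) mfd \<Rightarrow> ('p, 'e) bilin set \<Rightarrow> bool" where
  "conformal_class M C \<longleftrightarrow>
     (\<exists>g. metric M g \<and>
        C = {g'. metric M g' \<and>
               (\<exists>f. smooth_fun_on M (pts M) f \<and> (\<forall>p\<in>pts M. f p > 0) \<and>
                  (\<forall>p\<in>pts M. \<forall>v\<in>tangent_space M p. \<forall>w\<in>tangent_space M p.
                     g' p v w = f p * g p v w))})"

text \<open>Signature \<open>(n, n)\<close>, \<open>n = CARD('n)\<close>: at each point there is a basis \<open>(e\<^sub>i), (f\<^sub>i)\<close>, \<open>i \<in> 'n\<close>, of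
  the tangent space that is orthonormal with the \<open>e\<^sub>i\<close> of square \<open>1\<close> and the \<open>f\<^sub>i\<close> of square \<open>-1\<close>
  (linear independence follows from orthonormality).\<close>

definition split_signature ::
    "'n::finite itself \<Rightarrow> ('p, 'e::euclidean_space) mfd \<Rightarrow> ('p, 'e) bilin \<Rightarrow> bool" where
  "split_signature n M g \<longleftrightarrow>
     (\<forall>p\<in>pts M. \<exists>e f :: 'n \<Rightarrow> ('p, 'e) tvec.
        range e \<subseteq> tangent_space M p \<and> range f \<subseteq> tangent_space M p \<and>
        (\<forall>i j. g p (e i) (e j) = (if i = j then 1 else 0) \<and>
               g p (f i) (f j) = (if i = j then -1 else 0) \<and>
               g p (e i) (f j) = 0) \<and>
        (\<forall>v\<in>tangent_space M p. \<exists>r s. v = (\<lambda>c. \<Sum>i\<in>UNIV. r i *\<^sub>R e i c + s i *\<^sub>R f i c)))"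

definition pulls_back_to_multiple ::
    "('p, 'f::euclidean_space) mfd \<Rightarrow> ('q, 'e::euclidean_space) mfd \<Rightarrow> ('p \<Rightarrow> 'q)
      \<Rightarrow> ('q, 'e) bilin \<Rightarrow> ('p, 'f) bilin \<Rightarrow> bool" where
  "pulls_back_to_multiple P Q q g h \<longleftrightarrow>
     (\<exists>f. smooth_fun_on P (pts P) f \<and> (\<forall>p\<in>pts P. f p > 0) \<and>
        (\<forall>p\<in>pts P. \<forall>v\<in>tangent_space P p. \<forall>w\<in>tangent_space P p.
           g (q p) (tangent_map P Q q p v) (tangent_map P Q q p w) = f p * h p v w))"

end

theory Submission
  imports Defs
begin

text \<open>In a local trivialisation with \<open>H\<close>-coordinate \<open>(B, l)\<close> let \<open>\<mu>\<close> be \<open>det B\<close> times row \<open>a\<close> of \<open>B\<inverse>\<close>,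
  so that \<open>\<mu> B = det B e\<^sub>a\<close>. Differentiating this identity and inserting it into
  \<open>b A = \<Gamma> b + db\<close> shows that \<open>(det B)\<^sup>2\<close> times the bilinear form depends only on \<open>(\<pi>, \<mu>)\<close> and its
  derivative, and that the distribution is the kernel of the derivative of \<open>(\<pi>, \<mu>)\<close>. The leaves are
  therefore the connected components of the fibres of \<open>(\<pi>, \<mu>)\<close>, that is, the sets on which
  \<open>(\<pi>, \<mu>)\<close> and the sign of \<open>det B\<close> are constant; they are connected because matrices with
  positive determinant are. The maps \<open>(\<pi>, \<mu>)\<close> have local sections, so they induce the charts of the
  leaf space. The local metrics found above are glued with bump functions on \<open>M\<close>.\<close>

section \<open>Calculus of smooth maps\<close>

text \<open>The cofactor row comes from the structure group. If a trace-free matrix has vanishing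
  \<open>hat_theta\<close> and \<open>hat_eta\<close> components, then row a of its upper left block
  Y is tr(Y) e_a. This is the linearisation at C = 1 of the condition e_a C = det C e_a, and det(B)
  e_a B^-1 is invariant under B -> B C for exactly these C. The bilinear form itself is not constant
  along a leaf: there det C takes all positive values, and the form scales by its inverse square. So
  a metric appears only after rescaling, and the factor (det B)^2 depends on the trivialisation. The
  condition for a rescaled form to descend is linear in the factor; hence any nonnegative
  combination of the local factors that is positive everywhere will do, and no partition of unity
  with sum 1 is required. The bound n >= 2 provides a second index, which absorbs the determinant
  when \<open>\<mu>\<close> is varied and the trace when a value of the connection is
  prescribed.\<close>

lemma ck_on_continuous_on: "ck_on k S f \<Longrightarrow> continuous_on S f"
  by (cases k) (auto simp: differentiable_imp_continuous_within continuous_at_imp_continuous_on)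

lemma ck_on_SucD: "ck_on (Suc k) S f \<Longrightarrow> ck_on k S f"
proof (induction k arbitrary: f)
  case 0
  then show ?case using ck_on_continuous_on by fastforce
qed simp

lemma ck_on_subset: "ck_on k S f \<Longrightarrow> T \<subseteq> S \<Longrightarrow> ck_on k T f"
  by (induction k arbitrary: f) (auto intro: continuous_on_subset)

lemma frechet_derivative_cong_open:
  assumes "open S" "x \<in> S" "\<And>y. y \<in> S \<Longrightarrow> f y = g y"
  shows "frechet_derivative f (at x) = frechet_derivative g (at x)"
proof -
  have "(f has_derivative D) (at x) \<longleftrightarrow> (g has_derivative D) (at x)" for D
    using has_derivative_transform_within_open[OF _ assms(1,2)] assms(3) by metis
  then show ?thesis by (simp add: frechet_derivative_def)
qed

lemma differentiable_cong_open:
  assumes "open S" "x \<in> S" "\<And>y. y \<in> S \<Longrightarrow> f y = g y"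
  shows "f differentiable (at x) \<longleftrightarrow> g differentiable (at x)"
  unfolding differentiable_def
  using has_derivative_transform_within_open[OF _ assms(1,2)] assms(3) by metis

lemma ck_on_cong:
  assumes "open S" "\<And>x. x \<in> S \<Longrightarrow> f x = g x"
  shows "ck_on k S f \<longleftrightarrow> ck_on k S g"
  using assms(2)
proof (induction k arbitrary: f g)
  case 0
  then have "continuous_on S f \<longleftrightarrow> continuous_on S g" by (intro continuous_on_cong) auto
  then show ?case by simp
next
  case (Suc k)
  have "(\<forall>x\<in>S. f differentiable at x) \<longleftrightarrow> (\<forall>x\<in>S. g differentiable at x)"
    using differentiable_cong_open[OF assms(1)] Suc.prems by blast
  moreover have "ck_on k S (\<lambda>x. frechet_derivative f (at x) v) \<longleftrightarrow>
      ck_on k S (\<lambda>x. frechet_derivative g (at x) v)" for v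
    by (rule Suc.IH) (metis Suc.prems assms(1) frechet_derivative_cong_open)
  ultimately show ?case by simp
qed

lemma ck_on_local:
  assumes "\<And>x. x \<in> S \<Longrightarrow> \<exists>T. open T \<and> x \<in> T \<and> ck_on k T f"
  shows "ck_on k S f"
  using assms
proof (induction k arbitrary: f)
  case 0
  have "isCont f x" if "x \<in> S" for x
    using 0[OF that] by (auto simp: continuous_on_eq_continuous_at)
  then show ?case by (simp add: continuous_at_imp_continuous_on)
next
  case (Suc k)
  have "f differentiable at x" if "x \<in> S" for x
    using Suc.prems[OF that] by auto
  moreover have "ck_on k S (\<lambda>x. frechet_derivative f (at x) v)" for v
    by (rule Suc.IH) (use Suc.prems in force)
  ultimately show ?case by simp
qed

lemma ck_on_const [simp]: "ck_on k S (\<lambda>x. c)"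
  by (induction k arbitrary: c) (auto simp: frechet_derivative_const)

text \<open>The derivative at every point is f itself, so each directional derivative is
  constant.\<close>

lemma ck_on_linear: "bounded_linear f \<Longrightarrow> ck_on k S f"
proof (cases k)
  case (Suc m)
  assume f: "bounded_linear f"
  have "frechet_derivative f (at x) = f" for x
    using f by (metis bounded_linear_imp_has_derivative frechet_derivative_at)
  then show ?thesis using f Suc by (auto intro: bounded_linear_imp_differentiable)
qed (simp add: linear_continuous_on)

lemma frechet_derivative_at': "(f has_derivative f') (at x) \<Longrightarrow> frechet_derivative f (at x) = f'"
  using frechet_derivative_at by metis

lemma ck_on_bounded_linear:
  assumes L: "bounded_linear L" and S: "open S" and "ck_on k S f"
  shows "ck_on k S (\<lambda>x. L (f x))"
  using assms(3)
proof (induction k arbitrary: f)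
  case 0
  then show ?case using bounded_linear.continuous_on[OF L] by auto
next
  case (Suc k)
  have d: "((\<lambda>x. L (f x)) has_derivative (\<lambda>v. L (frechet_derivative f (at x) v))) (at x)"
    if "x \<in> S" for x
    by (rule bounded_linear.has_derivative[OF L]) (use Suc.prems that in \<open>auto simp: frechet_derivative_works\<close>)
  have "ck_on k S (\<lambda>x. frechet_derivative (\<lambda>x. L (f x)) (at x) v)" for v
    using Suc by (subst ck_on_cong[OF S, of _ "\<lambda>x. L (frechet_derivative f (at x) v)"])
      (auto simp: frechet_derivative_at'[OF d])
  then show ?case using d by (auto simp: differentiable_def)
qed

lemma ck_on_add:
  assumes S: "open S" and "ck_on k S f" "ck_on k S g"
  shows "ck_on k S (\<lambda>x. f x + g x)"
  using assms(2,3)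
proof (induction k arbitrary: f g)
  case 0
  then show ?case by (auto intro: continuous_intros)
next
  case (Suc k)
  have d: "((\<lambda>x. f x + g x) has_derivative
      (\<lambda>v. frechet_derivative f (at x) v + frechet_derivative g (at x) v)) (at x)"
    if "x \<in> S" for x
    using Suc.prems that by (auto simp: frechet_derivative_works intro: has_derivative_add)
  have "ck_on k S (\<lambda>x. frechet_derivative (\<lambda>x. f x + g x) (at x) v)" for v
    using Suc by (subst ck_on_cong[OF S, of _
          "\<lambda>x. frechet_derivative f (at x) v + frechet_derivative g (at x) v"])
      (auto simp: frechet_derivative_at'[OF d])
  then show ?case using d by (auto simp: differentiable_def)
qed

text \<open>The product rule gives a sum of two values of B, each with one undifferentiated factor.
  That factor has order k by \<open>ck_on_SucD\<close>, so the induction hypothesis, general in f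
  and g, applies to both terms.\<close>

lemma ck_on_bilinear:
  assumes B: "bounded_bilinear B" and S: "open S" and "ck_on k S f" "ck_on k S g"
  shows "ck_on k S (\<lambda>x. B (f x) (g x))"
  using assms(3,4)
proof (induction k arbitrary: f g)
  case 0
  then show ?case using bounded_bilinear.continuous_on[OF B] by auto
next
  case (Suc k)
  have d: "((\<lambda>x. B (f x) (g x)) has_derivative
      (\<lambda>v. B (f x) (frechet_derivative g (at x) v) + B (frechet_derivative f (at x) v) (g x))) (at x)"
    if "x \<in> S" for x
    by (rule bounded_bilinear.FDERIV[OF B]) (use Suc.prems that in \<open>auto simp: frechet_derivative_works\<close>)
  have "ck_on k S (\<lambda>x. frechet_derivative (\<lambda>x. B (f x) (g x)) (at x) v)" for v
  proof (subst ck_on_cong[OF S, of _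
          "\<lambda>x. B (f x) (frechet_derivative g (at x) v) + B (frechet_derivative f (at x) v) (g x)"])
    show "ck_on k S (\<lambda>x. B (f x) (frechet_derivative g (at x) v) + B (frechet_derivative f (at x) v) (g x))"
      using Suc ck_on_SucD[OF Suc.prems(1)] ck_on_SucD[OF Suc.prems(2)]
      by (intro ck_on_add S Suc.IH) auto
  qed (auto simp: frechet_derivative_at'[OF d])
  then show ?case using d by (auto simp: differentiable_def)
qed

lemma ck_on_sum:
  assumes S: "open S" and "\<And>i. i \<in> I \<Longrightarrow> ck_on k S (f i)"
  shows "ck_on k S (\<lambda>x. \<Sum>i\<in>I. f i x)"
  using assms(2) by (induction I rule: infinite_finite_induct) (auto intro!: ck_on_add S)

text \<open>\<open>ck_on\<close> controls derivatives in fixed directions only, whereas the chain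
  rule differentiates f in the direction of a moving vector. Expanding that vector in the standard
  basis brings back fixed directions; this is why the middle space of a composition is
  Euclidean.\<close>

lemma linear_frechet_derivative_sum_Basis:
  fixes f :: "'a::euclidean_space \<Rightarrow> 'b::real_normed_vector"
  assumes "f differentiable (at x)"
  shows "frechet_derivative f (at x) v = (\<Sum>b\<in>Basis. (v \<bullet> b) *\<^sub>R frechet_derivative f (at x) b)"
proof -
  have "linear (frechet_derivative f (at x))"
    using assms by (rule linear_frechet_derivative)
  from linear_sum[OF this, of "\<lambda>b. (v \<bullet> b) *\<^sub>R b" Basis] linear_cmul[OF this]
  show ?thesis by (simp add: euclidean_representation)
qed

lemma ck_on_compose:
  fixes f :: "'b::euclidean_space \<Rightarrow> 'c::real_normed_vector" and g :: "'a::real_normed_vector \<Rightarrow> 'b"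
  assumes S: "open S" and T: "open T" and gS: "g ` S \<subseteq> T" and f: "ck_on k T f" and g: "ck_on k S g"
  shows "ck_on k S (\<lambda>x. f (g x))"
  using f g
proof (induction k arbitrary: f)
  case 0
  then show ?case using gS by (auto intro: continuous_on_compose2)
next
  case (Suc k)
  let ?df = "\<lambda>b x. frechet_derivative f (at x) b"
  let ?D = "\<lambda>v x. \<Sum>b\<in>Basis. (frechet_derivative g (at x) v \<bullet> b) *\<^sub>R ?df b (g x)"
  have d: "((\<lambda>x. f (g x)) has_derivative (\<lambda>v. ?D v x)) (at x)" if x: "x \<in> S" for x
  proof -
    have fd: "f differentiable at (g x)" using Suc.prems x gS by auto
    have "((\<lambda>x. f (g x)) has_derivative
        (\<lambda>v. frechet_derivative f (at (g x)) (frechet_derivative g (at x) v))) (at x)"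
      using Suc.prems x fd by (intro has_derivative_compose[of g _ x UNIV f])
         (auto simp: frechet_derivative_works)
    then show ?thesis
      by (subst (asm) linear_frechet_derivative_sum_Basis[OF fd])
  qed
  have "ck_on k S (\<lambda>x. frechet_derivative (\<lambda>x. f (g x)) (at x) v)" for v
  proof (subst ck_on_cong[OF S, of _ "?D v"])
    show "ck_on k S (?D v)"
    proof (intro ck_on_sum S ck_on_bilinear[OF bounded_bilinear_scaleR])
      fix b :: 'b
      show "ck_on k S (\<lambda>x. frechet_derivative g (at x) v \<bullet> b)"
        using Suc.prems by (intro ck_on_bounded_linear[OF bounded_linear_inner_left] S) auto
      show "ck_on k S (\<lambda>x. ?df b (g x))"
        using Suc.prems ck_on_SucD[OF Suc.prems(2)] by (intro Suc.IH) auto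
    qed
  qed (auto simp: frechet_derivative_at'[OF d])
  then show ?case using d by (auto simp: differentiable_def)
qed

text \<open>In the derivative - f' / f^2 the function inverse f occurs undifferentiated, so its
  order k yields order k + 1.\<close>

lemma ck_on_inverse:
  fixes f :: "'a::real_normed_vector \<Rightarrow> real"
  assumes S: "open S" and "ck_on k S f" and nz: "\<And>x. x \<in> S \<Longrightarrow> f x \<noteq> 0"
  shows "ck_on k S (\<lambda>x. inverse (f x))"
  using assms(2)
proof (induction k)
  case 0
  then show ?case using nz by (auto intro!: continuous_on_inverse)
next
  case (Suc k)
  let ?D = "\<lambda>v x. - (inverse (f x) * frechet_derivative f (at x) v * inverse (f x))"
  have d: "((\<lambda>x. inverse (f x)) has_derivative (\<lambda>v. ?D v x)) (at x)" if x: "x \<in> S" for x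
    using Suc.prems x nz[OF x] by (intro Deriv.has_derivative_inverse) (auto simp: frechet_derivative_works)
  have "ck_on k S (\<lambda>x. frechet_derivative (\<lambda>x. inverse (f x)) (at x) v)" for v
  proof (subst ck_on_cong[OF S, of _ "?D v"])
    show "ck_on k S (?D v)"
      using Suc.IH ck_on_SucD[OF Suc.prems] Suc.prems
      by (intro ck_on_bounded_linear[OF bounded_linear_minus[OF bounded_linear_ident]] S
          ck_on_bilinear[OF bounded_bilinear_mult]) auto
  qed (auto simp: frechet_derivative_at'[OF d])
  then show ?case using d by (auto simp: differentiable_def)
qed

section \<open>Closure properties of smooth maps on open sets\<close>

lemma smooth_onD_continuous: "smooth_on S f \<Longrightarrow> continuous_on S f"
  using ck_on_continuous_on smooth_on_def by blast

lemma smooth_on_differentiable: "smooth_on S f \<Longrightarrow> x \<in> S \<Longrightarrow> f differentiable (at x)"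
proof -
  assume "smooth_on S f" "x \<in> S"
  then have "ck_on (Suc 0) S f" unfolding smooth_on_def by blast
  then show ?thesis using \<open>x \<in> S\<close> by simp
qed

lemma smooth_on_has_derivative:
  "smooth_on S f \<Longrightarrow> x \<in> S \<Longrightarrow> (f has_derivative frechet_derivative f (at x)) (at x)"
  using smooth_on_differentiable frechet_derivative_works by blast

lemma smooth_on_frechet_derivative:
  "smooth_on S f \<Longrightarrow> smooth_on S (\<lambda>x. frechet_derivative f (at x) v)"
  unfolding smooth_on_def
proof
  fix k assume "\<forall>k. ck_on k S f"
  then have "ck_on (Suc k) S f" by blast
  then show "ck_on k S (\<lambda>x. frechet_derivative f (at x) v)" by simp
qed

lemma smooth_on_subset: "smooth_on S f \<Longrightarrow> T \<subseteq> S \<Longrightarrow> smooth_on T f"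
  unfolding smooth_on_def using ck_on_subset by blast

lemma smooth_on_cong:
  "open S \<Longrightarrow> (\<And>x. x \<in> S \<Longrightarrow> f x = g x) \<Longrightarrow> smooth_on S f \<longleftrightarrow> smooth_on S g"
  unfolding smooth_on_def using ck_on_cong by blast

lemma smooth_on_local:
  assumes "\<And>x. x \<in> S \<Longrightarrow> \<exists>T. open T \<and> x \<in> T \<and> smooth_on T f"
  shows "smooth_on S f"
  unfolding smooth_on_def
proof (intro allI ck_on_local)
  fix k x assume "x \<in> S"
  then obtain T where "open T" "x \<in> T" "smooth_on T f" using assms by blast
  then show "\<exists>T. open T \<and> x \<in> T \<and> ck_on k T f" unfolding smooth_on_def by blast
qed

lemma smooth_on_const [simp]: "smooth_on S (\<lambda>x. c)"
  by (simp add: smooth_on_def)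

lemma smooth_on_linear: "bounded_linear f \<Longrightarrow> smooth_on S f"
  by (simp add: smooth_on_def ck_on_linear)

lemma smooth_on_id [simp]: "smooth_on S (\<lambda>x. x)"
  by (simp add: smooth_on_linear bounded_linear_ident)

lemma smooth_on_bounded_linear:
  "bounded_linear L \<Longrightarrow> open S \<Longrightarrow> smooth_on S f \<Longrightarrow> smooth_on S (\<lambda>x. L (f x))"
  by (simp add: smooth_on_def ck_on_bounded_linear)

lemma smooth_on_add: "open S \<Longrightarrow> smooth_on S f \<Longrightarrow> smooth_on S g \<Longrightarrow> smooth_on S (\<lambda>x. f x + g x)"
  by (simp add: smooth_on_def ck_on_add)

lemma smooth_on_sum:
  "open S \<Longrightarrow> (\<And>i. i \<in> I \<Longrightarrow> smooth_on S (f i)) \<Longrightarrow> smooth_on S (\<lambda>x. \<Sum>i\<in>I. f i x)"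
  by (simp add: smooth_on_def ck_on_sum)

lemma smooth_on_scaleR:
  "open S \<Longrightarrow> smooth_on S f \<Longrightarrow> smooth_on S g \<Longrightarrow> smooth_on S (\<lambda>x. f x *\<^sub>R g x)"
  by (simp add: smooth_on_def ck_on_bilinear[OF bounded_bilinear_scaleR])

lemma smooth_on_mult:
  fixes f g :: "_ \<Rightarrow> real"
  shows "open S \<Longrightarrow> smooth_on S f \<Longrightarrow> smooth_on S g \<Longrightarrow> smooth_on S (\<lambda>x. f x * g x)"
  by (simp add: smooth_on_def ck_on_bilinear[OF bounded_bilinear_mult])

lemma smooth_on_inner:
  "open S \<Longrightarrow> smooth_on S f \<Longrightarrow> smooth_on S g \<Longrightarrow> smooth_on S (\<lambda>x. f x \<bullet> g x)"
  by (simp add: smooth_on_def ck_on_bilinear[OF bounded_bilinear_inner])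

lemma smooth_on_minus: "open S \<Longrightarrow> smooth_on S f \<Longrightarrow> smooth_on S (\<lambda>x. - f x)"
  by (rule smooth_on_bounded_linear[OF bounded_linear_minus[OF bounded_linear_ident]])

lemma smooth_on_diff: "open S \<Longrightarrow> smooth_on S f \<Longrightarrow> smooth_on S g \<Longrightarrow> smooth_on S (\<lambda>x. f x - g x)"
  using smooth_on_add[of S f "\<lambda>x. - g x"] smooth_on_minus[of S g] by simp

lemma smooth_on_inverse:
  fixes f :: "_ \<Rightarrow> real"
  shows "open S \<Longrightarrow> smooth_on S f \<Longrightarrow> (\<And>x. x \<in> S \<Longrightarrow> f x \<noteq> 0) \<Longrightarrow> smooth_on S (\<lambda>x. inverse (f x))"
  by (simp add: smooth_on_def ck_on_inverse)

lemma smooth_on_divide: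
  fixes f g :: "_ \<Rightarrow> real"
  shows "open S \<Longrightarrow> smooth_on S f \<Longrightarrow> smooth_on S g \<Longrightarrow> (\<And>x. x \<in> S \<Longrightarrow> g x \<noteq> 0)
    \<Longrightarrow> smooth_on S (\<lambda>x. f x / g x)"
  by (simp add: divide_inverse smooth_on_mult smooth_on_inverse)

lemma smooth_on_prod:
  fixes f :: "'i \<Rightarrow> _ \<Rightarrow> real"
  assumes "open S" "\<And>i. i \<in> I \<Longrightarrow> smooth_on S (f i)"
  shows "smooth_on S (\<lambda>x. \<Prod>i\<in>I. f i x)"
  using assms(2) by (induction I rule: infinite_finite_induct) (auto intro!: smooth_on_mult assms(1))

lemma smooth_on_compose:
  fixes f :: "'b::euclidean_space \<Rightarrow> 'c::real_normed_vector"
  assumes "open S" "open T" "\<And>x. x \<in> S \<Longrightarrow> g x \<in> T" "smooth_on T f" "smooth_on S g"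
  shows "smooth_on S (\<lambda>x. f (g x))"
  using assms ck_on_compose[of S T g _ f] by (simp add: smooth_on_def image_subset_iff)

lemma smooth_on_Pair:
  assumes S: "open S" and "smooth_on S f" "smooth_on S g"
  shows "smooth_on S (\<lambda>x. (f x, g x))"
proof -
  have "bounded_linear (\<lambda>u. (u, 0))" "bounded_linear (\<lambda>u. (0, u))"
    by (rule bounded_linear_Pair; simp)+
  from this[THEN smooth_on_bounded_linear, OF S] assms(2,3)
  have "smooth_on S (\<lambda>x. (f x, 0) + (0, g x))"
    by (intro smooth_on_add S) auto
  then show ?thesis by simp
qed

lemma smooth_on_fst: "open S \<Longrightarrow> smooth_on S f \<Longrightarrow> smooth_on S (\<lambda>x. fst (f x))"
  by (rule smooth_on_bounded_linear[OF bounded_linear_fst])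

lemma smooth_on_snd: "open S \<Longrightarrow> smooth_on S f \<Longrightarrow> smooth_on S (\<lambda>x. snd (f x))"
  by (rule smooth_on_bounded_linear[OF bounded_linear_snd])

lemma smooth_on_vec_nth: "open S \<Longrightarrow> smooth_on S f \<Longrightarrow> smooth_on S (\<lambda>x. f x $ i)"
  by (rule smooth_on_bounded_linear[OF bounded_linear_vec_nth])

lemma bounded_linear_axis: "bounded_linear (axis i :: 'a::euclidean_space \<Rightarrow> 'a^'n)"
  by (rule linear_conv_bounded_linear[THEN iffD1], rule linearI) (auto simp: axis_def vec_eq_iff)

text \<open>A vector with smooth entries is the finite sum of their images under the linear
  embeddings \<open>axis i\<close>.\<close>

lemma smooth_on_vec_lambda:
  fixes f :: "'n::finite \<Rightarrow> _ \<Rightarrow> 'a::euclidean_space"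
  assumes S: "open S" and "\<And>i. smooth_on S (f i)"
  shows "smooth_on S (\<lambda>x. \<chi> i. f i x)"
proof -
  have "smooth_on S (\<lambda>x. \<Sum>i\<in>UNIV. axis i (f i x))"
    using assms by (intro smooth_on_sum S smooth_on_bounded_linear[OF bounded_linear_axis])
  moreover have "(\<Sum>i\<in>UNIV. axis i (f i x)) = (\<chi> i. f i x)" for x
    by (simp add: vec_eq_iff axis_def if_distrib cong: if_cong)
  ultimately show ?thesis by simp
qed

lemma smooth_on_if:
  "(Q \<Longrightarrow> smooth_on S f) \<Longrightarrow> (\<not> Q \<Longrightarrow> smooth_on S g) \<Longrightarrow> smooth_on S (\<lambda>x. if Q then f x else g x)"
  by (cases Q) simp_all

lemma smooth_on_det:
  fixes f :: "_ \<Rightarrow> real^'n^'n"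
  assumes S: "open S" and f: "smooth_on S f"
  shows "smooth_on S (\<lambda>x. det (f x))"
  unfolding det_def
  by (intro smooth_on_sum smooth_on_mult smooth_on_prod S smooth_on_const smooth_on_vec_nth f)

lemmas smooth_intros = smooth_on_add smooth_on_sum smooth_on_scaleR smooth_on_mult smooth_on_inner
  smooth_on_minus smooth_on_diff smooth_on_prod smooth_on_Pair smooth_on_fst smooth_on_snd
  smooth_on_vec_nth smooth_on_vec_lambda smooth_on_det smooth_on_const smooth_on_id

section \<open>Smooth maps between manifolds and their derivatives\<close>

text \<open>Vector-valued counterpart of \<open>smooth_fun_on\<close>. Coordinate maps, the
  H-coordinate and the maps that cut out the leaves are of this kind, and maps between manifolds are
  reduced to it by composition with the charts of the target.\<close>

definition smooth_vec_on ::
    "('p, 'e::euclidean_space) mfd \<Rightarrow> 'p set \<Rightarrow> ('p \<Rightarrow> 'v::real_normed_vector) \<Rightarrow> bool" where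
  "smooth_vec_on M W F \<longleftrightarrow>
     openin (mtop M) W \<and> (\<forall>c\<in>charts M. smooth_on (snd c ` (fst c \<inter> W)) (F \<circ> chart_inv c))"

text \<open>Every smooth map into a manifold is handled through its composites with such maps, and every
  tangent vector is the push-forward of a vector along one of them (\<open>push_chart\<close> below).\<close>

definition smooth_param ::
    "'a::euclidean_space set \<Rightarrow> ('p, 'e::euclidean_space) mfd \<Rightarrow> ('a \<Rightarrow> 'p) \<Rightarrow> bool" where
  "smooth_param S M \<sigma> \<longleftrightarrow> open S \<and> \<sigma> ` S \<subseteq> pts M \<and>
     (\<forall>W. openin (mtop M) W \<longrightarrow> open {x\<in>S. \<sigma> x \<in> W}) \<and>
     (\<forall>d\<in>charts M. smooth_on {x\<in>S. \<sigma> x \<in> fst d} (\<lambda>x. snd d (\<sigma> x)))"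

definition push ::
    "('p, 'e::euclidean_space) mfd \<Rightarrow> ('a::euclidean_space \<Rightarrow> 'p) \<Rightarrow> 'a \<Rightarrow> 'a \<Rightarrow> ('p, 'e) tvec" where
  "push M \<sigma> x e =
     (\<lambda>d. if d \<in> charts_at M (\<sigma> x) then frechet_derivative (\<lambda>x. snd d (\<sigma> x)) (at x) e else 0)"

lemma is_chart_subset: "is_chart X c \<Longrightarrow> fst c \<subseteq> topspace X"
  unfolding is_chart_def by (simp add: openin_subset)

lemma is_chart_inj: "is_chart X c \<Longrightarrow> inj_on (snd c) (fst c)"
  using is_chart_subset[of X c] unfolding is_chart_def
  by (auto dest!: homeomorphic_imp_injective_map simp: Int_absorb1)

lemma chart_inv_left: "is_chart X c \<Longrightarrow> p \<in> fst c \<Longrightarrow> chart_inv c (snd c p) = p"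
  by (simp add: is_chart_inj)

lemma chart_inv_right: "x \<in> snd c ` fst c \<Longrightarrow> snd c (chart_inv c x) = x"
  by (rule f_inv_into_f)

lemma chart_inv_in: "x \<in> snd c ` fst c \<Longrightarrow> chart_inv c x \<in> fst c"
  by (rule inv_into_into)

lemma chart_image_eq:
  "is_chart X c \<Longrightarrow> snd c ` (fst c \<inter> W) = {x \<in> snd c ` fst c. chart_inv c x \<in> W}"
  by (auto simp: chart_inv_left chart_inv_right)

lemma chart_open_image:
  assumes c: "is_chart X c" and W: "openin X W"
  shows "open (snd c ` (fst c \<inter> W))"
proof -
  have "open_map (subtopology X (fst c)) (top_of_set (snd c ` fst c)) (snd c)"
    using c homeomorphic_imp_open_map unfolding is_chart_def by blast
  moreover have "openin (subtopology X (fst c)) (fst c \<inter> W)"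
    using W by (simp add: openin_subtopology_Int2)
  ultimately have "openin (top_of_set (snd c ` fst c)) (snd c ` (fst c \<inter> W))"
    by (simp add: open_map_def)
  then show ?thesis using c unfolding is_chart_def by (meson openin_open_eq)
qed

lemma chart_open_preimage:
  assumes c: "is_chart X c" and T: "open T"
  shows "openin X {p \<in> fst c. snd c p \<in> T}"
proof -
  have cont: "continuous_map (subtopology X (fst c)) (top_of_set (snd c ` fst c)) (snd c)"
    using c homeomorphic_imp_continuous_map unfolding is_chart_def by blast
  have "openin (top_of_set (snd c ` fst c)) (snd c ` fst c \<inter> T)"
    using T by (simp add: openin_open_Int)
  from openin_continuous_map_preimage[OF cont this]
  have "openin (subtopology X (fst c)) {p \<in> fst c. snd c p \<in> T}"
    using is_chart_subset[OF c] by (simp add: Int_absorb1 conj_ac cong: conj_cong)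
  then show ?thesis using c unfolding is_chart_def using openin_trans_full by blast
qed

lemma smooth_manifold_chart: "smooth_manifold M \<Longrightarrow> c \<in> charts M \<Longrightarrow> is_chart (mtop M) c"
  unfolding smooth_manifold_def by blast

lemma smooth_manifold_charts_at:
  assumes "smooth_manifold M" "p \<in> pts M" obtains c where "c \<in> charts_at M p"
  using assms unfolding smooth_manifold_def charts_at_def by blast

lemma charts_atD: "c \<in> charts_at M p \<Longrightarrow> c \<in> charts M" "c \<in> charts_at M p \<Longrightarrow> p \<in> fst c"
  by (auto simp: charts_at_def)

lemma some_charts_at: "c \<in> charts_at M p \<Longrightarrow> (SOME c. c \<in> charts_at M p) \<in> charts_at M p"
  by (rule someI)

lemma smooth_vec_onD:
  assumes "smooth_vec_on M W F"
  shows "openin (mtop M) W" "c \<in> charts M \<Longrightarrow> smooth_on (snd c ` (fst c \<inter> W)) (F \<circ> chart_inv c)"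
  using assms unfolding smooth_vec_on_def by auto

lemma smooth_fun_on_iff: "smooth_fun_on M W f \<longleftrightarrow> smooth_vec_on M W f"
  unfolding smooth_fun_on_def smooth_vec_on_def ..

lemma smooth_paramD:
  assumes "smooth_param S M \<sigma>"
  shows "open S" "x \<in> S \<Longrightarrow> \<sigma> x \<in> pts M" "openin (mtop M) W \<Longrightarrow> open {x\<in>S. \<sigma> x \<in> W}"
    "d \<in> charts M \<Longrightarrow> smooth_on {x\<in>S. \<sigma> x \<in> fst d} (\<lambda>x. snd d (\<sigma> x))"
  using assms unfolding smooth_param_def by auto

text \<open>Compatibility within the atlas is used in two halves: here the coordinate map is smooth,
  in \<open>smooth_param_chart\<close> its inverse is a smooth parametrisation.\<close>

lemma smooth_vec_on_chart:
  assumes "smooth_manifold M" "c \<in> charts M"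
  shows "smooth_vec_on M (fst c) (snd c)"
  unfolding smooth_vec_on_def
proof (intro conjI ballI)
  show "openin (mtop M) (fst c)"
    using smooth_manifold_chart[OF assms] unfolding is_chart_def by blast
  fix d assume "d \<in> charts M"
  then have "compatible d c" using assms unfolding smooth_manifold_def by blast
  then show "smooth_on (snd d ` (fst d \<inter> fst c)) (snd c \<circ> chart_inv d)"
    unfolding compatible_def by blast
qed

lemma smooth_param_chart:
  assumes sm: "smooth_manifold M" and c: "c \<in> charts M"
  shows "smooth_param (snd c ` fst c) M (chart_inv c)"
proof -
  have ic: "is_chart (mtop M) c" using smooth_manifold_chart[OF sm c] .
  have op: "open {x \<in> snd c ` fst c. chart_inv c x \<in> W}" if "openin (mtop M) W" for W
    using chart_open_image[OF ic that] by (simp add: chart_image_eq[OF ic])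
  have "smooth_on {x \<in> snd c ` fst c. chart_inv c x \<in> fst d} (\<lambda>x. snd d (chart_inv c x))"
    if d: "d \<in> charts M" for d
    using smooth_vec_onD(2)[OF smooth_vec_on_chart[OF sm d] c]
    by (simp add: chart_image_eq[OF ic] comp_def)
  moreover have "open (snd c ` fst c)" using ic unfolding is_chart_def by blast
  moreover have "chart_inv c ` snd c ` fst c \<subseteq> pts M"
    using is_chart_subset[OF ic] by (auto simp: chart_inv_left[OF ic])
  ultimately show ?thesis using op unfolding smooth_param_def by blast
qed

lemma smooth_param_comp_vec:
  assumes sm: "smooth_manifold M" and \<sigma>: "smooth_param S M \<sigma>" and F: "smooth_vec_on M W F"
  shows "smooth_on {x\<in>S. \<sigma> x \<in> W} (\<lambda>x. F (\<sigma> x))"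
proof (rule smooth_on_local)
  fix x assume x: "x \<in> {x\<in>S. \<sigma> x \<in> W}"
  then obtain d where d: "d \<in> charts_at M (\<sigma> x)"
    using smooth_manifold_charts_at[OF sm] smooth_paramD(2)[OF \<sigma>] by blast
  note d' = charts_atD[OF d]
  have id: "is_chart (mtop M) d" using smooth_manifold_chart[OF sm d'(1)] .
  let ?T = "{x\<in>S. \<sigma> x \<in> fst d \<inter> W}"
  have oT: "open ?T" using smooth_paramD(3)[OF \<sigma>] id smooth_vec_onD(1)[OF F]
    unfolding is_chart_def by (meson openin_Int)
  have "smooth_on ?T (\<lambda>x. (F \<circ> chart_inv d) (snd d (\<sigma> x)))"
  proof (rule smooth_on_compose[OF oT chart_open_image[OF id smooth_vec_onD(1)[OF F]] _
        smooth_vec_onD(2)[OF F d'(1)]])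
    show "smooth_on ?T (\<lambda>x. snd d (\<sigma> x))"
      by (rule smooth_on_subset[OF smooth_paramD(4)[OF \<sigma> d'(1)]]) auto
  qed auto
  moreover have "smooth_on ?T (\<lambda>x. (F \<circ> chart_inv d) (snd d (\<sigma> x))) \<longleftrightarrow> smooth_on ?T (\<lambda>x. F (\<sigma> x))"
    by (rule smooth_on_cong[OF oT]) (simp add: chart_inv_left[OF id])
  ultimately show "\<exists>T. open T \<and> x \<in> T \<and> smooth_on T (\<lambda>x. F (\<sigma> x))"
    using oT x d'(2) by blast
qed

text \<open>Chain rule through an arbitrary chart d around the image point. With F another
  coordinate map it is the Jacobian relation that makes \<open>push\<close> tangent; for general F
  it makes \<open>vec_deriv\<close> insensitive to the chart picked by SOME.\<close>

lemma frechet_derivative_param_chart: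
  assumes sm: "smooth_manifold M" and \<sigma>: "smooth_param S M \<sigma>" and F: "smooth_vec_on M W F"
    and x: "x \<in> S" "\<sigma> x \<in> W" and d: "d \<in> charts_at M (\<sigma> x)"
  shows "frechet_derivative (\<lambda>x. F (\<sigma> x)) (at x) e =
    frechet_derivative (F \<circ> chart_inv d) (at (snd d (\<sigma> x)))
      (frechet_derivative (\<lambda>x. snd d (\<sigma> x)) (at x) e)"
proof -
  note d' = charts_atD[OF d]
  have id: "is_chart (mtop M) d" using smooth_manifold_chart[OF sm d'(1)] .
  let ?T = "{x\<in>S. \<sigma> x \<in> fst d \<inter> W}"
  have oT: "open ?T" using smooth_paramD(3)[OF \<sigma>] id smooth_vec_onD(1)[OF F]
    unfolding is_chart_def by (meson openin_Int)
  have 1: "((\<lambda>x. snd d (\<sigma> x)) has_derivative frechet_derivative (\<lambda>x. snd d (\<sigma> x)) (at x)) (at x)"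
    using smooth_on_has_derivative[OF smooth_paramD(4)[OF \<sigma> d'(1)]] x d'(2) by blast
  have 2: "(F \<circ> chart_inv d has_derivative
      frechet_derivative (F \<circ> chart_inv d) (at (snd d (\<sigma> x)))) (at (snd d (\<sigma> x)))"
    using smooth_on_has_derivative[OF smooth_vec_onD(2)[OF F d'(1)]] x d'(2) by blast
  have "((\<lambda>x. (F \<circ> chart_inv d) (snd d (\<sigma> x))) has_derivative
      (\<lambda>e. frechet_derivative (F \<circ> chart_inv d) (at (snd d (\<sigma> x)))
      (frechet_derivative (\<lambda>x. snd d (\<sigma> x)) (at x) e))) (at x)"
    by (rule has_derivative_compose[OF 1 2])
  from fun_cong[OF frechet_derivative_at'[OF this], of e]
    frechet_derivative_cong_open[OF oT, of x "\<lambda>x. (F \<circ> chart_inv d) (snd d (\<sigma> x))" "\<lambda>x. F (\<sigma> x)"]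
  show ?thesis using x d'(2) by (simp add: chart_inv_left[OF id])
qed

section \<open>Tangent vectors as push-forwards, and derivatives of vector-valued maps\<close>

lemma tangent_space_outside: "v \<in> tangent_space M p \<Longrightarrow> d \<notin> charts_at M p \<Longrightarrow> v d = 0"
  unfolding tangent_space_def by blast

lemma push_tangent:
  assumes sm: "smooth_manifold M" and \<sigma>: "smooth_param S M \<sigma>" and x: "x \<in> S"
  shows "push M \<sigma> x e \<in> tangent_space M (\<sigma> x)"
proof -
  have "frechet_derivative (\<lambda>x. snd d (\<sigma> x)) (at x) e =
        frechet_derivative (snd d \<circ> chart_inv c) (at (snd c (\<sigma> x)))
         (frechet_derivative (\<lambda>x. snd c (\<sigma> x)) (at x) e)"
    if "c \<in> charts_at M (\<sigma> x)" "d \<in> charts_at M (\<sigma> x)" for c d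
    using frechet_derivative_param_chart[OF sm \<sigma> smooth_vec_on_chart[OF sm charts_atD(1)[OF that(2)]]
        x charts_atD(2)[OF that(2)] that(1)] .
  note eq = this
  have "push M \<sigma> x e d = frechet_derivative (snd d \<circ> chart_inv c) (at (snd c (\<sigma> x))) (push M \<sigma> x e c)"
    if cd: "c \<in> charts_at M (\<sigma> x)" "d \<in> charts_at M (\<sigma> x)" for c d
    unfolding push_def if_P[OF cd(1)] if_P[OF cd(2)] by (rule eq[OF cd])
  moreover have "push M \<sigma> x e d = 0" if "d \<notin> charts_at M (\<sigma> x)" for d
    using that by (simp add: push_def)
  ultimately show ?thesis unfolding tangent_space_def by blast
qed

lemma vec_deriv_push:
  assumes sm: "smooth_manifold M" and \<sigma>: "smooth_param S M \<sigma>" and F: "smooth_vec_on M W F"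
    and x: "x \<in> S" "\<sigma> x \<in> W"
  shows "vec_deriv M F (\<sigma> x) (push M \<sigma> x e) = frechet_derivative (\<lambda>x. F (\<sigma> x)) (at x) e"
proof -
  obtain d where "d \<in> charts_at M (\<sigma> x)"
    using smooth_manifold_charts_at[OF sm] smooth_paramD(2)[OF \<sigma>] x by blast
  from some_charts_at[OF this] show ?thesis
    unfolding vec_deriv_def Let_def push_def
    by (simp add: frechet_derivative_param_chart[OF sm \<sigma> F x])
qed

lemma chart_vec_push: "x \<in> snd c ` fst c \<Longrightarrow> chart_vec M c (chart_inv c x) e = push M (chart_inv c) x e"
  unfolding chart_vec_def push_def by (simp add: chart_inv_right comp_def cong: if_cong)

lemma push_chart:
  assumes sm: "smooth_manifold M" and c: "c \<in> charts_at M p" and v: "v \<in> tangent_space M p"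
  shows "push M (chart_inv c) (snd c p) (v c) = v"
proof
  fix d
  have ic: "is_chart (mtop M) c" using smooth_manifold_chart[OF sm charts_atD(1)[OF c]] .
  have [simp]: "chart_inv c (snd c p) = p" using chart_inv_left[OF ic charts_atD(2)[OF c]] .
  show "push M (chart_inv c) (snd c p) (v c) d = v d"
  proof (cases "d \<in> charts_at M p")
    case True
    then have "v d = frechet_derivative (snd d \<circ> chart_inv c) (at (snd c p)) (v c)"
      using v c unfolding tangent_space_def by blast
    then show ?thesis using True by (simp only: push_def if_True comp_def \<open>chart_inv c (snd c p) = p\<close>)
  next
    case False
    then show ?thesis using tangent_space_outside[OF v] by (simp add: push_def)
  qed
qed

lemma tangent_space_push:
  assumes sm: "smooth_manifold M" and p: "p \<in> pts M" and v: "v \<in> tangent_space M p"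
  obtains c x where "c \<in> charts_at M p" "smooth_param (snd c ` fst c) M (chart_inv c)"
    "x \<in> snd c ` fst c" "x = snd c p" "chart_inv c x = p" "v = push M (chart_inv c) x (v c)"
proof -
  obtain c where c: "c \<in> charts_at M p" using smooth_manifold_charts_at[OF sm p] .
  then have ic: "is_chart (mtop M) c" using smooth_manifold_chart[OF sm charts_atD(1)[OF c]] by blast
  show ?thesis
  proof
    show "c \<in> charts_at M p" "snd c p = snd c p" by (fact c refl)+
    show "smooth_param (snd c ` fst c) M (chart_inv c)"
      using smooth_param_chart[OF sm charts_atD(1)[OF c]] .
    show "snd c p \<in> snd c ` fst c" "chart_inv c (snd c p) = p"
      using charts_atD(2)[OF c] chart_inv_left[OF ic] by auto
    show "v = push M (chart_inv c) (snd c p) (v c)" using push_chart[OF sm c v] by simp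
  qed
qed

lemma tangent_space_lincomb:
  assumes sm: "smooth_manifold M" and p: "p \<in> pts M"
    and v: "v \<in> tangent_space M p" "w \<in> tangent_space M p"
  shows "(\<lambda>c. r *\<^sub>R v c + s *\<^sub>R w c) \<in> tangent_space M p"
proof -
  have "frechet_derivative (snd d \<circ> chart_inv c) (at (snd c p)) (r *\<^sub>R v c + s *\<^sub>R w c) =
      r *\<^sub>R frechet_derivative (snd d \<circ> chart_inv c) (at (snd c p)) (v c) +
      s *\<^sub>R frechet_derivative (snd d \<circ> chart_inv c) (at (snd c p)) (w c)"
    if "c \<in> charts_at M p" "d \<in> charts_at M p" for c d
  proof -
    have "smooth_on (snd c ` (fst c \<inter> fst d)) (snd d \<circ> chart_inv c)"
      using that sm unfolding smooth_manifold_def compatible_def charts_at_def by blast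
    then have "snd d \<circ> chart_inv c differentiable at (snd c p)"
      using smooth_on_differentiable that unfolding charts_at_def by blast
    from linear_frechet_derivative[OF this] show ?thesis by (simp add: linear_add linear_cmul)
  qed
  note lin = this
  show ?thesis unfolding tangent_space_def mem_Collect_eq
  proof (intro conjI allI impI ballI)
    fix c assume "c \<notin> charts_at M p"
    then show "r *\<^sub>R v c + s *\<^sub>R w c = 0" using v[THEN tangent_space_outside] by simp
  next
    fix c d assume cd: "c \<in> charts_at M p" "d \<in> charts_at M p"
    then have "v d = frechet_derivative (snd d \<circ> chart_inv c) (at (snd c p)) (v c)"
      "w d = frechet_derivative (snd d \<circ> chart_inv c) (at (snd c p)) (w c)"
      using v unfolding tangent_space_def by blast+
    then show "r *\<^sub>R v d + s *\<^sub>R w d = frechet_derivative (snd d \<circ> chart_inv c) (at (snd c p))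
        (r *\<^sub>R v c + s *\<^sub>R w c)" by (simp only: lin[OF cd])
  qed
qed

lemma zero_tangent:
  assumes sm: "smooth_manifold M" and p: "p \<in> pts M"
  shows "(\<lambda>c. 0) \<in> tangent_space M p"
proof -
  obtain c where c: "c \<in> charts_at M p" using smooth_manifold_charts_at[OF sm p] .
  have "smooth_param (snd c ` fst c) M (chart_inv c)" "snd c p \<in> snd c ` fst c" "chart_inv c (snd c p) = p"
    using smooth_param_chart[OF sm] c chart_inv_left[OF smooth_manifold_chart[OF sm]]
    by (auto simp: charts_at_def)
  from push_tangent[OF sm this(1,2)] this(3) have "push M (chart_inv c) (snd c p) 0 \<in> tangent_space M p"
    by simp
  from tangent_space_lincomb[OF sm p this this, of 0 0] show ?thesis by simp
qed

lemma push_lincomb: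
  assumes sm: "smooth_manifold M" and \<sigma>: "smooth_param S M \<sigma>" and x: "x \<in> S"
  shows "push M \<sigma> x (r *\<^sub>R e + s *\<^sub>R e') = (\<lambda>d. r *\<^sub>R push M \<sigma> x e d + s *\<^sub>R push M \<sigma> x e' d)"
proof
  fix d
  show "push M \<sigma> x (r *\<^sub>R e + s *\<^sub>R e') d = r *\<^sub>R push M \<sigma> x e d + s *\<^sub>R push M \<sigma> x e' d"
  proof (cases "d \<in> charts_at M (\<sigma> x)")
    case True
    then have "(\<lambda>x. snd d (\<sigma> x)) differentiable at x"
      using smooth_on_differentiable[OF smooth_paramD(4)[OF \<sigma>]] x by (auto simp: charts_at_def)
    from linear_frechet_derivative[OF this] True show ?thesis
      by (simp add: push_def linear_add linear_cmul)
  qed (simp add: push_def)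
qed

lemma tangent_space_eqI:
  assumes sm: "smooth_manifold M" and c: "c \<in> charts_at M p"
    and "v \<in> tangent_space M p" "w \<in> tangent_space M p" "v c = w c"
  shows "v = w"
  using push_chart[OF sm c] assms(3-5) by metis

lemma smooth_vec_on_lincomb:
  assumes sm: "smooth_manifold M" and F: "smooth_vec_on M W F" and p: "p \<in> W"
    and v: "v \<in> tangent_space M p" "w \<in> tangent_space M p"
  shows "vec_deriv M F p (\<lambda>c. r *\<^sub>R v c + s *\<^sub>R w c) = r *\<^sub>R vec_deriv M F p v + s *\<^sub>R vec_deriv M F p w"
proof -
  have "p \<in> pts M" using p smooth_vec_onD(1)[OF F] openin_subset by blast
  then obtain c where "c \<in> charts_at M p" using smooth_manifold_charts_at[OF sm] by blast
  then have c: "(SOME c. c \<in> charts_at M p) \<in> charts_at M p" by (rule some_charts_at)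
  then have "F \<circ> chart_inv (SOME c. c \<in> charts_at M p) differentiable
      at (snd (SOME c. c \<in> charts_at M p) p)"
    using smooth_on_differentiable[OF smooth_vec_onD(2)[OF F charts_atD(1)[OF c]]] charts_atD(2)[OF c] p
    by blast
  from linear_frechet_derivative[OF this] show ?thesis
    unfolding vec_deriv_def Let_def by (simp add: linear_add linear_cmul)
qed

lemma smooth_vec_on_compose:
  fixes F :: "'p \<Rightarrow> 'v::euclidean_space"
  assumes sm: "smooth_manifold M" and F: "smooth_vec_on M W F" and T: "open T"
    and FT: "\<And>p. p \<in> W \<Longrightarrow> F p \<in> T" and \<Phi>: "smooth_on T \<Phi>"
  shows "smooth_vec_on M W (\<lambda>p. \<Phi> (F p))"
  unfolding smooth_vec_on_def
proof (intro conjI ballI)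
  show "openin (mtop M) W" using smooth_vec_onD(1)[OF F] .
  fix c assume c: "c \<in> charts M"
  have ic: "is_chart (mtop M) c" using smooth_manifold_chart[OF sm c] .
  show "smooth_on (snd c ` (fst c \<inter> W)) ((\<lambda>p. \<Phi> (F p)) \<circ> chart_inv c)"
    unfolding comp_def
  proof (rule smooth_on_compose[OF chart_open_image[OF ic smooth_vec_onD(1)[OF F]] T _ \<Phi>])
    show "smooth_on (snd c ` (fst c \<inter> W)) (\<lambda>x. F (chart_inv c x))"
      using smooth_vec_onD(2)[OF F c] by (simp add: comp_def)
  qed (use FT in \<open>auto simp: chart_inv_left[OF ic]\<close>)
qed

lemma vec_deriv_compose:
  fixes F :: "'p \<Rightarrow> 'v::euclidean_space"
  assumes sm: "smooth_manifold M" and F: "smooth_vec_on M W F" and p: "p \<in> W"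
    and \<Phi>: "(\<Phi> has_derivative \<Phi>') (at (F p))" and v: "v \<in> tangent_space M p"
  shows "vec_deriv M (\<lambda>p. \<Phi> (F p)) p v = \<Phi>' (vec_deriv M F p v)"
proof -
  have "p \<in> pts M" using p smooth_vec_onD(1)[OF F] openin_subset by blast
  then obtain c where "c \<in> charts_at M p" using smooth_manifold_charts_at[OF sm] by blast
  then have c: "(SOME c. c \<in> charts_at M p) \<in> charts_at M p" by (rule some_charts_at)
  let ?c = "SOME c. c \<in> charts_at M p"
  have ic: "is_chart (mtop M) ?c" using smooth_manifold_chart[OF sm charts_atD(1)[OF c]] .
  have "(F \<circ> chart_inv ?c has_derivative frechet_derivative (F \<circ> chart_inv ?c) (at (snd ?c p))) (at (snd ?c p))"
    using smooth_on_has_derivative[OF smooth_vec_onD(2)[OF F charts_atD(1)[OF c]]] charts_atD(2)[OF c] p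
    by blast
  from has_derivative_compose[OF this, of \<Phi> \<Phi>'] \<Phi>
  have "((\<lambda>x. \<Phi> ((F \<circ> chart_inv ?c) x)) has_derivative
     (\<lambda>e. \<Phi>' (frechet_derivative (F \<circ> chart_inv ?c) (at (snd ?c p)) e))) (at (snd ?c p))"
    by (simp add: chart_inv_left[OF ic charts_atD(2)[OF c]])
  from frechet_derivative_at'[OF this] show ?thesis
    unfolding vec_deriv_def Let_def by (simp add: comp_def)
qed

lemma smooth_vec_on_subset:
  assumes sm: "smooth_manifold M" and "smooth_vec_on M W F" "openin (mtop M) W'" "W' \<subseteq> W"
  shows "smooth_vec_on M W' F"
  using assms unfolding smooth_vec_on_def by (meson Int_mono image_mono order_refl smooth_on_subset)

lemma smooth_vec_on_cong:
  assumes sm: "smooth_manifold M" and eq: "\<And>p. p \<in> W \<Longrightarrow> F p = G p"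
  shows "smooth_vec_on M W F \<longleftrightarrow> smooth_vec_on M W G"
proof -
  have "smooth_on (snd c ` (fst c \<inter> W)) (F \<circ> chart_inv c) \<longleftrightarrow>
      smooth_on (snd c ` (fst c \<inter> W)) (G \<circ> chart_inv c)"
    if "c \<in> charts M" "openin (mtop M) W" for c
    using smooth_manifold_chart[OF sm that(1)] eq that(2)
    by (intro smooth_on_cong chart_open_image) (auto simp: chart_inv_left)
  then show ?thesis unfolding smooth_vec_on_def by blast
qed

lemma vec_deriv_cong:
  assumes sm: "smooth_manifold M" and W: "openin (mtop M) W" "p \<in> W"
    and eq: "\<And>p. p \<in> W \<Longrightarrow> F p = G p"
  shows "vec_deriv M F p v = vec_deriv M G p v"
proof -
  have "p \<in> pts M" using W openin_subset by blast
  then obtain c where "c \<in> charts_at M p" using smooth_manifold_charts_at[OF sm] by blast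
  then have c: "(SOME c. c \<in> charts_at M p) \<in> charts_at M p" by (rule some_charts_at)
  let ?c = "SOME c. c \<in> charts_at M p"
  have ic: "is_chart (mtop M) ?c" using smooth_manifold_chart[OF sm charts_atD(1)[OF c]] .
  have "frechet_derivative (F \<circ> chart_inv ?c) (at (snd ?c p)) = frechet_derivative (G \<circ> chart_inv ?c) (at (snd ?c p))"
    by (rule frechet_derivative_cong_open[OF chart_open_image[OF ic W(1)]])
      (use W(2) charts_atD(2)[OF c] eq in \<open>auto simp: chart_inv_left[OF ic]\<close>)
  then show ?thesis unfolding vec_deriv_def Let_def by simp
qed

lemma smooth_vec_on_local:
  assumes sm: "smooth_manifold M" and W: "\<And>p. p \<in> W \<Longrightarrow> \<exists>V. p \<in> V \<and> V \<subseteq> W \<and> smooth_vec_on M V F"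
  shows "smooth_vec_on M W F"
  unfolding smooth_vec_on_def
proof (intro conjI ballI)
  show "openin (mtop M) W"
    using W by (subst openin_subopen) (meson smooth_vec_onD(1))
  fix c assume c: "c \<in> charts M"
  have ic: "is_chart (mtop M) c" using smooth_manifold_chart[OF sm c] .
  show "smooth_on (snd c ` (fst c \<inter> W)) (F \<circ> chart_inv c)"
  proof (rule smooth_on_local)
    fix x assume "x \<in> snd c ` (fst c \<inter> W)"
    then obtain p where p: "p \<in> fst c" "p \<in> W" "x = snd c p" by auto
    then obtain V where "p \<in> V" "V \<subseteq> W" "smooth_vec_on M V F" using W by blast
    then show "\<exists>T. open T \<and> x \<in> T \<and> smooth_on T (F \<circ> chart_inv c)"
      using p c chart_open_image[OF ic] unfolding smooth_vec_on_def by blast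
  qed
qed

lemma smooth_vec_on_Pair:
  assumes sm: "smooth_manifold M" and F: "smooth_vec_on M W F" and G: "smooth_vec_on M W G"
  shows "smooth_vec_on M W (\<lambda>p. (F p, G p))"
proof -
  have "smooth_on (snd c ` (fst c \<inter> W)) ((\<lambda>p. (F p, G p)) \<circ> chart_inv c)" if c: "c \<in> charts M" for c
    using smooth_on_Pair[OF chart_open_image[OF smooth_manifold_chart[OF sm c] smooth_vec_onD(1)[OF F]]
        smooth_vec_onD(2)[OF F c] smooth_vec_onD(2)[OF G c]] by (simp add: comp_def)
  then show ?thesis using F unfolding smooth_vec_on_def by blast
qed

lemma smooth_vec_on_const: "openin (mtop M) W \<Longrightarrow> smooth_vec_on M W (\<lambda>p. k)"
  unfolding smooth_vec_on_def by (simp add: comp_def)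

lemma smooth_vec_on_continuous:
  assumes sm: "smooth_manifold M" and F: "smooth_vec_on M W F" and T: "open T"
  shows "openin (mtop M) {p \<in> W. F p \<in> T}"
proof (subst openin_subopen, intro ballI)
  fix p assume p: "p \<in> {p \<in> W. F p \<in> T}"
  then have "p \<in> pts M" using smooth_vec_onD(1)[OF F] openin_subset by blast
  then obtain c where c: "c \<in> charts M" "p \<in> fst c" using smooth_manifold_charts_at[OF sm] charts_atD by metis
  have ic: "is_chart (mtop M) c" using smooth_manifold_chart[OF sm c(1)] .
  let ?A = "snd c ` (fst c \<inter> W)"
  have "continuous_on ?A (F \<circ> chart_inv c)"
    using smooth_onD_continuous[OF smooth_vec_onD(2)[OF F c(1)]] .
  then have "open (?A \<inter> (F \<circ> chart_inv c) -` T)"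
    using chart_open_image[OF ic smooth_vec_onD(1)[OF F]] T by (rule continuous_open_preimage)
  from chart_open_preimage[OF ic this]
  have "openin (mtop M) {q \<in> fst c. snd c q \<in> ?A \<inter> (F \<circ> chart_inv c) -` T}" .
  moreover have "{q \<in> fst c. snd c q \<in> ?A \<inter> (F \<circ> chart_inv c) -` T} = {q \<in> fst c. q \<in> W \<and> F q \<in> T}"
    using is_chart_inj[OF ic] by (auto simp: chart_inv_left[OF ic] inj_on_def)
  ultimately show "\<exists>U. openin (mtop M) U \<and> p \<in> U \<and> U \<subseteq> {p \<in> W. F p \<in> T}"
    using p c by (intro exI[of _ "{q \<in> fst c. q \<in> W \<and> F q \<in> T}"]) auto
qed

lemma smooth_param_compose:
  assumes sm: "smooth_manifold M" and \<sigma>: "smooth_param S M \<sigma>" and S': "open S'" and g: "smooth_on S' g" "\<And>x. x \<in> S' \<Longrightarrow> g x \<in> S"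
  shows "smooth_param S' M (\<lambda>x. \<sigma> (g x))"
  unfolding smooth_param_def
proof (intro conjI allI impI ballI)
  have op: "open {x \<in> S'. \<sigma> (g x) \<in> W}" if "open {x\<in>S. \<sigma> x \<in> W}" for W
  proof -
    have "open (S' \<inter> g -` {x\<in>S. \<sigma> x \<in> W})"
      by (rule continuous_open_preimage[OF smooth_onD_continuous[OF g(1)] S' that])
    also have "S' \<inter> g -` {x\<in>S. \<sigma> x \<in> W} = {x \<in> S'. \<sigma> (g x) \<in> W}" using g(2) by auto
    finally show ?thesis .
  qed
  show "open {x \<in> S'. \<sigma> (g x) \<in> W}" if "openin (mtop M) W" for W
    using op smooth_paramD(3)[OF \<sigma> that] by blast
  fix d assume d: "d \<in> charts M"
  show "smooth_on {x \<in> S'. \<sigma> (g x) \<in> fst d} (\<lambda>x. snd d (\<sigma> (g x)))"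
  proof -
    have o: "open {x \<in> S. \<sigma> x \<in> fst d}"
      using smooth_paramD(3)[OF \<sigma> smooth_vec_onD(1)[OF smooth_vec_on_chart[OF sm d]]] .
    show ?thesis
      by (rule smooth_on_compose[OF op[OF o] o _ smooth_paramD(4)[OF \<sigma> d] smooth_on_subset[OF g(1)]])
        (use g(2) in auto)
  qed
qed (use smooth_paramD[OF \<sigma>] S' g in auto)

lemma vec_deriv_chart:
  assumes sm: "smooth_manifold M" and c: "c \<in> charts_at M p" and v: "v \<in> tangent_space M p"
  shows "vec_deriv M (snd c) p v = v c"
proof -
  have ic: "is_chart (mtop M) c" using smooth_manifold_chart[OF sm charts_atD(1)[OF c]] .
  have x: "snd c p \<in> snd c ` fst c" and i: "chart_inv c (snd c p) = p"
    using charts_atD(2)[OF c] chart_inv_left[OF ic] by auto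
  have "vec_deriv M (snd c) p v =
      frechet_derivative (\<lambda>x. snd c (chart_inv c x)) (at (snd c p)) (v c)"
    using vec_deriv_push[OF sm smooth_param_chart[OF sm charts_atD(1)[OF c]]
        smooth_vec_on_chart[OF sm charts_atD(1)[OF c]] x, of "v c"] charts_atD(2)[OF c]
    by (simp add: i push_chart[OF sm c v])
  also have "frechet_derivative (\<lambda>x. snd c (chart_inv c x)) (at (snd c p)) =
      frechet_derivative (\<lambda>x. x) (at (snd c p))"
    by (rule frechet_derivative_cong_open[of "snd c ` fst c"])
      (use ic x in \<open>auto simp: is_chart_def chart_inv_left[OF ic]\<close>)
  finally show ?thesis by simp
qed

text \<open>Each component of the tangent map is a derivative of a vector-valued map, so linearity
  and the chain rule for \<open>tangent_map\<close> follow from those for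
  \<open>vec_deriv\<close>.\<close>

lemma tangent_map_eq:
  "tangent_map M N f p v = (\<lambda>d. if d \<in> charts_at N (f p) then vec_deriv M (\<lambda>p. snd d (f p)) p v else 0)"
  unfolding tangent_map_def vec_deriv_def Let_def comp_def ..

section \<open>Smooth maps between manifolds\<close>

lemma smooth_map_onD:
  assumes "smooth_map_on M N W f"
  shows "openin (mtop M) W" "p \<in> W \<Longrightarrow> f p \<in> pts N"
    "openin (mtop N) V \<Longrightarrow> openin (mtop M) {p \<in> W. f p \<in> V}"
    "c \<in> charts M \<Longrightarrow> d \<in> charts N \<Longrightarrow>
      smooth_on (snd c ` (fst c \<inter> {p \<in> W. f p \<in> fst d})) (\<lambda>x. snd d (f (chart_inv c x)))"
proof -
  show W: "openin (mtop M) W" using assms unfolding smooth_map_on_def by blast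
  have tW: "topspace (subtopology (mtop M) W) = W"
    using openin_subset[OF W] by (simp add: Int_absorb1)
  have cont: "continuous_map (subtopology (mtop M) W) (mtop N) f"
    using assms unfolding smooth_map_on_def by blast
  show "f p \<in> pts N" if "p \<in> W"
    using continuous_map_image_subset_topspace[OF cont] that tW by auto
  show "openin (mtop M) {p \<in> W. f p \<in> V}" if "openin (mtop N) V"
    using openin_continuous_map_preimage[OF cont that] W tW openin_trans_full by metis
  assume "c \<in> charts M" "d \<in> charts N"
  then have "smooth_on (snd c ` (fst c \<inter> W \<inter> f -` fst d)) (snd d \<circ> f \<circ> chart_inv c)"
    using assms unfolding smooth_map_on_def by blast
  moreover have "fst c \<inter> W \<inter> f -` fst d = fst c \<inter> {p \<in> W. f p \<in> fst d}" by auto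
  ultimately show "smooth_on (snd c ` (fst c \<inter> {p \<in> W. f p \<in> fst d})) (\<lambda>x. snd d (f (chart_inv c x)))"
    by (simp add: comp_def)
qed

lemma smooth_map_onI:
  assumes W: "openin (mtop M) W" and im: "\<And>p. p \<in> W \<Longrightarrow> f p \<in> pts N"
    and cont: "\<And>V. openin (mtop N) V \<Longrightarrow> openin (mtop M) {p \<in> W. f p \<in> V}"
    and sm: "\<And>d. d \<in> charts N \<Longrightarrow> smooth_vec_on M {p \<in> W. f p \<in> fst d} (\<lambda>p. snd d (f p))"
  shows "smooth_map_on M N W f"
  unfolding smooth_map_on_def
proof (intro conjI ballI)
  have tW: "topspace (subtopology (mtop M) W) = W"
    using openin_subset[OF W] by (simp add: Int_absorb1)
  have "openin (subtopology (mtop M) W) {p \<in> W. f p \<in> V}" if "openin (mtop N) V" for V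
    using cont[OF that] by (metis (no_types, lifting) mem_Collect_eq openin_subset_topspace_eq
        openin_subtopology_Int2 inf.absorb_iff2 subsetI)
  then show "continuous_map (subtopology (mtop M) W) (mtop N) f"
    unfolding continuous_map_def tW using im by blast
  fix c d assume "c \<in> charts M" "d \<in> charts N"
  moreover have "fst c \<inter> W \<inter> f -` fst d = fst c \<inter> {p \<in> W. f p \<in> fst d}" by auto
  ultimately show "smooth_on (snd c ` (fst c \<inter> W \<inter> f -` fst d)) (snd d \<circ> f \<circ> chart_inv c)"
    using smooth_vec_onD(2)[OF sm] by (simp add: comp_def)
qed (rule W)

lemma smooth_map_vec:
  assumes M: "smooth_manifold M" and N: "smooth_manifold N"
    and f: "smooth_map_on M N W f" and F: "smooth_vec_on N V F"
  shows "smooth_vec_on M {p \<in> W. f p \<in> V} (\<lambda>p. F (f p))"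
  unfolding smooth_vec_on_def
proof (intro conjI ballI)
  show "openin (mtop M) {p \<in> W. f p \<in> V}"
    using smooth_map_onD(3)[OF f smooth_vec_onD(1)[OF F]] .
  fix c assume c: "c \<in> charts M"
  have ic: "is_chart (mtop M) c" using smooth_manifold_chart[OF M c] .
  show "smooth_on (snd c ` (fst c \<inter> {p \<in> W. f p \<in> V})) ((\<lambda>p. F (f p)) \<circ> chart_inv c)"
  proof (rule smooth_on_local)
    fix x assume "x \<in> snd c ` (fst c \<inter> {p \<in> W. f p \<in> V})"
    then obtain p where p: "p \<in> fst c" "p \<in> W" "f p \<in> V" "x = snd c p" by auto
    then obtain d where d: "d \<in> charts N" "f p \<in> fst d"
      using smooth_manifold_charts_at[OF N] smooth_map_onD(2)[OF f] charts_atD by metis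
    have id: "is_chart (mtop N) d" using smooth_manifold_chart[OF N d(1)] .
    have od: "openin (mtop N) (fst d \<inter> V)"
      using id smooth_vec_onD(1)[OF F] unfolding is_chart_def by (meson openin_Int)
    let ?T = "snd c ` (fst c \<inter> {p \<in> W. f p \<in> fst d \<inter> V})"
    have oT: "open ?T" using chart_open_image[OF ic smooth_map_onD(3)[OF f od]] .
    have "smooth_on ?T (\<lambda>x. (F \<circ> chart_inv d) (snd d (f (chart_inv c x))))"
    proof (rule smooth_on_compose[OF oT chart_open_image[OF id smooth_vec_onD(1)[OF F]] _
          smooth_vec_onD(2)[OF F d(1)]])
      show "smooth_on ?T (\<lambda>x. snd d (f (chart_inv c x)))"
        by (rule smooth_on_subset[OF smooth_map_onD(4)[OF f c d(1)]]) auto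
    qed (auto simp: chart_inv_left[OF ic])
    moreover have "smooth_on ?T (\<lambda>x. (F \<circ> chart_inv d) (snd d (f (chart_inv c x)))) \<longleftrightarrow>
        smooth_on ?T ((\<lambda>p. F (f p)) \<circ> chart_inv c)"
      by (rule smooth_on_cong[OF oT]) (auto simp: chart_inv_left[OF id] chart_inv_left[OF ic])
    ultimately show "\<exists>T. open T \<and> x \<in> T \<and> smooth_on T ((\<lambda>p. F (f p)) \<circ> chart_inv c)"
      using oT p d by (intro exI[of _ ?T]) auto
  qed
qed

lemma smooth_map_param:
  assumes M: "smooth_manifold M" and N: "smooth_manifold N"
    and f: "smooth_map_on M N W f" and \<sigma>: "smooth_param S M \<sigma>" and SW: "\<And>x. x \<in> S \<Longrightarrow> \<sigma> x \<in> W"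
  shows "smooth_param S N (\<lambda>x. f (\<sigma> x))"
  unfolding smooth_param_def
proof (intro conjI allI impI ballI)
  show "open S" using smooth_paramD(1)[OF \<sigma>] .
  show "(\<lambda>x. f (\<sigma> x)) ` S \<subseteq> pts N" using smooth_map_onD(2)[OF f] SW by auto
  show "open {x \<in> S. f (\<sigma> x) \<in> V}" if "openin (mtop N) V" for V
    using smooth_paramD(3)[OF \<sigma> smooth_map_onD(3)[OF f that]] SW by (simp cong: conj_cong)
  fix d assume d: "d \<in> charts N"
  show "smooth_on {x \<in> S. f (\<sigma> x) \<in> fst d} (\<lambda>x. snd d (f (\<sigma> x)))"
    using smooth_param_comp_vec[OF M \<sigma> smooth_map_vec[OF M N f smooth_vec_on_chart[OF N d]]] SW
    by (simp cong: conj_cong)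
qed

lemma tangent_map_push:
  assumes M: "smooth_manifold M" and N: "smooth_manifold N"
    and f: "smooth_map_on M N W f" and \<sigma>: "smooth_param S M \<sigma>" and x: "x \<in> S" "\<sigma> x \<in> W"
  shows "tangent_map M N f (\<sigma> x) (push M \<sigma> x e) = push N (\<lambda>x. f (\<sigma> x)) x e"
proof
  fix d
  show "tangent_map M N f (\<sigma> x) (push M \<sigma> x e) d = push N (\<lambda>x. f (\<sigma> x)) x e d"
  proof (cases "d \<in> charts_at N (f (\<sigma> x))")
    case True
    then show ?thesis
      using vec_deriv_push[OF M \<sigma> smooth_map_vec[OF M N f smooth_vec_on_chart[OF N]] x(1)] x(2)
      unfolding tangent_map_eq push_def[of N] by (auto simp: charts_at_def)
  qed (simp add: tangent_map_eq push_def)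
qed

lemma tangent_map_tangent:
  assumes M: "smooth_manifold M" and N: "smooth_manifold N"
    and f: "smooth_map_on M N W f" and p: "p \<in> W" and v: "v \<in> tangent_space M p"
  shows "tangent_map M N f p v \<in> tangent_space N (f p)"
proof -
  have "p \<in> pts M" using p smooth_map_onD(1)[OF f] openin_subset by blast
  then obtain c x where c: "smooth_param (snd c ` fst c) M (chart_inv c)" "x \<in> snd c ` fst c"
      "chart_inv c x = p" "v = push M (chart_inv c) x (v c)"
    using tangent_space_push[OF M _ v] by metis
  let ?S = "{x \<in> snd c ` fst c. chart_inv c x \<in> W}"
  have S: "smooth_param ?S M (chart_inv c)"
    using smooth_param_compose[OF M c(1) smooth_paramD(3)[OF c(1) smooth_map_onD(1)[OF f]] smooth_on_id] by simp
  have xS: "x \<in> ?S" using c p by auto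
  have "tangent_map M N f (chart_inv c x) (push M (chart_inv c) x (v c)) =
      push N (\<lambda>x. f (chart_inv c x)) x (v c)"
    using tangent_map_push[OF M N f S xS] xS by simp
  moreover have "push N (\<lambda>x. f (chart_inv c x)) x (v c) \<in> tangent_space N (f (chart_inv c x))"
    using push_tangent[OF N smooth_map_param[OF M N f S] xS] by simp
  ultimately show ?thesis using c(3,4) by simp
qed

lemma vec_deriv_tangent_map:
  assumes M: "smooth_manifold M" and N: "smooth_manifold N"
    and f: "smooth_map_on M N W f" and F: "smooth_vec_on N V F"
    and p: "p \<in> W" "f p \<in> V" and v: "v \<in> tangent_space M p"
  shows "vec_deriv N F (f p) (tangent_map M N f p v) = vec_deriv M (\<lambda>p. F (f p)) p v"
proof -
  have "p \<in> pts M" using p smooth_map_onD(1)[OF f] openin_subset by blast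
  then obtain c x where c: "smooth_param (snd c ` fst c) M (chart_inv c)" "x \<in> snd c ` fst c"
      "chart_inv c x = p" "v = push M (chart_inv c) x (v c)"
    using tangent_space_push[OF M _ v] by metis
  let ?S = "{x \<in> snd c ` fst c. chart_inv c x \<in> W}"
  have S: "smooth_param ?S M (chart_inv c)"
    using smooth_param_compose[OF M c(1) smooth_paramD(3)[OF c(1) smooth_map_onD(1)[OF f]] smooth_on_id] by simp
  have xS: "x \<in> ?S" using c p by auto
  have 1: "tangent_map M N f (chart_inv c x) (push M (chart_inv c) x (v c)) =
      push N (\<lambda>x. f (chart_inv c x)) x (v c)"
    using tangent_map_push[OF M N f S xS] xS by simp
  have 2: "vec_deriv N F (f (chart_inv c x)) (push N (\<lambda>x. f (chart_inv c x)) x (v c)) =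
      frechet_derivative (\<lambda>x. F (f (chart_inv c x))) (at x) (v c)"
    using vec_deriv_push[OF N smooth_map_param[OF M N f S] F xS] c(3) p by simp
  have 3: "vec_deriv M (\<lambda>p. F (f p)) (chart_inv c x) (push M (chart_inv c) x (v c)) =
      frechet_derivative (\<lambda>x. F (f (chart_inv c x))) (at x) (v c)"
    using vec_deriv_push[OF M S smooth_map_vec[OF M N f F] xS] c(3) p by simp
  show ?thesis using 1 2 3 c(3,4) by metis
qed

lemma tangent_map_lincomb:
  assumes M: "smooth_manifold M" and N: "smooth_manifold N"
    and f: "smooth_map_on M N W f" and p: "p \<in> W"
    and v: "v \<in> tangent_space M p" "w \<in> tangent_space M p"
  shows "tangent_map M N f p (\<lambda>c. r *\<^sub>R v c + s *\<^sub>R w c) =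
    (\<lambda>d. r *\<^sub>R tangent_map M N f p v d + s *\<^sub>R tangent_map M N f p w d)"
proof
  fix d
  show "tangent_map M N f p (\<lambda>c. r *\<^sub>R v c + s *\<^sub>R w c) d =
    r *\<^sub>R tangent_map M N f p v d + s *\<^sub>R tangent_map M N f p w d"
  proof (cases "d \<in> charts_at N (f p)")
    case True
    then show ?thesis
      using smooth_vec_on_lincomb[OF M smooth_map_vec[OF M N f smooth_vec_on_chart[OF N]] _ v] p
      unfolding tangent_map_eq by (auto simp: charts_at_def)
  qed (simp add: tangent_map_eq)
qed

text \<open>In a coordinate ball, which is convex, a map with zero derivative is constant. This is
  the local half of the argument that a connected integral manifold stays in one fibre.\<close>

lemma vec_deriv_zero_locally_constant:
  fixes F :: "'p \<Rightarrow> 'v::real_normed_vector"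
  assumes M: "smooth_manifold M" and F: "smooth_vec_on M W F"
    and zero: "\<And>p v. p \<in> W \<Longrightarrow> v \<in> tangent_space M p \<Longrightarrow> vec_deriv M F p v = 0" and p: "p \<in> W"
  obtains V where "openin (mtop M) V" "p \<in> V" "V \<subseteq> W" "\<And>q. q \<in> V \<Longrightarrow> F q = F p"
proof -
  have "p \<in> pts M" using p smooth_vec_onD(1)[OF F] openin_subset by blast
  then obtain c where c: "c \<in> charts M" "p \<in> fst c" using smooth_manifold_charts_at[OF M] charts_atD by metis
  have ic: "is_chart (mtop M) c" using smooth_manifold_chart[OF M c(1)] .
  let ?A = "snd c ` (fst c \<inter> W)"
  have "open ?A" using chart_open_image[OF ic smooth_vec_onD(1)[OF F]] .
  then obtain r where r: "r > 0" "ball (snd c p) r \<subseteq> ?A"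
    using p c openE[of ?A "snd c p"] by blast
  have dz: "((F \<circ> chart_inv c) has_derivative (\<lambda>h. 0)) (at x within ball (snd c p) r)"
    if x: "x \<in> ball (snd c p) r" for x
  proof -
    have xA: "x \<in> ?A" using r x by blast
    then have q: "chart_inv c x \<in> W" "x \<in> snd c ` fst c" by (auto simp: chart_inv_left[OF ic])
    have "frechet_derivative (\<lambda>x. F (chart_inv c x)) (at x) e = 0" for e
      using vec_deriv_push[OF M smooth_param_chart[OF M c(1)] F q(2,1), of e]
        zero[OF q(1) push_tangent[OF M smooth_param_chart[OF M c(1)] q(2)]] by simp
    then have "frechet_derivative (F \<circ> chart_inv c) (at x) = (\<lambda>h. 0)" by (auto simp: comp_def)
    then have "((F \<circ> chart_inv c) has_derivative (\<lambda>h. 0)) (at x)"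
      using smooth_on_has_derivative[OF smooth_vec_onD(2)[OF F c(1)] xA] by simp
    then show ?thesis by (rule has_derivative_at_withinI)
  qed
  have const: "F (chart_inv c x) = F p" if "x \<in> ball (snd c p) r" for x
    using has_derivative_zero_unique[OF convex_ball dz that, of "snd c p"] r
    by (simp add: chart_inv_left[OF ic c(2)])
  let ?V = "{q \<in> fst c. snd c q \<in> ball (snd c p) r}"
  show thesis
  proof
    show "openin (mtop M) ?V" by (rule chart_open_preimage[OF ic open_ball])
    show "p \<in> ?V" using c r by simp
    show "?V \<subseteq> W"
    proof
      fix q assume "q \<in> ?V"
      then obtain q' where "q' \<in> fst c" "q' \<in> W" "snd c q = snd c q'" "q \<in> fst c" using r by blast
      then show "q \<in> W" using is_chart_inj[OF ic] by (metis inj_onD)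
    qed
    show "F q = F p" if "q \<in> ?V" for q
      using const[of "snd c q"] that by (auto simp: chart_inv_left[OF ic])
  qed
qed

text \<open>A 1-form is known to be smooth only on chart vectors with constant components. The
  pushed vector has varying components in the chart c, and expanding them in the standard basis
  leaves smooth coefficients times such values.\<close>

lemma smooth_one_form_push:
  fixes \<omega> :: "'p \<Rightarrow> ('p, 'e::euclidean_space) tvec \<Rightarrow> 'v::real_normed_vector"
  assumes M: "smooth_manifold M" and \<omega>: "one_form_on M (pts M) \<omega>" and \<sigma>: "smooth_param S M \<sigma>"
  shows "smooth_on S (\<lambda>x. \<omega> (\<sigma> x) (push M \<sigma> x e))"
proof (rule smooth_on_local)
  fix x assume x: "x \<in> S"
  then obtain c where c: "c \<in> charts M" "\<sigma> x \<in> fst c"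
    using smooth_manifold_charts_at[OF M] charts_atD smooth_paramD(2)[OF \<sigma>] by metis
  have ic: "is_chart (mtop M) c" using smooth_manifold_chart[OF M c(1)] .
  note pc = smooth_param_chart[OF M c(1)]
  let ?T = "{x\<in>S. \<sigma> x \<in> fst c}"
  have oT: "open ?T" using smooth_paramD(3)[OF \<sigma>] ic unfolding is_chart_def by blast
  let ?D = "\<lambda>y. frechet_derivative (\<lambda>x. snd c (\<sigma> x)) (at y) e"
  let ?w = "\<lambda>b x. \<omega> (chart_inv c x) (chart_vec M c (chart_inv c x) b)"
  have eq: "\<omega> (\<sigma> y) (push M \<sigma> y e) = (\<Sum>b\<in>Basis. (?D y \<bullet> b) *\<^sub>R ?w b (snd c (\<sigma> y)))"
    if y: "y \<in> ?T" for y
  proof -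
    have yS: "y \<in> S" and yc: "c \<in> charts_at M (\<sigma> y)" using y c by (auto simp: charts_at_def)
    let ?z = "snd c (\<sigma> y)"
    have z: "?z \<in> snd c ` fst c" and iz: "chart_inv c ?z = \<sigma> y"
      using y chart_inv_left[OF ic] by auto
    have 1: "push M \<sigma> y e = push M (chart_inv c) ?z (?D y)"
      using push_chart[OF M yc push_tangent[OF M \<sigma> yS, of e]] yc by (simp add: push_def[of M \<sigma>])
    have "linear (\<lambda>b. \<omega> (\<sigma> y) (push M (chart_inv c) ?z b))"
    proof (rule linearI)
      have t: "push M (chart_inv c) ?z b \<in> tangent_space M (\<sigma> y)" for b
        using push_tangent[OF M pc z] iz by simp
      have *: "\<omega> (\<sigma> y) (push M (chart_inv c) ?z (r *\<^sub>R b + s *\<^sub>R b')) =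
          r *\<^sub>R \<omega> (\<sigma> y) (push M (chart_inv c) ?z b) + s *\<^sub>R \<omega> (\<sigma> y) (push M (chart_inv c) ?z b')" for r s b b'
        unfolding push_lincomb[OF M pc z]
        using \<omega> smooth_paramD(2)[OF \<sigma> yS] t unfolding one_form_on_def by blast
      show "\<omega> (\<sigma> y) (push M (chart_inv c) ?z (b + b')) =
          \<omega> (\<sigma> y) (push M (chart_inv c) ?z b) + \<omega> (\<sigma> y) (push M (chart_inv c) ?z b')" for b b'
        using *[of 1 b 1 b'] by simp
      show "\<omega> (\<sigma> y) (push M (chart_inv c) ?z (r *\<^sub>R b)) = r *\<^sub>R \<omega> (\<sigma> y) (push M (chart_inv c) ?z b)" for r b
        using *[of r b 0 b] by simp
    qed
    from linear_sum[OF this, of "\<lambda>b. (?D y \<bullet> b) *\<^sub>R b" Basis] linear_cmul[OF this]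
    have "\<omega> (\<sigma> y) (push M (chart_inv c) ?z (?D y)) =
        (\<Sum>b\<in>Basis. (?D y \<bullet> b) *\<^sub>R \<omega> (\<sigma> y) (push M (chart_inv c) ?z b))"
      by (simp add: euclidean_representation)
    then show ?thesis using 1 chart_vec_push[OF z] iz by simp
  qed
  have sc: "smooth_on ?T (\<lambda>x. snd c (\<sigma> x))" using smooth_paramD(4)[OF \<sigma> c(1)] .
  have "smooth_on ?T (\<lambda>y. \<Sum>b\<in>Basis. (?D y \<bullet> b) *\<^sub>R ?w b (snd c (\<sigma> y)))"
  proof (intro smooth_on_sum smooth_on_scaleR oT smooth_on_inner smooth_on_const
      smooth_on_frechet_derivative sc)
    fix b :: 'e
    have "smooth_on (snd c ` (fst c \<inter> pts M)) (?w b)"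
      using \<omega> c(1) unfolding one_form_on_def by blast
    moreover have "fst c \<inter> pts M = fst c" using is_chart_subset[OF ic] by blast
    ultimately have w: "smooth_on (snd c ` fst c) (?w b)" by simp
    show "smooth_on ?T (\<lambda>y. ?w b (snd c (\<sigma> y)))"
      by (rule smooth_on_compose[OF oT smooth_paramD(1)[OF pc] _ w sc]) auto
  qed
  then have "smooth_on ?T (\<lambda>x. \<omega> (\<sigma> x) (push M \<sigma> x e))"
    by (subst smooth_on_cong[OF oT eq])
  then show "\<exists>T. open T \<and> x \<in> T \<and> smooth_on T (\<lambda>x. \<omega> (\<sigma> x) (push M \<sigma> x e))"
    using oT x c(2) by blast
qed

text \<open>If \<open>\<sigma>\<close> inverts F, then d\<open>\<sigma>\<close> inverts dF. Hence a
  tangent vector is determined by its components in coordinates F that need not be a chart of the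
  atlas.\<close>

lemma coordinates_push:
  fixes F :: "'p \<Rightarrow> 'a::euclidean_space"
  assumes M: "smooth_manifold M" and F: "smooth_vec_on M W F" and \<sigma>: "smooth_param S M \<sigma>"
    and FS: "\<And>p. p \<in> W \<Longrightarrow> F p \<in> S" and \<sigma>F: "\<And>p. p \<in> W \<Longrightarrow> \<sigma> (F p) = p"
    and p: "p \<in> W" and v: "v \<in> tangent_space M p"
  shows "push M \<sigma> (F p) (vec_deriv M F p v) = v"
proof -
  have W: "openin (mtop M) W" using smooth_vec_onD(1)[OF F] .
  have "p \<in> pts M" using p W openin_subset by blast
  then obtain c where c: "c \<in> charts_at M p" using smooth_manifold_charts_at[OF M] by metis
  note c' = charts_atD[OF c]
  show ?thesis
  proof (rule tangent_space_eqI[OF M c])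
    show "push M \<sigma> (F p) (vec_deriv M F p v) \<in> tangent_space M p"
      using push_tangent[OF M \<sigma> FS[OF p]] \<sigma>F[OF p] by simp
    have "((\<lambda>x. snd c (\<sigma> x)) has_derivative frechet_derivative (\<lambda>x. snd c (\<sigma> x)) (at (F p))) (at (F p))"
      using smooth_on_has_derivative[OF smooth_paramD(4)[OF \<sigma> c'(1)]] FS[OF p] \<sigma>F[OF p] c'(2) by simp
    from vec_deriv_compose[OF M F p this v]
    have "frechet_derivative (\<lambda>x. snd c (\<sigma> x)) (at (F p)) (vec_deriv M F p v) =
        vec_deriv M (\<lambda>p. snd c (\<sigma> (F p))) p v" by simp
    also have "\<dots> = vec_deriv M (snd c) p v"
      by (rule vec_deriv_cong[OF M W p]) (simp add: \<sigma>F)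
    also have "\<dots> = v c" by (rule vec_deriv_chart[OF M c v])
    finally show "push M \<sigma> (F p) (vec_deriv M F p v) c = v c"
      using c \<sigma>F[OF p] by (simp add: push_def)
  qed (rule v)
qed

text \<open>Differentiability of g is the inverse function theorem for a given continuous inverse.
  Smoothness then bootstraps from g' = (f')^-1 composed with g. The isomorphism J to some real^'m is
  there because determinants are defined for such vectors only.\<close>

lemma smooth_on_inverse_function:
  fixes f g :: "'a::euclidean_space \<Rightarrow> 'a" and J :: "'a \<Rightarrow> real^'m"
  assumes J: "linear J" "bij J" and S: "open S" and f: "smooth_on S f" and fS: "open (f ` S)"
    and g: "continuous_on (f ` S) g" and gf: "\<And>x. x \<in> S \<Longrightarrow> g (f x) = x"
    and surj: "\<And>x. x \<in> S \<Longrightarrow> surj (frechet_derivative f (at x))"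
  shows "smooth_on (f ` S) g"
proof -
  define K where "K = inv J"
  have KJ: "K (J x) = x" and JK: "J (K y) = y" for x y
    using J(2) unfolding K_def by (auto simp: bij_is_inj bij_is_surj surj_f_inv_f)
  have K: "linear K"
  proof (rule linearI)
    show "K (x + y) = K x + K y" for x y
      using KJ[of "K x + K y"] by (simp add: linear_add[OF J(1)] JK)
    show "K (r *\<^sub>R x) = r *\<^sub>R K x" for r x
      using KJ[of "r *\<^sub>R K x"] by (simp add: linear_cmul[OF J(1)] JK)
  qed
  let ?D = "\<lambda>x. frechet_derivative f (at x)"
  let ?A = "\<lambda>x. \<chi> i j. J (?D x (K (axis j 1))) $ i"
  \<comment> \<open>Cramer's solution u of the equation Df(x) u = v, transported by J. Being a
    quotient of determinants it is visibly smooth in x.\<close>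
  let ?w = "\<lambda>v x. K (\<chi> k. det (\<chi> i j. if j = k then J v $ i else ?A x $ i $ j) / det (?A x))"
  have lin: "linear (?D x)" if "x \<in> S" for x
    using linear_frechet_derivative[OF smooth_on_differentiable[OF f that]] .
  have inj: "inj (?D x)" if "x \<in> S" for x
    using linear_surjective_imp_injective[OF lin[OF that]] surj[OF that] by auto
  have A: "?A x *v y = J (?D x (K y))" if x: "x \<in> S" for x y
  proof -
    have "linear (\<lambda>y. J (?D x (K y)))"
      using linear_compose[OF linear_compose[OF K lin[OF x]] J(1)] by (simp add: comp_def)
    from matrix_works[OF this[unfolded linear_matrix_vector_mul_eq[symmetric]], of y]
    show ?thesis unfolding matrix_def by simp
  qed
  have det: "det (?A x) \<noteq> 0" if x: "x \<in> S" for x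
  proof -
    have "inj ((*v) (?A x))"
    proof (rule injI)
      fix y z assume "?A x *v y = ?A x *v z"
      then have "J (?D x (K y)) = J (?D x (K z))" by (simp add: A[OF x])
      then show "y = z" by (metis KJ JK inj[OF x] injD)
    qed
    then show ?thesis by (metis invertible_det_nz invertible_left_inverse matrix_left_invertible_injective)
  qed
  have w: "?D x u = v \<longleftrightarrow> u = ?w v x" if x: "x \<in> S" for x u v
  proof -
    let ?z = "\<chi> k. det (\<chi> i j. if j = k then J v $ i else ?A x $ i $ j) / det (?A x)"
    have "?D x u = v \<longleftrightarrow> ?A x *v J u = J v"
      unfolding A[OF x] KJ using KJ by metis
    also have "\<dots> \<longleftrightarrow> J u = ?z" by (rule cramer[OF det[OF x]])
    also have "\<dots> \<longleftrightarrow> u = K ?z" using KJ[of u] JK[of ?z] by auto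
    finally show ?thesis .
  qed
  have dg: "(g has_derivative (\<lambda>v. ?w v (g y))) (at y)" if y: "y \<in> f ` S" for y
  proof -
    obtain x where x: "x \<in> S" "y = f x" using y by auto
    have "bij (?D x)" using inj[OF x(1)] surj[OF x(1)] by (simp add: bij_def)
    have inv: "inv (?D x) = (\<lambda>v. ?w v x)"
    proof
      fix v
      have "?D x (inv (?D x) v) = v" using surj[OF x(1)] by (rule surj_f_inv_f)
      then show "inv (?D x) v = ?w v x" by (simp only: w[OF x(1)])
    qed
    have "bounded_linear (inv (?D x))"
      using inj_linear_imp_inv_linear[OF lin[OF x(1)] inj[OF x(1)]] linear_conv_bounded_linear by blast
    moreover have "inv (?D x) \<circ> ?D x = id" using inj[OF x(1)] by simp
    ultimately have "(g has_derivative inv (?D x)) (at (f x))"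
      by (intro has_derivative_inverse_dieudonne[OF S fS smooth_onD_continuous[OF f] g gf x(1)
            smooth_on_has_derivative[OF f x(1)]])
    moreover have gy: "g y = x" using x gf by simp
    ultimately show ?thesis unfolding gy unfolding x(2) inv by blast
  qed
  have sw: "smooth_on S (?w v)" for v
  proof (intro smooth_on_bounded_linear[of K] S smooth_on_vec_lambda smooth_on_divide smooth_on_det)
    show "bounded_linear K" using K by (simp add: linear_conv_bounded_linear)
    have "bounded_linear J" using J by (simp add: linear_conv_bounded_linear)
    then have e: "smooth_on S (\<lambda>x. J (?D x (K (axis j 1))) $ i)" for i j
      by (intro smooth_on_vec_nth S smooth_on_bounded_linear[of J] smooth_on_frechet_derivative f)
    then show "smooth_on S (\<lambda>x. J (?D x (K (axis j 1))) $ i)" for i j .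
    show "smooth_on S (\<lambda>x. if j = k then J v $ i else ?A x $ i $ j)" for i j k
      using e by (cases "j = k") auto
  qed (use det in auto)
  \<comment> \<open>The derivative of g in direction v is the smooth map \<open>?w v\<close>
    composed with g, so k derivatives of g give one more.\<close>
  have "ck_on k (f ` S) g" for k
  proof (induction k)
    case 0
    then show ?case using g by simp
  next
    case (Suc k)
    have "ck_on k (f ` S) (\<lambda>y. frechet_derivative g (at y) v)" for v
    proof -
      have "ck_on k (f ` S) (\<lambda>y. ?w v (g y))"
        using sw[unfolded smooth_on_def] by (intro ck_on_compose[OF fS S _ _ Suc]) (auto simp: gf)
      then show ?thesis
        by (subst ck_on_cong[OF fS, of _ "\<lambda>y. ?w v (g y)"]) (simp_all add: frechet_derivative_at'[OF dg])
    qed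
    then show ?case using dg by (auto simp: differentiable_def)
  qed
  then show ?thesis unfolding smooth_on_def by blast
qed

section \<open>Quotient manifolds\<close>

text \<open>Uses the topology only, so it applies to charts of two atlases whose compatibility is
  still to be shown.\<close>

lemma continuous_on_transition:
  assumes c: "is_chart X c" and d: "is_chart X d"
  shows "continuous_on (snd d ` (fst d \<inter> fst c)) (snd c \<circ> chart_inv d)"
proof -
  let ?A = "snd d ` (fst d \<inter> fst c)"
  have o: "open ?A" using chart_open_image[OF d] c unfolding is_chart_def by blast
  have "open ((snd c \<circ> chart_inv d) -` T \<inter> ?A)" if T: "open T" for T
  proof -
    have "open (snd d ` (fst d \<inter> {p \<in> fst c. snd c p \<in> T}))"
      using chart_open_image[OF d chart_open_preimage[OF c T]] .
    also have "snd d ` (fst d \<inter> {p \<in> fst c. snd c p \<in> T}) = (snd c \<circ> chart_inv d) -` T \<inter> ?A"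
      by (auto simp: chart_inv_left[OF d])
    finally show ?thesis .
  qed
  then show ?thesis using continuous_on_open_vimage[OF o] by blast
qed

text \<open>For a chart that need not belong to the atlas, compatibility becomes smoothness of the
  coordinate map and of its inverse, to which the general lemmas on smooth maps apply.\<close>

lemma compatible_atlas_iff:
  assumes M: "smooth_manifold M" and c: "is_chart (mtop M) c"
  shows "(\<forall>d\<in>charts M. compatible c d) \<longleftrightarrow>
    smooth_vec_on M (fst c) (snd c) \<and> smooth_param (snd c ` fst c) M (chart_inv c)"
proof -
  have [simp]: "chart_inv c ` snd c ` fst c \<subseteq> pts M" "open (snd c ` fst c)" "openin (mtop M) (fst c)"
    using is_chart_subset[OF c] c by (auto simp: chart_inv_left[OF c] is_chart_def)
  have op: "open {x \<in> snd c ` fst c. chart_inv c x \<in> W}" if "openin (mtop M) W" for W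
    using chart_open_image[OF c that] by (simp add: chart_image_eq[OF c])
  have "compatible c d \<longleftrightarrow> smooth_on (snd d ` (fst d \<inter> fst c)) (snd c \<circ> chart_inv d) \<and>
      smooth_on {x \<in> snd c ` fst c. chart_inv c x \<in> fst d} (\<lambda>x. snd d (chart_inv c x))" for d
    unfolding compatible_def by (simp add: chart_image_eq[OF c] Int_commute comp_def conj_commute)
  then show ?thesis
    unfolding smooth_vec_on_def smooth_param_def using op by auto
qed

lemma compatible_sym: "compatible c d \<longleftrightarrow> compatible d c"
  unfolding compatible_def by (auto simp: Int_commute)

text \<open>Two charts compatible with all of M are compatible with each other: the transition map
  is the parametrisation of M by one of them followed by the smooth coordinate map of the
  other.\<close>

lemma maximal_atlas_extension:
  assumes M: "smooth_manifold M"
  defines "N \<equiv> \<lparr>mtop = mtop M, charts = {c. is_chart (mtop M) c \<and> (\<forall>d\<in>charts M. compatible c d)}\<rparr>"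
  shows "smooth_manifold N" "maximal_atlas N" "charts M \<subseteq> charts N"
proof -
  have comp: "compatible c d" if "c \<in> charts N" "d \<in> charts N" for c d
  proof -
    have half: "smooth_on (snd c ` (fst c \<inter> fst d)) (snd d \<circ> chart_inv c)"
      if "c \<in> charts N" "d \<in> charts N" for c d
    proof -
      have c: "is_chart (mtop M) c" and d: "is_chart (mtop M) d"
        using that unfolding N_def by auto
      have "smooth_on {x \<in> snd c ` fst c. chart_inv c x \<in> fst d} (\<lambda>x. snd d (chart_inv c x))"
        using that compatible_atlas_iff[OF M c] compatible_atlas_iff[OF M d]
          smooth_param_comp_vec[OF M] unfolding N_def by auto
      then show ?thesis by (simp add: chart_image_eq[OF c] comp_def)
    qed
    show ?thesis unfolding compatible_def using half[of c d] half[of d c] that by (simp add: Int_commute)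
  qed
  show sub: "charts M \<subseteq> charts N"
    using M unfolding N_def smooth_manifold_def by auto
  have "pts N = \<Union> (fst ` charts N)"
  proof
    show "pts N \<subseteq> \<Union> (fst ` charts N)"
      using M sub unfolding smooth_manifold_def N_def by auto
    show "\<Union> (fst ` charts N) \<subseteq> pts N" unfolding N_def using is_chart_subset by fastforce
  qed
  moreover have "mtop N = mtop M" "\<forall>c\<in>charts N. is_chart (mtop M) c" unfolding N_def by auto
  moreover have "Hausdorff_space (mtop M)" "second_countable (mtop M)"
    using M unfolding smooth_manifold_def by auto
  ultimately show "smooth_manifold N" unfolding smooth_manifold_def using comp by metis
  show "maximal_atlas N" unfolding maximal_atlas_def using sub by (auto simp: N_def)
qed

text \<open>Abstract form of the leaf space. Each W is saturated and \<open>\<Psi>\<close> separates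
  exactly the classes in it; local sections through every point play the part of the constant rank
  theorem. A separation condition is imposed only on classes with no common domain, since the others
  are separated by the values of \<open>\<Psi>\<close>.\<close>

locale quotient_charts =
  fixes P :: "('p, 'f::euclidean_space) mfd" and R :: "('p \<times> 'p) set"
    and \<F> :: "('p set \<times> ('p \<Rightarrow> 'e::euclidean_space)) set"
  assumes P: "smooth_manifold P" and R: "equiv (pts P) R"
    and vec: "\<And>W \<Psi>. (W, \<Psi>) \<in> \<F> \<Longrightarrow> smooth_vec_on P W \<Psi>"
    and cover: "\<And>p. p \<in> pts P \<Longrightarrow> \<exists>W \<Psi>. (W, \<Psi>) \<in> \<F> \<and> p \<in> W"
    and fibre: "\<And>W \<Psi> p. (W, \<Psi>) \<in> \<F> \<Longrightarrow> p \<in> W \<Longrightarrow> R `` {p} = {p'\<in>W. \<Psi> p' = \<Psi> p}"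
    and sections: "\<And>W \<Psi> p. (W, \<Psi>) \<in> \<F> \<Longrightarrow> p \<in> W \<Longrightarrow>
      \<exists>S \<sigma>. smooth_param S P \<sigma> \<and> \<Psi> p \<in> S \<and> \<sigma> (\<Psi> p) = p \<and> (\<forall>x\<in>S. \<sigma> x \<in> W \<and> \<Psi> (\<sigma> x) = x)"
    and separation: "\<And>p p'. p \<in> pts P \<Longrightarrow> p' \<in> pts P \<Longrightarrow> (p, p') \<notin> R \<Longrightarrow>
      (\<exists>W \<Psi>. (W, \<Psi>) \<in> \<F> \<and> p \<in> W \<and> p' \<in> W) \<or>
      (\<exists>U V. openin (mtop P) U \<and> openin (mtop P) V \<and> p \<in> U \<and> p' \<in> V \<and>
         R `` U \<inter> R `` V = {})"
begin

abbreviation q where "q p \<equiv> R `` {p}"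

definition "qtop = topology (\<lambda>V. V \<subseteq> pts P // R \<and> openin (mtop P) {p \<in> pts P. q p \<in> V})"

lemma openin_qtop: "openin qtop V \<longleftrightarrow> V \<subseteq> pts P // R \<and> openin (mtop P) {p \<in> pts P. q p \<in> V}"
proof -
  have "istopology (\<lambda>V. V \<subseteq> pts P // R \<and> openin (mtop P) {p \<in> pts P. q p \<in> V})"
    unfolding istopology_def
  proof (intro conjI allI impI)
    fix S T assume "S \<subseteq> pts P // R \<and> openin (mtop P) {p \<in> pts P. q p \<in> S}"
      "T \<subseteq> pts P // R \<and> openin (mtop P) {p \<in> pts P. q p \<in> T}"
    moreover have "{p \<in> pts P. q p \<in> S \<inter> T} = {p \<in> pts P. q p \<in> S} \<inter> {p \<in> pts P. q p \<in> T}" by auto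
    ultimately show "S \<inter> T \<subseteq> pts P // R" "openin (mtop P) {p \<in> pts P. q p \<in> S \<inter> T}" by auto
  next
    fix K assume "\<forall>S\<in>K. S \<subseteq> pts P // R \<and> openin (mtop P) {p \<in> pts P. q p \<in> S}"
    moreover have "{p \<in> pts P. q p \<in> \<Union>K} = (\<Union>S\<in>K. {p \<in> pts P. q p \<in> S})" by auto
    ultimately show "\<Union>K \<subseteq> pts P // R" "openin (mtop P) {p \<in> pts P. q p \<in> \<Union>K}" by auto
  qed
  then show ?thesis unfolding qtop_def by (simp add: topology_inverse')
qed

lemma q_in: "p \<in> pts P \<Longrightarrow> q p \<in> pts P // R"
  by (rule quotientI)

lemma topspace_qtop [simp]: "topspace qtop = pts P // R"
proof
  show "topspace qtop \<subseteq> pts P // R" using openin_topspace[of qtop] openin_qtop by blast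
  have "{p \<in> pts P. q p \<in> pts P // R} = pts P" using q_in by auto
  then have "openin qtop (pts P // R)" by (simp add: openin_qtop)
  then show "pts P // R \<subseteq> topspace qtop" by (rule openin_subset)
qed

lemma W_subset: "(W, \<Psi>) \<in> \<F> \<Longrightarrow> W \<subseteq> pts P"
  using smooth_vec_onD(1)[OF vec] openin_subset by blast

lemma R_iff: "(W, \<Psi>) \<in> \<F> \<Longrightarrow> p \<in> W \<Longrightarrow> (p, p') \<in> R \<longleftrightarrow> p' \<in> W \<and> \<Psi> p' = \<Psi> p"
  using fibre by blast

lemma q_eq: "p \<in> pts P \<Longrightarrow> p' \<in> pts P \<Longrightarrow> q p = q p' \<longleftrightarrow> (p, p') \<in> R"
  using R eq_equiv_class_iff by fast

lemma q_in_image: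
  assumes F: "(W, \<Psi>) \<in> \<F>" and p: "p \<in> pts P" "q p \<in> q ` W" shows "p \<in> W"
proof -
  obtain w where w: "w \<in> W" "q w = q p" using p(2) by auto
  then have "(w, p) \<in> R" using q_eq[of w p] W_subset[OF F] p(1) by blast
  then show ?thesis using R_iff[OF F w(1)] by blast
qed

text \<open>The saturation of an open set is open: for p equivalent to w in \<open>W0\<close>, the
  point \<open>\<sigma> (\<Psi> p)\<close> of a section through w is equivalent to p, and it stays
  in \<open>W0\<close> as p varies slightly.\<close>

lemma q_open:
  assumes W0: "openin (mtop P) W0" shows "openin qtop (q ` W0)"
  unfolding openin_qtop
proof
  have W0P: "W0 \<subseteq> pts P" using W0 openin_subset by blast
  then show "q ` W0 \<subseteq> pts P // R" using q_in by blast
  show "openin (mtop P) {p \<in> pts P. q p \<in> q ` W0}"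
  proof (subst openin_subopen, intro ballI)
    fix p assume "p \<in> {p \<in> pts P. q p \<in> q ` W0}"
    then obtain w where w: "p \<in> pts P" "w \<in> W0" "q p = q w" by auto
    then have wP: "w \<in> pts P" using W0P by blast
    obtain W \<Psi> where F: "(W, \<Psi>) \<in> \<F>" "w \<in> W" using cover[OF wP] by blast
    have p: "p \<in> W" "\<Psi> p = \<Psi> w" using R_iff[OF F] q_eq[OF wP w(1)] w(3) by auto
    obtain S \<sigma> where \<sigma>: "smooth_param S P \<sigma>" "\<Psi> w \<in> S" "\<sigma> (\<Psi> w) = w"
      "\<And>x. x \<in> S \<Longrightarrow> \<sigma> x \<in> W \<and> \<Psi> (\<sigma> x) = x" using sections[OF F] by blast
    let ?N = "{x\<in>S. \<sigma> x \<in> W0}"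
    have "openin (mtop P) {p \<in> W. \<Psi> p \<in> ?N}"
      by (rule smooth_vec_on_continuous[OF P vec[OF F(1)] smooth_paramD(3)[OF \<sigma>(1) W0]])
    moreover have "p \<in> {p \<in> W. \<Psi> p \<in> ?N}" using p \<sigma> w by auto
    moreover have "{p \<in> W. \<Psi> p \<in> ?N} \<subseteq> {p \<in> pts P. q p \<in> q ` W0}"
    proof
      fix p assume p: "p \<in> {p \<in> W. \<Psi> p \<in> ?N}"
      then have "(p, \<sigma> (\<Psi> p)) \<in> R" using R_iff[OF F(1)] \<sigma>(4) by auto
      then have "q p = q (\<sigma> (\<Psi> p))" using R equiv_class_eq by fast
      then show "p \<in> {p \<in> pts P. q p \<in> q ` W0}" using p W_subset[OF F(1)] by blast
    qed
    ultimately show "\<exists>T. openin (mtop P) T \<and> p \<in> T \<and> T \<subseteq> {p \<in> pts P. q p \<in> q ` W0}" by blast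
  qed
qed

lemma q_continuous: "openin qtop V \<Longrightarrow> openin (mtop P) {p \<in> pts P. q p \<in> V}"
  by (simp add: openin_qtop)

lemma quotient_map_q: "quotient_map (mtop P) qtop q"
  unfolding quotient_map_def topspace_qtop by (auto simp: openin_qtop quotient_def)

text \<open>The value on a class is read off at an arbitrary representative;
  \<open>snd_qchart\<close> shows independence of the choice, as \<open>\<Psi>\<close> is constant
  on classes.\<close>

definition qchart :: "'p set \<times> ('p \<Rightarrow> 'e) \<Rightarrow> ('p set, 'e) chart" where
  "qchart F = (q ` fst F, \<lambda>y. snd F (SOME p. p \<in> y))"

lemma fst_qchart [simp]: "fst (qchart (W, \<Psi>)) = q ` W"
  by (simp add: qchart_def)

lemma snd_qchart:
  assumes "(W, \<Psi>) \<in> \<F>" "p \<in> W" shows "snd (qchart (W, \<Psi>)) (q p) = \<Psi> p"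
proof -
  have "p \<in> q p" using fibre[OF assms] assms by simp
  then have "(SOME p'. p' \<in> q p) \<in> q p" by (rule someI)
  then show ?thesis using fibre[OF assms] by (simp add: qchart_def)
qed

lemma qchart_image: "(W, \<Psi>) \<in> \<F> \<Longrightarrow> snd (qchart (W, \<Psi>)) ` fst (qchart (W, \<Psi>)) = \<Psi> ` W"
  by (auto simp: snd_qchart image_image)

lemma open_\<Psi>_image:
  assumes F: "(W, \<Psi>) \<in> \<F>" and W0: "openin (mtop P) W0" "W0 \<subseteq> W"
  shows "open (\<Psi> ` W0)"
proof (subst open_subopen, intro ballI)
  fix x assume "x \<in> \<Psi> ` W0"
  then obtain w where w: "w \<in> W0" "x = \<Psi> w" by blast
  obtain S \<sigma> where \<sigma>: "smooth_param S P \<sigma>" "\<Psi> w \<in> S" "\<sigma> (\<Psi> w) = w"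
    "\<And>x. x \<in> S \<Longrightarrow> \<sigma> x \<in> W \<and> \<Psi> (\<sigma> x) = x" using sections[OF F] w W0 by blast
  have "open {x\<in>S. \<sigma> x \<in> W0}" using smooth_paramD(3)[OF \<sigma>(1) W0(1)] .
  moreover have "x \<in> {x\<in>S. \<sigma> x \<in> W0}" using \<sigma> w by simp
  moreover have "{x\<in>S. \<sigma> x \<in> W0} \<subseteq> \<Psi> ` W0" using \<sigma>(4) by (auto simp: image_iff) metis
  ultimately show "\<exists>T. open T \<and> x \<in> T \<and> T \<subseteq> \<Psi> ` W0" by blast
qed

lemma is_chart_qchart:
  assumes F: "(W, \<Psi>) \<in> \<F>" shows "is_chart qtop (qchart (W, \<Psi>))"
proof -
  let ?c = "qchart (W, \<Psi>)"
  have oW: "openin (mtop P) W" using smooth_vec_onD(1)[OF vec[OF F]] .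
  have oq: "openin qtop (q ` W)" by (rule q_open[OF oW])
  have oi: "open (\<Psi> ` W)" using open_\<Psi>_image[OF F oW] by simp
  have top: "topspace (subtopology qtop (q ` W)) = q ` W"
    using openin_subset[OF oq] by (simp add: Int_absorb1)
  have "homeomorphic_map (subtopology qtop (q ` W)) (top_of_set (\<Psi> ` W)) (snd ?c)"
  proof (rule bijective_open_imp_homeomorphic_map)
    show "continuous_map (subtopology qtop (q ` W)) (top_of_set (\<Psi> ` W)) (snd ?c)"
      unfolding continuous_map_def top
    proof (intro conjI allI impI)
      show "snd ?c \<in> q ` W \<rightarrow> topspace (top_of_set (\<Psi> ` W))" using snd_qchart[OF F] by auto
      fix U assume "openin (top_of_set (\<Psi> ` W)) U"
      then have U: "open U" "U \<subseteq> \<Psi> ` W" using oi by (auto simp: openin_open_eq)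
      have "{p \<in> pts P. q p \<in> {y \<in> q ` W. snd ?c y \<in> U}} = {p \<in> W. \<Psi> p \<in> U}"
      proof (intro set_eqI iffI)
        fix x assume x: "x \<in> {p \<in> pts P. q p \<in> {y \<in> q ` W. snd ?c y \<in> U}}"
        then have "x \<in> W" using q_in_image[OF F] by blast
        then show "x \<in> {p \<in> W. \<Psi> p \<in> U}" using x snd_qchart[OF F] by simp
      qed (use W_subset[OF F] snd_qchart[OF F] in auto)
      then have "openin qtop {y \<in> q ` W. snd ?c y \<in> U}"
        using smooth_vec_on_continuous[OF P vec[OF F] U(1)] openin_subset[OF oq]
        by (auto simp: openin_qtop)
      then show "openin (subtopology qtop (q ` W)) {y \<in> q ` W. snd ?c y \<in> U}"
        by (metis (no_types, lifting) inf.absorb_iff2 mem_Collect_eq openin_subtopology_Int2 subsetI)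
    qed
    show "open_map (subtopology qtop (q ` W)) (top_of_set (\<Psi> ` W)) (snd ?c)"
      unfolding open_map_def
    proof (intro allI impI)
      fix U assume "openin (subtopology qtop (q ` W)) U"
      then have U: "openin qtop U" "U \<subseteq> q ` W" using oq openin_open_subtopology by blast+
      have "snd ?c ` U = \<Psi> ` {p \<in> pts P. q p \<in> U}"
      proof -
        have "U = q ` {p \<in> pts P. q p \<in> U}" using U W_subset[OF F] by auto
        moreover have "{p \<in> pts P. q p \<in> U} \<subseteq> W" using U(2) q_in_image[OF F] by blast
        ultimately show ?thesis using snd_qchart[OF F] by (metis (no_types, lifting) image_cong image_image subsetD)
      qed
      moreover have "{p \<in> pts P. q p \<in> U} \<subseteq> W" using U(2) q_in_image[OF F] by blast
      ultimately show "openin (top_of_set (\<Psi> ` W)) (snd ?c ` U)"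
        using open_\<Psi>_image[OF F q_continuous[OF U(1)]] oi by (auto simp: openin_open_eq)
    qed
    show "snd ?c ` topspace (subtopology qtop (q ` W)) = topspace (top_of_set (\<Psi> ` W))"
      unfolding top using qchart_image[OF F] by simp
    show "inj_on (snd ?c) (topspace (subtopology qtop (q ` W)))"
      unfolding top using snd_qchart[OF F] R_iff[OF F] q_eq W_subset[OF F]
      by (auto simp: inj_on_def)
  qed
  then show ?thesis unfolding is_chart_def qchart_image[OF F] using oq oi by simp
qed

lemma qchart_inv:
  assumes F: "(W, \<Psi>) \<in> \<F>" "p \<in> W"
  shows "chart_inv (qchart (W, \<Psi>)) (\<Psi> p) = q p"
  using chart_inv_left[OF is_chart_qchart[OF F(1)], of "q p"] F snd_qchart[OF F] by auto

text \<open>Atlas consisting of the quotient charts alone; the leaf space \<open>Q\<close> is its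
  maximal extension.\<close>

definition Q0 :: "('p set, 'e) mfd" where "Q0 = \<lparr>mtop = qtop, charts = qchart ` \<F>\<rparr>"

lemma Q0_simps [simp]: "mtop Q0 = qtop" "charts Q0 = qchart ` \<F>"
  by (simp_all add: Q0_def)

text \<open>Near each point the inverse of a quotient chart is q composed with a section, so in this
  chart h becomes \<open>G\<close> along the section. Both smoothness of transition maps and
  comparison with foreign charts follow from this.\<close>

lemma smooth_along_section:
  assumes F: "(W, \<Psi>) \<in> \<F>" and G: "smooth_vec_on P V G" and VP: "V \<subseteq> pts P"
    and h: "\<And>p. p \<in> V \<Longrightarrow> h (q p) = G p"
  shows "smooth_on (snd (qchart (W, \<Psi>)) ` (q ` W \<inter> q ` V)) (h \<circ> chart_inv (qchart (W, \<Psi>)))"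
proof (rule smooth_on_local)
  let ?c = "qchart (W, \<Psi>)"
  fix x assume "x \<in> snd ?c ` (q ` W \<inter> q ` V)"
  then obtain w p where w: "w \<in> W" "p \<in> V" "q p = q w" "x = \<Psi> w" using snd_qchart[OF F] by auto
  have pW: "p \<in> W" using q_in_image[OF F] w VP by blast
  have x: "x = \<Psi> p" using R_iff[OF F w(1)] q_eq w W_subset[OF F] VP by (metis subsetD)
  obtain S \<sigma> where \<sigma>: "smooth_param S P \<sigma>" "\<Psi> p \<in> S" "\<sigma> (\<Psi> p) = p"
    "\<And>x. x \<in> S \<Longrightarrow> \<sigma> x \<in> W \<and> \<Psi> (\<sigma> x) = x" using sections[OF F pW] by blast
  let ?T = "{x\<in>S. \<sigma> x \<in> V}"
  have oT: "open ?T" using smooth_paramD(3)[OF \<sigma>(1) smooth_vec_onD(1)[OF G]] .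
  have "smooth_on ?T (\<lambda>x. G (\<sigma> x))" by (rule smooth_param_comp_vec[OF P \<sigma>(1) G])
  moreover have "smooth_on ?T (\<lambda>x. G (\<sigma> x)) \<longleftrightarrow> smooth_on ?T (h \<circ> chart_inv ?c)"
  proof (rule smooth_on_cong[OF oT])
    fix y assume y: "y \<in> ?T"
    then have "chart_inv ?c y = q (\<sigma> y)" using qchart_inv[OF F, of "\<sigma> y"] \<sigma>(4)[of y] by simp
    then show "G (\<sigma> y) = (h \<circ> chart_inv ?c) y" using h[of "\<sigma> y"] y by simp
  qed
  ultimately show "\<exists>T. open T \<and> x \<in> T \<and> smooth_on T (h \<circ> chart_inv ?c)"
    using oT x \<sigma> w by (intro exI[of _ ?T]) auto
qed

text \<open>Classes in a common domain are separated by disjoint neighbourhoods of their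
  coordinates, the others by the assumption \<open>separation\<close>. Second countability is
  inherited through the open continuous surjection q, and transition maps are smooth along
  sections.\<close>

lemma smooth_manifold_Q0: "smooth_manifold Q0"
  unfolding smooth_manifold_def Q0_simps
proof (intro conjI ballI)
  show "Hausdorff_space qtop"
    unfolding Hausdorff_space_def
  proof (intro allI impI)
    fix y y' assume "y \<in> topspace qtop \<and> y' \<in> topspace qtop \<and> y \<noteq> y'"
    then have y: "y \<in> pts P // R" "y' \<in> pts P // R" "y \<noteq> y'" by auto
    then obtain p p' where p: "p \<in> pts P" "p' \<in> pts P" "y = q p" "y' = q p'"
      by (meson quotientE)
    have "(p, p') \<notin> R" using q_eq[OF p(1,2)] y(3) p(3,4) by blast
    note p = p this
    have "\<exists>U V. openin (mtop P) U \<and> openin (mtop P) V \<and> p \<in> U \<and> p' \<in> V \<and> R `` U \<inter> R `` V = {}"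
    proof (cases "\<exists>W \<Psi>. (W, \<Psi>) \<in> \<F> \<and> p \<in> W \<and> p' \<in> W")
      case True
      then obtain W \<Psi> where F: "(W, \<Psi>) \<in> \<F>" "p \<in> W" "p' \<in> W" by blast
      then have "\<Psi> p \<noteq> \<Psi> p'" using R_iff[OF F(1,2)] p(5) by metis
      then obtain A B where AB: "open A" "open B" "\<Psi> p \<in> A" "\<Psi> p' \<in> B" "A \<inter> B = {}"
        using hausdorff by metis
      have "R `` {p \<in> W. \<Psi> p \<in> A} \<inter> R `` {p \<in> W. \<Psi> p \<in> B} = {}"
        using R_iff[OF F(1)] AB(5) by fastforce
      then show ?thesis using smooth_vec_on_continuous[OF P vec[OF F(1)]] AB F by blast
    next
      case False
      with separation[OF p(1,2,5)] show ?thesis by (elim disjE) (blast, assumption)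
    qed
    then obtain U V where UV: "openin (mtop P) U" "openin (mtop P) V" "p \<in> U" "p' \<in> V"
      "R `` U \<inter> R `` V = {}" by blast
    have "disjnt (q ` U) (q ` V)"
    proof -
      have False if "u \<in> U" "v \<in> V" "q u = q v" for u v
      proof -
        have "u \<in> pts P" using that UV(1) openin_subset by blast
        then have "u \<in> q u" using R by (meson equiv_class_self)
        then show False using UV(5) that by blast
      qed
      then show ?thesis unfolding disjnt_def by blast
    qed
    then show "\<exists>U V. openin qtop U \<and> openin qtop V \<and> y \<in> U \<and> y' \<in> V \<and> disjnt U V"
      using q_open[OF UV(1)] q_open[OF UV(2)] UV(3,4) p(3,4) by blast
  qed
  show "second_countable qtop"
  proof (rule second_countable_open_map_image)
    show "continuous_map (mtop P) qtop q" using quotient_map_q quotient_imp_continuous_map by blast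
    show "open_map (mtop P) qtop q" using q_open by (simp add: open_map_def)
    show "q ` pts P = topspace qtop" by (auto simp: quotient_def)
    show "second_countable (mtop P)" using P unfolding smooth_manifold_def by blast
  qed
  show "is_chart qtop c" if "c \<in> qchart ` \<F>" for c
    using that is_chart_qchart by auto
  show "topspace qtop = \<Union> (fst ` qchart ` \<F>)"
  proof
    show "topspace qtop \<subseteq> \<Union> (fst ` qchart ` \<F>)"
    proof
      fix y assume "y \<in> topspace qtop"
      then obtain p where p: "p \<in> pts P" "y = q p" using quotientE by (metis topspace_qtop)
      then obtain W \<Psi> where "(W, \<Psi>) \<in> \<F>" "p \<in> W" using cover by blast
      then have "y \<in> fst (qchart (W, \<Psi>))" "qchart (W, \<Psi>) \<in> qchart ` \<F>" using p by auto
      then show "y \<in> \<Union> (fst ` qchart ` \<F>)" by blast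
    qed
    show "\<Union> (fst ` qchart ` \<F>) \<subseteq> topspace qtop"
      using is_chart_subset[OF is_chart_qchart] by (auto simp del: topspace_qtop) blast
  qed
  show "compatible c d" if cd: "c \<in> qchart ` \<F>" "d \<in> qchart ` \<F>" for c d
  proof -
    have half: "smooth_on (snd c ` (fst c \<inter> fst d)) (snd d \<circ> chart_inv c)"
      if cd': "c \<in> qchart ` \<F>" "d \<in> qchart ` \<F>" for c d
    proof -
      obtain W \<Psi> V G where F: "(W, \<Psi>) \<in> \<F>" "(V, G) \<in> \<F>" "c = qchart (W, \<Psi>)" "d = qchart (V, G)"
        using cd' by (auto elim!: imageE)
      show ?thesis
        using smooth_along_section[OF F(1) vec[OF F(2)] W_subset[OF F(2)], of "snd d"] snd_qchart[OF F(2)]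
        by (simp add: F)
    qed
    show ?thesis unfolding compatible_def using half[of c d] half[of d c] cd by (simp add: Int_commute)
  qed
qed

definition Q :: "('p set, 'e) mfd" where
  "Q = \<lparr>mtop = qtop, charts = {c. is_chart qtop c \<and> (\<forall>d\<in>qchart ` \<F>. compatible c d)}\<rparr>"

lemma Q_top [simp]: "mtop Q = qtop" by (simp add: Q_def)

lemma Q_manifold: "smooth_manifold Q" "maximal_atlas Q" and Q0_Q: "qchart ` \<F> \<subseteq> charts Q"
  using maximal_atlas_extension[OF smooth_manifold_Q0] unfolding Q_def by simp_all

lemma smooth_map_Q0: "smooth_map_on P Q0 (pts P) q"
proof (rule smooth_map_onI)
  fix d assume "d \<in> charts Q0"
  then obtain W \<Psi> where F: "(W, \<Psi>) \<in> \<F>" "d = qchart (W, \<Psi>)" by auto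
  have "{p \<in> pts P. q p \<in> fst d} = W" using F q_in_image[OF F(1)] W_subset[OF F(1)] by auto
  moreover have "smooth_vec_on P W (\<lambda>p. snd d (q p))"
    using vec[OF F(1)] smooth_vec_on_cong[OF P, of W \<Psi> "\<lambda>p. snd d (q p)"] snd_qchart[OF F(1)] F(2) by simp
  ultimately show "smooth_vec_on P {p \<in> pts P. q p \<in> fst d} (\<lambda>p. snd d (q p))" by simp
qed (use q_in q_continuous in auto)

lemma smooth_map_Q: "smooth_map_on P Q (pts P) q"
proof (rule smooth_map_onI)
  fix d assume "d \<in> charts Q"
  then have "is_chart (mtop Q0) d" "\<forall>c\<in>charts Q0. compatible d c" by (auto simp: Q_def)
  then have "smooth_vec_on Q0 (fst d) (snd d)" using compatible_atlas_iff[OF smooth_manifold_Q0] by blast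
  from smooth_map_vec[OF P smooth_manifold_Q0 smooth_map_Q0 this]
  show "smooth_vec_on P {p \<in> pts P. q p \<in> fst d} (\<lambda>p. snd d (q p))" .
qed (use q_in q_continuous in auto)

lemma submersion_Q: "submersion P Q q"
  unfolding submersion_def
proof (intro conjI ballI smooth_map_Q)
  fix p assume p: "p \<in> pts P"
  show "tangent_map P Q q p ` tangent_space P p = tangent_space Q (q p)"
  proof
    show "tangent_map P Q q p ` tangent_space P p \<subseteq> tangent_space Q (q p)"
      using tangent_map_tangent[OF P Q_manifold(1) smooth_map_Q p] by blast
    show "tangent_space Q (q p) \<subseteq> tangent_map P Q q p ` tangent_space P p"
    proof
      fix u assume u: "u \<in> tangent_space Q (q p)"
      obtain W \<Psi> where F: "(W, \<Psi>) \<in> \<F>" "p \<in> W" using cover[OF p] by blast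
      obtain S \<sigma> where \<sigma>: "smooth_param S P \<sigma>" "\<Psi> p \<in> S" "\<sigma> (\<Psi> p) = p"
        "\<And>x. x \<in> S \<Longrightarrow> \<sigma> x \<in> W \<and> \<Psi> (\<sigma> x) = x" using sections[OF F] by blast
      let ?c = "qchart (W, \<Psi>)"
      have c: "?c \<in> charts_at Q (q p)" using F Q0_Q by (auto simp: charts_at_def)
      \<comment> \<open>The lift of u is the derivative of a local section applied to the components
        of u in the quotient chart.\<close>
      let ?v = "push P \<sigma> (\<Psi> p) (u ?c)"
      have \<sigma>P: "\<sigma> x \<in> pts P" if "x \<in> S" for x using smooth_paramD(2)[OF \<sigma>(1) that] .
      have 1: "tangent_map P Q q p ?v = push Q (\<lambda>x. q (\<sigma> x)) (\<Psi> p) (u ?c)"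
        using tangent_map_push[OF P Q_manifold(1) smooth_map_Q \<sigma>(1,2) \<sigma>P[OF \<sigma>(2)]] \<sigma>(3) by simp
      have "frechet_derivative (\<lambda>x. snd ?c (q (\<sigma> x))) (at (\<Psi> p)) = frechet_derivative (\<lambda>x. x) (at (\<Psi> p))"
        using snd_qchart[OF F(1)] \<sigma> smooth_paramD(1)[OF \<sigma>(1)]
        by (intro frechet_derivative_cong_open[of S]) auto
      then have "push Q (\<lambda>x. q (\<sigma> x)) (\<Psi> p) (u ?c) ?c = u ?c"
        using c \<sigma>(3) by (simp add: push_def)
      moreover have "push Q (\<lambda>x. q (\<sigma> x)) (\<Psi> p) (u ?c) \<in> tangent_space Q (q p)"
        using push_tangent[OF Q_manifold(1) smooth_map_param[OF P Q_manifold(1) smooth_map_Q \<sigma>(1) \<sigma>P] \<sigma>(2)]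
          \<sigma>(3) by simp
      ultimately have "push Q (\<lambda>x. q (\<sigma> x)) (\<Psi> p) (u ?c) = u"
        by (rule tangent_space_eqI[OF Q_manifold(1) c _ u, rotated])
      then have "u = tangent_map P Q q p ?v" unfolding 1 by (rule sym)
      moreover have "?v \<in> tangent_space P p" using push_tangent[OF P \<sigma>(1,2)] \<sigma>(3) by simp
      ultimately show "u \<in> tangent_map P Q q p ` tangent_space P p" by (rule image_eqI)
    qed
  qed
qed

lemma quotient_manifold_Q: "quotient_manifold P R Q"
  unfolding quotient_manifold_def using Q_manifold submersion_Q quotient_map_q by simp

text \<open>An arbitrary chart d of the maximal atlas also has local sections: change to a quotient
  chart and continue with a section of \<open>\<Psi>\<close>. Objects descending from P can then be
  examined in every chart of \<open>Q\<close>.\<close>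

lemma sections_Q:
  assumes d: "d \<in> charts Q" and y: "y \<in> snd d ` fst d"
  obtains S \<sigma> where "smooth_param S P \<sigma>" "y \<in> S" "S \<subseteq> snd d ` fst d" "\<And>x. x \<in> S \<Longrightarrow> q (\<sigma> x) = chart_inv d x"
proof -
  have d': "is_chart qtop d" "\<forall>c\<in>charts Q0. compatible d c" using d by (auto simp: Q_def)
  then have par: "smooth_param (snd d ` fst d) Q0 (chart_inv d)"
    using compatible_atlas_iff[OF smooth_manifold_Q0, of d] by auto
  have "chart_inv d y \<in> pts P // R"
    using y chart_inv_in[OF y] is_chart_subset[OF d'(1)] by auto
  then obtain p where p: "p \<in> pts P" "chart_inv d y = q p" by (auto simp: quotient_def)
  obtain W \<Psi> where F: "(W, \<Psi>) \<in> \<F>" "p \<in> W" using cover[OF p(1)] by blast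
  obtain S \<sigma> where \<sigma>: "smooth_param S P \<sigma>" "\<Psi> p \<in> S" "\<sigma> (\<Psi> p) = p"
    "\<And>x. x \<in> S \<Longrightarrow> \<sigma> x \<in> W \<and> \<Psi> (\<sigma> x) = x" using sections[OF F] by blast
  let ?c = "qchart (W, \<Psi>)"
  let ?g = "\<lambda>x. snd ?c (chart_inv d x)"
  let ?A = "{x \<in> snd d ` fst d. chart_inv d x \<in> fst ?c}"
  have sg: "smooth_on ?A ?g" using smooth_paramD(4)[OF par, of ?c] F by auto
  have oA: "open ?A" using smooth_paramD(3)[OF par, of "fst ?c"] is_chart_qchart[OF F(1)]
    unfolding is_chart_def by auto
  let ?S = "?A \<inter> ?g -` S"
  have oS: "open ?S"
    by (rule continuous_open_preimage[OF smooth_onD_continuous[OF sg] oA smooth_paramD(1)[OF \<sigma>(1)]])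
  show thesis
  proof
    show "smooth_param ?S P (\<lambda>x. \<sigma> (?g x))"
      by (rule smooth_param_compose[OF P \<sigma>(1) oS smooth_on_subset[OF sg]]) auto
    show "y \<in> ?S" using y p F \<sigma>(2) snd_qchart[OF F] by auto
    show "?S \<subseteq> snd d ` fst d" by auto
    fix x assume x: "x \<in> ?S"
    then obtain w where w: "w \<in> W" "chart_inv d x = q w" by auto
    then have "q (\<sigma> (?g x)) = chart_inv ?c (?g x)"
      using qchart_inv[OF F(1), of "\<sigma> (?g x)"] \<sigma>(4)[of "?g x"] x by simp
    also have "\<dots> = q w" using qchart_inv[OF F(1) w(1)] snd_qchart[OF F(1) w(1)] w(2) by simp
    finally show "q (\<sigma> (?g x)) = chart_inv d x" using w by simp
  qed
qed

text \<open>The quotient topology is forced. A chart d of \<open>Q'\<close> composed with the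
  inverse of a quotient chart is smooth by descent along sections, its differential is onto because
  q is a submersion onto \<open>Q'\<close>, and so its inverse is smooth as well. Both atlases being
  maximal, they coincide.\<close>

lemma quotient_manifold_unique:
  fixes J :: "'e \<Rightarrow> real^'m"
  assumes J: "linear J" "bij J" and Q': "quotient_manifold P R Q'"
  shows "Q' = Q"
proof -
  have M': "smooth_manifold Q'" "maximal_atlas Q'" "pts Q' = pts P // R"
    "quotient_map (mtop P) (mtop Q') q" "submersion P Q' q"
    using Q' unfolding quotient_manifold_def by auto
  have "openin (mtop Q') V \<longleftrightarrow> openin qtop V" for V
  proof (cases "V \<subseteq> pts P // R")
    case True
    then show ?thesis using M'(3,4) unfolding quotient_map_def openin_qtop by auto
  next
    case False
    then show ?thesis using M'(3) openin_subset[of "mtop Q'" V] by (auto simp: openin_qtop)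
  qed
  then have top: "mtop Q' = qtop" by (simp add: topology_eq)
  have sm': "smooth_map_on P Q' (pts P) q" using M'(5) unfolding submersion_def by blast
  have comp: "compatible e d" if d: "d \<in> charts Q'" and e: "e \<in> qchart ` \<F>" for d e
  proof -
    obtain W \<Psi> where F: "(W, \<Psi>) \<in> \<F>" "e = qchart (W, \<Psi>)" using e by auto
    have id: "is_chart qtop d" using smooth_manifold_chart[OF M'(1) d] top by simp
    have ie: "is_chart qtop e" using is_chart_qchart F by simp
    have dom: "fst d \<subseteq> pts P // R" using is_chart_subset[OF id] by simp
    let ?V = "{p \<in> pts P. q p \<in> fst d}"
    have dq: "smooth_vec_on P ?V (\<lambda>p. snd d (q p))"
      by (rule smooth_map_vec[OF P M'(1) sm' smooth_vec_on_chart[OF M'(1) d]])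
    have qV: "q ` ?V = fst d" using dom by (auto simp: quotient_def)
    let ?S = "snd e ` (fst e \<inter> fst d)"
    let ?h = "snd d \<circ> chart_inv e"
    have h: "smooth_on ?S ?h"
      using smooth_along_section[OF F(1) dq, of "snd d"] qV F(2) by auto
    have oS: "open ?S" using chart_open_image[OF ie] id unfolding is_chart_def by blast
    have im: "?h ` ?S = snd d ` (fst d \<inter> fst e)"
      using chart_inv_left[OF ie] by (auto simp: image_iff)
    have "smooth_on (?h ` ?S) (snd e \<circ> chart_inv d)"
    proof (rule smooth_on_inverse_function[OF J oS h])
      show "open (?h ` ?S)" unfolding im
        using chart_open_image[OF id] ie unfolding is_chart_def by blast
      show "continuous_on (?h ` ?S) (snd e \<circ> chart_inv d)"
        unfolding im by (rule continuous_on_transition[OF ie id])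
      show "(snd e \<circ> chart_inv d) (?h x) = x" if "x \<in> ?S" for x
        using that chart_inv_left[OF ie] chart_inv_left[OF id] by auto
      fix x assume "x \<in> ?S"
      then obtain p where p: "p \<in> W" "q p \<in> fst d" "x = \<Psi> p" using F snd_qchart[OF F(1)] by auto
      have pP: "p \<in> pts P" using p W_subset[OF F(1)] by blast
      have xS: "\<Psi> p \<in> ?S" using \<open>x \<in> ?S\<close> p by simp
      have d_at: "d \<in> charts_at Q' (q p)" using d p by (simp add: charts_at_def)
      \<comment> \<open>The vector with components u in d lifts to P; differentiating the identity
        d(q p) = h(\<open>\<Psi>\<close> p) along the lift exhibits u as a value of the differential
        of h.\<close>
      have "u \<in> range (frechet_derivative ?h (at x))" for u
      proof -
        let ?u = "push Q' (chart_inv d) (snd d (q p)) u"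
        have pd: "snd d (q p) \<in> snd d ` fst d" "chart_inv d (snd d (q p)) = q p"
          using p chart_inv_left[OF id] by auto
        have u: "?u \<in> tangent_space Q' (q p)"
          using push_tangent[OF M'(1) smooth_param_chart[OF M'(1) d] pd(1)] pd(2) by simp
        then obtain v where v: "v \<in> tangent_space P p" "?u = tangent_map P Q' q p v"
          using M'(5) pP unfolding submersion_def by blast
        have "frechet_derivative (\<lambda>x. snd d (chart_inv d x)) (at (snd d (q p))) =
            frechet_derivative (\<lambda>x. x) (at (snd d (q p)))"
          using id pd chart_inv_right[of _ d] by (intro frechet_derivative_cong_open[of "snd d ` fst d"])
            (auto simp: is_chart_def)
        then have "u = ?u d" using d_at pd(2) by (simp add: push_def)
        also have "\<dots> = vec_deriv P (\<lambda>p. snd d (q p)) p v"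
          using v(2) d_at by (simp add: tangent_map_eq)
        also have "\<dots> = vec_deriv P (\<lambda>p. ?h (\<Psi> p)) p v"
        proof (rule vec_deriv_cong[OF P])
          show "openin (mtop P) (W \<inter> ?V)"
            using smooth_vec_onD(1)[OF vec[OF F(1)]] smooth_vec_onD(1)[OF dq] by blast
        qed (use p pP qchart_inv[OF F(1)] F(2) in auto)
        also have "\<dots> = frechet_derivative ?h (at (\<Psi> p)) (vec_deriv P \<Psi> p v)"
          by (rule vec_deriv_compose[OF P vec[OF F(1)] p(1) smooth_on_has_derivative[OF h xS] v(1)])
        finally show ?thesis using p by simp
      qed
      then show "surj (frechet_derivative ?h (at x))" by blast
    qed
    then show ?thesis unfolding compatible_def using h im by (simp add: Int_commute)
  qed
  have sub: "charts Q' \<subseteq> charts Q"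
  proof
    fix d assume d: "d \<in> charts Q'"
    have "is_chart qtop d" using smooth_manifold_chart[OF M'(1) d] unfolding top .
    moreover have "\<forall>e\<in>qchart ` \<F>. compatible d e" using comp[OF d] compatible_sym by blast
    ultimately show "d \<in> charts Q" unfolding Q_def by simp
  qed
  have "charts Q \<subseteq> charts Q'"
  proof
    fix e assume e: "e \<in> charts Q"
    then have "compatible e d" if "d \<in> charts Q'" for d
      using sub that Q_manifold(1) unfolding smooth_manifold_def by blast
    moreover have "is_chart (mtop Q') e" using smooth_manifold_chart[OF Q_manifold(1) e] top by simp
    ultimately show "e \<in> charts Q'" using M'(2) unfolding maximal_atlas_def by blast
  qed
  with sub have "charts Q' = charts Q" by blast
  then show ?thesis using top by (intro mfd.equality) auto
qed

end

section \<open>Determinants and matrices with positive determinant\<close>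

definition set_row :: "'n \<Rightarrow> real^'n \<Rightarrow> real^'n^'n \<Rightarrow> real^'n^'n" where
  "set_row k v X = (\<chi> i. if i = k then v else X $ i)"

lemma set_row_nth: "set_row k v X $ i = (if i = k then v else X $ i)"
  by (simp add: set_row_def)

lemma set_row_same [simp]: "set_row k (X $ k) X = X"
  by (simp add: vec_eq_iff set_row_nth)

lemma set_row_set_row [simp]: "set_row k v (set_row k w X) = set_row k v X"
  by (simp add: vec_eq_iff set_row_nth)

lemma linear_det_set_row: "linear (\<lambda>v. det (set_row k v X))"
proof (rule linearI)
  show "det (set_row k (v + w) X) = det (set_row k v X) + det (set_row k w X)" for v w
    unfolding set_row_def by (rule det_row_add)
  show "det (set_row k (c *\<^sub>R v) X) = c *\<^sub>R det (set_row k v X)" for c v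
  proof -
    have "c *\<^sub>R v = c *s v" by (simp add: vec_eq_iff)
    from det_row_mul[of k c "\<lambda>i. v" "\<lambda>i. X $ i", folded this]
    show ?thesis unfolding set_row_def by simp
  qed
qed

lemma det_set_row_scaleR: "det (set_row k (c *\<^sub>R v) X) = c * det (set_row k v X)"
  using linear_cmul[OF linear_det_set_row[of k X], of c v] by simp

lemma det_set_row_add: "det (set_row k (v + w) X) = det (set_row k v X) + det (set_row k w X)"
  by (rule linear_add[OF linear_det_set_row])

lemma det_set_row_other:
  assumes "j \<noteq> k" shows "det (set_row k (X $ j) X) = 0"
  by (rule det_identical_rows[OF assms]) (use assms in \<open>simp add: row_def set_row_nth vec_eq_iff\<close>)

lemma det_add_row:
  assumes "j \<noteq> k" shows "det (set_row k (X $ k + c *\<^sub>R X $ j) X) = det X"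
  by (simp add: det_set_row_add det_set_row_scaleR det_set_row_other[OF assms])

text \<open>Laplace expansion along row k, by linearity of the determinant in that row: replacing
  the row by another unit vector leaves column k zero.\<close>

lemma det_eq_of_column:
  assumes col: "\<And>i. i \<noteq> k \<Longrightarrow> X $ i $ k = 0"
  shows "det X = X $ k $ k * det (set_row k (axis k 1) X)"
proof -
  have zero: "det (set_row k (axis l 1) X) = 0" if "l \<noteq> k" for l
    by (rule det_zero_column(1)[of k])
      (use that col in \<open>auto simp: column_def vec_eq_iff set_row_nth axis_def\<close>)
  have "X $ k = (\<Sum>l\<in>UNIV. (X $ k $ l) *\<^sub>R axis l 1)"
    by (simp add: vec_eq_iff axis_def if_distrib cong: if_cong)
  then have "det X = det (set_row k (\<Sum>l\<in>UNIV. (X $ k $ l) *\<^sub>R axis l 1) X)" by simp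
  also have "\<dots> = (\<Sum>l\<in>UNIV. X $ k $ l * det (set_row k (axis l 1) X))"
    using linear_sum[OF linear_det_set_row[of k X], of "\<lambda>l. (X $ k $ l) *\<^sub>R axis l 1" UNIV]
    by (simp add: det_set_row_scaleR)
  also have "\<dots> = (\<Sum>l\<in>UNIV. if l = k then X $ k $ k * det (set_row k (axis k 1) X) else 0)"
    by (rule sum.cong) (auto simp: zero)
  finally show ?thesis by simp
qed

lemma set_row_lincomb:
  "(1 - s) *\<^sub>R set_row k v X + s *\<^sub>R set_row k w X = set_row k ((1 - s) *\<^sub>R v + s *\<^sub>R w) X"
  by (simp add: vec_eq_iff set_row_nth algebra_simps)

text \<open>\<open>I\<close> holds the rows that are still free; the others are already unit
  vectors. Induction on \<open>I\<close> therefore ends at the identity matrix.\<close>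

definition pos_det_rows :: "'n::finite set \<Rightarrow> (real^'n^'n) set" where
  "pos_det_rows I = {X. det X > 0 \<and> (\<forall>i. i \<notin> I \<longrightarrow> X $ i = axis i 1)}"

text \<open>The determinant is affine in a single row, so on the segment between two matrices that
  differ in row k it lies between two positive values.\<close>

lemma path_component_set_row:
  assumes X: "X \<in> pos_det_rows I" and k: "k \<in> I" and d: "det (set_row k v X) > 0"
  shows "path_component (pos_det_rows I) X (set_row k v X)"
proof (rule path_component_linepath, rule subsetI)
  fix Y assume "Y \<in> closed_segment X (set_row k v X)"
  then obtain s where s: "0 \<le> s" "s \<le> 1" "Y = (1 - s) *\<^sub>R X + s *\<^sub>R set_row k v X"
    by (auto simp: closed_segment_def)
  have Y: "Y = set_row k ((1 - s) *\<^sub>R X $ k + s *\<^sub>R v) X"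
    using set_row_lincomb[of s k "X $ k" X v] s by simp
  have "det Y = (1 - s) * det X + s * det (set_row k v X)"
    unfolding Y det_set_row_add det_set_row_scaleR by simp
  moreover have "0 < det X" using X by (simp add: pos_det_rows_def)
  ultimately have "det Y > 0" using s d
    by (smt (verit, best) mult_nonneg_nonneg mult_pos_pos)
  then show "Y \<in> pos_det_rows I" using X k unfolding Y by (auto simp: pos_det_rows_def set_row_nth)
qed

lemma path_component_row_op:
  assumes X: "X \<in> pos_det_rows I" and k: "k \<in> I" "j \<noteq> k"
  shows "path_component (pos_det_rows I) X (set_row k (X $ k + c *\<^sub>R X $ j) X)"
  using path_component_set_row[OF X k(1)] X by (simp add: det_add_row[OF k(2)] pos_det_rows_def)

text \<open>Gaussian elimination, one row of \<open>I\<close> at a time, along paths of positive determinant.\<close>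

lemma path_component_pos_det_rows:
  assumes "X \<in> pos_det_rows I" shows "path_component (pos_det_rows I) X (mat 1)"
  using finite[of I] assms
proof (induction I arbitrary: X rule: finite_induct)
  case empty
  then have "X = mat 1" by (auto simp: pos_det_rows_def vec_eq_iff mat_def axis_def)
  then show ?case using empty by (simp add: path_component_refl)
next
  case (insert k J)
  let ?G = "pos_det_rows (insert k J)"
  have rows: "Y $ i $ k = 0" if "Y \<in> ?G" "i \<notin> insert k J" for Y i
    using that by (auto simp: pos_det_rows_def axis_def)
  have "\<exists>Y. path_component ?G X Y \<and> Y $ k $ k = 1"
  proof -
    \<comment> \<open>A nonzero entry of column k outside row k can be used to set the entry (k, k)
      to 1, whatever its sign before.\<close>
    have step: "\<exists>Z. path_component ?G Y Z \<and> Z $ k $ k = 1"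
      if Y: "Y \<in> ?G" "i \<noteq> k" "Y $ i $ k \<noteq> 0" for Y i
      using path_component_row_op[OF Y(1), of k i "(1 - Y $ k $ k) / Y $ i $ k"] Y
      by (intro exI conjI) (auto simp: set_row_nth)
    show ?thesis
    proof (cases "\<exists>i. i \<noteq> k \<and> X $ i $ k \<noteq> 0")
      case True
      then show ?thesis using step[OF insert.prems] by blast
    next
      case False
      then have "det X = X $ k $ k * det (set_row k (axis k 1) X)" by (intro det_eq_of_column) auto
      moreover have "det X > 0" using insert.prems by (simp add: pos_det_rows_def)
      ultimately have nz: "X $ k $ k \<noteq> 0" by auto
      show ?thesis
      \<comment> \<open>Here the entry (k, k) is the only nonzero one in its column. If row k is the
        only free row, it may be replaced by e_k at once, the result being the identity.\<close>
      proof (cases "J = {}")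
        case True
        have "set_row k (axis k 1) X = mat 1"
          using insert.prems True by (auto simp: pos_det_rows_def vec_eq_iff set_row_nth mat_def axis_def)
        then show ?thesis
          using path_component_set_row[OF insert.prems, of k "axis k 1"]
          by (intro exI[of _ "mat 1"]) (simp, simp add: mat_def)
      next
        case ne: False
        then obtain j where j: "j \<in> J" "j \<noteq> k" using insert.hyps by auto
        \<comment> \<open>The pivot may be negative, so row k cannot simply be rescaled. Adding it
          to another free row j creates the nonzero entry outside row k that \<open>step\<close>
          requires.\<close>
        let ?Y = "set_row j (X $ j + 1 *\<^sub>R X $ k) X"
        have XY: "path_component ?G X ?Y"
          by (rule path_component_row_op[OF insert.prems]) (use j in auto)
        have "X $ j $ k = 0" using False j(2) by blast
        then have "?Y $ j $ k \<noteq> 0" using nz by (simp add: set_row_nth)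
        then show ?thesis
          using step[OF path_component_mem(2)[OF XY] j(2)] path_component_trans[OF XY] by blast
      qed
    qed
  qed
  then obtain Y where Y: "path_component ?G X Y" "Y $ k $ k = 1" by blast
  \<comment> \<open>Column k is cleared in the rows of \<open>J\<close> one by one; outside the free
    rows it is zero already by \<open>rows\<close>.\<close>
  have "\<exists>Z. path_component ?G X Z \<and> Z $ k $ k = 1 \<and> (\<forall>i\<in>J'. Z $ i $ k = 0)" if "J' \<subseteq> J" for J'
    using finite_subset[OF that insert.hyps(1)] that
  proof (induction J' rule: finite_induct)
    case empty
    then show ?case using Y by blast
  next
    case (insert i J')
    then obtain Z where Z: "path_component ?G X Z" "Z $ k $ k = 1" "\<forall>i\<in>J'. Z $ i $ k = 0" by auto
    have i: "i \<in> insert k J" "k \<noteq> i" using insert.prems \<open>k \<notin> J\<close> by auto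
    let ?Z = "set_row i (Z $ i + (- Z $ i $ k) *\<^sub>R Z $ k) Z"
    have "path_component ?G Z ?Z" by (rule path_component_row_op[OF path_component_mem(2)[OF Z(1)] i])
    then have "path_component ?G X ?Z" using Z(1) path_component_trans by blast
    moreover have "?Z $ k $ k = 1" "\<forall>j\<in>insert i J'. ?Z $ j $ k = 0"
      using Z i by (auto simp: set_row_nth)
    ultimately show ?case by blast
  qed
  then obtain Z where Z: "path_component ?G X Z" "Z $ k $ k = 1" "\<forall>i\<in>J. Z $ i $ k = 0" by blast
  have ZG: "Z \<in> ?G" using Z(1) by (rule path_component_mem(2))
  have "det Z = Z $ k $ k * det (set_row k (axis k 1) Z)"
    using Z(3) rows[OF ZG] by (intro det_eq_of_column) auto
  then have d: "det (set_row k (axis k 1) Z) > 0" using ZG Z(2) by (simp add: pos_det_rows_def)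
  have 1: "path_component ?G Z (set_row k (axis k 1) Z)"
    by (rule path_component_set_row[OF ZG _ d]) simp
  have "set_row k (axis k 1) Z \<in> pos_det_rows J"
    using ZG d by (auto simp: pos_det_rows_def set_row_nth)
  then have "path_component (pos_det_rows J) (set_row k (axis k 1) Z) (mat 1)" by (rule insert.IH)
  then have "path_component ?G (set_row k (axis k 1) Z) (mat 1)"
    by (rule path_component_of_subset[rotated]) (auto simp: pos_det_rows_def)
  then show ?case using Z(1) 1 path_component_trans by blast
qed

text \<open>The cofactor of the diagonal entry (a, a). It does not depend on row a.\<close>

definition minor_det :: "'n::finite \<Rightarrow> real^'n^'n \<Rightarrow> real" where
  "minor_det a X = det (set_row a (axis a 1) X)"

lemma minor_det_set_row [simp]: "minor_det a (set_row a v X) = minor_det a X"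
  by (simp add: minor_det_def)

text \<open>Row a does not enter the condition and is moved to e_a along a segment. Then the
  cofactor is the full determinant, and the elimination result applies with all rows but a
  free.\<close>

lemma connected_minor_det_pos: "connected {X. minor_det a X > 0}"
proof -
  have "path_component {X. minor_det a X > 0} X (mat 1)" if X: "minor_det a X > 0" for X
  proof -
    let ?Y = "set_row a (axis a 1) X"
    have "closed_segment X ?Y \<subseteq> {X. minor_det a X > 0}"
    proof
      fix Z assume "Z \<in> closed_segment X ?Y"
      then obtain s where "Z = (1 - s) *\<^sub>R X + s *\<^sub>R ?Y" by (auto simp: closed_segment_def)
      then have "Z = set_row a ((1 - s) *\<^sub>R X $ a + s *\<^sub>R axis a 1) X"
        using set_row_lincomb[of s a "X $ a" X] by simp
      then show "Z \<in> {X. minor_det a X > 0}" using X by simp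
    qed
    then have 1: "path_component {X. minor_det a X > 0} X ?Y" by (rule path_component_linepath)
    have "?Y \<in> pos_det_rows (UNIV - {a})"
      using X by (simp add: pos_det_rows_def minor_det_def set_row_nth)
    then have "path_component (pos_det_rows (UNIV - {a})) ?Y (mat 1)"
      by (rule path_component_pos_det_rows)
    moreover have "pos_det_rows (UNIV - {a}) \<subseteq> {X. minor_det a X > 0}"
    proof
      fix Z assume Z: "Z \<in> pos_det_rows (UNIV - {a})"
      then have "set_row a (axis a 1) Z = Z" by (auto simp: pos_det_rows_def vec_eq_iff set_row_nth)
      then show "Z \<in> {X. minor_det a X > 0}" using Z by (simp add: minor_det_def pos_det_rows_def)
    qed
    ultimately show ?thesis using 1 path_component_of_subset path_component_trans by blast
  qed
  then have "path_connected {X. minor_det a X > 0}"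
    unfolding path_connected_component by (metis mem_Collect_eq path_component_sym path_component_trans)
  then show ?thesis by (rule path_connected_imp_connected)
qed

section \<open>The cofactor row, a submersion from the general linear group\<close>

text \<open>Row a of the adjugate, given by the numerators in Cramer's rule; this makes it
  polynomial in B.\<close>

definition cofactor_row :: "'n::finite \<Rightarrow> real^'n^'n \<Rightarrow> real^'n" where
  "cofactor_row a B = (\<chi> j. det (\<chi> i k. if k = a then axis j 1 $ i else B $ i $ k))"

lemma matrix_mult_row: "(C ** B) $ a = C $ a v* (B :: real^'n^'n)"
  by (simp add: vec_eq_iff matrix_matrix_mult_def vector_matrix_mult_def mult.commute)

lemma mat_one_row: "mat 1 $ a = axis a 1"
  by (auto simp: vec_eq_iff mat_def axis_def)

lemma cofactor_row_eq:
  assumes B: "det B \<noteq> 0"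
  shows "cofactor_row a B v* B = det B *\<^sub>R axis a 1"
proof -
  obtain C where C: "B ** C = mat 1" "C ** B = mat 1"
    using B unfolding invertible_det_nz[symmetric] invertible_def by auto
  have "cofactor_row a B $ j = det B * C $ a $ j" for j
  proof -
    have "B *v (C *v axis j 1) = axis j 1" by (simp add: matrix_vector_mul_assoc C)
    then have "C *v axis j 1 = (\<chi> k. det (\<chi> i l. if l = k then axis j 1 $ i else B $ i $ l) / det B)"
      using cramer[OF B] by blast
    then have "(C *v axis j 1) $ a = cofactor_row a B $ j / det B"
      by (simp add: cofactor_row_def)
    moreover have "(C *v axis j 1) $ a = C $ a $ j"
      by (simp add: matrix_vector_mult_def axis_def if_distrib cong: if_cong)
    ultimately show ?thesis using B by (simp add: field_simps)
  qed
  then have "cofactor_row a B = det B *\<^sub>R (C $ a)" by (simp add: vec_eq_iff)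
  moreover have "C $ a v* B = axis a 1"
    using arg_cong[OF C(2), of "\<lambda>X. X $ a"] by (simp add: matrix_mult_row mat_one_row)
  ultimately show ?thesis by (simp add: scaleR_vector_matrix_assoc)
qed

lemma vector_matrix_cancel:
  fixes B :: "real^'n^'n"
  assumes B: "det B \<noteq> 0" and eq: "v v* B = w v* B" shows "v = w"
proof -
  obtain C where "B ** C = mat 1"
    using B unfolding invertible_det_nz[symmetric] invertible_def by auto
  then show ?thesis using arg_cong[OF eq, of "\<lambda>u. u v* C"] by (simp add: vector_matrix_mul_assoc)
qed

lemma cofactor_row_unique:
  assumes "det B \<noteq> 0" "m v* B = det B *\<^sub>R axis a 1" shows "cofactor_row a B = m"
  using vector_matrix_cancel[OF assms(1)] cofactor_row_eq[OF assms(1)] assms(2) by metis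

lemma axis_vector_matrix: "axis a 1 v* (C :: real^'n^'n) = C $ a"
  by (simp add: vec_eq_iff vector_matrix_mult_def axis_def if_distrib if_distribR cong: if_cong)

text \<open>Describes a fibre of the cofactor row inside the general linear group: B times the
  subgroup of all C with e_a C = det C e_a.\<close>

lemma cofactor_row_mult_iff:
  assumes B: "det B \<noteq> 0" and C: "det C \<noteq> 0"
  shows "cofactor_row a (B ** C) = cofactor_row a B \<longleftrightarrow> C $ a = det C *\<^sub>R axis a 1"
proof -
  have d: "det (B ** C) \<noteq> 0" using B C by (simp add: det_mul)
  have 1: "cofactor_row a B v* (B ** C) = det B *\<^sub>R C $ a"
    by (simp add: vector_matrix_mul_assoc[symmetric] cofactor_row_eq[OF B] scaleR_vector_matrix_assoc
        axis_vector_matrix)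
  show ?thesis
  proof
    assume "cofactor_row a (B ** C) = cofactor_row a B"
    then have "det B *\<^sub>R C $ a = (det B * det C) *\<^sub>R axis a 1"
      using 1 cofactor_row_eq[OF d, of a] by (simp add: det_mul)
    then show "C $ a = det C *\<^sub>R axis a 1" using B by (metis scaleR_left_imp_eq scaleR_scaleR)
  next
    assume "C $ a = det C *\<^sub>R axis a 1"
    then show "cofactor_row a (B ** C) = cofactor_row a B"
      using 1 by (intro cofactor_row_unique d) (simp add: det_mul)
  qed
qed

lemma smooth_on_cofactor_row:
  assumes "open S" "smooth_on S f" shows "smooth_on S (\<lambda>x. cofactor_row a (f x))"
  unfolding cofactor_row_def
proof (intro smooth_on_vec_lambda smooth_on_det assms(1))
  show "smooth_on S (\<lambda>x. if k = a then axis j 1 $ i else f x $ i $ k)" for i j k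
    using assms by (intro smooth_on_if smooth_on_const smooth_on_vec_nth)
qed

lemma smooth_on_matrix_mult:
  fixes f g :: "_ \<Rightarrow> real^'n^'n"
  assumes "open S" "smooth_on S f" "smooth_on S g" shows "smooth_on S (\<lambda>x. f x ** g x)"
  unfolding matrix_matrix_mult_def using assms by (intro smooth_intros)

lemma smooth_on_vector_matrix:
  fixes f :: "_ \<Rightarrow> real^'n" and g :: "_ \<Rightarrow> real^'n^'n"
  assumes "open S" "smooth_on S f" "smooth_on S g" shows "smooth_on S (\<lambda>x. f x v* g x)"
  unfolding vector_matrix_mult_def using assms by (intro smooth_intros)

text \<open>The solution of \<open>r v* T = e\<^sub>a\<close> with \<open>det T = 1\<close> that has the rows \<open>e\<^sub>i\<close> apart from the two
  with the indices \<open>a\<close> and \<open>b\<close>.\<close>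

definition row_section :: "'n::finite \<Rightarrow> 'n \<Rightarrow> real^'n \<Rightarrow> real^'n^'n" where
  "row_section a b r = (\<chi> i. if i = a
      then (\<chi> j. if j = a then 1 / r $ a else if j = b then - r $ b else - (r $ j / r $ a))
      else if i = b then r $ a *\<^sub>R axis b 1 else axis i 1)"

text \<open>Ensures that the local sections pass through the prescribed point.\<close>

lemma row_section_axis: "a \<noteq> b \<Longrightarrow> row_section a b (axis a 1) = mat 1"
  by (simp add: row_section_def vec_eq_iff mat_def axis_def)

text \<open>Column a is zero outside row a, and with row a replaced by e_a the matrix is diagonal
  with the single nontrivial entry r_a. It cancels the pivot 1 / r_a.\<close>

lemma det_row_section:
  assumes ab: "a \<noteq> b" and r: "r $ a \<noteq> 0" shows "det (row_section a b r) = 1"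
proof -
  let ?T = "row_section a b r"
  have "det ?T = ?T $ a $ a * det (set_row a (axis a 1) ?T)"
    using ab by (intro det_eq_of_column) (auto simp: row_section_def axis_def)
  also have "det (set_row a (axis a 1) ?T) = (\<Prod>i\<in>UNIV. set_row a (axis a 1) ?T $ i $ i)"
    by (rule det_diagonal) (auto simp: row_section_def set_row_nth axis_def)
  also have "\<dots> = (\<Prod>i\<in>UNIV. if i = b then r $ a else 1)"
    using ab by (intro prod.cong) (auto simp: row_section_def set_row_nth axis_def)
  finally show ?thesis using r by (simp add: row_section_def)
qed

lemma vec_row_section:
  assumes ab: "a \<noteq> b" and r: "r $ a \<noteq> 0" shows "r v* row_section a b r = axis a 1"
proof -
  let ?T = "row_section a b r"
  have "(\<Sum>i\<in>UNIV. r $ i * ?T $ i $ j) = axis a 1 $ j" for j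
  proof -
    have "(\<Sum>i\<in>UNIV. r $ i * ?T $ i $ j) = r $ a * ?T $ a $ j + (\<Sum>i\<in>UNIV - {a}. r $ i * ?T $ i $ j)"
      by (simp add: sum.remove[of UNIV a])
    also have "(\<Sum>i\<in>UNIV - {a}. r $ i * ?T $ i $ j) =
        (\<Sum>i\<in>UNIV - {a}. if i = j then (if j = b then r $ a * r $ b else r $ j) else 0)"
      using ab by (intro sum.cong) (auto simp: row_section_def axis_def)
    also have "\<dots> = (if j = a then 0 else if j = b then r $ a * r $ b else r $ j)" by simp
    finally show ?thesis using r ab by (auto simp: row_section_def axis_def)
  qed
  then show ?thesis by (simp add: vec_eq_iff vector_matrix_mult_def mult.commute)
qed

text \<open>A section of the cofactor row near B that keeps the determinant. The scaling of r is
  chosen so that r = e_a, hence a correction factor 1, when m is the cofactor row of B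
  itself.\<close>

lemma cofactor_row_section:
  assumes ab: "a \<noteq> b" and B: "det B \<noteq> 0" and r: "r = inverse (det B) *\<^sub>R (m v* B)" "r $ a \<noteq> 0"
  shows "cofactor_row a (B ** row_section a b r) = m" "det (B ** row_section a b r) = det B"
proof -
  show d: "det (B ** row_section a b r) = det B" by (simp add: det_mul det_row_section[OF ab r(2)])
  have "m v* B = det B *\<^sub>R r" using B r(1) by simp
  then have "m v* (B ** row_section a b r) = det B *\<^sub>R axis a 1"
    by (simp add: vector_matrix_mul_assoc[symmetric] scaleR_vector_matrix_assoc vec_row_section[OF ab r(2)])
  then show "cofactor_row a (B ** row_section a b r) = m" using B d by (intro cofactor_row_unique) auto
qed

lemma smooth_on_row_section:
  assumes S: "open S" and f: "smooth_on S f" and nz: "\<And>x. x \<in> S \<Longrightarrow> f x $ a \<noteq> 0"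
  shows "smooth_on S (\<lambda>x. row_section a b (f x))"
  unfolding row_section_def
proof (intro smooth_on_vec_lambda S)
  fix i
  have fj: "smooth_on S (\<lambda>x. f x $ j)" for j by (intro smooth_on_vec_nth S f)
  have "smooth_on S (\<lambda>x. if j = a then 1 / f x $ a else if j = b then - f x $ b else - (f x $ j / f x $ a))" for j
    using fj nz by (intro smooth_on_if smooth_on_divide smooth_on_minus smooth_on_const S)
  then have 1: "smooth_on S (\<lambda>x. \<chi> j. if j = a then 1 / f x $ a else if j = b then - f x $ b else - (f x $ j / f x $ a))"
    by (intro smooth_on_vec_lambda S)
  show "smooth_on S (\<lambda>x. if i = a
      then (\<chi> j. if j = a then 1 / f x $ a else if j = b then - f x $ b else - (f x $ j / f x $ a))
      else if i = b then f x $ a *\<^sub>R axis b 1 else axis i 1)"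
    using 1 fj by (intro smooth_on_if smooth_on_scaleR smooth_on_const S)
qed

text \<open>A global chart of \<open>{C. C\<^sub>a = det C e\<^sub>a, det C > 0} \<times> \<real>\<^sup>n\<close>: the free row \<open>a\<close> of \<open>X\<close> carries the second
  factor, and row \<open>b\<close> is rescaled to free \<open>C\<close> of its constraint on the determinant.\<close>

definition fibre_param :: "'n::finite \<Rightarrow> 'n \<Rightarrow> real^'n^'n \<Rightarrow> real^'n^'n" where
  "fibre_param a b X = (\<chi> i. if i = a then minor_det a X *\<^sub>R axis a 1
     else if i = b then inverse (minor_det a X) *\<^sub>R X $ b else X $ i)"

text \<open>Inverse of \<open>fibre_param\<close>, together with the second factor. The entry
  \<open>C $ a $ a\<close> equals det C on the constraint set and keeps the formula
  polynomial.\<close>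

definition fibre_coord :: "'n::finite \<Rightarrow> 'n \<Rightarrow> (real^'n^'n) \<times> (real^'n) \<Rightarrow> real^'n^'n" where
  "fibre_coord a b = (\<lambda>(C, l). \<chi> i. if i = a then l else if i = b then C $ a $ a *\<^sub>R C $ b else C $ i)"

text \<open>Row a contributes the factor t = \<open>minor_det a X\<close> and row b the factor 1 /
  t; what remains is the cofactor t.\<close>

lemma det_fibre_param:
  assumes ab: "a \<noteq> b" and X: "minor_det a X \<noteq> 0"
  shows "det (fibre_param a b X) = minor_det a X"
proof -
  let ?t = "minor_det a X"
  have "fibre_param a b X = set_row a (?t *\<^sub>R axis a 1) (set_row b (inverse ?t *\<^sub>R X $ b) X)"
    by (simp add: vec_eq_iff fibre_param_def set_row_nth)
  then have "det (fibre_param a b X) = ?t * det (set_row a (axis a 1) (set_row b (inverse ?t *\<^sub>R X $ b) X))"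
    by (simp add: det_set_row_scaleR)
  also have "set_row a (axis a 1) (set_row b (inverse ?t *\<^sub>R X $ b) X) =
      set_row b (inverse ?t *\<^sub>R set_row a (axis a 1) X $ b) (set_row a (axis a 1) X)"
    using ab by (simp add: vec_eq_iff set_row_nth)
  also have "det \<dots> = inverse ?t * minor_det a X"
    unfolding det_set_row_scaleR by (simp add: minor_det_def)
  finally show ?thesis using X by simp
qed

lemma fibre_param_row: "fibre_param a b X $ a = minor_det a X *\<^sub>R axis a 1"
  by (simp add: fibre_param_def)

lemma fibre_coord_param:
  assumes "a \<noteq> b" "minor_det a X \<noteq> 0"
  shows "fibre_coord a b (fibre_param a b X, X $ a) = X"
  using assms by (simp add: vec_eq_iff fibre_coord_def fibre_param_def axis_def)

lemma
  assumes ab: "a \<noteq> b" and C: "C $ a = det C *\<^sub>R axis a 1" "det C \<noteq> 0"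
  shows minor_det_fibre_coord: "minor_det a (fibre_coord a b (C, l)) = det C"
    and fibre_param_coord: "fibre_param a b (fibre_coord a b (C, l)) = C"
    and fibre_coord_row: "fibre_coord a b (C, l) $ a = l"
proof -
  have aa: "C $ a $ a = det C" by (subst C(1)) (simp add: axis_def)
  \<comment> \<open>The constraint pulls the factor det C out of row a, which leaves det C = det C
    times the cofactor, so the cofactor of C is 1.\<close>
  have "det C = det (set_row a (det C *\<^sub>R axis a 1) C)" by (subst C(1)[symmetric]) simp
  then have m: "minor_det a C = 1" using C(2) by (simp add: det_set_row_scaleR minor_det_def)
  have "set_row a (axis a 1) (fibre_coord a b (C, l)) =
      set_row b (det C *\<^sub>R set_row a (axis a 1) C $ b) (set_row a (axis a 1) C)"
    using ab by (simp add: vec_eq_iff set_row_nth fibre_coord_def aa)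
  then show *: "minor_det a (fibre_coord a b (C, l)) = det C"
    using m unfolding minor_det_def by (simp only: det_set_row_scaleR set_row_same mult_1_right)
  show "fibre_param a b (fibre_coord a b (C, l)) = C"
    unfolding fibre_param_def * using ab C by (simp add: vec_eq_iff fibre_coord_def aa)
  show "fibre_coord a b (C, l) $ a = l" by (simp add: fibre_coord_def)
qed

lemma smooth_on_minor_det: "open S \<Longrightarrow> smooth_on S f \<Longrightarrow> smooth_on S (\<lambda>x. minor_det a (f x))"
  unfolding minor_det_def set_row_def
  by (intro smooth_on_det smooth_on_vec_lambda[of S] smooth_on_if smooth_on_const smooth_on_vec_nth)

lemma open_minor_det_pos: "open {X. minor_det a X > 0}"
proof -
  have "continuous_on UNIV (minor_det a)"
    using smooth_onD_continuous[OF smooth_on_minor_det[OF open_UNIV smooth_on_id]] .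
  then show ?thesis by (simp add: open_Collect_less)
qed

lemma smooth_on_fibre_param:
  assumes S: "open S" and f: "smooth_on S f" and nz: "\<And>x. x \<in> S \<Longrightarrow> minor_det a (f x) \<noteq> 0"
  shows "smooth_on S (\<lambda>x. fibre_param a b (f x))"
  unfolding fibre_param_def
proof (intro smooth_on_vec_lambda S)
  fix i
  have "smooth_on S (\<lambda>x. minor_det a (f x))" by (rule smooth_on_minor_det[OF S f])
  then show "smooth_on S (\<lambda>x. if i = a then minor_det a (f x) *\<^sub>R axis a 1
     else if i = b then inverse (minor_det a (f x)) *\<^sub>R f x $ b else f x $ i)"
    using f nz by (intro smooth_on_if smooth_on_scaleR smooth_on_const smooth_on_inverse smooth_on_vec_nth S)
qed

lemma smooth_on_fibre_coord:
  assumes S: "open S" and f: "smooth_on S f" "smooth_on S g"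
  shows "smooth_on S (\<lambda>x. fibre_coord a b (f x, g x))"
  unfolding fibre_coord_def prod.case
proof (intro smooth_on_vec_lambda S)
  fix i
  show "smooth_on S (\<lambda>x. if i = a then g x else if i = b then f x $ a $ a *\<^sub>R f x $ b else f x $ i)"
    using f by (intro smooth_on_if smooth_on_scaleR smooth_on_vec_nth S)
qed

section \<open>Locally finite families of bump functions\<close>

definition flat_exp :: "real poly \<Rightarrow> real \<Rightarrow> real" where
  "flat_exp p x = (if x > 0 then poly p (inverse x) * exp (- inverse x) else 0)"

lemma poly_times_exp_minus_tendsto_0: "((\<lambda>t. poly p t * exp (- t)) \<longlongrightarrow> (0::real)) at_top"
proof -
  have "((\<lambda>t. \<Sum>i\<le>degree p. coeff p i * (t ^ i / exp t)) \<longlongrightarrow> (\<Sum>i\<le>degree p. coeff p i * 0)) at_top"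
    by (intro tendsto_sum tendsto_mult tendsto_const tendsto_power_div_exp_0)
  then show ?thesis
    by (simp add: poly_altdef sum_distrib_right exp_minus divide_inverse mult.assoc)
qed

lemma flat_exp_tendsto_0: "(flat_exp p \<longlongrightarrow> 0) (at 0)"
proof -
  have "((\<lambda>x. poly p (inverse x) * exp (- inverse x)) \<longlongrightarrow> 0) (at_right 0)"
    by (rule filterlim_compose[OF poly_times_exp_minus_tendsto_0 filterlim_inverse_at_top_right])
  then have "(flat_exp p \<longlongrightarrow> 0) (at_right 0)"
    by (rule Lim_transform_eventually) (auto simp: flat_exp_def eventually_at_filter)
  moreover have "(flat_exp p \<longlongrightarrow> 0) (at_left 0)"
    by (rule Lim_transform_eventually[OF tendsto_const]) (auto simp: flat_exp_def eventually_at_filter)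
  ultimately show ?thesis by (simp add: filterlim_at_split)
qed

text \<open>With t = 1/x one has dt/dx = - t^2, so p(t) exp(-t) has derivative t^2 (p - p')(t)
  exp(-t); \<open>[:0, 0, 1:]\<close> is the factor t^2.\<close>

lemma has_field_derivative_flat_exp:
  "(flat_exp p has_field_derivative flat_exp ([:0, 0, 1:] * (p - pderiv p)) x) (at x)"
proof (cases x "0 :: real" rule: linorder_cases)
  case less
  have "((\<lambda>x. 0) has_field_derivative 0) (at x)" by simp
  then have "(flat_exp p has_field_derivative 0) (at x)"
    by (rule has_field_derivative_transform_within_open[of _ _ _ "{..<0}"])
      (use less in \<open>auto simp: flat_exp_def\<close>)
  then show ?thesis using less by (simp add: flat_exp_def)
next
  case equal
  \<comment> \<open>The difference quotient at 0 belongs to the family again, with p multiplied by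
    t, and tends to 0.\<close>
  have "((\<lambda>h. flat_exp ([:0, 1:] * p) h) \<longlongrightarrow> 0) (at 0)" by (rule flat_exp_tendsto_0)
  then have "((\<lambda>h. (flat_exp p (0 + h) - flat_exp p 0) / h) \<longlongrightarrow> 0) (at 0)"
    by (rule Lim_transform_eventually)
      (auto simp: flat_exp_def divide_inverse eventually_at_filter)
  then show ?thesis unfolding equal DERIV_def by (simp add: flat_exp_def)
next
  case greater
  have "((\<lambda>x. poly p (inverse x) * exp (- inverse x)) has_field_derivative
      poly ([:0, 0, 1:] * (p - pderiv p)) (inverse x) * exp (- inverse x)) (at x)"
    using greater by (auto intro!: derivative_eq_intros poly_DERIV DERIV_chain'[where f = inverse and g = "poly p"]
        simp: power2_eq_square algebra_simps)
  then have "(flat_exp p has_field_derivative poly ([:0, 0, 1:] * (p - pderiv p)) (inverse x) * exp (- inverse x)) (at x)"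
    by (rule has_field_derivative_transform_within_open[of _ _ _ "{0<..}"])
      (use greater in \<open>auto simp: flat_exp_def\<close>)
  then show ?thesis using greater by (simp add: flat_exp_def)
qed

lemma smooth_on_flat_exp: "smooth_on UNIV (flat_exp p)"
proof -
  have "ck_on k UNIV (flat_exp p)" for k
  proof (induction k arbitrary: p)
    case 0
    have "continuous_on UNIV (flat_exp p)"
      using has_field_derivative_flat_exp
      by (intro continuous_at_imp_continuous_on ballI DERIV_isCont)
    then show ?case by simp
  next
    case (Suc k)
    let ?q = "[:0, 0, 1:] * (p - pderiv p)"
    have d: "(flat_exp p has_derivative (\<lambda>v. v * flat_exp ?q x)) (at x)" for x
      using has_field_derivative_flat_exp[of p x] by (simp add: has_field_derivative_def mult.commute[of _ "flat_exp _ _"] lambda_one)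
    have "ck_on k UNIV (\<lambda>x. v * flat_exp ?q x)" for v
      by (rule ck_on_bounded_linear[OF bounded_linear_mult_right open_UNIV Suc])
    then show ?case using d by (auto simp: frechet_derivative_at'[OF d] differentiable_def)
  qed
  then show ?thesis unfolding smooth_on_def by blast
qed

text \<open>The function exp(-1/x) for positive x and 0 otherwise.\<close>

definition cutoff :: "real \<Rightarrow> real" where "cutoff = flat_exp 1"

lemma smooth_on_cutoff: "smooth_on UNIV cutoff"
  unfolding cutoff_def by (rule smooth_on_flat_exp)

lemma cutoff_pos_iff [simp]: "cutoff x > 0 \<longleftrightarrow> x > 0" and cutoff_nonneg [simp]: "cutoff x \<ge> 0"
  and cutoff_eq_0_iff [simp]: "cutoff x = 0 \<longleftrightarrow> x \<le> 0"
  by (auto simp: cutoff_def flat_exp_def)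

section \<open>Bump functions on manifolds\<close>

lemma smooth_vec_on_mult:
  fixes f g :: "_ \<Rightarrow> real"
  assumes "smooth_manifold M" "smooth_vec_on M W f" "smooth_vec_on M W g"
  shows "smooth_vec_on M W (\<lambda>p. f p * g p)"
proof -
  have "smooth_on UNIV (\<lambda>z::real \<times> real. fst z * snd z)" by (intro smooth_intros open_UNIV)
  from smooth_vec_on_compose[OF assms(1) smooth_vec_on_Pair[OF assms] open_UNIV _ this]
  show ?thesis by simp
qed

lemma smooth_vec_on_add:
  fixes f g :: "_ \<Rightarrow> real"
  assumes "smooth_manifold M" "smooth_vec_on M W f" "smooth_vec_on M W g"
  shows "smooth_vec_on M W (\<lambda>p. f p + g p)"
proof -
  have "smooth_on UNIV (\<lambda>z::real \<times> real. fst z + snd z)" by (intro smooth_intros open_UNIV)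
  from smooth_vec_on_compose[OF assms(1) smooth_vec_on_Pair[OF assms] open_UNIV _ this]
  show ?thesis by simp
qed

lemma smooth_vec_on_prod:
  fixes f :: "'i \<Rightarrow> _ \<Rightarrow> real"
  assumes M: "smooth_manifold M" "openin (mtop M) W" and f: "\<And>i. i \<in> I \<Longrightarrow> smooth_vec_on M W (f i)"
  shows "smooth_vec_on M W (\<lambda>p. \<Prod>i\<in>I. f i p)"
  using f by (induction I rule: infinite_finite_induct)
    (auto intro!: smooth_vec_on_mult M smooth_vec_on_const)

lemma smooth_vec_on_sum:
  fixes f :: "'i \<Rightarrow> _ \<Rightarrow> real"
  assumes M: "smooth_manifold M" "openin (mtop M) W" and f: "\<And>i. i \<in> I \<Longrightarrow> smooth_vec_on M W (f i)"
  shows "smooth_vec_on M W (\<lambda>p. \<Sum>i\<in>I. f i p)"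
  using f by (induction I rule: infinite_finite_induct)
    (auto intro!: smooth_vec_on_add M smooth_vec_on_const)

text \<open>The support lies in the image of a closed coordinate ball, which is compact and hence
  closed because M is Hausdorff; this makes the extension by zero smooth. The value at p exceeds 1
  so that a later factor \<open>cutoff (1 - \<rho>)\<close> vanishes near p.\<close>

lemma bump_function:
  fixes M :: "('p, 'e::euclidean_space) mfd"
  assumes M: "smooth_manifold M" and W: "openin (mtop M) W" and p: "p \<in> W"
  obtains \<rho> :: "'p \<Rightarrow> real" and C where "smooth_vec_on M (pts M) \<rho>" "\<And>q. \<rho> q \<ge> 0" "\<rho> p > 1"
    "closedin (mtop M) C" "C \<subseteq> W" "\<And>q. q \<notin> C \<Longrightarrow> \<rho> q = 0"
proof -
  have "p \<in> pts M" using p W openin_subset by blast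
  then obtain c where c: "c \<in> charts M" "p \<in> fst c" using smooth_manifold_charts_at[OF M] charts_atD by metis
  have ic: "is_chart (mtop M) c" using smooth_manifold_chart[OF M c(1)] .
  note sc = smooth_vec_on_chart[OF M c(1)] and pc = smooth_param_chart[OF M c(1)]
  have oc: "openin (mtop M) (fst c)" using ic unfolding is_chart_def by blast
  have "open (snd c ` (fst c \<inter> W))" by (rule chart_open_image[OF ic W])
  then obtain r where r: "r > 0" "cball (snd c p) r \<subseteq> snd c ` (fst c \<inter> W)"
    using c p open_contains_cball[of "snd c ` (fst c \<inter> W)"] by blast
  let ?K = "cball (snd c p) r"
  let ?C = "chart_inv c ` ?K"
  have K: "?K \<subseteq> snd c ` fst c" using r by blast
  have "continuous_map (top_of_set (snd c ` fst c)) (mtop M) (chart_inv c)"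
    unfolding continuous_map_def
  proof (intro conjI allI impI)
    show "chart_inv c \<in> topspace (top_of_set (snd c ` fst c)) \<rightarrow> pts M"
      using smooth_paramD(2)[OF pc] by auto
    fix U assume "openin (mtop M) U"
    from smooth_paramD(3)[OF pc this]
    show "openin (top_of_set (snd c ` fst c)) {x \<in> topspace (top_of_set (snd c ` fst c)). chart_inv c x \<in> U}"
      by (auto intro: openin_subset_trans[of UNIV] simp: open_openin[symmetric] openin_open_eq[OF smooth_paramD(1)[OF pc]])
  qed
  moreover have "compactin (top_of_set (snd c ` fst c)) ?K"
    using K by (simp add: compactin_subtopology)
  ultimately have "compactin (mtop M) ?C" by (rule image_compactin[rotated])
  then have C: "closedin (mtop M) ?C"
    using M compactin_imp_closedin unfolding smooth_manifold_def by blast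
  have CW: "?C \<subseteq> W"
    using r(2) by (auto simp: chart_inv_left[OF ic] dest!: subsetD[OF r(2)])
  let ?s = "\<lambda>x. cutoff (r\<^sup>2 - (x - snd c p) \<bullet> (x - snd c p))"
  \<comment> \<open>Normalises the value at p to 2.\<close>
  let ?k = "2 / cutoff (r\<^sup>2)"
  have k: "cutoff (r\<^sup>2) > 0" using r(1) by simp
  define \<rho> where "\<rho> q = (if q \<in> fst c then ?k * ?s (snd c q) else 0)" for q
  have zero: "\<rho> q = 0" if q: "q \<notin> ?C" for q
  proof (cases "q \<in> fst c")
    case True
    have "snd c q \<notin> ?K" using q True by (metis chart_inv_left[OF ic] imageI)
    then have "r < norm (snd c q - snd c p)" by (simp add: dist_norm norm_minus_commute)
    then have "r\<^sup>2 \<le> (norm (snd c q - snd c p))\<^sup>2" using r(1) by (intro power_mono) auto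
    then show ?thesis by (simp add: \<rho>_def True power2_norm_eq_inner)
  qed (simp add: \<rho>_def)
  have "smooth_vec_on M (pts M) \<rho>"
  proof (rule smooth_vec_on_local[OF M])
    fix q assume q: "q \<in> pts M"
    show "\<exists>V. q \<in> V \<and> V \<subseteq> pts M \<and> smooth_vec_on M V \<rho>"
    proof (cases "q \<in> fst c")
      case True
      have "smooth_on UNIV (\<lambda>x. ?k * ?s x)"
        by (intro smooth_on_mult smooth_on_const open_UNIV smooth_on_compose[OF open_UNIV open_UNIV _ smooth_on_cutoff]
            smooth_on_diff smooth_on_inner smooth_on_id) simp
      from smooth_vec_on_compose[OF M sc open_UNIV _ this]
      have "smooth_vec_on M (fst c) \<rho>"
        using smooth_vec_on_cong[OF M, of "fst c" \<rho> "\<lambda>q. ?k * ?s (snd c q)"] by (simp add: \<rho>_def)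
      then show ?thesis using True is_chart_subset[OF ic] by blast
    next
      case False
      have CF: "?C \<subseteq> fst c" using K by (auto simp: inv_into_into)
      have o: "openin (mtop M) (pts M - ?C)" using C by (simp add: openin_diff)
      have "smooth_vec_on M (pts M - ?C) \<rho> \<longleftrightarrow> smooth_vec_on M (pts M - ?C) (\<lambda>q. 0::real)"
        by (rule smooth_vec_on_cong[OF M]) (simp add: zero)
      then have "smooth_vec_on M (pts M - ?C) \<rho>" using smooth_vec_on_const[OF o] by simp
      moreover have "q \<in> pts M - ?C" using False CF q by blast
      ultimately show ?thesis by (intro exI[of _ "pts M - ?C"]) simp
    qed
  qed
  moreover have "\<rho> q \<ge> 0" for q using k by (simp add: \<rho>_def)
  moreover have "\<rho> p > 1" using c(2) k by (simp add: \<rho>_def)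
  ultimately show thesis using that C CW zero by blast
qed

text \<open>The factors of \<open>\<psi> i\<close> with \<open>j < i\<close> vanish where \<open>\<rho> j > 1\<close>, which makes the family locally finite without
  an exhaustion by compact sets.\<close>

lemma locally_finite_bump_functions:
  fixes M :: "('p, 'e::euclidean_space) mfd"
  assumes M: "smooth_manifold M" and ne: "pts M \<noteq> {}"
    and cov: "\<And>x. x \<in> pts M \<Longrightarrow> \<exists>W. openin (mtop M) W \<and> x \<in> W \<and> Q W"
  obtains \<psi> :: "nat \<Rightarrow> 'p \<Rightarrow> real" and W C :: "nat \<Rightarrow> 'p set"
  where "\<And>i. smooth_vec_on M (pts M) (\<psi> i)" "\<And>i x. \<psi> i x \<ge> 0"
    "\<And>i. openin (mtop M) (W i)" "\<And>i. Q (W i)"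
    "\<And>i. closedin (mtop M) (C i)" "\<And>i. C i \<subseteq> W i" "\<And>i x. x \<notin> C i \<Longrightarrow> \<psi> i x = 0"
    "\<And>x. x \<in> pts M \<Longrightarrow> \<exists>V N. openin (mtop M) V \<and> x \<in> V \<and> (\<forall>i>N. \<forall>y\<in>V. \<psi> i y = 0)"
    "\<And>x. x \<in> pts M \<Longrightarrow> \<exists>i. \<psi> i x > 0"
proof -
  let ?B = "\<lambda>x \<rho> W C. smooth_vec_on M (pts M) \<rho> \<and> (\<forall>q. \<rho> q \<ge> (0::real)) \<and> \<rho> x > 1 \<and> openin (mtop M) W \<and> Q W \<and>
      closedin (mtop M) C \<and> C \<subseteq> W \<and> (\<forall>q. q \<notin> C \<longrightarrow> \<rho> q = 0)"
  have "\<exists>t. ?B x (fst t) (fst (snd t)) (snd (snd t))" if x: "x \<in> pts M" for x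
  proof -
    obtain W where W: "openin (mtop M) W" "x \<in> W" "Q W" using cov[OF x] by blast
    show ?thesis
    proof (rule bump_function[OF M W(1,2)])
      fix \<rho> :: "'p \<Rightarrow> real" and C
      assume "smooth_vec_on M (pts M) \<rho>" "\<And>q. \<rho> q \<ge> 0" "\<rho> x > 1" "closedin (mtop M) C" "C \<subseteq> W"
        "\<And>q. q \<notin> C \<Longrightarrow> \<rho> q = 0"
      then show ?thesis using W by (intro exI[of _ "(\<rho>, W, C)"]) simp
    qed
  qed
  then obtain F where F: "\<And>x. x \<in> pts M \<Longrightarrow> ?B x (fst (F x)) (fst (snd (F x))) (snd (snd (F x)))"
    by metis
  define \<rho> where "\<rho> x = fst (F x)" for x
  define W where "W x = fst (snd (F x))" for x
  define C where "C x = snd (snd (F x))" for x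
  have *: "\<And>x. x \<in> pts M \<Longrightarrow> smooth_vec_on M (pts M) (\<rho> x)"
    "\<And>x q. x \<in> pts M \<Longrightarrow> \<rho> x q \<ge> (0::real)" "\<And>x. x \<in> pts M \<Longrightarrow> \<rho> x x > 1"
    "\<And>x. x \<in> pts M \<Longrightarrow> openin (mtop M) (W x)" "\<And>x. x \<in> pts M \<Longrightarrow> Q (W x)"
    "\<And>x. x \<in> pts M \<Longrightarrow> closedin (mtop M) (C x)" "\<And>x. x \<in> pts M \<Longrightarrow> C x \<subseteq> W x"
    "\<And>x q. x \<in> pts M \<Longrightarrow> q \<notin> C x \<Longrightarrow> \<rho> x q = 0"
    using F unfolding \<rho>_def W_def C_def by blast+
  define V where "V x = {y \<in> pts M. \<rho> x y \<in> {1<..}}" for x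
  have V: "openin (mtop M) (V x)" if "x \<in> pts M" for x
    unfolding V_def by (rule smooth_vec_on_continuous[OF M *(1)[OF that] open_greaterThan])
  \<comment> \<open>Countably many of the sets where a bump function exceeds 1 already cover
    M.\<close>
  have "Lindelof_space (mtop M)"
    using M second_countable_imp_Lindelof_space unfolding smooth_manifold_def by blast
  moreover have "\<Union> (V ` pts M) = pts M" using *(3) by (auto simp: V_def)
  ultimately obtain \<V> where \<V>: "countable \<V>" "\<V> \<subseteq> V ` pts M" "\<Union> \<V> = pts M"
    unfolding Lindelof_space_def using V by (metis (no_types, lifting) imageE)
  then obtain X where X: "countable X" "X \<subseteq> pts M" "\<V> = V ` X" by (metis countable_subset_image)
  have Xne: "X \<noteq> {}"
  proof
    assume "X = {}"
    then have "pts M = {}" unfolding \<V>(3)[symmetric] X(3) by simp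
    with ne show False by contradiction
  qed
  \<comment> \<open>The enumeration repeats points if X is finite; repetitions do no harm, since
    positivity is checked at a least index.\<close>
  define x where "x = from_nat_into X"
  have xM: "x i \<in> pts M" for i using from_nat_into[OF Xne] X(2) by (auto simp: x_def)
  have xcov: "\<exists>i. y \<in> V (x i)" if "y \<in> pts M" for y
    using that \<V>(3) X(1,3) from_nat_into_surj[OF X(1)] by (metis UN_E x_def)
  define \<psi> where "\<psi> i y = \<rho> (x i) y * (\<Prod>j<i. cutoff (1 - \<rho> (x j) y))" for i y
  show thesis
  proof (rule that[of \<psi> "\<lambda>i. W (x i)" "\<lambda>i. C (x i)"])
    have "smooth_vec_on M (pts M) (\<lambda>y. cutoff (1 - \<rho> (x j) y))" for j
    proof -
      have "smooth_on UNIV (\<lambda>t. cutoff (1 - t))"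
        by (intro smooth_on_compose[OF open_UNIV open_UNIV _ smooth_on_cutoff] smooth_on_diff
            smooth_on_const smooth_on_id) auto
      from smooth_vec_on_compose[OF M *(1)[OF xM] open_UNIV _ this] show ?thesis by simp
    qed
    then show "smooth_vec_on M (pts M) (\<psi> i)" for i
      unfolding \<psi>_def by (intro smooth_vec_on_mult M *(1) xM smooth_vec_on_prod) auto
    show "\<psi> i y \<ge> 0" for i y
      unfolding \<psi>_def by (intro mult_nonneg_nonneg *(2) xM prod_nonneg) auto
    show "\<exists>U N. openin (mtop M) U \<and> y \<in> U \<and> (\<forall>i>N. \<forall>z\<in>U. \<psi> i z = 0)" if y: "y \<in> pts M" for y
    proof -
      obtain j where j: "y \<in> V (x j)" using xcov[OF y] by blast
      have "\<psi> i z = 0" if "i > j" "z \<in> V (x j)" for i z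
        using that unfolding \<psi>_def V_def by (auto intro!: prod_zero bexI[of _ j])
      then show ?thesis using V[OF xM] j by blast
    qed
    show "\<exists>i. \<psi> i y > 0" if y: "y \<in> pts M" for y
    proof -
      obtain k where "y \<in> V (x k)" using xcov[OF y] by blast
      then have "\<rho> (x k) y > 0" by (simp add: V_def)
      \<comment> \<open>At the least index with a positive bump function all earlier ones vanish, so
        the factors of the product are \<open>cutoff 1\<close>.\<close>
      then obtain i where i: "\<rho> (x i) y > 0" "\<And>j. j < i \<Longrightarrow> \<not> \<rho> (x j) y > 0"
        using exists_least_iff[of "\<lambda>i. \<rho> (x i) y > 0"] by metis
      then have "\<rho> (x j) y = 0" if "j < i" for j using that *(2)[OF xM, of j y] by force
      then have "\<psi> i y > 0" unfolding \<psi>_def using i(1) by (intro mult_pos_pos prod_pos) auto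
      then show ?thesis ..
    qed
    show "\<psi> i y = 0" if "y \<notin> C (x i)" for i y
      using *(8)[OF xM that] by (simp add: \<psi>_def)
  qed (use * xM in auto)
qed

text \<open>On a suitable neighbourhood the sum over the varying support is the fixed finite sum
  over i up to N.\<close>

lemma smooth_vec_on_locally_finite_sum:
  fixes G :: "nat \<Rightarrow> 'p \<Rightarrow> real"
  assumes M: "smooth_manifold M" and G: "\<And>i. smooth_vec_on M (pts M) (G i)"
    and fin: "\<And>p. p \<in> pts M \<Longrightarrow> \<exists>V N. openin (mtop M) V \<and> p \<in> V \<and> (\<forall>i>N. \<forall>q\<in>V. G i q = 0)"
  shows "smooth_vec_on M (pts M) (\<lambda>p. \<Sum>i | G i p \<noteq> 0. G i p)"
proof (rule smooth_vec_on_local[OF M])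
  fix p assume p: "p \<in> pts M"
  obtain V N where V: "openin (mtop M) V" "p \<in> V" "\<forall>i>N. \<forall>q\<in>V. G i q = 0"
    using fin[OF p] by (elim exE conjE)
  have VM: "V \<subseteq> pts M" using V(1) openin_subset by blast
  have "(\<Sum>i | G i q \<noteq> 0. G i q) = (\<Sum>i\<le>N. G i q)" if "q \<in> V" for q
  proof (rule sum.mono_neutral_left)
    have "i \<le> N" if "G i q \<noteq> 0" for i
      using V(3) \<open>q \<in> V\<close> that by (cases "i > N") auto
    then show "{i. G i q \<noteq> 0} \<subseteq> {..N}" by blast
  qed auto
  then have "smooth_vec_on M V (\<lambda>p. \<Sum>i | G i p \<noteq> 0. G i p) \<longleftrightarrow> smooth_vec_on M V (\<lambda>p. \<Sum>i\<le>N. G i p)"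
    by (intro smooth_vec_on_cong M)
  moreover have "smooth_vec_on M V (\<lambda>p. \<Sum>i\<le>N. G i p)"
    by (intro smooth_vec_on_sum M V(1) smooth_vec_on_subset[OF M G V(1) VM])
  ultimately show "\<exists>V. p \<in> V \<and> V \<subseteq> pts M \<and> smooth_vec_on M V (\<lambda>p. \<Sum>i | G i p \<noteq> 0. G i p)"
    using V(2) VM by blast
qed

section \<open>Linear algebra of a value of the Cartan connection\<close>

lemma vector_matrix_add_right: "v v* (A + B) = v v* A + v v* (B :: real^'n^'m)"
  by (simp add: vec_eq_iff vector_matrix_mult_def algebra_simps sum.distrib)

text \<open>\<open>Z\<close> is the value of the Cartan connection on a tangent vector, \<open>block B 0 l (inverse (det B))\<close> the
  \<open>H\<close>-coordinate, and \<open>dB\<close>, \<open>dl\<close>, \<open>dd\<close>, \<open>dm\<close> are the derivatives of \<open>B\<close>, \<open>l\<close>, \<open>det B\<close>, \<open>m\<close> along the vector.\<close>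

locale cartan_value =
  fixes a :: "'n::finite" and B :: "real^'n^'n" and l m :: "real^'n"
    and Z :: "'n bmat" and \<Gamma> :: "real^'n^'n" and \<theta> \<omega> :: "real^'n" and \<gamma> :: real
    and dB :: "real^'n^'n" and dl dm :: "real^'n" and dd :: real
  assumes det: "det B \<noteq> 0"
    and m: "m v* B = det B *\<^sub>R axis a 1"
    and dm: "dm v* B + m v* dB = dd *\<^sub>R axis a 1"
    and Z: "block B 0 l (inverse (det B)) ** Z =
      block \<Gamma> \<theta> \<omega> \<gamma> ** block B 0 l (inverse (det B)) +
      block dB 0 dl (- (inverse (det B) * dd * inverse (det B)))"
begin

text \<open>\<open>th\<close> and \<open>et\<close> are the values of \<open>hat_theta\<close> and
  of row a of \<open>hat_eta\<close> on the vector, see \<open>th_hat\<close> and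
  \<open>et_hat\<close>.\<close>

definition "th = (\<chi> j. Z $ Some j $ None)"

definition "et = (\<chi> j. Z $ Some a $ Some j + (if a = j then Z $ None $ None else 0))"

text \<open>The upper part of the last column of \<open>Z\<close>.\<close>

lemma B_th: "B *v (det B *\<^sub>R th) = \<theta>"
proof -
  have "(\<Sum>k\<in>UNIV. B $ i $ k * Z $ Some k $ None) = \<theta> $ i * inverse (det B)" for i
    using arg_cong[OF Z, of "\<lambda>X. X $ Some i $ None"]
    by (simp add: matrix_matrix_mult_def block_def sum_option)
  then show ?thesis using det
    by (simp add: vec_eq_iff matrix_vector_mult_def th_def mult.left_commute sum_distrib_left[symmetric])
qed

lemma th_eq_0_iff: "th = 0 \<longleftrightarrow> \<theta> = 0"
proof
  assume "\<theta> = 0"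
  then have "B *v (det B *\<^sub>R th) = 0" using B_th by simp
  moreover obtain C where "C ** B = mat 1"
    using det unfolding invertible_det_nz[symmetric] invertible_def by auto
  ultimately have "det B *\<^sub>R th = 0"
    by (metis matrix_vector_mul_assoc matrix_vector_mul_lid matrix_vector_mult_0_right)
  then show "th = 0" using det by simp
qed (use B_th in auto)

text \<open>Multiplying the upper left block of \<open>Z\<close> by m turns m B into det B e_a and
  produces the term m dB, which \<open>dm\<close> replaces by dd e_a - dm B. The lower right entry
  contributes - dd, so all derivatives except dm disappear.\<close>

lemma et_eq: "det B *\<^sub>R et = (m v* \<Gamma>) v* B + (m \<bullet> \<theta>) *\<^sub>R l - dm v* B
    + (det B * (\<gamma> - det B * (l \<bullet> th))) *\<^sub>R axis a 1"
proof -
  define Y where "Y = (\<chi> i j. Z $ Some i $ Some j)"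
  have "B ** Y = \<Gamma> ** B + (\<chi> i j. \<theta> $ i * l $ j) + dB"
  proof -
    have "(\<Sum>k\<in>UNIV. B $ i $ k * Z $ Some k $ Some j) =
        (\<Sum>k\<in>UNIV. \<Gamma> $ i $ k * B $ k $ j) + \<theta> $ i * l $ j + dB $ i $ j" for i j
      using arg_cong[OF Z, of "\<lambda>X. X $ Some i $ Some j"]
      by (simp add: matrix_matrix_mult_def block_def sum_option)
    then show ?thesis by (simp add: vec_eq_iff matrix_matrix_mult_def Y_def)
  qed
  from arg_cong[OF this, of "\<lambda>X. m v* X"]
  have "det B *\<^sub>R Y $ a = (m v* \<Gamma>) v* B + m v* (\<chi> i j. \<theta> $ i * l $ j) + m v* dB"
    by (simp add: vector_matrix_add_right vector_matrix_mul_assoc[symmetric] m scaleR_vector_matrix_assoc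
        axis_vector_matrix)
  moreover have "m v* (\<chi> i j. \<theta> $ i * l $ j) = (m \<bullet> \<theta>) *\<^sub>R l"
    by (simp add: vec_eq_iff vector_matrix_mult_def inner_vec_def sum_distrib_left mult_ac)
  moreover have "m v* dB = dd *\<^sub>R axis a 1 - dm v* B" using dm by (simp add: algebra_simps)
  ultimately have Y: "det B *\<^sub>R Y $ a = (m v* \<Gamma>) v* B + (m \<bullet> \<theta>) *\<^sub>R l + dd *\<^sub>R axis a 1 - dm v* B"
    by simp
  have "l \<bullet> th + inverse (det B) * Z $ None $ None =
      \<gamma> * inverse (det B) - inverse (det B) * dd * inverse (det B)"
    using arg_cong[OF Z, of "\<lambda>X. X $ None $ None"]
    by (simp add: matrix_matrix_mult_def block_def sum_option inner_vec_def th_def)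
  moreover have "det B * inverse (det B) = 1" using det by simp
  ultimately have N: "det B * Z $ None $ None = det B * (\<gamma> - det B * (l \<bullet> th)) - dd"
    by algebra
  have "et = Y $ a + Z $ None $ None *\<^sub>R axis a 1"
    by (auto simp: vec_eq_iff et_def Y_def axis_def)
  then have "det B *\<^sub>R et = det B *\<^sub>R Y $ a + (det B * Z $ None $ None) *\<^sub>R axis a 1"
    by (simp add: scaleR_add_right)
  then show ?thesis unfolding Y N by (simp add: algebra_simps)
qed

text \<open>On vectors killed by the connection forms of the base, \<open>et\<close> is - dm B / det
  B, and B is invertible.\<close>

lemma et_eq_0_iff:
  assumes "\<theta> = 0" "\<Gamma> = 0" "\<gamma> = 0" shows "et = 0 \<longleftrightarrow> dm = 0"
proof -
  have "th = 0" using th_eq_0_iff assms(1) by simp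
  then have "det B *\<^sub>R et = - (dm v* B)" using et_eq assms by simp
  then show ?thesis using det vector_matrix_cancel[OF det, of dm 0]
    by (metis neg_equal_0_iff_equal scaleR_eq_0_iff vector_matrix_mult_0)
qed

end

text \<open>The \<open>l\<close>-terms of \<open>et_eq\<close> are skew and cancel.\<close>

lemma cartan_value_pairing:
  assumes 1: "cartan_value a B l m Z \<Gamma> \<theta> \<omega> \<gamma> dB dl dm dd"
    and 2: "cartan_value a B l m Z' \<Gamma>' \<theta>' \<omega>' \<gamma>' dB' dl' dm' dd'"
  shows "(det B)\<^sup>2 * (cartan_value.et a Z \<bullet> cartan_value.th Z' + cartan_value.th Z \<bullet> cartan_value.et a Z') =
    (m v* \<Gamma>) \<bullet> \<theta>' - dm \<bullet> \<theta>' + \<gamma> * (m \<bullet> \<theta>') + ((m v* \<Gamma>') \<bullet> \<theta> - dm' \<bullet> \<theta> + \<gamma>' * (m \<bullet> \<theta>))"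
proof -
  interpret a: cartan_value a B l m Z \<Gamma> \<theta> \<omega> \<gamma> dB dl dm dd by (rule 1)
  interpret b: cartan_value a B l m Z' \<Gamma>' \<theta>' \<omega>' \<gamma>' dB' dl' dm' dd' by (rule 2)
  \<comment> \<open>Both sides are the pairing of m B = det B e_a with det B th, once evaluated on B
    th.\<close>
  have ax: "det B * (axis a 1 \<bullet> (det B *\<^sub>R th)) = m \<bullet> \<theta>" if "B *v (det B *\<^sub>R th) = \<theta>" for th \<theta>
    using dot_lmul_matrix[of m B "det B *\<^sub>R th"] that a.m by simp
  \<comment> \<open>One half of the symmetric product. \<open>th'\<close> and
    \<open>\<theta>'\<close> belong to the vector that \<open>et\<close> is taken of, so the
    statement serves twice with the roles exchanged.\<close>
  have pair: "(det B *\<^sub>R et) \<bullet> (det B *\<^sub>R th) = (m v* \<Gamma>) \<bullet> \<theta> + (m \<bullet> \<theta>') * (det B * (l \<bullet> th)) - dm \<bullet> \<theta>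
      + (\<gamma> - det B * (l \<bullet> th')) * (m \<bullet> \<theta>)"
    if et: "det B *\<^sub>R et = (m v* \<Gamma>) v* B + (m \<bullet> \<theta>') *\<^sub>R l - dm v* B
        + (det B * (\<gamma> - det B * (l \<bullet> th'))) *\<^sub>R axis a 1"
      and th: "B *v (det B *\<^sub>R th) = \<theta>"
    for et th th' \<Gamma> \<theta> \<theta>' \<gamma> dm
  proof -
    have "(det B *\<^sub>R et) \<bullet> (det B *\<^sub>R th) = ((m v* \<Gamma>) v* B) \<bullet> (det B *\<^sub>R th) + (m \<bullet> \<theta>') * (l \<bullet> (det B *\<^sub>R th))
        - (dm v* B) \<bullet> (det B *\<^sub>R th) + (\<gamma> - det B * (l \<bullet> th')) * (det B * (axis a 1 \<bullet> (det B *\<^sub>R th)))"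
      unfolding et by (simp only: inner_add_left inner_diff_left inner_scaleR_left mult_ac)
    then show ?thesis unfolding dot_lmul_matrix th ax[OF th] by simp
  qed
  have "(det B)\<^sup>2 * (a.et \<bullet> b.th + a.th \<bullet> b.et) =
      (det B *\<^sub>R a.et) \<bullet> (det B *\<^sub>R b.th) + (det B *\<^sub>R b.et) \<bullet> (det B *\<^sub>R a.th)"
    by (simp add: power2_eq_square algebra_simps inner_commute)
  also have "\<dots> = (m v* \<Gamma>) \<bullet> \<theta>' + (m \<bullet> \<theta>) * (det B * (l \<bullet> b.th)) - dm \<bullet> \<theta>' + (\<gamma> - det B * (l \<bullet> a.th)) * (m \<bullet> \<theta>')
    + ((m v* \<Gamma>') \<bullet> \<theta> + (m \<bullet> \<theta>') * (det B * (l \<bullet> a.th)) - dm' \<bullet> \<theta> + (\<gamma>' - det B * (l \<bullet> b.th)) * (m \<bullet> \<theta>))"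
    unfolding pair[OF a.et_eq b.B_th] pair[OF b.et_eq a.B_th] ..
  finally show ?thesis by (simp add: algebra_simps)
qed

lemma smooth_on_cofactor_row_GL: "smooth_on {B. det B \<noteq> 0} (cofactor_row a)"
  and smooth_on_det_GL: "smooth_on {B :: real^'n^'n. det B \<noteq> 0} det"
  and open_GL: "open {B :: real^'n^'n. det B \<noteq> 0}"
proof -
  have "continuous_on UNIV (det :: real^'n^'n \<Rightarrow> real)"
    using smooth_onD_continuous[OF smooth_on_det[OF open_UNIV smooth_on_id]] .
  then show o: "open {B :: real^'n^'n. det B \<noteq> 0}" by (simp add: open_Collect_neq)
  show "smooth_on {B :: real^'n^'n. det B \<noteq> 0} det" by (rule smooth_on_det[OF o smooth_on_id])
  have "continuous_on UNIV (det :: real^'a^'a \<Rightarrow> real)"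
    using smooth_onD_continuous[OF smooth_on_det[OF open_UNIV smooth_on_id]] .
  then have "open {B :: real^'a^'a. det B \<noteq> 0}" by (simp add: open_Collect_neq)
  then show "smooth_on {B. det B \<noteq> 0} (cofactor_row a)" by (rule smooth_on_cofactor_row[OF _ smooth_on_id])
qed

text \<open>The identity cofactor row times B = det B e_a holds on the open set of invertible
  matrices and may be differentiated there. The result is the hypothesis \<open>dm\<close> of
  \<open>cartan_value\<close>.\<close>

lemma cofactor_row_derivative:
  assumes B: "det B \<noteq> 0"
  shows "frechet_derivative (cofactor_row a) (at B) H v* B + cofactor_row a B v* H =
    frechet_derivative det (at B) H *\<^sub>R axis a 1"
proof -
  have c: "(cofactor_row a has_derivative frechet_derivative (cofactor_row a) (at B)) (at B)"
    by (rule smooth_on_has_derivative[OF smooth_on_cofactor_row_GL]) (use B in simp)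
  have d: "(det has_derivative frechet_derivative det (at B)) (at B)"
    by (rule smooth_on_has_derivative[OF smooth_on_det_GL]) (use B in simp)
  have bil: "bounded_bilinear (\<lambda>v A. v v* (A :: real^'a^'a))"
  proof (subst bilinear_conv_bounded_bilinear[symmetric])
    show "bilinear (\<lambda>v A. v v* (A :: real^'a^'a))"
      unfolding bilinear_def
      by (auto intro!: linearI simp: vec_eq_iff vector_matrix_mult_def algebra_simps sum.distrib sum_distrib_left)
  qed
  have 1: "((\<lambda>B. cofactor_row a B v* B) has_derivative
      (\<lambda>H. cofactor_row a B v* H + frechet_derivative (cofactor_row a) (at B) H v* B)) (at B)"
    by (rule bounded_bilinear.FDERIV[OF bil c has_derivative_ident])
  have "((\<lambda>B. det B *\<^sub>R axis a 1) has_derivative (\<lambda>H. frechet_derivative det (at B) H *\<^sub>R axis a (1::real))) (at B)"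
    by (rule bounded_linear.has_derivative[OF bounded_linear_scaleR_left d])
  then have "((\<lambda>B. cofactor_row a B v* B) has_derivative (\<lambda>H. frechet_derivative det (at B) H *\<^sub>R axis a 1)) (at B)"
    by (rule has_derivative_transform_within_open[OF _ open_GL]) (use B in \<open>simp_all add: cofactor_row_eq\<close>)
  from has_derivative_unique[OF 1 this] show ?thesis by (metis add.commute)
qed

section \<open>Local trivialisations of the Cartan bundle\<close>

lemma vec_deriv_bounded_linear:
  fixes F :: "'p \<Rightarrow> 'v::euclidean_space"
  assumes "smooth_manifold M" "smooth_vec_on M W F" "p \<in> W" "v \<in> tangent_space M p" "bounded_linear L"
  shows "vec_deriv M (\<lambda>p. L (F p)) p v = L (vec_deriv M F p v)"
  by (rule vec_deriv_compose[OF assms(1-3) bounded_linear_imp_has_derivative[OF assms(5)] assms(4)])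

lemma vec_deriv_const [simp]: "vec_deriv M (\<lambda>p. k) p v = 0"
  by (simp add: vec_deriv_def comp_def)

lemma hat_eta_eq:
  assumes "A p v \<in> sl"
  shows "hat_eta A a b p v = A p v $ Some a $ Some b + (if a = b then A p v $ None $ None else 0)"
  unfolding hat_eta_def hat_Gamma_trace[of A p v, OF assms] by (simp add: hat_Gamma_def field_simps)

abbreviation H_elem :: "real^'n^'n \<Rightarrow> real^'n \<Rightarrow> 'n::finite bmat" where
  "H_elem B l \<equiv> block B 0 l (inverse (det B))"

lemma H_elem_in: "det B \<noteq> 0 \<Longrightarrow> H_elem B l \<in> H_group"
  unfolding H_group_def using invertible_det_nz by blast

lemma H_groupE:
  assumes "h \<in> H_group" obtains B l where "det B \<noteq> 0" "h = H_elem B l"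
  using assms unfolding H_group_def using invertible_det_nz by blast

lemma block_nth [simp]:
  "block B u l s $ Some i $ Some j = B $ i $ j" "block B u l s $ Some i $ None = u $ i"
  "block B u l s $ None $ Some j = l $ j" "block B u l s $ None $ None = s"
  by (simp_all add: block_def)

lemma bmat_eq_iff:
  "X = Y \<longleftrightarrow> (\<forall>i j. X $ Some i $ Some j = Y $ Some i $ Some j) \<and> (\<forall>i. X $ Some i $ None = Y $ Some i $ None)
    \<and> (\<forall>j. X $ None $ Some j = Y $ None $ Some j) \<and> X $ None $ None = Y $ None $ None"
  for X Y :: "'n::finite bmat"
  unfolding vec_eq_iff by (metis option.exhaust)

lemma invertible_H_elem:
  fixes B :: "real^'n^'n"
  assumes B: "det B \<noteq> 0" shows "invertible (H_elem B l)"
proof -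
  obtain C where C: "C ** B = mat 1"
    using B unfolding invertible_det_nz[symmetric] invertible_def by auto
  have C': "(\<Sum>k\<in>UNIV. C $ i $ k * B $ k $ j) = (if i = j then 1 else 0)" for i j
    using arg_cong[OF C, of "\<lambda>X. X $ i $ j"] by (simp add: matrix_matrix_mult_def mat_def)
  have "(l v* C) v* B = l" by (simp add: vector_matrix_mul_assoc C)
  then have l: "(\<Sum>k\<in>UNIV. (l v* C) $ k * B $ k $ j) = l $ j" for j
    by (metis (no_types, lifting) sum.cong vec_lambda_beta vector_matrix_mult_def)
  have "block C 0 (- (det B *\<^sub>R (l v* C))) (det B) ** H_elem B l = mat 1"
    unfolding bmat_eq_iff using B l
    by (simp add: matrix_matrix_mult_def sum_option C' mat_def mult.assoc sum_negf sum_distrib_left[symmetric])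
  then show ?thesis using invertible_left_inverse by blast
qed

lemma H_group_smooth:
  "smooth_on ({B :: real^('n::finite)^'n. det B \<noteq> 0} \<times> UNIV) (\<lambda>z. H_elem (fst z) (snd z))" (is "smooth_on ?S _")
  unfolding block_def
proof (intro smooth_on_vec_lambda)
  show o: "open ?S" by (intro open_Times open_GL open_UNIV)
  then show "open ?S" .
  fix i j :: "'n option"
  have 1: "smooth_on ?S (\<lambda>z. fst z $ i $ j)" for i j by (intro smooth_intros o)
  have 2: "smooth_on ?S (\<lambda>z. snd z $ j)" for j by (intro smooth_intros o)
  have 3: "smooth_on ?S (\<lambda>z. inverse (det (fst z)))" by (intro smooth_on_inverse smooth_intros o) auto
  show "smooth_on ?S (\<lambda>z. case i of
        None \<Rightarrow> case j of None \<Rightarrow> inverse (det (fst z)) | Some b \<Rightarrow> snd z $ b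
      | Some a \<Rightarrow> case j of None \<Rightarrow> 0 $ a | Some b \<Rightarrow> fst z $ a $ b)"
    using 1 2 3 by (cases i; cases j) simp_all
qed

lemma continuous_map_top_of_set_open:
  assumes "open S" "\<And>x. x \<in> S \<Longrightarrow> g x \<in> topspace N" "\<And>V. openin N V \<Longrightarrow> open {x\<in>S. g x \<in> V}"
  shows "continuous_map (top_of_set S) N g"
  unfolding continuous_map_def using assms by (auto simp: openin_open_eq)

text \<open>What the Cartan bundle provides over one open set U: a dual pair of frames, a
  trivialisation and the local form of A. The assumptions do not mention \<open>a\<close>, so the
  predicate \<open>gauge\<close> is written without it.\<close>

locale gauge =
  fixes M :: "('m, real^'n) mfd"
    and P :: "('p, (real^'n) \<times> (real^'n^'n) \<times> (real^'n)) mfd"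
    and \<pi> :: "'p \<Rightarrow> 'm" and act :: "'p \<Rightarrow> 'n::finite bmat \<Rightarrow> 'p"
    and A :: "'p \<Rightarrow> ('p, (real^'n) \<times> (real^'n^'n) \<times> (real^'n)) tvec \<Rightarrow> 'n bmat"
    and a :: 'n
    and U :: "'m set" and b :: "'p \<Rightarrow> 'n bmat" and \<theta> X G
  assumes M: "smooth_manifold M" and P: "smooth_manifold P"
    and \<pi>: "smooth_map_on P M (pts P) \<pi>"
    and A_sl: "\<And>p v. p \<in> pts P \<Longrightarrow> v \<in> tangent_space P p \<Longrightarrow> A p v \<in> sl"
    and frames: "dual_frames_on M U \<theta> X"
    and triv: "local_trivialization M P \<pi> act U b"
    and A_eq: "\<And>p v. p \<in> pts P \<Longrightarrow> \<pi> p \<in> U \<Longrightarrow> v \<in> tangent_space P p \<Longrightarrow>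
      A p v = matrix_inv (b p) ** cartan_gauge M \<theta> X G (\<pi> p) (tangent_map P M \<pi> p v) ** b p
                 + matrix_inv (b p) ** vec_deriv P b p v"
begin

section \<open>Coordinates on the part of the bundle over U\<close>

definition "PU = {p \<in> pts P. \<pi> p \<in> U}"
definition "Bp p = (\<chi> i j. b p $ Some i $ Some j)"
definition "lp p = (\<chi> j. b p $ None $ Some j)"
definition "\<Phi> p = (\<pi> p, b p)"
definition "\<mu> p = cofactor_row a (Bp p)"

abbreviation "hc \<equiv> \<lambda>h :: 'n bmat. (\<chi> i j. h $ Some i $ Some j, \<chi> j. h $ None $ Some j)"
abbreviation "pc c \<equiv> (fst c \<times> (H_group :: 'n bmat set), map_prod (snd c) hc)"

lemma triv_facts:
  shows oU: "openin (mtop M) U" and bij\<Phi>: "bij_betw \<Phi> PU (U \<times> H_group)"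
    and sm\<Phi>: "smooth_map_on P (prod_mfd M H_mfd) PU \<Phi>"
    and sm\<Phi>_inv: "smooth_map_on (prod_mfd M H_mfd) P (U \<times> H_group) (inv_into PU \<Phi>)"
proof -
  have "\<Phi> = (\<lambda>p. (\<pi> p, b p))" by (auto simp: \<Phi>_def)
  then show "openin (mtop M) U" "bij_betw \<Phi> PU (U \<times> H_group)"
    "smooth_map_on P (prod_mfd M H_mfd) PU \<Phi>"
    "smooth_map_on (prod_mfd M H_mfd) P (U \<times> H_group) (inv_into PU \<Phi>)"
    using triv unfolding local_trivialization_def Let_def PU_def[symmetric] by auto
qed

lemma PU_pts: "PU \<subseteq> pts P" by (auto simp: PU_def)

lemma b_eq: assumes "p \<in> PU" shows "det (Bp p) \<noteq> 0" "b p = H_elem (Bp p) (lp p)"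
proof -
  have "b p \<in> H_group" using bij_betw_apply[OF bij\<Phi> assms] by (simp add: \<Phi>_def)
  then obtain B l where h: "det B \<noteq> 0" "b p = H_elem B l" by (rule H_groupE)
  then have "Bp p = B" "lp p = l" by (simp_all add: Bp_def lp_def vec_eq_iff)
  then show "det (Bp p) \<noteq> 0" "b p = H_elem (Bp p) (lp p)" using h by auto
qed

lemma pc_chart: "c \<in> charts M \<Longrightarrow> pc c \<in> charts (prod_mfd M H_mfd)"
  unfolding prod_mfd_def H_mfd_def mfd.simps by (intro CollectI exI conjI) auto

lemma \<pi>_open: "openin (mtop M) V \<Longrightarrow> openin (mtop P) {p \<in> PU. \<pi> p \<in> V}"
proof -
  assume "openin (mtop M) V"
  then have "openin (mtop P) {p \<in> pts P. \<pi> p \<in> U \<inter> V}" using smooth_map_onD(3)[OF \<pi>] oU by blast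
  moreover have "{p \<in> pts P. \<pi> p \<in> U \<inter> V} = {p \<in> PU. \<pi> p \<in> V}" by (auto simp: PU_def)
  ultimately show ?thesis by simp
qed

lemma oPU: "openin (mtop P) PU"
  using smooth_map_onD(3)[OF \<pi> oU] by (simp add: PU_def)

lemma chart_open: "c \<in> charts M \<Longrightarrow> openin (mtop M) (fst c)"
  using smooth_manifold_chart[OF M] unfolding is_chart_def by blast

text \<open>\<open>Fc c\<close> and \<open>Sc c\<close> are mutually inverse coordinates (x, B, l)
  between \<open>Wc c\<close> and the open set \<open>Oc c\<close>. They come from the
  trivialisation and take the place of the charts of P in explicit computations.\<close>

definition "Wc c = {p \<in> PU. \<pi> p \<in> fst c}"
definition "Fc c p = (snd c (\<pi> p), Bp p, lp p)"
definition Oc :: "('m, real^'n) chart \<Rightarrow> ((real^'n) \<times> (real^'n^'n) \<times> (real^'n)) set" where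
  "Oc c = (snd c ` (fst c \<inter> U)) \<times> {B. det B \<noteq> 0} \<times> UNIV"
definition Sc :: "('m, real^'n) chart \<Rightarrow> (real^'n) \<times> (real^'n^'n) \<times> (real^'n) \<Rightarrow> 'p" where
  "Sc c = (\<lambda>(y, B, l). inv_into PU \<Phi> (chart_inv c y, H_elem B l))"

lemma oWc: "c \<in> charts M \<Longrightarrow> openin (mtop P) (Wc c)"
  unfolding Wc_def by (rule \<pi>_open[OF chart_open])

lemma smooth_Fc:
  assumes c: "c \<in> charts M" shows "smooth_vec_on P (Wc c) (Fc c)"
  unfolding smooth_vec_on_def
proof (intro conjI ballI oWc[OF c])
  fix e assume e: "e \<in> charts P"
  have "{p \<in> PU. \<Phi> p \<in> fst (pc c)} = Wc c"
    using bij_betw_apply[OF bij\<Phi>] by (auto simp: Wc_def \<Phi>_def)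
  moreover have "snd (pc c) (\<Phi> q) = Fc c q" for q by (simp add: \<Phi>_def Fc_def Bp_def lp_def)
  ultimately show "smooth_on (snd e ` (fst e \<inter> Wc c)) (Fc c \<circ> chart_inv e)"
    using smooth_map_onD(4)[OF sm\<Phi> e pc_chart[OF c]] by (simp add: comp_def)
qed

lemma Fc_in: "p \<in> Wc c \<Longrightarrow> Fc c p \<in> Oc c"
  using b_eq(1) by (auto simp: Wc_def Fc_def Oc_def PU_def)

lemma Sc_Fc:
  assumes c: "c \<in> charts M" and p: "p \<in> Wc c" shows "Sc c (Fc c p) = p"
proof -
  have "p \<in> PU" "\<pi> p \<in> fst c" using p by (auto simp: Wc_def)
  then have "Sc c (Fc c p) = inv_into PU \<Phi> (\<Phi> p)"
    using b_eq(2)[of p] chart_inv_left[OF smooth_manifold_chart[OF M c]] by (simp add: Sc_def Fc_def \<Phi>_def)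
  then show ?thesis using bij\<Phi> \<open>p \<in> PU\<close> by (simp add: bij_betw_def)
qed

lemma Sc_facts:
  assumes c: "c \<in> charts M" and z: "(y, B, l) \<in> Oc c"
  shows "Sc c (y, B, l) \<in> Wc c" "\<pi> (Sc c (y, B, l)) = chart_inv c y" "Bp (Sc c (y, B, l)) = B"
    "lp (Sc c (y, B, l)) = l" "Fc c (Sc c (y, B, l)) = (y, B, l)"
proof -
  have ic: "is_chart (mtop M) c" using smooth_manifold_chart[OF M c] .
  have z': "chart_inv c y \<in> U" "chart_inv c y \<in> fst c" "H_elem B l \<in> H_group" "y \<in> snd c ` fst c"
    using z H_elem_in[of B l] by (auto simp: Oc_def chart_inv_left[OF ic])
  then have im: "(chart_inv c y, H_elem B l) \<in> \<Phi> ` PU" using bij\<Phi> by (simp add: bij_betw_def)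
  have in1: "Sc c (y, B, l) \<in> PU" unfolding Sc_def prod.case by (rule inv_into_into[OF im])
  have eq: "\<Phi> (Sc c (y, B, l)) = (chart_inv c y, H_elem B l)"
    unfolding Sc_def prod.case by (rule f_inv_into_f[OF im])
  then show p: "\<pi> (Sc c (y, B, l)) = chart_inv c y" by (simp add: \<Phi>_def)
  then show "Sc c (y, B, l) \<in> Wc c" using in1 z' by (simp add: Wc_def)
  have be: "b (Sc c (y, B, l)) = H_elem B l" using eq by (simp add: \<Phi>_def)
  show B: "Bp (Sc c (y, B, l)) = B" and l: "lp (Sc c (y, B, l)) = l"
    unfolding Bp_def lp_def be by (simp_all add: vec_eq_iff)
  show "Fc c (Sc c (y, B, l)) = (y, B, l)"
    using chart_inv_right[OF z'(4)] by (simp add: Fc_def p B l)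
qed

lemma open_Oc: "c \<in> charts M \<Longrightarrow> open (Oc c)"
  unfolding Oc_def using chart_open_image[OF smooth_manifold_chart[OF M] oU]
  by (intro open_Times open_GL open_UNIV) auto

text \<open>Smoothness of the inverse trivialisation is stated through the product charts of M and
  H. It yields the claim once the inverse of such a chart is recognised as the explicit map
  \<open>?g\<close>.\<close>

lemma smooth_Sc:
  assumes c: "c \<in> charts M" shows "smooth_param (Oc c) P (Sc c)"
  unfolding smooth_param_def
proof (intro conjI allI impI ballI open_Oc[OF c])
  have ic: "is_chart (mtop M) c" using smooth_manifold_chart[OF M c] .
  show "Sc c ` Oc c \<subseteq> pts P" using Sc_facts(1)[OF c] PU_pts by (force simp: Wc_def)
  let ?g = "\<lambda>z :: (real^'n) \<times> (real^'n^'n) \<times> (real^'n). (chart_inv c (fst z), H_elem (fst (snd z)) (snd (snd z)))"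
  have Sg: "Sc c z = inv_into PU \<Phi> (?g z)" for z by (simp add: Sc_def split_beta)
  have g_in: "?g z \<in> U \<times> H_group" "?g z \<in> fst (pc c)" if "z \<in> Oc c" for z
    using that H_elem_in by (auto simp: Oc_def chart_inv_left[OF ic])
  note pcM = smooth_param_chart[OF M c]
  have cont: "continuous_map (top_of_set (Oc c)) (mtop (prod_mfd M H_mfd)) ?g"
    unfolding prod_mfd_def mfd.simps H_mfd_def continuous_map_pairwise
  proof
    show "continuous_map (top_of_set (Oc c)) (mtop M) (fst \<circ> ?g)"
    proof (rule continuous_map_top_of_set_open[OF open_Oc[OF c]])
      show "(fst \<circ> ?g) z \<in> pts M" if "z \<in> Oc c" for z
        using g_in(2)[OF that] is_chart_subset[OF ic] by auto
      fix V assume "openin (mtop M) V"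
      from smooth_paramD(3)[OF pcM this] have "open ({x \<in> snd c ` fst c. chart_inv c x \<in> V} \<times> UNIV)"
        by (intro open_Times open_UNIV)
      then have "open (Oc c \<inter> {x \<in> snd c ` fst c. chart_inv c x \<in> V} \<times> UNIV)"
        using open_Oc[OF c] by (intro open_Int)
      moreover have "Oc c \<inter> {x \<in> snd c ` fst c. chart_inv c x \<in> V} \<times> UNIV = {z \<in> Oc c. (fst \<circ> ?g) z \<in> V}"
        by (auto simp: Oc_def)
      ultimately show "open {z \<in> Oc c. (fst \<circ> ?g) z \<in> V}" by simp
    qed
    have "continuous_on ({B. det B \<noteq> 0} \<times> UNIV) (\<lambda>z. H_elem (fst z) (snd z))"
      by (rule smooth_onD_continuous[OF H_group_smooth])
    then have "continuous_on (Oc c) (\<lambda>z. H_elem (fst (snd z)) (snd (snd z)))"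
      by (rule continuous_on_compose2[of _ _ _ snd]) (auto simp: Oc_def intro: continuous_intros)
    then show "continuous_map (top_of_set (Oc c)) (top_of_set H_group) (snd \<circ> ?g)"
      using g_in(1) by (auto simp: comp_def)
  qed
  show "open {z \<in> Oc c. Sc c z \<in> V}" if "openin (mtop P) V" for V
  proof -
    have "openin (mtop (prod_mfd M H_mfd)) {w \<in> U \<times> H_group. inv_into PU \<Phi> w \<in> V}"
      by (rule smooth_map_onD(3)[OF sm\<Phi>_inv that])
    from openin_continuous_map_preimage[OF cont this]
    have "openin (top_of_set (Oc c)) {z \<in> Oc c. ?g z \<in> {w \<in> U \<times> H_group. inv_into PU \<Phi> w \<in> V}}" by simp
    moreover have "{z \<in> Oc c. ?g z \<in> {w \<in> U \<times> H_group. inv_into PU \<Phi> w \<in> V}} = {z \<in> Oc c. Sc c z \<in> V}"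
      using g_in(1) Sg by auto
    ultimately show ?thesis using openin_open_eq[OF open_Oc[OF c]] by simp
  qed
  fix e assume e: "e \<in> charts P"
  let ?A = "snd (pc c) ` (fst (pc c) \<inter> {w \<in> U \<times> H_group. inv_into PU \<Phi> w \<in> fst e})"
  \<comment> \<open>On \<open>H_group\<close> the matrix is determined by B and l, so the product
    chart is injective and \<open>?g\<close> is its inverse.\<close>
  have inv: "chart_inv (pc c) z = ?g z" "snd (pc c) (?g z) = z" if z: "z \<in> Oc c" for z
  proof -
    show 1: "snd (pc c) (?g z) = z"
      using z by (auto simp: Oc_def chart_inv_left[OF ic] vec_eq_iff)
    have "inj_on (snd (pc c)) (fst (pc c))"
    proof (rule inj_onI)
      fix w w' assume w: "w \<in> fst (pc c)" "w' \<in> fst (pc c)" "snd (pc c) w = snd (pc c) w'"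
      then have "fst w = fst w'" using is_chart_inj[OF ic] by (auto simp: inj_on_def map_prod_def split_beta)
      moreover have "snd w = snd w'"
      proof -
        obtain B l B' l' where "snd w = H_elem B l" "snd w' = H_elem B' l'" using w H_groupE by (metis mem_Sigma_iff prod.collapse fst_conv)
        moreover have "hc (snd w) = hc (snd w')" using w(3) by (simp add: map_prod_def split_beta)
        ultimately have "B = B'" "l = l'" by (simp_all add: vec_eq_iff)
        then show ?thesis using \<open>snd w = H_elem B l\<close> \<open>snd w' = H_elem B' l'\<close> by simp
      qed
      ultimately show "w = w'" by (simp add: prod_eq_iff)
    qed
    from inv_into_f_f[OF this g_in(2)[OF z]] show "chart_inv (pc c) z = ?g z" unfolding 1 .
  qed
  have "{z \<in> Oc c. Sc c z \<in> fst e} \<subseteq> ?A"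
  proof
    fix z assume z: "z \<in> {z \<in> Oc c. Sc c z \<in> fst e}"
    then have "?g z \<in> fst (pc c) \<inter> {w \<in> U \<times> H_group. inv_into PU \<Phi> w \<in> fst e}" using g_in Sg by auto
    moreover have "z = snd (pc c) (?g z)" using inv(2)[of z] z by simp
    ultimately show "z \<in> ?A" by (rule image_eqI[rotated])
  qed
  then have 1: "smooth_on {z \<in> Oc c. Sc c z \<in> fst e} (\<lambda>x. snd e (inv_into PU \<Phi> (chart_inv (pc c) x)))"
    using smooth_map_onD(4)[OF sm\<Phi>_inv pc_chart[OF c] e] smooth_on_subset by blast
  have o: "open {z \<in> Oc c. Sc c z \<in> fst e}"
    using \<open>\<And>V. openin (mtop P) V \<Longrightarrow> open {z \<in> Oc c. Sc c z \<in> V}\<close> smooth_manifold_chart[OF P e]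
    unfolding is_chart_def by blast
  show "smooth_on {z \<in> Oc c. Sc c z \<in> fst e} (\<lambda>x. snd e (Sc c x))"
  proof (rule smooth_on_cong[OF o, THEN iffD2, OF _ 1])
    fix x assume x: "x \<in> {z \<in> Oc c. Sc c z \<in> fst e}"
    then have "x \<in> Oc c" by blast
    show "snd e (Sc c x) = snd e (inv_into PU \<Phi> (chart_inv (pc c) x))"
      unfolding inv(1)[OF \<open>x \<in> Oc c\<close>] Sg ..
  qed
qed

lemma smooth_BL: "smooth_vec_on P PU (\<lambda>p. (Bp p, lp p))"
proof (rule smooth_vec_on_local[OF P])
  fix p assume p: "p \<in> PU"
  then have "\<pi> p \<in> pts M" using smooth_map_onD(2)[OF \<pi>] PU_pts by blast
  then obtain c where c: "c \<in> charts M" "\<pi> p \<in> fst c" using smooth_manifold_charts_at[OF M] charts_atD by metis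
  have "smooth_vec_on P (Wc c) (\<lambda>p. snd (Fc c p))"
    by (rule smooth_vec_on_compose[OF P smooth_Fc[OF c(1)] open_UNIV])
      (auto intro: smooth_on_linear bounded_linear_snd)
  then have "smooth_vec_on P (Wc c) (\<lambda>p. (Bp p, lp p))" by (simp add: Fc_def)
  moreover have "p \<in> Wc c" "Wc c \<subseteq> PU" using p c by (auto simp: Wc_def)
  ultimately show "\<exists>V. p \<in> V \<and> V \<subseteq> PU \<and> smooth_vec_on P V (\<lambda>p. (Bp p, lp p))" by blast
qed

lemma smooth_Bp: "smooth_vec_on P PU Bp" and smooth_lp: "smooth_vec_on P PU lp"
proof -
  have "smooth_vec_on P PU (\<lambda>p. fst (Bp p, lp p))" "smooth_vec_on P PU (\<lambda>p. snd (Bp p, lp p))"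
    by (rule smooth_vec_on_compose[OF P smooth_BL open_UNIV];
        simp add: smooth_on_linear bounded_linear_fst bounded_linear_snd)+
  then show "smooth_vec_on P PU Bp" "smooth_vec_on P PU lp" by simp_all
qed

lemma smooth_b: "smooth_vec_on P PU b"
proof -
  have "smooth_vec_on P PU (\<lambda>p. H_elem (fst (Bp p, lp p)) (snd (Bp p, lp p)))"
    by (rule smooth_vec_on_compose[OF P smooth_BL _ _ H_group_smooth])
      (auto intro: open_Times open_GL simp: b_eq)
  then show ?thesis using smooth_vec_on_cong[OF P, of PU b "\<lambda>p. H_elem (Bp p) (lp p)"] b_eq(2) by simp
qed

lemma smooth_\<mu>: "smooth_vec_on P PU \<mu>"
  unfolding \<mu>_def[abs_def] by (rule smooth_vec_on_compose[OF P smooth_Bp open_GL _ smooth_on_cofactor_row_GL]) (simp add: b_eq)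

lemma smooth_det: "smooth_vec_on P PU (\<lambda>p. det (Bp p))"
  by (rule smooth_vec_on_compose[OF P smooth_Bp open_GL _ smooth_on_det_GL]) (simp add: b_eq)

abbreviation "dB p v \<equiv> vec_deriv P Bp p v"
abbreviation "dl p v \<equiv> vec_deriv P lp p v"
abbreviation "d\<mu> p v \<equiv> vec_deriv P \<mu> p v"
abbreviation "dd p v \<equiv> frechet_derivative det (at (Bp p)) (dB p v)"
abbreviation "d\<pi> p v \<equiv> tangent_map P M \<pi> p v"

lemma d\<mu>_eq:
  assumes p: "p \<in> PU" and v: "v \<in> tangent_space P p"
  shows "d\<mu> p v = frechet_derivative (cofactor_row a) (at (Bp p)) (dB p v)"
  unfolding \<mu>_def[abs_def]
  by (rule vec_deriv_compose[OF P smooth_Bp p smooth_on_has_derivative[OF smooth_on_cofactor_row_GL] v])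
    (simp add: b_eq[OF p])

lemma vec_deriv_b:
  assumes p: "p \<in> PU" and v: "v \<in> tangent_space P p"
  shows "vec_deriv P b p v =
    block (dB p v) 0 (dl p v) (- (inverse (det (Bp p)) * dd p v * inverse (det (Bp p))))"
proof -
  have e: "vec_deriv P b p v $ i $ j = vec_deriv P (\<lambda>p. b p $ i $ j) p v" for i j
    by (rule vec_deriv_bounded_linear[OF P smooth_b p v, symmetric])
      (intro bounded_linear_compose[OF bounded_linear_vec_nth bounded_linear_vec_nth])
  have B: "dB p v $ i $ j = vec_deriv P (\<lambda>p. Bp p $ i $ j) p v" for i j
    by (rule vec_deriv_bounded_linear[OF P smooth_Bp p v, symmetric])
      (intro bounded_linear_compose[OF bounded_linear_vec_nth bounded_linear_vec_nth])
  have l: "dl p v $ j = vec_deriv P (\<lambda>p. lp p $ j) p v" for j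
    by (rule vec_deriv_bounded_linear[OF P smooth_lp p v, symmetric]) (rule bounded_linear_vec_nth)
  have "vec_deriv P (\<lambda>p. b p $ Some i $ None) p v = vec_deriv P (\<lambda>p. 0::real) p v" for i
    by (rule vec_deriv_cong[OF P oPU p]) (simp add: b_eq(2))
  then have N: "vec_deriv P (\<lambda>p. b p $ Some i $ None) p v = 0" for i by simp
  have "vec_deriv P (\<lambda>p. b p $ None $ None) p v = vec_deriv P (\<lambda>p. inverse (det (Bp p))) p v"
    by (rule vec_deriv_cong[OF P oPU p]) (subst b_eq(2), simp_all)
  also have "\<dots> = - (inverse (det (Bp p)) * dd p v * inverse (det (Bp p)))"
    by (rule vec_deriv_compose[OF P smooth_Bp p _ v], rule Deriv.has_derivative_inverse)
      (auto simp: b_eq(1)[OF p] intro!: smooth_on_has_derivative[OF smooth_on_det_GL])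
  finally show ?thesis
    unfolding bmat_eq_iff e block_nth B l by (simp add: N Bp_def lp_def)
qed

section \<open>The connection and the distribution in a gauge\<close>

definition "tr x u = 1 / (real CARD('n) + 1) * (\<Sum>c\<in>UNIV. conn_form \<theta> G c c x u)"
definition "\<Gamma>m x u = (\<chi> i j. conn_form \<theta> G i j x u - tr x u * (if i = j then 1 else 0))"
definition "\<theta>m x u = (\<chi> i. \<theta> i x u)"
definition "\<omega>m x u = (\<chi> j. - schouten_form M \<theta> X G j x u)"

text \<open>Names the four blocks of the local connection matrix, in the order in which
  \<open>cartan_value\<close> takes them.\<close>

lemma cartan_gauge_eq: "cartan_gauge M \<theta> X G x u = block (\<Gamma>m x u) (\<theta>m x u) (\<omega>m x u) (- tr x u)"
  unfolding cartan_gauge_def Let_def tr_def \<Gamma>m_def \<theta>m_def \<omega>m_def ..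

lemma cartan_value_at:
  assumes p: "p \<in> PU" and v: "v \<in> tangent_space P p"
  shows "cartan_value a (Bp p) (lp p) (\<mu> p) (A p v) (\<Gamma>m (\<pi> p) (d\<pi> p v)) (\<theta>m (\<pi> p) (d\<pi> p v))
    (\<omega>m (\<pi> p) (d\<pi> p v)) (- tr (\<pi> p) (d\<pi> p v)) (dB p v) (dl p v) (d\<mu> p v) (dd p v)"
proof
  show d: "det (Bp p) \<noteq> 0" using b_eq(1)[OF p] .
  show "\<mu> p v* Bp p = det (Bp p) *\<^sub>R axis a 1" unfolding \<mu>_def by (rule cofactor_row_eq[OF d])
  show "d\<mu> p v v* Bp p + \<mu> p v* dB p v = dd p v *\<^sub>R axis a 1"
    unfolding d\<mu>_eq[OF p v] \<mu>_def by (rule cofactor_row_derivative[OF d])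
  have inv: "b p ** matrix_inv (b p) = mat 1"
    using invertible_H_elem[OF d, of "lp p"] unfolding b_eq(2)[OF p] invertible_def matrix_inv_def
    by (rule someI2_ex) simp
  have "A p v = matrix_inv (b p) ** cartan_gauge M \<theta> X G (\<pi> p) (d\<pi> p v) ** b p
      + matrix_inv (b p) ** vec_deriv P b p v"
    using A_eq p v by (simp add: PU_def)
  then have "b p ** A p v = cartan_gauge M \<theta> X G (\<pi> p) (d\<pi> p v) ** b p + vec_deriv P b p v"
    by (simp add: matrix_add_ldistrib matrix_mul_assoc inv)
  then show "H_elem (Bp p) (lp p) ** A p v =
      block (\<Gamma>m (\<pi> p) (d\<pi> p v)) (\<theta>m (\<pi> p) (d\<pi> p v)) (\<omega>m (\<pi> p) (d\<pi> p v)) (- tr (\<pi> p) (d\<pi> p v)) **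
        H_elem (Bp p) (lp p) + block (dB p v) 0 (dl p v) (- (inverse (det (Bp p)) * dd p v * inverse (det (Bp p))))"
    unfolding cartan_gauge_eq vec_deriv_b[OF p v] b_eq(2)[OF p, symmetric] .
qed

text \<open>Holds because A is trace-free, which turns the trace term of \<open>hat_eta\<close> into
  the entry (None, None).\<close>

lemma
  assumes p: "p \<in> PU" and v: "v \<in> tangent_space P p"
  shows th_hat: "cartan_value.th (A p v) = (\<chi> j. hat_theta A j p v)"
    and et_hat: "cartan_value.et a (A p v) = (\<chi> j. hat_eta A a j p v)"
proof -
  have sl: "A p v \<in> sl" using A_sl p v PU_pts by blast
  show "cartan_value.th (A p v) = (\<chi> j. hat_theta A j p v)"
    unfolding cartan_value.th_def[OF cartan_value_at[OF p v]] hat_theta_def ..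
  show "cartan_value.et a (A p v) = (\<chi> j. hat_eta A a j p v)"
    unfolding cartan_value.et_def[OF cartan_value_at[OF p v]] using hat_eta_eq[of A p v a, OF sl]
    by (simp add: vec_eq_iff)
qed

lemma hat_g_et_th:
  assumes p: "p \<in> PU" and v: "v \<in> tangent_space P p" and w: "w \<in> tangent_space P p"
  shows "hat_g A a p v w = cartan_value.et a (A p v) \<bullet> cartan_value.th (A p w)
    + cartan_value.th (A p v) \<bullet> cartan_value.et a (A p w)"
  unfolding et_hat[OF p v] et_hat[OF p w] th_hat[OF p v] th_hat[OF p w] hat_g_def inner_vec_def
  by (simp add: sum.distrib)

text \<open>The right-hand side of \<open>cartan_value_pairing\<close> is built from
  \<open>\<pi>\<close>, \<open>\<mu>\<close> and their derivatives alone, so it agrees at two points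
  of a fibre.\<close>

lemma hat_g_pullback:
  assumes p: "p \<in> PU" and v: "v \<in> tangent_space P p" and w: "w \<in> tangent_space P p"
    and p': "p' \<in> PU" and v': "v' \<in> tangent_space P p'" and w': "w' \<in> tangent_space P p'"
    and eq: "\<pi> p = \<pi> p'" "\<mu> p = \<mu> p'" "d\<pi> p v = d\<pi> p' v'" "d\<pi> p w = d\<pi> p' w'"
      "d\<mu> p v = d\<mu> p' v'" "d\<mu> p w = d\<mu> p' w'"
  shows "(det (Bp p))\<^sup>2 * hat_g A a p v w = (det (Bp p'))\<^sup>2 * hat_g A a p' v' w'"
  unfolding hat_g_et_th[OF p v w] hat_g_et_th[OF p' v' w']
    cartan_value_pairing[OF cartan_value_at[OF p v] cartan_value_at[OF p w]]
    cartan_value_pairing[OF cartan_value_at[OF p' v'] cartan_value_at[OF p' w']] eq ..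

text \<open>In a chart the n forms give a linear map of the n-dimensional model space to itself. The
  dual fields show that it is onto, hence it is injective.\<close>

lemma frames_zero:
  assumes x: "x \<in> U" and u: "u \<in> tangent_space M x"
  shows "\<theta>m x u = 0 \<longleftrightarrow> u = (\<lambda>c. 0)"
proof -
  have one: "one_form_on M U (\<theta> i)" and vf: "vector_field_on M U (X i)" for i
    using frames unfolding dual_frames_on_def by auto
  have dual: "\<theta> i x (X j x) = (if i = j then 1 else 0)" for i j
    using frames x unfolding dual_frames_on_def by auto
  have lin: "\<theta> i x (\<lambda>c. r *\<^sub>R v c + s *\<^sub>R w c) = r * \<theta> i x v + s * \<theta> i x w"
    if "v \<in> tangent_space M x" "w \<in> tangent_space M x" for i r s v w
    using one[of i] x that unfolding one_form_on_def by (auto simp del: scaleR_conv_of_real)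
  have xM: "x \<in> pts M" using x oU openin_subset by blast
  obtain c where c: "c \<in> charts_at M x" using smooth_manifold_charts_at[OF M xM] .
  note c' = charts_atD[OF c]
  have ic: "is_chart (mtop M) c" using smooth_manifold_chart[OF M c'(1)] .
  note pcM = smooth_param_chart[OF M c'(1)]
  let ?x = "snd c x"
  have xc: "?x \<in> snd c ` fst c" and ix: "chart_inv c ?x = x" using c'(2) chart_inv_left[OF ic] by auto
  have t: "push M (chart_inv c) ?x e \<in> tangent_space M x" for e
    using push_tangent[OF M pcM xc] ix by simp
  let ?L = "\<lambda>e. \<theta>m x (push M (chart_inv c) ?x e)"
  have lc: "?L (r *\<^sub>R e + s *\<^sub>R e') = r *\<^sub>R ?L e + s *\<^sub>R ?L e'" for r s e e'
    unfolding push_lincomb[OF M pcM xc] by (simp add: \<theta>m_def vec_eq_iff lin[OF t t])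
  have L: "linear ?L"
  proof (rule linearI)
    show "?L (e + e') = ?L e + ?L e'" for e e' using lc[of 1 e 1 e'] by simp
    show "?L (r *\<^sub>R e) = r *\<^sub>R ?L e" for r e using lc[of r e 0 e] by simp
  qed
  have LX: "?L (X i x c) = axis i 1" for i
  proof -
    have "X i x \<in> tangent_space M x" using vf[of i] x unfolding vector_field_on_def by blast
    from push_chart[OF M c this] show ?thesis by (auto simp: \<theta>m_def vec_eq_iff dual axis_def)
  qed
  have "?L (\<Sum>i\<in>UNIV. (y $ i) *\<^sub>R X i x c) = y" for y
    by (simp add: linear_sum[OF L] linear_cmul[OF L] LX vec_eq_iff axis_def if_distrib cong: if_cong)
  then have "surj ?L" by (rule surjI)
  then have inj: "inj ?L" using linear_surjective_imp_injective[OF L] by simp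
  show ?thesis
  proof
    assume "\<theta>m x u = 0"
    then have "?L (u c) = ?L 0" using push_chart[OF M c u] linear_0[OF L] by simp
    then have "u c = 0" by (rule injD[OF inj])
    then show "u = (\<lambda>c. 0)" using tangent_space_eqI[OF M c u zero_tangent[OF M xM]] by simp
  next
    assume "u = (\<lambda>c. 0)"
    then show "\<theta>m x u = 0" using lin[OF u u, of _ 0 0] by (simp add: \<theta>m_def vec_eq_iff)
  qed
qed

text \<open>Vanishing of \<open>th\<close> means that the vector is vertical; then all connection
  forms of the base vanish on it, and vanishing of \<open>et\<close> reduces to that of the
  derivative of \<open>\<mu>\<close>.\<close>

lemma dist_D_iff:
  assumes p: "p \<in> PU"
  shows "v \<in> dist_D P A a p \<longleftrightarrow> v \<in> tangent_space P p \<and> d\<pi> p v = (\<lambda>c. 0) \<and> d\<mu> p v = 0"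
proof (cases "v \<in> tangent_space P p")
  case v: True
  have x: "\<pi> p \<in> U" "p \<in> pts P" using p by (auto simp: PU_def)
  interpret cartan_value a "Bp p" "lp p" "\<mu> p" "A p v" "\<Gamma>m (\<pi> p) (d\<pi> p v)" "\<theta>m (\<pi> p) (d\<pi> p v)"
    "\<omega>m (\<pi> p) (d\<pi> p v)" "- tr (\<pi> p) (d\<pi> p v)" "dB p v" "dl p v" "d\<mu> p v" "dd p v"
    by (rule cartan_value_at[OF p v])
  have "v \<in> dist_D P A a p \<longleftrightarrow> th = 0 \<and> et = 0"
    unfolding th_hat[OF p v] et_hat[OF p v] dist_D_def using v by (auto simp: vec_eq_iff)
  moreover have "th = 0 \<longleftrightarrow> d\<pi> p v = (\<lambda>c. 0)"
    using th_eq_0_iff frames_zero[OF x(1) tangent_map_tangent[OF P M \<pi> x(2) v]] by simp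
  moreover have "et = 0 \<longleftrightarrow> d\<mu> p v = 0" if "\<theta>m (\<pi> p) (d\<pi> p v) = 0"
  proof (rule et_eq_0_iff[OF that])
    have "\<theta> i (\<pi> p) (d\<pi> p v) = 0" for i using that by (simp add: \<theta>m_def vec_eq_iff)
    then have "conn_form \<theta> G i j (\<pi> p) (d\<pi> p v) = 0" for i j by (simp add: conn_form_def)
    then show "\<Gamma>m (\<pi> p) (d\<pi> p v) = 0" "- tr (\<pi> p) (d\<pi> p v) = 0"
      by (simp_all add: \<Gamma>m_def tr_def vec_eq_iff)
  qed
  ultimately show ?thesis using v th_eq_0_iff by blast
qed (simp add: dist_D_def)

end

section \<open>The leaves\<close>

lemma push_cong:
  fixes M :: "('p, 'e::euclidean_space) mfd"
  assumes "open S" "x \<in> S" "\<And>y. y \<in> S \<Longrightarrow> \<sigma> y = \<tau> y"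
  shows "push M \<sigma> x e = push M \<tau> x e"
proof -
  have "frechet_derivative (\<lambda>x. snd d (\<sigma> x)) (at x) = frechet_derivative (\<lambda>x. snd d (\<tau> x)) (at x)"
    for d :: "('p, 'e) chart"
    by (rule frechet_derivative_cong_open[OF assms(1,2)]) (simp add: assms(3))
  then show ?thesis unfolding push_def assms(3)[OF assms(2)] by (simp cong: if_cong)
qed

lemma vec_deriv_zero_vec:
  assumes "smooth_manifold M" "smooth_vec_on M W F" "p \<in> W"
  shows "vec_deriv M F p (\<lambda>c. 0) = 0"
proof -
  have "p \<in> pts M" using assms smooth_vec_onD(1) openin_subset by blast
  from smooth_vec_on_lincomb[OF assms zero_tangent[OF assms(1) this] zero_tangent[OF assms(1) this], of 0 0]
  show ?thesis by simp
qed

text \<open>A leaf receives its topology and smooth structure from a single global coordinate; the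
  subspace topology of P does not enter.\<close>

definition one_chart :: "'p set \<Rightarrow> ('p \<Rightarrow> 'k::euclidean_space) \<Rightarrow> ('p, 'k) mfd" where
  "one_chart L \<kappa> = \<lparr>mtop = pullback_topology L \<kappa> euclidean, charts = {(L, \<kappa>)}\<rparr>"

lemma one_chart_simps [simp]:
  "charts (one_chart L \<kappa>) = {(L, \<kappa>)}" "pts (one_chart L \<kappa>) = L"
  by (auto simp: one_chart_def topspace_pullback_topology)

lemma openin_one_chart: "openin (mtop (one_chart L \<kappa>)) V \<longleftrightarrow> (\<exists>T. open T \<and> V = {p\<in>L. \<kappa> p \<in> T})"
  by (auto simp: one_chart_def openin_pullback_topology vimage_def)

lemma
  assumes inj: "inj_on \<kappa> L" and op: "open (\<kappa> ` L)"
  shows smooth_manifold_one_chart: "smooth_manifold (one_chart L \<kappa>)"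
    and connected_one_chart: "connected (\<kappa> ` L) \<Longrightarrow> connected_space (mtop (one_chart L \<kappa>))"
proof -
  let ?X = "mtop (one_chart L \<kappa>)"
  have homeo: "homeomorphic_map ?X (top_of_set (\<kappa> ` L)) \<kappa>"
  proof (rule bijective_open_imp_homeomorphic_map)
    show "continuous_map ?X (top_of_set (\<kappa> ` L)) \<kappa>"
      unfolding continuous_map_def using op by (auto simp: openin_open_eq openin_one_chart)
    show "open_map ?X (top_of_set (\<kappa> ` L)) \<kappa>"
      unfolding open_map_def
    proof (intro allI impI)
      fix V assume "openin ?X V"
      then obtain T where "open T" "V = {p\<in>L. \<kappa> p \<in> T}" by (auto simp: openin_one_chart)
      then have "\<kappa> ` V = T \<inter> \<kappa> ` L" by auto
      then show "openin (top_of_set (\<kappa> ` L)) (\<kappa> ` V)" using \<open>open T\<close> op by (simp add: openin_open_eq open_Int)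
    qed
  qed (use inj in simp_all)
  then have sp: "?X homeomorphic_space top_of_set (\<kappa> ` L)"
    by (rule homeomorphic_map_imp_homeomorphic_space)
  show "connected (\<kappa> ` L) \<Longrightarrow> connected_space ?X"
    using homeomorphic_connected_space[OF sp] connectedin_iff_connected[of "\<kappa> ` L"]
    unfolding connectedin_def by simp
  have "Hausdorff_space ?X" using homeomorphic_Hausdorff_space[OF sp] by (simp add: Hausdorff_space_subtopology)
  moreover have "second_countable (euclidean :: 'b topology)"
  proof -
    obtain \<B> :: "'b set set" where "countable \<B>" "\<And>C. C \<in> \<B> \<Longrightarrow> open C" "\<And>S. open S \<Longrightarrow> \<exists>U. U \<subseteq> \<B> \<and> S = \<Union> U"
      using univ_second_countable by metis
    then have "\<exists>V\<in>\<B>. x \<in> V \<and> V \<subseteq> S" if S: "open S" "x \<in> S" for S x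
    proof -
      obtain U where U: "U \<subseteq> \<B>" "S = \<Union> U" using \<open>\<And>S. open S \<Longrightarrow> \<exists>U. U \<subseteq> \<B> \<and> S = \<Union> U\<close>[OF S(1)] by blast
      then show ?thesis using S(2) by blast
    qed
    then show ?thesis unfolding second_countable_def
      using \<open>countable \<B>\<close> \<open>\<And>C. C \<in> \<B> \<Longrightarrow> open C\<close> by (intro exI[of _ \<B>]) auto
  qed
  then have "second_countable ?X"
    using homeomorphic_space_second_countability[OF sp] second_countable_subtopology by blast
  moreover have L: "openin ?X L" using openin_topspace[of ?X] by simp
  then have sub: "subtopology ?X L = ?X" by (metis one_chart_simps(2) subtopology_topspace)
  have "is_chart ?X (L, \<kappa>)" unfolding is_chart_def using L op homeo sub by simp
  moreover have "compatible (L, \<kappa>) (L, \<kappa>)"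
  proof -
    have "smooth_on (\<kappa> ` L) (\<lambda>x. x)" by simp
    then have "smooth_on (\<kappa> ` L) (\<kappa> \<circ> inv_into L \<kappa>)"
      by (rule smooth_on_cong[OF op, THEN iffD1, rotated]) (simp add: f_inv_into_f)
    then show ?thesis by (simp add: compatible_def)
  qed
  ultimately show "smooth_manifold (one_chart L \<kappa>)" unfolding smooth_manifold_def by simp
qed

definition top_block :: "'n::finite bmat \<Rightarrow> real^'n^'n" where
  "top_block h = (\<chi> i j. h $ Some i $ Some j)"

text \<open>Only the sign of s matters: it selects one of the two sheets det B > 0 and det B < 0,
  and s = 0 gives the empty set. This definition and the next stand outside the locale so that all
  gauges can be collected in one family of charts.\<close>

definition fol_dom :: "('p, 'f::euclidean_space) mfd \<Rightarrow> ('p \<Rightarrow> 'm) \<Rightarrow> 'm set \<Rightarrow> ('p \<Rightarrow> 'n::finite bmat)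
    \<Rightarrow> ('m, real^'n) chart \<Rightarrow> real \<Rightarrow> 'p set" where
  "fol_dom P \<pi> U b c s = {p \<in> pts P. \<pi> p \<in> U \<and> \<pi> p \<in> fst c \<and> s * det (top_block (b p)) > 0}"

definition fol_map :: "'n::finite \<Rightarrow> ('p \<Rightarrow> 'm) \<Rightarrow> ('p \<Rightarrow> 'n bmat) \<Rightarrow> ('m, real^'n) chart
    \<Rightarrow> 'p \<Rightarrow> (real^'n) \<times> (real^'n)" where
  "fol_map a \<pi> b c p = (snd c (\<pi> p), cofactor_row a (top_block (b p)))"

section \<open>Fibres of the local submersions are the leaves\<close>

context gauge
begin

abbreviation "\<Psi> c \<equiv> fol_map a \<pi> b c"
abbreviation "WE c s \<equiv> fol_dom P \<pi> U b c s"

lemma \<Psi>_eq: "\<Psi> c p = (snd c (\<pi> p), \<mu> p)"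
  by (simp add: fol_map_def \<mu>_def Bp_def top_block_def)

lemma WE_eq: "WE c s = {p \<in> Wc c. s * det (Bp p) > 0}"
  by (auto simp: fol_dom_def Wc_def PU_def Bp_def top_block_def)

lemma Wc_PU: "Wc c \<subseteq> PU" by (auto simp: Wc_def)

lemma oWE: assumes c: "c \<in> charts M" shows "openin (mtop P) (WE c s)"
proof -
  have "open {x :: real. s * x > 0}" by (intro open_Collect_less continuous_intros)
  from smooth_vec_on_continuous[OF P smooth_vec_on_subset[OF P smooth_det oWc[OF c] Wc_PU] this]
  show ?thesis unfolding WE_eq by simp
qed

lemma WE_sub: "WE c s \<subseteq> Wc c" "WE c s \<subseteq> PU" "WE c s \<subseteq> pts P"
  using Wc_PU PU_pts unfolding WE_eq by blast+

lemma smooth_c\<pi>: assumes c: "c \<in> charts M" shows "smooth_vec_on P (Wc c) (\<lambda>p. snd c (\<pi> p))"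
proof -
  have "smooth_vec_on P (Wc c) (\<lambda>p. fst (Fc c p))"
    by (rule smooth_vec_on_compose[OF P smooth_Fc[OF c] open_UNIV])
      (auto intro: smooth_on_linear bounded_linear_fst)
  then show ?thesis by (simp add: Fc_def)
qed

lemma smooth_\<Psi>_Wc: assumes c: "c \<in> charts M" shows "smooth_vec_on P (Wc c) (\<Psi> c)"
  using smooth_vec_on_Pair[OF P smooth_c\<pi>[OF c] smooth_vec_on_subset[OF P smooth_\<mu> oWc[OF c] Wc_PU]]
  by (simp add: \<Psi>_eq[abs_def])

lemma smooth_\<Psi>: "c \<in> charts M \<Longrightarrow> smooth_vec_on P (WE c s) (\<Psi> c)"
  using smooth_vec_on_subset[OF P smooth_\<Psi>_Wc oWE WE_sub(1)] by blast

lemma d\<Psi>_eq: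
  assumes c: "c \<in> charts M" and p: "p \<in> Wc c" and v: "v \<in> tangent_space P p"
  shows "vec_deriv P (\<Psi> c) p v = (d\<pi> p v c, d\<mu> p v)"
proof (rule prod_eqI)
  have f: "vec_deriv P (\<lambda>p. fst (\<Psi> c p)) p v = fst (vec_deriv P (\<Psi> c) p v)"
    and s: "vec_deriv P (\<lambda>p. snd (\<Psi> c p)) p v = snd (vec_deriv P (\<Psi> c) p v)"
    by (rule vec_deriv_bounded_linear[OF P smooth_\<Psi>_Wc[OF c] p v], simp add: bounded_linear_fst bounded_linear_snd)+
  have "c \<in> charts_at M (\<pi> p)" using c p by (simp add: charts_at_def Wc_def)
  then show "fst (vec_deriv P (\<Psi> c) p v) = fst (d\<pi> p v c, d\<mu> p v)"
    using f by (simp add: \<Psi>_eq tangent_map_eq)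
  show "snd (vec_deriv P (\<Psi> c) p v) = snd (d\<pi> p v c, d\<mu> p v)"
    using s by (simp add: \<Psi>_eq)
qed

lemma d\<pi>_eqI:
  assumes c: "c \<in> charts M" and p: "p \<in> Wc c" "p' \<in> Wc c" "\<pi> p = \<pi> p'"
    and v: "v \<in> tangent_space P p" "v' \<in> tangent_space P p'" and eq: "d\<pi> p v c = d\<pi> p' v' c"
  shows "d\<pi> p v = d\<pi> p' v'"
proof (rule tangent_space_eqI[OF M, of c "\<pi> p"])
  show "d\<pi> p v c = d\<pi> p' v' c" by (rule eq)
  show "c \<in> charts_at M (\<pi> p)" using c p by (simp add: charts_at_def Wc_def)
  have "p \<in> pts P" "p' \<in> pts P" using p Wc_PU PU_pts by blast+
  then show "d\<pi> p v \<in> tangent_space M (\<pi> p)" "d\<pi> p' v' \<in> tangent_space M (\<pi> p)"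
    using tangent_map_tangent[OF P M \<pi> _ v(1)] tangent_map_tangent[OF P M \<pi> _ v(2)] unfolding p(3) by blast+
qed

lemma dist_D_\<Psi>:
  assumes c: "c \<in> charts M" and p: "p \<in> Wc c"
  shows "v \<in> dist_D P A a p \<longleftrightarrow> v \<in> tangent_space P p \<and> vec_deriv P (\<Psi> c) p v = 0"
proof (cases "v \<in> tangent_space P p")
  case v: True
  have pPU: "p \<in> PU" and pP: "p \<in> pts P" using p Wc_PU PU_pts by blast+
  have "\<pi> p \<in> pts M" using smooth_map_onD(2)[OF \<pi> pP] .
  have "d\<pi> p v = (\<lambda>c. 0) \<longleftrightarrow> d\<pi> p v c = 0"
  proof
    assume "d\<pi> p v c = 0"
    then show "d\<pi> p v = (\<lambda>c. 0)"
      using p c by (intro tangent_space_eqI[OF M, of c "\<pi> p"] tangent_map_tangent[OF P M \<pi> pP v]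
          zero_tangent[OF M \<open>\<pi> p \<in> pts M\<close>]) (auto simp: charts_at_def Wc_def)
  qed simp
  then show ?thesis unfolding dist_D_iff[OF pPU] d\<Psi>_eq[OF c p v] using v by (simp add: prod_eq_iff)
qed (simp add: dist_D_def)

text \<open>The section keeps l and det B at their values at p and corrects B by
  \<open>row_section\<close> so that the cofactor row takes the prescribed value.\<close>

lemma section_exists:
  assumes c: "c \<in> charts M" and p: "p \<in> WE c s" and k: "a \<noteq> k"
  shows "\<exists>S \<sigma>. smooth_param S P \<sigma> \<and> \<Psi> c p \<in> S \<and> \<sigma> (\<Psi> c p) = p \<and> (\<forall>x\<in>S. \<sigma> x \<in> WE c s \<and> \<Psi> c (\<sigma> x) = x)"
proof -
  have pW: "p \<in> Wc c" and pPU: "p \<in> PU" using p WE_sub by blast+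
  have d: "det (Bp p) \<noteq> 0" by (rule b_eq(1)[OF pPU])
  let ?r = "\<lambda>m. inverse (det (Bp p)) *\<^sub>R (m v* Bp p)"
  let ?A = "snd c ` (fst c \<inter> U)"
  \<comment> \<open>Positivity of the pivot is an open condition, and it holds at p, where the
    vector is e_a.\<close>
  define S where "S = ?A \<times> {m. ?r m $ a > 0}"
  define g where "g = (\<lambda>x :: (real^'n) \<times> (real^'n). (fst x, Bp p ** row_section a k (?r (snd x)), lp p))"
  have oA: "open ?A" by (rule chart_open_image[OF smooth_manifold_chart[OF M c] oU])
  have sr: "smooth_on UNIV (\<lambda>m. ?r m)"
    by (intro smooth_on_scaleR smooth_on_vector_matrix smooth_on_const smooth_on_id open_UNIV)
  have "open {m. ?r m $ a > 0}"
    using smooth_onD_continuous[OF smooth_on_vec_nth[OF open_UNIV sr]]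
    by (intro open_Collect_less) (auto intro: continuous_intros)
  then have oS: "open S" unfolding S_def by (intro open_Times oA)
  have sg: "smooth_on S g"
    unfolding g_def
  proof (intro smooth_on_Pair oS smooth_on_fst smooth_on_id smooth_on_const smooth_on_matrix_mult smooth_on_row_section)
    show "smooth_on S (\<lambda>x. ?r (snd x))"
      by (rule smooth_on_compose[OF oS open_UNIV _ sr]) (simp, rule smooth_on_linear[OF bounded_linear_snd])
  qed (auto simp: S_def)
  have g: "g x \<in> Oc c" "det (Bp p ** row_section a k (?r (snd x))) = det (Bp p)"
    "cofactor_row a (Bp p ** row_section a k (?r (snd x))) = snd x" if x: "x \<in> S" for x
  proof -
    have r: "?r (snd x) $ a \<noteq> 0" using x by (auto simp: S_def)
    show *: "det (Bp p ** row_section a k (?r (snd x))) = det (Bp p)"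
      "cofactor_row a (Bp p ** row_section a k (?r (snd x))) = snd x"
      using cofactor_row_section[OF k d refl r] by simp_all
    show "g x \<in> Oc c" using x d * by (auto simp: g_def Oc_def S_def)
  qed
  have r0: "?r (\<mu> p) = axis a 1" using cofactor_row_eq[OF d] d by (simp add: \<mu>_def)
  have "?r (\<mu> p) $ a > 0" unfolding r0 by (simp add: axis_def)
  then have \<Psi>S: "\<Psi> c p \<in> S" using pW unfolding S_def \<Psi>_eq by (auto simp: Wc_def PU_def)
  show ?thesis
  proof (intro exI[of _ S] exI[of _ "\<lambda>x. Sc c (g x)"] conjI ballI)
    show "smooth_param S P (\<lambda>x. Sc c (g x))"
      by (rule smooth_param_compose[OF P smooth_Sc[OF c] oS sg g(1)])
    show "\<Psi> c p \<in> S" by (rule \<Psi>S)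
    have "g (\<Psi> c p) = Fc c p" by (simp add: g_def \<Psi>_eq Fc_def r0 row_section_axis[OF k])
    then show "Sc c (g (\<Psi> c p)) = p" using Sc_Fc[OF c pW] by simp
    fix x assume x: "x \<in> S"
    have z: "(fst x, Bp p ** row_section a k (?r (snd x)), lp p) \<in> Oc c" using g(1)[OF x] by (simp add: g_def)
    note f = Sc_facts[OF c z]
    have "fst x \<in> snd c ` fst c" using x by (auto simp: S_def)
    then show "\<Psi> c (Sc c (g x)) = x"
      using g(3)[OF x] f chart_inv_right by (simp add: g_def \<Psi>_eq \<mu>_def prod_eq_iff)
    show "Sc c (g x) \<in> WE c s" using f g(2)[OF x] p by (simp add: g_def WE_eq)
  qed
qed

definition "Lf c s p = {p' \<in> WE c s. \<Psi> c p' = \<Psi> c p}"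

lemma Lf_\<pi>: assumes c: "c \<in> charts M" and "p \<in> WE c s" "p' \<in> Lf c s p" shows "\<pi> p' = \<pi> p" "\<mu> p' = \<mu> p"
proof -
  have "p \<in> Wc c" "p' \<in> Wc c" using assms(2,3) WE_sub unfolding Lf_def by blast+
  moreover have "snd c (\<pi> p') = snd c (\<pi> p)" "\<mu> p' = \<mu> p"
    using assms(3) by (simp_all add: Lf_def \<Psi>_eq)
  ultimately show "\<pi> p' = \<pi> p" "\<mu> p' = \<mu> p"
    using is_chart_inj[OF smooth_manifold_chart[OF M c]] by (auto simp: Wc_def inj_on_def)
qed

text \<open>Closedness in all of P, and not only in the foliated domain, is what the connectedness
  argument requires, because an integral manifold might leave that domain. The complement consists
  of the points with another base point, another \<open>\<mu>\<close> or the opposite sign of det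
  B.\<close>

lemma Lf_closed:
  assumes c: "c \<in> charts M" and p: "p \<in> WE c s" shows "openin (mtop P) (pts P - Lf c s p)"
proof -
  have pW: "p \<in> Wc c" "p \<in> pts P" using p WE_sub by blast+
  have xM: "\<pi> p \<in> pts M" using smooth_map_onD(2)[OF \<pi> pW(2)] .
  have "Hausdorff_space (mtop M)" using M unfolding smooth_manifold_def by blast
  then have "closedin (mtop M) {\<pi> p}" using xM by (rule closedin_Hausdorff_singleton)
  then have "openin (mtop M) (pts M - {\<pi> p})" by (simp add: openin_diff)
  then have 1: "openin (mtop P) {q \<in> pts P. \<pi> q \<in> pts M - {\<pi> p}}" by (rule smooth_map_onD(3)[OF \<pi>])
  have 2: "openin (mtop P) {q \<in> PU. \<mu> q \<in> - {\<mu> p}}"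
    by (rule smooth_vec_on_continuous[OF P smooth_\<mu>]) auto
  have "open {x :: real. s * x < 0}" by (intro open_Collect_less continuous_intros)
  from smooth_vec_on_continuous[OF P smooth_det this]
  have 3: "openin (mtop P) {q \<in> PU. s * det (Bp q) < 0}" by simp
  have s: "s \<noteq> 0" using p by (auto simp: WE_eq)
  have "pts P - Lf c s p = {q \<in> pts P. \<pi> q \<in> pts M - {\<pi> p}} \<union> {q \<in> PU. \<mu> q \<in> - {\<mu> p}} \<union> {q \<in> PU. s * det (Bp q) < 0}"
    (is "?l = ?r")
  proof
    show "?r \<subseteq> ?l"
    proof
      fix q assume q: "q \<in> ?r"
      have "q \<notin> Lf c s p"
      proof
        assume L: "q \<in> Lf c s p"
        then have "s * det (Bp q) > 0" by (simp add: Lf_def WE_eq)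
        then show False using q Lf_\<pi>[OF c p L] by auto
      qed
      then show "q \<in> ?l" using q PU_pts by auto
    qed
    show "?l \<subseteq> ?r"
    proof
      fix q assume q: "q \<in> ?l"
      show "q \<in> ?r"
      proof (cases "\<pi> q = \<pi> p")
        case True
        then have qW: "q \<in> Wc c" "q \<in> PU" using q pW by (auto simp: Wc_def PU_def)
        then have "\<not> (s * det (Bp q) > 0) \<or> \<mu> q \<noteq> \<mu> p" using q True by (auto simp: Lf_def WE_eq \<Psi>_eq)
        moreover have "s * det (Bp q) \<noteq> 0" using b_eq(1)[OF qW(2)] s by simp
        ultimately show ?thesis using qW(2) by auto
      next
        case False
        then show ?thesis using q smooth_map_onD(2)[OF \<pi>, of q] by auto
      qed
    qed
  qed
  then show ?thesis using 1 2 3 by auto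
qed

text \<open>Inside N the fibre is closed by \<open>Lf_closed\<close>, and it is open because the
  derivative of \<open>\<Psi> c\<close> vanishes along N. Since N is connected, the fibre is
  everything.\<close>

lemma integral_manifold_subset_fibre:
  fixes N :: "('p, 'k::euclidean_space) mfd"
  assumes c: "c \<in> charts M" and N: "integral_manifold P (dist_D P A a) N"
    and p: "p \<in> pts N" "p \<in> WE c s"
  shows "pts N \<subseteq> Lf c s p"
proof -
  have sN: "smooth_manifold N" and con: "connected_space (mtop N)"
    and inc: "smooth_map_on N P (pts N) (\<lambda>p. p)"
    and bij: "\<And>q. q \<in> pts N \<Longrightarrow> bij_betw (tangent_map N P (\<lambda>p. p) q) (tangent_space N q) (dist_D P A a q)"
    using N unfolding integral_manifold_def by auto
  let ?W = "{q \<in> pts N. q \<in> WE c s}"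
  have s\<Psi>: "smooth_vec_on N ?W (\<Psi> c)" using smooth_map_vec[OF sN P inc smooth_\<Psi>[OF c]] by simp
  have zero: "vec_deriv N (\<Psi> c) q v = 0" if q: "q \<in> ?W" and v: "v \<in> tangent_space N q" for q v
  proof -
    have "tangent_map N P (\<lambda>p. p) q v \<in> dist_D P A a q" using bij_betw_apply[OF bij v] q by blast
    moreover have "q \<in> Wc c" using q WE_sub by blast
    ultimately have "vec_deriv P (\<Psi> c) q (tangent_map N P (\<lambda>p. p) q v) = 0" using dist_D_\<Psi>[OF c] by blast
    then show ?thesis using vec_deriv_tangent_map[OF sN P inc smooth_\<Psi>[OF c, of s] _ _ v] q by simp
  qed
  have oL: "openin (mtop N) (pts N \<inter> Lf c s p)"
  proof (subst openin_subopen, intro ballI)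
    fix q assume q: "q \<in> pts N \<inter> Lf c s p"
    then have qW: "q \<in> ?W" by (auto simp: Lf_def)
    obtain V where V: "openin (mtop N) V" "q \<in> V" "V \<subseteq> ?W" "\<And>r. r \<in> V \<Longrightarrow> \<Psi> c r = \<Psi> c q"
      by (rule vec_deriv_zero_locally_constant[OF sN s\<Psi> zero qW]) (assumption, assumption, rule that)
    have "V \<subseteq> pts N \<inter> Lf c s p" using V(3,4) q by (auto simp: Lf_def)
    then show "\<exists>T. openin (mtop N) T \<and> q \<in> T \<and> T \<subseteq> pts N \<inter> Lf c s p" using V(1,2) by blast
  qed
  have "openin (mtop N) {q \<in> pts N. q \<in> pts P - Lf c s p}"
    by (rule smooth_map_onD(3)[OF inc Lf_closed[OF c p(2)]])
  moreover have "{q \<in> pts N. q \<in> pts P - Lf c s p} = pts N - Lf c s p"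
    using smooth_map_onD(2)[OF inc] by auto
  ultimately have oC: "openin (mtop N) (pts N - Lf c s p)" by simp
  have "pts N \<inter> Lf c s p \<noteq> {}" using p by (auto simp: Lf_def)
  then have "pts N - Lf c s p = {}"
    using con oL oC unfolding connected_space_def by blast
  then show ?thesis by blast
qed

text \<open>The fibre is B0 times the matrices C with e_a C = det C e_a and det C > 0, with l free.
  \<open>fibre_param\<close> turns this into an open connected set of n by n matrices, which gives
  one global coordinate of dimension n^2.\<close>

lemma fibre_integral_manifold:
  assumes c: "c \<in> charts M" and p0: "p0 \<in> WE c s" and k: "a \<noteq> k"
  shows "\<exists>N :: ('p, real^'n^'n) mfd. integral_manifold P (dist_D P A a) N \<and> pts N = Lf c s p0"
proof -
  let ?L = "Lf c s p0"
  let ?D = "dist_D P A a"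
  have p0W: "p0 \<in> Wc c" and p0PU: "p0 \<in> PU" using p0 WE_sub by blast+
  have d0: "det (Bp p0) \<noteq> 0" by (rule b_eq(1)[OF p0PU])
  obtain C where C: "Bp p0 ** C = mat 1" "C ** Bp p0 = mat 1"
    using d0 unfolding invertible_det_nz[symmetric] invertible_def by auto
  define XS where "XS = {X :: real^'n^'n. minor_det a X > 0}"
  have oXS: "open XS" unfolding XS_def by (rule open_minor_det_pos)
  define g where "g X = (snd c (\<pi> p0), Bp p0 ** fibre_param a k X, X $ a)" for X
  define \<tau> where "\<tau> X = Sc c (g X)" for X
  \<comment> \<open>Recovers X from a point of the fibre; C is the inverse of the matrix B of the
    base point.\<close>
  define \<kappa> where "\<kappa> p = fibre_coord a k (C ** Bp p, lp p)" for p
  have dt: "det (fibre_param a k X) = minor_det a X" if "X \<in> XS" for X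
    using det_fibre_param[OF k, of X] that by (simp add: XS_def)
  have gO: "g X \<in> Oc c" if "X \<in> XS" for X
    using that dt[OF that] d0 p0W unfolding g_def Oc_def Wc_def PU_def XS_def by (auto simp: det_mul)
  have sg: "smooth_on XS g" unfolding g_def
    by (intro smooth_on_Pair oXS smooth_on_const smooth_on_matrix_mult smooth_on_fibre_param
        smooth_on_id smooth_on_vec_nth) (auto simp: XS_def)
  have s\<tau>: "smooth_param XS P \<tau>"
    unfolding \<tau>_def[abs_def] by (rule smooth_param_compose[OF P smooth_Sc[OF c] oXS sg gO])
  have \<tau>f: "\<tau> X \<in> Wc c" "\<pi> (\<tau> X) = \<pi> p0" "Bp (\<tau> X) = Bp p0 ** fibre_param a k X" "lp (\<tau> X) = X $ a"
    if "X \<in> XS" for X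
    using Sc_facts[OF c gO[OF that, unfolded g_def]] p0W chart_inv_left[OF smooth_manifold_chart[OF M c]]
    unfolding \<tau>_def g_def Wc_def by auto
  have \<tau>L: "\<tau> X \<in> ?L" if X: "X \<in> XS" for X
  proof -
    have t: "minor_det a X > 0" using X by (simp add: XS_def)
    have "cofactor_row a (Bp p0 ** fibre_param a k X) = cofactor_row a (Bp p0)"
      using cofactor_row_mult_iff[OF d0, of "fibre_param a k X"] dt[OF X] t fibre_param_row by simp
    then have \<Psi>: "\<Psi> c (\<tau> X) = \<Psi> c p0" using \<tau>f[OF X] by (simp add: \<Psi>_eq \<mu>_def)
    have e: "s * det (Bp (\<tau> X)) = (s * det (Bp p0)) * minor_det a X"
      using \<tau>f(3)[OF X] dt[OF X] by (simp add: det_mul)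
    have "s * det (Bp p0) > 0" using p0 by (simp add: WE_eq)
    then have "s * det (Bp (\<tau> X)) > 0" unfolding e using t by (rule mult_pos_pos)
    then have "\<tau> X \<in> WE c s" using \<tau>f(1)[OF X] unfolding WE_eq by blast
    then show ?thesis using \<Psi> by (simp add: Lf_def)
  qed
  have \<kappa>\<tau>: "\<kappa> (\<tau> X) = X" if X: "X \<in> XS" for X
  proof -
    have "C ** Bp (\<tau> X) = fibre_param a k X" using \<tau>f(3)[OF X] C by (simp add: matrix_mul_assoc)
    then show ?thesis using \<tau>f(4)[OF X] fibre_coord_param[OF k] X by (simp add: \<kappa>_def XS_def)
  qed
  have \<kappa>L: "\<kappa> p \<in> XS" "\<tau> (\<kappa> p) = p" if p: "p \<in> ?L" for p
  proof -
    let ?C = "C ** Bp p"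
    have pW: "p \<in> Wc c" and pPU: "p \<in> PU" and sd: "s * det (Bp p) > 0"
      using p WE_sub unfolding Lf_def by (blast, blast, simp add: WE_eq)
    have B: "Bp p = Bp p0 ** ?C" using C by (simp add: matrix_mul_assoc)
    then have db: "det (Bp p) = det (Bp p0) * det ?C" by (metis det_mul)
    moreover have "s * det (Bp p0) > 0" using p0 by (simp add: WE_eq)
    ultimately have dC: "det ?C > 0" using sd by (metis mult.assoc zero_less_mult_pos)
    have "cofactor_row a (Bp p0 ** ?C) = cofactor_row a (Bp p0)"
      using Lf_\<pi>(2)[OF c p0 p] B by (simp add: \<mu>_def)
    then have row: "?C $ a = det ?C *\<^sub>R axis a 1" using cofactor_row_mult_iff[OF d0] dC by simp
    show "\<kappa> p \<in> XS" using minor_det_fibre_coord[OF k row] dC by (simp add: \<kappa>_def XS_def)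
    have "g (\<kappa> p) = Fc c p"
      using fibre_param_coord[OF k row] fibre_coord_row[OF k row] dC B Lf_\<pi>(1)[OF c p0 p]
      by (simp add: g_def \<kappa>_def Fc_def)
    then show "\<tau> (\<kappa> p) = p" using Sc_Fc[OF c pW] by (simp add: \<tau>_def)
  qed
  have im: "\<kappa> ` ?L = XS" using \<kappa>L(1) \<kappa>\<tau> \<tau>L by (metis (no_types, lifting) equalityI image_eqI image_subsetI subsetI)
  have inj: "inj_on \<kappa> ?L" using \<kappa>L(2) by (metis inj_onI)
  let ?N = "one_chart ?L \<kappa>"
  let ?ch = "(?L, \<kappa>)"
  have sN: "smooth_manifold ?N" using smooth_manifold_one_chart[OF inj] im oXS by simp
  have con: "connected_space (mtop ?N)"
  proof (rule connected_one_chart[OF inj])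
    show "open (\<kappa> ` ?L)" unfolding im by (rule oXS)
    show "connected (\<kappa> ` ?L)" unfolding im XS_def by (rule connected_minor_det_pos)
  qed
  have ci: "chart_inv ?ch X = \<tau> X" if X: "X \<in> XS" for X
    using inv_into_f_eq[OF inj \<tau>L[OF X] \<kappa>\<tau>[OF X]] by simp
  have LP: "?L \<subseteq> pts P" using WE_sub unfolding Lf_def by blast
  have inc: "smooth_map_on ?N P (pts ?N) (\<lambda>p. p)"
  proof (rule smooth_map_onI)
    show op: "openin (mtop ?N) {p \<in> pts ?N. p \<in> V}" if V: "openin (mtop P) V" for V
    proof -
      have "{p \<in> pts ?N. p \<in> V} = {p \<in> ?L. \<kappa> p \<in> {X \<in> XS. \<tau> X \<in> V}}" using \<kappa>L by auto
      then show ?thesis unfolding openin_one_chart using smooth_paramD(3)[OF s\<tau> V] by blast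
    qed
    show "openin (mtop ?N) (pts ?N)" by (rule openin_topspace)
    fix d assume d: "d \<in> charts P"
    have od: "openin (mtop P) (fst d)" using smooth_manifold_chart[OF P d] unfolding is_chart_def by blast
    have "\<kappa> ` (?L \<inter> {p \<in> ?L. p \<in> fst d}) = {X \<in> XS. \<tau> X \<in> fst d}"
    proof
      show "\<kappa> ` (?L \<inter> {p \<in> ?L. p \<in> fst d}) \<subseteq> {X \<in> XS. \<tau> X \<in> fst d}" using \<kappa>L by auto
      show "{X \<in> XS. \<tau> X \<in> fst d} \<subseteq> \<kappa> ` (?L \<inter> {p \<in> ?L. p \<in> fst d})"
      proof
        fix X assume "X \<in> {X \<in> XS. \<tau> X \<in> fst d}"
        then have "X = \<kappa> (\<tau> X)" "\<tau> X \<in> ?L \<inter> {p \<in> ?L. p \<in> fst d}" using \<kappa>\<tau> \<tau>L by auto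
        then show "X \<in> \<kappa> ` (?L \<inter> {p \<in> ?L. p \<in> fst d})" by (rule image_eqI)
      qed
    qed
    moreover have "smooth_on {X \<in> XS. \<tau> X \<in> fst d} (\<lambda>X. snd d (chart_inv ?ch X))"
      by (rule smooth_on_cong[OF smooth_paramD(3)[OF s\<tau> od], THEN iffD1, OF _ smooth_paramD(4)[OF s\<tau> d]])
        (use ci in simp)
    ultimately show "smooth_vec_on ?N {p \<in> pts ?N. p \<in> fst d} (\<lambda>p. snd d p)"
      unfolding smooth_vec_on_def using op[OF od] by (simp add: comp_def)
  qed (use LP in auto)
  have s\<kappa>: "smooth_vec_on P (Wc c) \<kappa>"
  proof -
    have "smooth_on UNIV (\<lambda>z :: (real^'n^'n) \<times> (real^'n). fibre_coord a k (C ** fst z, snd z))"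
      by (intro smooth_on_fibre_coord smooth_on_matrix_mult smooth_on_fst smooth_on_snd smooth_on_id
          smooth_on_const open_UNIV)
    from smooth_vec_on_compose[OF P smooth_BL open_UNIV _ this]
    have "smooth_vec_on P PU \<kappa>" by (simp add: \<kappa>_def[abs_def])
    then show ?thesis using smooth_vec_on_subset[OF P _ oWc[OF c] Wc_PU] by blast
  qed
  have "bij_betw (tangent_map ?N P (\<lambda>p. p) p) (tangent_space ?N p) (?D p)" if p: "p \<in> ?L" for p
  proof -
    let ?X = "\<kappa> p"
    have X: "?X \<in> XS" and \<tau>X: "\<tau> ?X = p" using \<kappa>L[OF p] by auto
    have pWE: "p \<in> WE c s" and pW: "p \<in> Wc c" and pP: "p \<in> pts P"
      using p WE_sub LP unfolding Lf_def by blast+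
    have ch: "?ch \<in> charts_at ?N p" using p by (simp add: charts_at_def)
    have t\<tau>: "push P \<tau> ?X e \<in> tangent_space P p" for e using push_tangent[OF P s\<tau> X] \<tau>X by simp
    have pN: "smooth_param XS ?N (chart_inv ?ch)" using smooth_param_chart[OF sN, of ?ch] im by simp
    have tm: "tangent_map ?N P (\<lambda>p. p) p (push ?N (chart_inv ?ch) ?X e) = push P \<tau> ?X e" for e
    proof -
      have "tangent_map ?N P (\<lambda>p. p) (chart_inv ?ch ?X) (push ?N (chart_inv ?ch) ?X e) =
          push P (chart_inv ?ch) ?X e"
        by (rule tangent_map_push[OF sN P inc pN X]) (use ci X \<tau>L in simp)
      also have "push P (chart_inv ?ch) ?X e = push P \<tau> ?X e"
        by (rule push_cong[OF oXS X]) (rule ci)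
      finally show ?thesis using ci[OF X] \<tau>X by simp
    qed
    have \<Psi>\<tau>: "vec_deriv P (\<Psi> c) p (push P \<tau> ?X e) = 0" for e
    proof -
      have "frechet_derivative (\<lambda>X. \<Psi> c (\<tau> X)) (at ?X) = frechet_derivative (\<lambda>X. \<Psi> c p0) (at ?X)"
        by (rule frechet_derivative_cong_open[OF oXS X]) (use \<tau>L in \<open>auto simp: Lf_def\<close>)
      then show ?thesis using vec_deriv_push[OF P s\<tau> smooth_\<Psi>_Wc[OF c] X] \<tau>X pW by simp
    qed
    have \<kappa>\<tau>': "vec_deriv P \<kappa> p (push P \<tau> ?X e) = e" for e
    proof -
      have "frechet_derivative (\<lambda>X. \<kappa> (\<tau> X)) (at ?X) = frechet_derivative (\<lambda>X. X) (at ?X)"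
        by (rule frechet_derivative_cong_open[OF oXS X \<kappa>\<tau>])
      then show ?thesis using vec_deriv_push[OF P s\<tau> s\<kappa> X] \<tau>X pW by simp
    qed
    have form: "v = push ?N (chart_inv ?ch) ?X (v ?ch)" if "v \<in> tangent_space ?N p" for v
      using push_chart[OF sN ch that] by simp
    show ?thesis
    proof (rule bij_betw_imageI)
      show "inj_on (tangent_map ?N P (\<lambda>p. p) p) (tangent_space ?N p)"
      proof (rule inj_onI)
        fix v w assume vw: "v \<in> tangent_space ?N p" "w \<in> tangent_space ?N p"
          "tangent_map ?N P (\<lambda>p. p) p v = tangent_map ?N P (\<lambda>p. p) p w"
        then have "push P \<tau> ?X (v ?ch) = push P \<tau> ?X (w ?ch)" using form tm by metis
        then have "v ?ch = w ?ch" using \<kappa>\<tau>' by metis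
        then show "v = w" using form vw by metis
      qed
      show "tangent_map ?N P (\<lambda>p. p) p ` tangent_space ?N p = ?D p"
      proof
        show "tangent_map ?N P (\<lambda>p. p) p ` tangent_space ?N p \<subseteq> ?D p"
        proof
          fix u assume "u \<in> tangent_map ?N P (\<lambda>p. p) p ` tangent_space ?N p"
          then obtain v where "v \<in> tangent_space ?N p" "u = tangent_map ?N P (\<lambda>p. p) p v" by blast
          then have "u = push P \<tau> ?X (v ?ch)" using form tm by metis
          then show "u \<in> ?D p" using t\<tau> \<Psi>\<tau> dist_D_\<Psi>[OF c pW] by blast
        qed
        show "?D p \<subseteq> tangent_map ?N P (\<lambda>p. p) p ` tangent_space ?N p"
        proof
          fix u assume "u \<in> ?D p"
          then have u: "u \<in> tangent_space P p" "vec_deriv P (\<Psi> c) p u = 0" using dist_D_\<Psi>[OF c pW] by auto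
          obtain S \<sigma> where \<sigma>: "smooth_param S P \<sigma>" "\<Psi> c p \<in> S" "\<sigma> (\<Psi> c p) = p"
            "\<And>x. x \<in> S \<Longrightarrow> \<sigma> x \<in> WE c s \<and> \<Psi> c (\<sigma> x) = x" using section_exists[OF c pWE k] by blast
          have t\<sigma>: "push P \<sigma> (\<Psi> c p) y \<in> tangent_space P p" for y using push_tangent[OF P \<sigma>(1,2)] \<sigma>(3) by simp
          have \<Psi>\<sigma>: "vec_deriv P (\<Psi> c) p (push P \<sigma> (\<Psi> c p) y) = y" for y
          proof -
            have "frechet_derivative (\<lambda>x. \<Psi> c (\<sigma> x)) (at (\<Psi> c p)) = frechet_derivative (\<lambda>x. x) (at (\<Psi> c p))"
              by (rule frechet_derivative_cong_open[OF smooth_paramD(1)[OF \<sigma>(1)] \<sigma>(2)]) (use \<sigma>(4) in simp)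
            then show ?thesis using vec_deriv_push[OF P \<sigma>(1) smooth_\<Psi>_Wc[OF c] \<sigma>(2)] \<sigma>(3) pW by simp
          qed
          \<comment> \<open>That every vector of the distribution is tangent to the fibre is a
            dimension count. Directions along the fibre and along a section together are
            parametrised by the model space of P, and \<open>T\<close> expresses them in the
            coordinates \<open>Fc c\<close>.\<close>
          define w where "w z = (\<lambda>c'. 1 *\<^sub>R push P \<tau> ?X (fst (snd z)) c' + 1 *\<^sub>R push P \<sigma> (\<Psi> c p) (fst z, snd (snd z)) c')"
            for z :: "(real^'n) \<times> (real^'n^'n) \<times> (real^'n)"
          have tw: "w z \<in> tangent_space P p" for z
            unfolding w_def by (rule tangent_space_lincomb[OF P pP t\<tau> t\<sigma>])
          have \<Psi>w: "vec_deriv P (\<Psi> c) p (w z) = (fst z, snd (snd z))" for z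
            unfolding w_def smooth_vec_on_lincomb[OF P smooth_\<Psi>_Wc[OF c] pW t\<tau> t\<sigma>] \<Psi>\<tau> \<Psi>\<sigma> by simp
          define T where "T z = vec_deriv P (Fc c) p (w z)" for z
          have T_eq: "T z = frechet_derivative (\<lambda>X. Fc c (\<tau> X)) (at ?X) (fst (snd z)) +
              frechet_derivative (\<lambda>x. Fc c (\<sigma> x)) (at (\<Psi> c p)) (fst z, snd (snd z))" for z
            unfolding T_def w_def smooth_vec_on_lincomb[OF P smooth_Fc[OF c] pW t\<tau> t\<sigma>]
            using vec_deriv_push[OF P s\<tau> smooth_Fc[OF c] X] vec_deriv_push[OF P \<sigma>(1) smooth_Fc[OF c] \<sigma>(2)]
              \<tau>X \<sigma>(3) pW by simp
          have l1: "linear (frechet_derivative (\<lambda>X. Fc c (\<tau> X)) (at ?X))"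
            by (rule linear_frechet_derivative, rule smooth_on_differentiable[OF smooth_param_comp_vec[OF P s\<tau> smooth_Fc[OF c]]])
              (use X \<tau>X pW in simp)
          have l2: "linear (frechet_derivative (\<lambda>x. Fc c (\<sigma> x)) (at (\<Psi> c p)))"
            by (rule linear_frechet_derivative, rule smooth_on_differentiable[OF smooth_param_comp_vec[OF P \<sigma>(1) smooth_Fc[OF c]]])
              (use \<sigma>(2,3) pW in simp)
          have linT: "linear T"
          proof (rule linearI)
            show "T (y + z) = T y + T z" for y z
              unfolding T_eq using linear_add[OF l1] linear_add[OF l2, of "(fst y, snd (snd y))" "(fst z, snd (snd z))"]
              by simp
            show "T (r *\<^sub>R z) = r *\<^sub>R T z" for r z
              unfolding T_eq using linear_cmul[OF l1] linear_cmul[OF l2, of r "(fst z, snd (snd z))"]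
              by (simp add: scaleR_add_right)
          qed
          have inverse_F: "push P (Sc c) (Fc c p) (vec_deriv P (Fc c) p v) = v" if "v \<in> tangent_space P p" for v
            by (rule coordinates_push[OF P smooth_Fc[OF c] smooth_Sc[OF c] Fc_in Sc_Fc[OF c] pW that])
          \<comment> \<open>The derivative of \<open>\<Psi> c\<close> detects the section part and
            that of \<open>\<kappa>\<close> the fibre part. So \<open>T\<close> is injective, hence
            onto.\<close>
          have "z = 0" if z: "T z = 0" for z
          proof -
            have "vec_deriv P (Fc c) p (w z) = vec_deriv P (Fc c) p (\<lambda>c. 0)"
              using z vec_deriv_zero_vec[OF P smooth_Fc[OF c] pW] by (simp add: T_def)
            then have w0: "w z = (\<lambda>c. 0)" using inverse_F[OF tw] inverse_F[OF zero_tangent[OF P pP]] by metis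
            then have y: "fst z = 0" "snd (snd z) = 0"
              using \<Psi>w[of z] vec_deriv_zero_vec[OF P smooth_\<Psi>_Wc[OF c] pW] by (auto simp: prod_eq_iff)
            have "vec_deriv P \<kappa> p (push P \<sigma> (\<Psi> c p) (0, 0)) = 0"
            proof -
              have "push P \<sigma> (\<Psi> c p) (0, 0) = (\<lambda>c. 0)"
                using push_lincomb[OF P \<sigma>(1,2), of 0 0 0 0] by (simp add: zero_prod_def)
              then show ?thesis using vec_deriv_zero_vec[OF P s\<kappa> pW] by simp
            qed
            then have "vec_deriv P \<kappa> p (w z) = fst (snd z)"
              unfolding w_def smooth_vec_on_lincomb[OF P s\<kappa> pW t\<tau> t\<sigma>] using \<kappa>\<tau>' y by simp
            then have "fst (snd z) = 0" using w0 vec_deriv_zero_vec[OF P s\<kappa> pW] by simp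
            then show "z = 0" using y by (simp add: prod_eq_iff)
          qed
          then have "inj T" using linear_injective_0[OF linT] by blast
          then have "surj T" using linear_injective_imp_surjective[OF linT] by blast
          then obtain z where "T z = vec_deriv P (Fc c) p u" by (metis surjD)
          then have uw: "u = w z" using inverse_F[OF tw] inverse_F[OF u(1)] unfolding T_def by metis
          \<comment> \<open>A vector killed by the derivative of \<open>\<Psi> c\<close> has no
            section part.\<close>
          then have "(fst z, snd (snd z)) = 0" using u(2) \<Psi>w by simp
          moreover have "push P \<sigma> (\<Psi> c p) 0 = (\<lambda>c. 0)" using push_lincomb[OF P \<sigma>(1,2), of 0 0 0 0] by simp
          ultimately have "u = push P \<tau> ?X (fst (snd z))" unfolding uw w_def by simp
          then have "u = tangent_map ?N P (\<lambda>p. p) p (push ?N (chart_inv ?ch) ?X (fst (snd z)))" using tm by simp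
          moreover have "push ?N (chart_inv ?ch) ?X (fst (snd z)) \<in> tangent_space ?N p"
            using push_tangent[OF sN pN X] ci[OF X] \<tau>X by simp
          ultimately show "u \<in> tangent_map ?N P (\<lambda>p. p) p ` tangent_space ?N p" by (rule image_eqI)
        qed
      qed
    qed
  qed
  moreover have "?L \<noteq> {}" using p0 by (auto simp: Lf_def)
  ultimately have "integral_manifold P ?D ?N"
    unfolding integral_manifold_def using sN con inc by simp
  then show ?thesis by (intro exI[of _ ?N]) simp
qed

text \<open>A connected integral manifold through p lies in the fibre, so the fibre is maximal; and
  any leaf through p, contained in the fibre, equals it by its own maximality.\<close>

lemma leaf_fibre:
  assumes c: "c \<in> charts M" and p: "p \<in> WE c s" and k: "a \<noteq> k"
  shows "leaf TYPE(real^'n^'n) P (dist_D P A a) (Lf c s p)"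
    and "leaf TYPE(real^'n^'n) P (dist_D P A a) L \<Longrightarrow> p \<in> L \<Longrightarrow> L = Lf c s p"
proof -
  obtain N :: "('p, real^'n^'n) mfd" where N: "integral_manifold P (dist_D P A a) N" "pts N = Lf c s p"
    using fibre_integral_manifold[OF assms] by blast
  have pL: "p \<in> Lf c s p" using p by (simp add: Lf_def)
  show "leaf TYPE(real^'n^'n) P (dist_D P A a) (Lf c s p)"
    unfolding leaf_def
  proof (intro conjI allI impI)
    show "\<exists>N :: ('p, real^'n^'n) mfd. integral_manifold P (dist_D P A a) N \<and> pts N = Lf c s p" using N by blast
    fix N' :: "('p, real^'n^'n) mfd"
    assume "integral_manifold P (dist_D P A a) N' \<and> Lf c s p \<subseteq> pts N'"
    then show "pts N' = Lf c s p" using integral_manifold_subset_fibre[OF c _ _ p] pL by blast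
  qed
  assume L: "leaf TYPE(real^'n^'n) P (dist_D P A a) L" "p \<in> L"
  then obtain N' :: "('p, real^'n^'n) mfd" where N': "integral_manifold P (dist_D P A a) N'" "pts N' = L"
    unfolding leaf_def by blast
  then have "L \<subseteq> Lf c s p" using integral_manifold_subset_fibre[OF c N'(1) _ p] L(2) by blast
  then show "L = Lf c s p" using L(1) N unfolding leaf_def by metis
qed

lemma leaf_rel_fibre:
  assumes c: "c \<in> charts M" and p: "p \<in> WE c s" and k: "a \<noteq> k"
  shows "leaf_rel P A a `` {p} = {p' \<in> WE c s. \<Psi> c p' = \<Psi> c p}"
proof -
  have "p \<in> Lf c s p" using p by (simp add: Lf_def)
  then have "leaf_rel P A a `` {p} = Lf c s p"
    using leaf_fibre[OF assms] unfolding leaf_rel_def by blast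
  then show ?thesis by (simp add: Lf_def)
qed

end

section \<open>Metrics on the leaf space\<close>

lemma tangent_sum:
  fixes v :: "'i \<Rightarrow> ('p, 'e::euclidean_space) tvec"
  assumes M: "smooth_manifold M" "p \<in> pts M" and I: "finite I"
    and v: "\<And>i. i \<in> I \<Longrightarrow> v i \<in> tangent_space M p"
  shows "(\<lambda>c. \<Sum>i\<in>I. r i *\<^sub>R v i c) \<in> tangent_space M p"
  using I v
proof (induction I rule: finite_induct)
  case empty
  then show ?case using zero_tangent[OF M] by simp
next
  case (insert i I)
  then show ?case using tangent_space_lincomb[OF M, of "v i" "\<lambda>c. \<Sum>i\<in>I. r i *\<^sub>R v i c" "r i" 1] by simp
qed

text \<open>L is assumed linear on the tangent space only, which is a proper subset of its type, so
  the library results on \<open>linear\<close> maps do not apply.\<close>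

lemma linear_tangent_sum:
  fixes v :: "'i \<Rightarrow> ('p, 'e::euclidean_space) tvec" and L :: "('p, 'e) tvec \<Rightarrow> 'v::real_vector"
  assumes M: "smooth_manifold M" "p \<in> pts M" and I: "finite I"
    and v: "\<And>i. i \<in> I \<Longrightarrow> v i \<in> tangent_space M p"
    and L: "\<And>u w r s. u \<in> tangent_space M p \<Longrightarrow> w \<in> tangent_space M p \<Longrightarrow>
      L (\<lambda>c. r *\<^sub>R u c + s *\<^sub>R w c) = r *\<^sub>R L u + s *\<^sub>R L w"
  shows "L (\<lambda>c. \<Sum>i\<in>I. r i *\<^sub>R v i c) = (\<Sum>i\<in>I. r i *\<^sub>R L (v i))"
  using I v
proof (induction I rule: finite_induct)
  case empty
  then show ?case using L[OF zero_tangent[OF M] zero_tangent[OF M], of 0 0] by simp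
next
  case (insert i I)
  then show ?case
    using L[of "v i" "\<lambda>c. \<Sum>i\<in>I. r i *\<^sub>R v i c" "r i" 1] tangent_sum[OF M, of I v r] by simp
qed

context quotient_charts
begin

abbreviation "dq p v \<equiv> tangent_map P Q q p v"

lemma dq_\<Psi>:
  assumes F: "(W, \<Psi>) \<in> \<F>" and p: "p \<in> W"
  shows "dq p v (qchart (W, \<Psi>)) = vec_deriv P \<Psi> p v"
proof -
  have "qchart (W, \<Psi>) \<in> charts_at Q (q p)" using F p Q0_Q by (auto simp: charts_at_def)
  then have "dq p v (qchart (W, \<Psi>)) = vec_deriv P (\<lambda>p. snd (qchart (W, \<Psi>)) (q p)) p v"
    by (simp add: tangent_map_eq)
  also have "\<dots> = vec_deriv P \<Psi> p v"
    by (rule vec_deriv_cong[OF P smooth_vec_onD(1)[OF vec[OF F]] p]) (rule snd_qchart[OF F])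
  finally show ?thesis .
qed

lemma dq_eq_0_iff:
  assumes F: "(W, \<Psi>) \<in> \<F>" and p: "p \<in> W" and v: "v \<in> tangent_space P p"
  shows "dq p v = (\<lambda>c. 0) \<longleftrightarrow> vec_deriv P \<Psi> p v = 0"
proof
  have pP: "p \<in> pts P" using W_subset[OF F] p by blast
  have qc: "qchart (W, \<Psi>) \<in> charts_at Q (q p)" using F p Q0_Q by (auto simp: charts_at_def)
  assume "vec_deriv P \<Psi> p v = 0"
  then have 0: "dq p v (qchart (W, \<Psi>)) = 0" using dq_\<Psi>[OF F p] by simp
  have "q p \<in> pts Q" using q_in[OF pP] by simp
  then show "dq p v = (\<lambda>c. 0)"
    by (intro tangent_space_eqI[OF Q_manifold(1) qc tangent_map_tangent[OF P Q_manifold(1) smooth_map_Q pP v]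
          zero_tangent[OF Q_manifold(1)]]) (use 0 in simp_all)
qed (use dq_\<Psi>[OF F p, of v] in simp)

lemma dq_surj:
  assumes "p \<in> pts P" "u \<in> tangent_space Q (q p)"
  obtains v where "v \<in> tangent_space P p" "u = dq p v"
  using submersion_Q assms unfolding submersion_def by blast

text \<open>The value on the quotient is computed at arbitrary lifts and is independent of them by
  \<open>wd\<close>. Nondegeneracy upstairs is needed modulo the kernel of dq only, and smoothness
  is tested along the sections of \<open>sections_Q\<close>.\<close>

lemma descend_metric:
  fixes h :: "('p, 'f) bilin"
  assumes bil: "\<And>p u v w r s. p \<in> pts P \<Longrightarrow> u \<in> tangent_space P p \<Longrightarrow> v \<in> tangent_space P p \<Longrightarrow>
      w \<in> tangent_space P p \<Longrightarrow> h p (\<lambda>c. r *\<^sub>R u c + s *\<^sub>R v c) w = r * h p u w + s * h p v w"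
    and sym: "\<And>p v w. p \<in> pts P \<Longrightarrow> v \<in> tangent_space P p \<Longrightarrow> w \<in> tangent_space P p \<Longrightarrow> h p v w = h p w v"
    and nondeg: "\<And>p v. p \<in> pts P \<Longrightarrow> v \<in> tangent_space P p \<Longrightarrow>
      (\<And>w. w \<in> tangent_space P p \<Longrightarrow> h p v w = 0) \<Longrightarrow> dq p v = (\<lambda>c. 0)"
    and smooth: "\<And>S \<sigma> e e'. smooth_param (S :: 'e set) P \<sigma> \<Longrightarrow>
      smooth_on S (\<lambda>x. h (\<sigma> x) (push P \<sigma> x e) (push P \<sigma> x e'))"
    and wd: "\<And>p v w p' v' w'. p \<in> pts P \<Longrightarrow> v \<in> tangent_space P p \<Longrightarrow> w \<in> tangent_space P p \<Longrightarrow>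
      p' \<in> pts P \<Longrightarrow> v' \<in> tangent_space P p' \<Longrightarrow> w' \<in> tangent_space P p' \<Longrightarrow>
      q p = q p' \<Longrightarrow> dq p v = dq p' v' \<Longrightarrow> dq p w = dq p' w' \<Longrightarrow> h p v w = h p' v' w'"
  obtains g where "metric Q g"
    "\<And>p v w. p \<in> pts P \<Longrightarrow> v \<in> tangent_space P p \<Longrightarrow> w \<in> tangent_space P p \<Longrightarrow>
      g (q p) (dq p v) (dq p w) = h p v w"
proof -
  define g where "g y u u' = (SOME z. \<exists>p v w. p \<in> pts P \<and> v \<in> tangent_space P p \<and> w \<in> tangent_space P p \<and>
      y = q p \<and> u = dq p v \<and> u' = dq p w \<and> z = h p v w)" for y u u'
  have g: "g (q p) (dq p v) (dq p w) = h p v w"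
    if "p \<in> pts P" "v \<in> tangent_space P p" "w \<in> tangent_space P p" for p v w
  proof -
    have "\<exists>p' v' w'. p' \<in> pts P \<and> v' \<in> tangent_space P p' \<and> w' \<in> tangent_space P p' \<and>
      q p = q p' \<and> dq p v = dq p' v' \<and> dq p w = dq p' w' \<and> g (q p) (dq p v) (dq p w) = h p' v' w'"
      unfolding g_def by (rule someI_ex) (use that in blast)
    then obtain p' v' w' where *: "p' \<in> pts P" "v' \<in> tangent_space P p'" "w' \<in> tangent_space P p'"
      "q p = q p'" "dq p v = dq p' v'" "dq p w = dq p' w'" "g (q p) (dq p v) (dq p w) = h p' v' w'"
      by (elim exE conjE)
    show ?thesis unfolding *(7) by (rule wd[OF that *(1-6), symmetric])
  qed
  have lift: thesis if "y \<in> pts Q" "\<And>p. p \<in> pts P \<Longrightarrow> y = q p \<Longrightarrow> thesis" for y thesis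
    using that by (auto simp: quotient_def)
  have "metric Q g"
    unfolding metric_def
  proof (intro conjI ballI allI impI)
    fix y u v w r s
    assume y: "y \<in> pts Q" and t: "u \<in> tangent_space Q y" "v \<in> tangent_space Q y" "w \<in> tangent_space Q y"
    obtain p where p: "p \<in> pts P" "y = q p" using lift[OF y] .
    obtain u' where u': "u' \<in> tangent_space P p" "u = dq p u'" using dq_surj[OF p(1)] t p(2) by metis
    obtain v' where v': "v' \<in> tangent_space P p" "v = dq p v'" using dq_surj[OF p(1)] t p(2) by metis
    obtain w' where w': "w' \<in> tangent_space P p" "w = dq p w'" using dq_surj[OF p(1)] t p(2) by metis
    have "(\<lambda>c. r *\<^sub>R u c + s *\<^sub>R v c) = dq p (\<lambda>c. r *\<^sub>R u' c + s *\<^sub>R v' c)"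
      unfolding u'(2) v'(2) by (rule tangent_map_lincomb[OF P Q_manifold(1) smooth_map_Q p(1) u'(1) v'(1), symmetric])
    then show "g y (\<lambda>c. r *\<^sub>R u c + s *\<^sub>R v c) w = r * g y u w + s * g y v w"
      using g[OF p(1) tangent_space_lincomb[OF P p(1) u'(1) v'(1)] w'(1)] bil[OF p(1) u'(1) v'(1) w'(1)]
        g[OF p(1) u'(1) w'(1)] g[OF p(1) v'(1) w'(1)] unfolding u'(2) v'(2) w'(2) p(2) by simp
  next
    fix y v w assume y: "y \<in> pts Q" and t: "v \<in> tangent_space Q y" "w \<in> tangent_space Q y"
    obtain p where p: "p \<in> pts P" "y = q p" using lift[OF y] .
    obtain v' where v': "v' \<in> tangent_space P p" "v = dq p v'" using dq_surj[OF p(1)] t p(2) by metis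
    obtain w' where w': "w' \<in> tangent_space P p" "w = dq p w'" using dq_surj[OF p(1)] t p(2) by metis
    show "g y v w = g y w v" unfolding v'(2) w'(2) p(2) g[OF p(1) v'(1) w'(1)] g[OF p(1) w'(1) v'(1)]
      by (rule sym[OF p(1) v'(1) w'(1)])
  next
    fix y v assume y: "y \<in> pts Q" and t: "v \<in> tangent_space Q y" and 0: "\<forall>w\<in>tangent_space Q y. g y v w = 0"
    obtain p where p: "p \<in> pts P" "y = q p" using lift[OF y] .
    obtain v' where v': "v' \<in> tangent_space P p" "v = dq p v'" using dq_surj[OF p(1)] t p(2) by metis
    have "h p v' w' = 0" if w': "w' \<in> tangent_space P p" for w'
    proof -
      have "dq p w' \<in> tangent_space Q y"
        unfolding p(2) by (rule tangent_map_tangent[OF P Q_manifold(1) smooth_map_Q p(1) w'])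
      then show ?thesis using 0 g[OF p(1) v'(1) w'] unfolding v'(2) p(2) by auto
    qed
    then show "v = (\<lambda>c. 0)" unfolding v'(2) by (rule nondeg[OF p(1) v'(1)])
  next
    fix c e e' assume c: "c \<in> charts Q"
    show "smooth_on (snd c ` fst c) (\<lambda>x. g (chart_inv c x) (chart_vec Q c (chart_inv c x) e) (chart_vec Q c (chart_inv c x) e'))"
    proof (rule smooth_on_local)
      fix x assume x: "x \<in> snd c ` fst c"
      obtain S \<sigma> where \<sigma>: "smooth_param S P \<sigma>" "x \<in> S" "S \<subseteq> snd c ` fst c" "\<And>y. y \<in> S \<Longrightarrow> q (\<sigma> y) = chart_inv c y"
        using sections_Q[OF c x] by blast
      have oS: "open S" using smooth_paramD(1)[OF \<sigma>(1)] .
      have cv: "chart_vec Q c (chart_inv c y) d = dq (\<sigma> y) (push P \<sigma> y d)" if y: "y \<in> S" for y d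
      proof -
        have "chart_vec Q c (chart_inv c y) d = push Q (chart_inv c) y d"
          by (rule chart_vec_push) (use y \<sigma>(3) in blast)
        also have "\<dots> = push Q (\<lambda>x. q (\<sigma> x)) y d" by (rule push_cong[OF oS y]) (simp add: \<sigma>(4))
        also have "\<dots> = dq (\<sigma> y) (push P \<sigma> y d)"
          by (rule tangent_map_push[OF P Q_manifold(1) smooth_map_Q \<sigma>(1) y smooth_paramD(2)[OF \<sigma>(1) y], symmetric])
        finally show ?thesis .
      qed
      have "smooth_on S (\<lambda>x. g (chart_inv c x) (chart_vec Q c (chart_inv c x) e) (chart_vec Q c (chart_inv c x) e'))"
      proof (rule smooth_on_cong[OF oS, THEN iffD1, OF _ smooth[OF \<sigma>(1), of e e']])
        fix y assume y: "y \<in> S"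
        note t = push_tangent[OF P \<sigma>(1) y]
        show "h (\<sigma> y) (push P \<sigma> y e) (push P \<sigma> y e') =
            g (chart_inv c y) (chart_vec Q c (chart_inv c y) e) (chart_vec Q c (chart_inv c y) e')"
          unfolding cv[OF y] unfolding \<sigma>(4)[OF y, symmetric]
          by (rule g[OF smooth_paramD(2)[OF \<sigma>(1) y] t t, symmetric])
      qed
      then show "\<exists>T. open T \<and> x \<in> T \<and> smooth_on T (\<lambda>x. g (chart_inv c x) (chart_vec Q c (chart_inv c x) e) (chart_vec Q c (chart_inv c x) e'))"
        using oS \<sigma>(2) by blast
    qed
  qed
  then show thesis using g that by blast
qed

end

section \<open>Proportional metrics and conformal classes\<close>

lemma metricD:
  assumes "metric M g"
  shows "p \<in> pts M \<Longrightarrow> u \<in> tangent_space M p \<Longrightarrow> v \<in> tangent_space M p \<Longrightarrow> w \<in> tangent_space M p \<Longrightarrow>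
      g p (\<lambda>c. r *\<^sub>R u c + s *\<^sub>R v c) w = r * g p u w + s * g p v w"
    "p \<in> pts M \<Longrightarrow> v \<in> tangent_space M p \<Longrightarrow> w \<in> tangent_space M p \<Longrightarrow> g p v w = g p w v"
    "p \<in> pts M \<Longrightarrow> v \<in> tangent_space M p \<Longrightarrow> (\<And>w. w \<in> tangent_space M p \<Longrightarrow> g p v w = 0) \<Longrightarrow> v = (\<lambda>c. 0)"
    "c \<in> charts M \<Longrightarrow> smooth_on (snd c ` fst c)
        (\<lambda>x. g (chart_inv c x) (chart_vec M c (chart_inv c x) e) (chart_vec M c (chart_inv c x) e'))"
  using assms unfolding metric_def by auto

text \<open>The factor is a quotient of components of the two metrics in a chart. Nondegeneracy
  provides components for which the denominator does not vanish near the given point.\<close>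

lemma proportional_metrics:
  fixes M :: "('q, 'e::euclidean_space) mfd"
  assumes M: "smooth_manifold M" and g: "metric M g" "metric M g'"
    and proportional: "\<And>p. p \<in> pts M \<Longrightarrow> \<exists>k>0. \<forall>v\<in>tangent_space M p. \<forall>w\<in>tangent_space M p. g' p v w = k * g p v w"
  obtains \<phi> where "smooth_fun_on M (pts M) \<phi>" "\<And>p. p \<in> pts M \<Longrightarrow> \<phi> p > 0"
    "\<And>p v w. p \<in> pts M \<Longrightarrow> v \<in> tangent_space M p \<Longrightarrow> w \<in> tangent_space M p \<Longrightarrow> g' p v w = \<phi> p * g p v w"
proof -
  define \<phi> where "\<phi> p = (SOME k. k > 0 \<and> (\<forall>v\<in>tangent_space M p. \<forall>w\<in>tangent_space M p. g' p v w = k * g p v w))" for p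
  have \<phi>: "\<phi> p > 0" "\<And>v w. v \<in> tangent_space M p \<Longrightarrow> w \<in> tangent_space M p \<Longrightarrow> g' p v w = \<phi> p * g p v w"
    if "p \<in> pts M" for p
  proof -
    have "\<exists>k. k > 0 \<and> (\<forall>v\<in>tangent_space M p. \<forall>w\<in>tangent_space M p. g' p v w = k * g p v w)" using proportional[OF that] by blast
    from someI_ex[OF this, folded \<phi>_def]
    show "\<phi> p > 0" "\<And>v w. v \<in> tangent_space M p \<Longrightarrow> w \<in> tangent_space M p \<Longrightarrow> g' p v w = \<phi> p * g p v w" by blast+
  qed
  have "smooth_on (snd c ` (fst c \<inter> pts M)) (\<phi> \<circ> chart_inv c)" if c: "c \<in> charts M" for c
  proof (rule smooth_on_local)
    fix x assume x': "x \<in> snd c ` (fst c \<inter> pts M)"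
    then have x: "x \<in> snd c ` fst c" by blast
    have ic: "is_chart (mtop M) c" using smooth_manifold_chart[OF M c] .
    note pc = smooth_param_chart[OF M c]
    have oc: "open (snd c ` fst c)" using smooth_paramD(1)[OF pc] .
    let ?p = "chart_inv c x"
    have p: "?p \<in> pts M" "c \<in> charts_at M ?p" "snd c ?p = x"
      using smooth_paramD(2)[OF pc x] c chart_inv_in[OF x] chart_inv_right[OF x] by (auto simp: charts_at_def)
    have vec: "v = chart_vec M c ?p (v c)" if "v \<in> tangent_space M ?p" for v
      using push_chart[OF M p(2) that] chart_vec_push[OF x] p(3) by metis
    have cvt: "chart_vec M c (chart_inv c y) e \<in> tangent_space M (chart_inv c y)" if "y \<in> snd c ` fst c" for y e
      unfolding chart_vec_push[OF that] by (rule push_tangent[OF M pc that])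
    \<comment> \<open>A nonzero tangent vector at the point, to which nondegeneracy is
      applied.\<close>
    obtain b :: 'e where b: "b \<in> Basis" using nonempty_Basis by blast
    have "chart_vec M c ?p b c = b"
    proof -
      have "frechet_derivative (\<lambda>x. snd c (chart_inv c x)) (at x) = frechet_derivative (\<lambda>x. x) (at x)"
        by (rule frechet_derivative_cong_open[OF oc x]) (rule chart_inv_right)
      then show ?thesis using p(2) unfolding chart_vec_push[OF x] push_def by simp
    qed
    then have "chart_vec M c ?p b \<noteq> (\<lambda>c. 0)" using nonzero_Basis[OF b] by metis
    then obtain w where w: "w \<in> tangent_space M ?p" "g ?p (chart_vec M c ?p b) w \<noteq> 0"
      using metricD(3)[OF g(1) p(1) cvt[OF x]] by blast
    let ?a = "\<lambda>y. g (chart_inv c y) (chart_vec M c (chart_inv c y) b) (chart_vec M c (chart_inv c y) (w c))"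
    let ?b = "\<lambda>y. g' (chart_inv c y) (chart_vec M c (chart_inv c y) b) (chart_vec M c (chart_inv c y) (w c))"
    have sa: "smooth_on (snd c ` fst c) ?a" and sb: "smooth_on (snd c ` fst c) ?b"
      by (rule metricD(4)[OF g(1) c], rule metricD(4)[OF g(2) c])
    let ?T = "snd c ` fst c \<inter> ?a -` (- {0})"
    have oT: "open ?T" by (rule continuous_open_preimage[OF smooth_onD_continuous[OF sa] oc]) auto
    have xT: "x \<in> ?T" using x w vec[OF w(1)] by auto
    have "smooth_on ?T (\<lambda>y. ?b y / ?a y)"
      by (rule smooth_on_divide[OF oT smooth_on_subset[OF sb] smooth_on_subset[OF sa]]) auto
    then have "smooth_on ?T (\<phi> \<circ> chart_inv c)"
    proof (rule smooth_on_cong[OF oT, THEN iffD1, rotated])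
      fix y assume y: "y \<in> ?T"
      then have "chart_inv c y \<in> pts M" using smooth_paramD(2)[OF pc] by blast
      from \<phi>(2)[OF this cvt cvt, of b "w c"] y
      show "?b y / ?a y = (\<phi> \<circ> chart_inv c) y" by auto
    qed
    then show "\<exists>T. open T \<and> x \<in> T \<and> smooth_on T (\<phi> \<circ> chart_inv c)" using oT xT by blast
  qed
  then have "smooth_fun_on M (pts M) \<phi>" unfolding smooth_fun_on_def by simp
  then show thesis using that \<phi> by blast
qed

definition metric_class :: "('q, 'e::euclidean_space) mfd \<Rightarrow> ('q, 'e) bilin \<Rightarrow> ('q, 'e) bilin set" where
  "metric_class M g = {g'. metric M g' \<and>
     (\<exists>f. smooth_fun_on M (pts M) f \<and> (\<forall>p\<in>pts M. f p > 0) \<and>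
        (\<forall>p\<in>pts M. \<forall>v\<in>tangent_space M p. \<forall>w\<in>tangent_space M p. g' p v w = f p * g p v w))}"

lemma conformal_class_iff: "conformal_class M C \<longleftrightarrow> (\<exists>g. metric M g \<and> C = metric_class M g)"
  unfolding conformal_class_def metric_class_def ..

lemma metric_class_self:
  assumes "metric M g" shows "g \<in> metric_class M g"
  unfolding metric_class_def
proof (intro CollectI conjI exI[of _ "\<lambda>p. 1"] assms)
  show "smooth_fun_on M (pts M) (\<lambda>p. 1)" unfolding smooth_fun_on_iff by (rule smooth_vec_on_const) simp
qed simp_all

lemma metric_class_trans:
  assumes M: "smooth_manifold M" and "g' \<in> metric_class M g" "g'' \<in> metric_class M g'"
  shows "g'' \<in> metric_class M g"
proof -
  obtain f where f: "smooth_fun_on M (pts M) f" "\<forall>p\<in>pts M. f p > 0"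
    "\<forall>p\<in>pts M. \<forall>v\<in>tangent_space M p. \<forall>w\<in>tangent_space M p. g' p v w = f p * g p v w"
    using assms(2) unfolding metric_class_def by blast
  obtain f' where f': "smooth_fun_on M (pts M) f'" "\<forall>p\<in>pts M. f' p > 0"
    "\<forall>p\<in>pts M. \<forall>v\<in>tangent_space M p. \<forall>w\<in>tangent_space M p. g'' p v w = f' p * g' p v w"
    using assms(3) unfolding metric_class_def by blast
  have "metric M g''" using assms(3) unfolding metric_class_def by blast
  then show ?thesis unfolding metric_class_def
  proof (intro CollectI conjI exI[of _ "\<lambda>p. f' p * f p"])
    show "smooth_fun_on M (pts M) (\<lambda>p. f' p * f p)"
      using f(1) f'(1) smooth_vec_on_mult[OF M] unfolding smooth_fun_on_iff by blast
  qed (use f f' in simp_all)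
qed

section \<open>The Cartan bundle\<close>

text \<open>The index k distinct from a is an auxiliary choice, available since n is at least 2; the
  leaf relation and the bilinear form depend on a alone.\<close>

locale cartan =
  fixes M :: "('m, real^'n) mfd"
    and P :: "('p, (real^'n) \<times> (real^'n^'n) \<times> (real^'n)) mfd"
    and \<pi> :: "'p \<Rightarrow> 'm" and act :: "'p \<Rightarrow> 'n::finite bmat \<Rightarrow> 'p"
    and A :: "'p \<Rightarrow> ('p, (real^'n) \<times> (real^'n^'n) \<times> (real^'n)) tvec \<Rightarrow> 'n bmat"
    and a k :: 'n
  assumes M: "smooth_manifold M" and P: "smooth_manifold P"
    and \<pi>: "smooth_map_on P M (pts P) \<pi>"
    and A_form: "one_form_on P (pts P) A"
    and A_bij: "\<And>p. p \<in> pts P \<Longrightarrow> bij_betw (A p) (tangent_space P p) sl"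
    and gauges: "\<And>x. x \<in> pts M \<Longrightarrow> \<exists>U b \<theta> X G. x \<in> U \<and> gauge M P \<pi> act A U b \<theta> X G"
    and ak: "a \<noteq> k"
begin

definition \<F> :: "('p set \<times> ('p \<Rightarrow> (real^'n) \<times> (real^'n))) set" where
  "\<F> = {(W, F). \<exists>U b \<theta> X G c s. gauge M P \<pi> act A U b \<theta> X G \<and> c \<in> charts M \<and>
     W = fol_dom P \<pi> U b c s \<and> F = fol_map a \<pi> b c}"

lemma \<F>I: "gauge M P \<pi> act A U b \<theta> X G \<Longrightarrow> c \<in> charts M \<Longrightarrow> (fol_dom P \<pi> U b c s, fol_map a \<pi> b c) \<in> \<F>"
  unfolding \<F>_def by blast

lemma \<F>E:
  assumes "(W, F) \<in> \<F>"
  obtains U b \<theta> X G c s where "gauge M P \<pi> act A U b \<theta> X G" "c \<in> charts M"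
    "W = fol_dom P \<pi> U b c s" "F = fol_map a \<pi> b c"
  using assms unfolding \<F>_def by blast

abbreviation "R \<equiv> leaf_rel P A a"

lemma in_fol_dom:
  assumes g: "gauge M P \<pi> act A U b \<theta> X G" and p: "p \<in> pts P" "\<pi> p \<in> U" "\<pi> p \<in> fst c"
  shows "p \<in> fol_dom P \<pi> U b c (sgn (det (top_block (b p))))"
proof -
  interpret g: gauge M P \<pi> act A a U b \<theta> X G by (rule g)
  have "det (top_block (b p)) \<noteq> 0" using g.b_eq(1)[of p] p by (simp add: g.PU_def g.Bp_def top_block_def)
  then have "sgn (det (top_block (b p))) * det (top_block (b p)) > 0"
    by (auto simp: sgn_if)
  then show ?thesis using p by (simp add: fol_dom_def)
qed

lemma exists_fol_dom:
  assumes p: "p \<in> pts P"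
  obtains U b \<theta> X G c s where "gauge M P \<pi> act A U b \<theta> X G" "c \<in> charts M" "p \<in> fol_dom P \<pi> U b c s"
proof -
  have x: "\<pi> p \<in> pts M" using smooth_map_onD(2)[OF \<pi> p] .
  obtain U b \<theta> X G where g: "\<pi> p \<in> U" "gauge M P \<pi> act A U b \<theta> X G"
    using gauges[OF x] by (elim exE conjE)
  obtain c where c: "c \<in> charts_at M (\<pi> p)" using smooth_manifold_charts_at[OF M x] .
  show thesis using that[OF g(2) charts_atD(1)[OF c] in_fol_dom[OF g(2) p g(1) charts_atD(2)[OF c]]] .
qed

lemma fibre_R:
  assumes g: "gauge M P \<pi> act A U b \<theta> X G" and c: "c \<in> charts M" and p: "p \<in> fol_dom P \<pi> U b c s"
  shows "R `` {p} = {p' \<in> fol_dom P \<pi> U b c s. fol_map a \<pi> b c p' = fol_map a \<pi> b c p}"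
    and "p' \<in> R `` {p} \<Longrightarrow> \<pi> p' = \<pi> p"
proof -
  interpret g: gauge M P \<pi> act A a U b \<theta> X G by (rule g)
  show *: "R `` {p} = {p' \<in> fol_dom P \<pi> U b c s. fol_map a \<pi> b c p' = fol_map a \<pi> b c p}"
    by (rule g.leaf_rel_fibre[OF c p ak])
  show "p' \<in> R `` {p} \<Longrightarrow> \<pi> p' = \<pi> p"
    unfolding * using g.Lf_\<pi>(1)[OF c p, of p'] unfolding g.Lf_def .
qed

lemma R_sub: "R \<subseteq> pts P \<times> pts P"
proof -
  have "L \<subseteq> pts P" if L: "leaf TYPE(real^'n^'n) P (dist_D P A a) L" for L
  proof -
    obtain N :: "('p, real^'n^'n) mfd" where "integral_manifold P (dist_D P A a) N" "pts N = L"
      using L unfolding leaf_def by blast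
    then show ?thesis unfolding integral_manifold_def using smooth_map_onD(2)[of N P "pts N" "\<lambda>p. p"] by blast
  qed
  then show ?thesis unfolding leaf_rel_def by blast
qed

text \<open>Being on a common leaf is transitive because all leaves through a point are one and the
  same fibre.\<close>

lemma equiv_R: "equiv (pts P) R"
proof (rule equivI)
  show "R \<subseteq> pts P \<times> pts P" by (rule R_sub)
  show "refl_on (pts P) R"
    unfolding refl_on_def
  proof
    fix p assume "p \<in> pts P"
    then obtain U b \<theta> X G c s where g: "gauge M P \<pi> act A U b \<theta> X G" "c \<in> charts M" "p \<in> fol_dom P \<pi> U b c s"
      by (rule exists_fol_dom)
    then show "(p, p) \<in> R" using fibre_R(1)[OF g] by blast
  qed
  show s: "sym R" unfolding leaf_rel_def sym_def by blast
  show "trans R"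
  proof (rule transI)
    fix p q r assume pq: "(p, q) \<in> R" and qr: "(q, r) \<in> R"
    then have "q \<in> pts P" using R_sub by blast
    then obtain U b \<theta> X G c s where g: "gauge M P \<pi> act A U b \<theta> X G" "c \<in> charts M" "q \<in> fol_dom P \<pi> U b c s"
      by (rule exists_fol_dom)
    have "(q, p) \<in> R" using s pq by (rule symD)
    then have p: "p \<in> fol_dom P \<pi> U b c s" "fol_map a \<pi> b c p = fol_map a \<pi> b c q"
      using fibre_R(1)[OF g] by blast+
    have "r \<in> fol_dom P \<pi> U b c s" "fol_map a \<pi> b c r = fol_map a \<pi> b c q"
      using fibre_R(1)[OF g] qr by blast+
    then show "(p, r) \<in> R" using fibre_R(1)[OF g(1,2) p(1)] p(2) by auto
  qed
qed

lemma R_\<pi>: "(p, p') \<in> R \<Longrightarrow> \<pi> p' = \<pi> p"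
proof -
  assume pp': "(p, p') \<in> R"
  then have "p \<in> pts P" using R_sub by blast
  then obtain U b \<theta> X G c s where g: "gauge M P \<pi> act A U b \<theta> X G" "c \<in> charts M" "p \<in> fol_dom P \<pi> U b c s"
    by (rule exists_fol_dom)
  show ?thesis using fibre_R(2)[OF g] pp' by blast
qed

sublocale quotient_charts P R \<F>
proof
  show "smooth_manifold P" "equiv (pts P) R" by (fact P equiv_R)+
  show "\<exists>W F. (W, F) \<in> \<F> \<and> p \<in> W" if "p \<in> pts P" for p
    using exists_fol_dom[OF that] \<F>I by metis
  fix W F assume WF: "(W, F) \<in> \<F>"
  then obtain U b \<theta> X G c s where g: "gauge M P \<pi> act A U b \<theta> X G" "c \<in> charts M"
    "W = fol_dom P \<pi> U b c s" "F = fol_map a \<pi> b c" by (rule \<F>E)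
  interpret g: gauge M P \<pi> act A a U b \<theta> X G by (rule g(1))
  show "smooth_vec_on P W F" unfolding g(3,4) by (rule g.smooth_\<Psi>[OF g(2)])
  show "R `` {p} = {p' \<in> W. F p' = F p}" if "p \<in> W" for p
    using fibre_R(1)[OF g(1,2)] that unfolding g(3,4) .
  show "\<exists>S \<sigma>. smooth_param S P \<sigma> \<and> F p \<in> S \<and> \<sigma> (F p) = p \<and> (\<forall>x\<in>S. \<sigma> x \<in> W \<and> F (\<sigma> x) = x)"
    if "p \<in> W" for p
    using g.section_exists[OF g(2) that[unfolded g(3)] ak] unfolding g(3,4) .
next
  fix p p' assume p: "p \<in> pts P" "p' \<in> pts P" "(p, p') \<notin> R"
  have x: "\<pi> p \<in> pts M" "\<pi> p' \<in> pts M" using smooth_map_onD(2)[OF \<pi>] p by auto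
  show "(\<exists>W F. (W, F) \<in> \<F> \<and> p \<in> W \<and> p' \<in> W) \<or>
      (\<exists>U V. openin (mtop P) U \<and> openin (mtop P) V \<and> p \<in> U \<and> p' \<in> V \<and> R `` U \<inter> R `` V = {})"
  \<comment> \<open>Points over different base points are separated in M. Over the same base point
    one gauge serves both: with equal signs of det B they share a domain, with opposite signs they
    lie in disjoint saturated open sheets.\<close>
  proof (cases "\<pi> p = \<pi> p'")
    case False
    have "Hausdorff_space (mtop M)" using M unfolding smooth_manifold_def by blast
    then obtain V V' where V: "openin (mtop M) V" "openin (mtop M) V'" "\<pi> p \<in> V" "\<pi> p' \<in> V'" "disjnt V V'"
      using x False unfolding Hausdorff_space_def by metis
    have "R `` {q \<in> pts P. \<pi> q \<in> V} \<inter> R `` {q \<in> pts P. \<pi> q \<in> V'} = {}"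
    proof -
      have False if "(r, t) \<in> R" "(r', t) \<in> R" "\<pi> r \<in> V" "\<pi> r' \<in> V'" for r r' t
        using R_\<pi>[OF that(1)] R_\<pi>[OF that(2)] that(3,4) V(5) by (auto simp: disjnt_def)
      then show ?thesis by blast
    qed
    then show ?thesis using smooth_map_onD(3)[OF \<pi> V(1)] smooth_map_onD(3)[OF \<pi> V(2)] V(3,4) p by blast
  next
    case True
    obtain U b \<theta> X G where g: "\<pi> p \<in> U" "gauge M P \<pi> act A U b \<theta> X G" using gauges[OF x(1)] by (elim exE conjE)
    obtain c where c: "c \<in> charts_at M (\<pi> p)" using smooth_manifold_charts_at[OF M x(1)] .
    note c' = charts_atD[OF c]
    interpret g: gauge M P \<pi> act A a U b \<theta> X G by (rule g(2))
    let ?s = "\<lambda>p. sgn (det (top_block (b p)))"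
    have d: "p \<in> fol_dom P \<pi> U b c (?s p)" "p' \<in> fol_dom P \<pi> U b c (?s p')"
      using in_fol_dom[OF g(2)] p g(1) c'(2) True by auto
    show ?thesis
    proof (cases "?s p = ?s p'")
      case True
      then show ?thesis using d \<F>I[OF g(2) c'(1)] by metis
    next
      case False
      have sub: "R `` fol_dom P \<pi> U b c s \<subseteq> fol_dom P \<pi> U b c s" for s
        using fibre_R(1)[OF g(2) c'(1)] by blast
      have "?s p = - ?s p'" using False d by (auto simp: sgn_if fol_dom_def split: if_splits)
      then have "fol_dom P \<pi> U b c (?s p) \<inter> fol_dom P \<pi> U b c (?s p') = {}" by (auto simp: fol_dom_def)
      then have "R `` fol_dom P \<pi> U b c (?s p) \<inter> R `` fol_dom P \<pi> U b c (?s p') = {}"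
        using sub[of "?s p"] sub[of "?s p'"] by blast
      then show ?thesis using d g.oWE[OF c'(1)] by blast
    qed
  qed
qed

section \<open>The bilinear form as a pairing of two R^n-valued forms\<close>

abbreviation "\<eta> p v \<equiv> \<chi> j. hat_eta A a j p v"
abbreviation "\<xi> p v \<equiv> \<chi> j. hat_theta A j p v"

lemma A_sl: "p \<in> pts P \<Longrightarrow> v \<in> tangent_space P p \<Longrightarrow> A p v \<in> sl"
  using A_bij bij_betw_apply by metis

lemma hat_g_inner: "hat_g A a p v w = \<eta> p v \<bullet> \<xi> p w + \<xi> p v \<bullet> \<eta> p w"
  by (simp add: hat_g_def inner_vec_def sum.distrib)

lemma A_lincomb:
  assumes "p \<in> pts P" "v \<in> tangent_space P p" "w \<in> tangent_space P p"
  shows "A p (\<lambda>c. r *\<^sub>R v c + s *\<^sub>R w c) = r *\<^sub>R A p v + s *\<^sub>R A p w"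
  using A_form assms unfolding one_form_on_def by blast

lemma
  assumes p: "p \<in> pts P" and v: "v \<in> tangent_space P p" and w: "w \<in> tangent_space P p"
  shows \<eta>_lincomb: "\<eta> p (\<lambda>c. r *\<^sub>R v c + s *\<^sub>R w c) = r *\<^sub>R \<eta> p v + s *\<^sub>R \<eta> p w"
    and \<xi>_lincomb: "\<xi> p (\<lambda>c. r *\<^sub>R v c + s *\<^sub>R w c) = r *\<^sub>R \<xi> p v + s *\<^sub>R \<xi> p w"
proof -
  have e: "hat_eta A a j p u = A p u $ Some a $ Some j + (if a = j then A p u $ None $ None else 0)"
    if "u \<in> tangent_space P p" for j u using hat_eta_eq[of A p u a j, OF A_sl[OF p that]] .
  show "\<eta> p (\<lambda>c. r *\<^sub>R v c + s *\<^sub>R w c) = r *\<^sub>R \<eta> p v + s *\<^sub>R \<eta> p w"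
    unfolding vec_eq_iff
    by (simp add: e[OF v] e[OF w] e[OF tangent_space_lincomb[OF P p v w]] A_lincomb[OF p v w] algebra_simps)
  show "\<xi> p (\<lambda>c. r *\<^sub>R v c + s *\<^sub>R w c) = r *\<^sub>R \<xi> p v + s *\<^sub>R \<xi> p w"
    unfolding vec_eq_iff by (simp add: hat_theta_def A_lincomb[OF p v w])
qed

text \<open>A maps onto all trace-free matrices, so row a and the last column can be prescribed; the
  entry (k, k) then restores trace 0.\<close>

lemma \<eta>\<xi>_surj:
  assumes p: "p \<in> pts P"
  obtains v where "v \<in> tangent_space P p" "\<eta> p v = \<alpha>" "\<xi> p v = \<beta>"
proof -
  define Y :: "real^'n^'n" where
    "Y = (\<chi> i j. if i = a then \<alpha> $ j else if i = k \<and> j = k then - \<alpha> $ a else 0)"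
  define Z where "Z = block Y \<beta> 0 0"
  have "(\<Sum>i\<in>UNIV. Y $ i $ i) = (\<Sum>i\<in>UNIV. (if i = a then \<alpha> $ a else 0) + (if i = k then - \<alpha> $ a else 0))"
    using ak by (intro sum.cong) (auto simp: Y_def)
  then have "(\<Sum>i\<in>UNIV. Y $ i $ i) = 0" by (simp add: sum.distrib)
  then have "Z \<in> sl" by (simp add: sl_def trace_def sum_option Z_def)
  then obtain v where v: "v \<in> tangent_space P p" "A p v = Z"
    using A_bij[OF p] unfolding bij_betw_def by (metis imageE)
  show thesis
  proof (rule that[OF v(1)])
    show "\<eta> p v = \<alpha>"
      using hat_eta_eq[of A p v a, OF A_sl[OF p v(1)]] v(2) by (simp add: vec_eq_iff Z_def Y_def)
    show "\<xi> p v = \<beta>" using v(2) by (simp add: vec_eq_iff hat_theta_def Z_def)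
  qed
qed

lemma dist_D_\<eta>\<xi>: "v \<in> dist_D P A a p \<longleftrightarrow> v \<in> tangent_space P p \<and> \<eta> p v = 0 \<and> \<xi> p v = 0"
  unfolding dist_D_def by (auto simp: vec_eq_iff)

lemma dq_eq_0:
  assumes p: "p \<in> pts P" and v: "v \<in> tangent_space P p"
  shows "dq p v = (\<lambda>c. 0) \<longleftrightarrow> \<eta> p v = 0 \<and> \<xi> p v = 0"
proof -
  obtain U b \<theta> X G c s where g: "gauge M P \<pi> act A U b \<theta> X G" "c \<in> charts M" "p \<in> fol_dom P \<pi> U b c s"
    using p by (rule exists_fol_dom)
  interpret g: gauge M P \<pi> act A a U b \<theta> X G by (rule g(1))
  have "p \<in> g.Wc c" using g(3) g.WE_sub(1) by blast
  from g.dist_D_\<Psi>[OF g(2) this] dq_eq_0_iff[OF \<F>I[OF g(1,2)] g(3) v]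
  show ?thesis using v dist_D_\<eta>\<xi> by blast
qed

lemma hat_g_sym: "hat_g A a p v w = hat_g A a p w v"
  by (simp add: hat_g_inner inner_commute)

lemma hat_g_lincomb:
  assumes "p \<in> pts P" "u \<in> tangent_space P p" "v \<in> tangent_space P p"
  shows "hat_g A a p (\<lambda>c. r *\<^sub>R u c + s *\<^sub>R v c) w = r * hat_g A a p u w + s * hat_g A a p v w"
  unfolding hat_g_inner \<eta>_lincomb[OF assms] \<xi>_lincomb[OF assms] by (simp add: algebra_simps)

lemma hat_g_nondegenerate:
  assumes p: "p \<in> pts P" and v: "v \<in> tangent_space P p"
    and 0: "\<And>w. w \<in> tangent_space P p \<Longrightarrow> hat_g A a p v w = 0"
  shows "dq p v = (\<lambda>c. 0)"
proof -
  \<comment> \<open>Exchanging the two components of v makes the pairing a sum of squares.\<close>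
  obtain w where w: "w \<in> tangent_space P p" "\<eta> p w = \<xi> p v" "\<xi> p w = \<eta> p v" by (rule \<eta>\<xi>_surj[OF p])
  have "\<eta> p v \<bullet> \<eta> p v + \<xi> p v \<bullet> \<xi> p v = 0" using 0[OF w(1)] unfolding hat_g_inner w(2,3) .
  then have "\<eta> p v = 0 \<and> \<xi> p v = 0"
    using inner_ge_zero[of "\<eta> p v"] inner_ge_zero[of "\<xi> p v"] by (metis add_nonneg_eq_0_iff inner_eq_zero_iff)
  then show ?thesis using dq_eq_0[OF p v] by blast
qed

lemma hat_g_smooth:
  assumes \<sigma>: "smooth_param S P \<sigma>"
  shows "smooth_on S (\<lambda>x. hat_g A a (\<sigma> x) (push P \<sigma> x e) (push P \<sigma> x e'))"
proof -
  have oS: "open S" using smooth_paramD(1)[OF \<sigma>] .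
  have s: "smooth_on S (\<lambda>x. A (\<sigma> x) (push P \<sigma> x e) $ i $ j)" for e i j
    by (intro smooth_on_vec_nth oS smooth_one_form_push[OF P A_form \<sigma>])
  have "smooth_on S (\<lambda>x. \<Sum>m\<in>UNIV. A (\<sigma> x) (push P \<sigma> x e) $ Some a $ m * A (\<sigma> x) (push P \<sigma> x e') $ m $ None
      + A (\<sigma> x) (push P \<sigma> x e') $ Some a $ m * A (\<sigma> x) (push P \<sigma> x e) $ m $ None)"
    by (intro smooth_on_sum smooth_on_add smooth_on_mult oS s)
  then show ?thesis
  proof (rule smooth_on_cong[OF oS, THEN iffD1, rotated])
    fix x assume x: "x \<in> S"
    note t = push_tangent[OF P \<sigma> x] and sx = smooth_paramD(2)[OF \<sigma> x]
    show "(\<Sum>m\<in>UNIV. A (\<sigma> x) (push P \<sigma> x e) $ Some a $ m * A (\<sigma> x) (push P \<sigma> x e') $ m $ None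
        + A (\<sigma> x) (push P \<sigma> x e') $ Some a $ m * A (\<sigma> x) (push P \<sigma> x e) $ m $ None) =
      hat_g A a (\<sigma> x) (push P \<sigma> x e) (push P \<sigma> x e')"
      by (rule hat_g_eq[of A "\<sigma> x" _ _ a, OF A_sl[OF sx t] A_sl[OF sx t], symmetric])
  qed
qed

text \<open>Equal classes lie in one sheet of one foliated domain, and there equality of the images
  under dq is equality of the derivatives of \<open>\<pi>\<close> and \<open>\<mu>\<close>.\<close>

lemma gauge_hat_g_descends:
  assumes g: "gauge M P \<pi> act A U b \<theta> X G"
    and p: "p \<in> pts P" "\<pi> p \<in> U" and v: "v \<in> tangent_space P p" "w \<in> tangent_space P p"
    and p': "p' \<in> pts P" and v': "v' \<in> tangent_space P p'" "w' \<in> tangent_space P p'"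
    and eq: "q p = q p'" "dq p v = dq p' v'" "dq p w = dq p' w'"
  shows "(det (top_block (b p)))\<^sup>2 * hat_g A a p v w = (det (top_block (b p')))\<^sup>2 * hat_g A a p' v' w'"
proof -
  interpret g: gauge M P \<pi> act A a U b \<theta> X G by (rule g)
  have "\<pi> p \<in> pts M" using smooth_map_onD(2)[OF \<pi> p(1)] .
  then obtain c where c: "c \<in> charts_at M (\<pi> p)" using smooth_manifold_charts_at[OF M] by blast
  note c' = charts_atD[OF c]
  let ?W = "fol_dom P \<pi> U b c (sgn (det (top_block (b p))))"
  let ?\<Psi> = "fol_map a \<pi> b c"
  note F = \<F>I[OF g c'(1), of "sgn (det (top_block (b p)))"]
  have pW: "p \<in> ?W" by (rule in_fol_dom[OF g p c'(2)])
  have R: "(p, p') \<in> R" using q_eq[OF p(1) p'] eq(1) by blast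
  then have p'W: "p' \<in> ?W" "?\<Psi> p' = ?\<Psi> p" using R_iff[OF F pW] by auto
  have d: "vec_deriv P ?\<Psi> p v = vec_deriv P ?\<Psi> p' v'" "vec_deriv P ?\<Psi> p w = vec_deriv P ?\<Psi> p' w'"
    using dq_\<Psi>[OF F pW, of v] dq_\<Psi>[OF F p'W(1), of v'] dq_\<Psi>[OF F pW, of w] dq_\<Psi>[OF F p'W(1), of w'] eq(2,3)
    by simp_all
  have W: "p \<in> g.Wc c" "p' \<in> g.Wc c" "p \<in> g.PU" "p' \<in> g.PU" using pW p'W(1) g.WE_sub by blast+
  have \<pi>p: "\<pi> p = \<pi> p'" using R_\<pi>[OF R] by simp
  have \<mu>: "g.\<mu> p = g.\<mu> p'" using p'W(2) by (simp add: g.\<Psi>_eq)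
  have dv: "g.d\<pi> p v c = g.d\<pi> p' v' c" "g.d\<mu> p v = g.d\<mu> p' v'"
    using d(1) g.d\<Psi>_eq[OF c'(1) W(1) v(1)] g.d\<Psi>_eq[OF c'(1) W(2) v'(1)] by simp_all
  have dw: "g.d\<pi> p w c = g.d\<pi> p' w' c" "g.d\<mu> p w = g.d\<mu> p' w'"
    using d(2) g.d\<Psi>_eq[OF c'(1) W(1) v(2)] g.d\<Psi>_eq[OF c'(1) W(2) v'(2)] by simp_all
  have "(det (g.Bp p))\<^sup>2 * hat_g A a p v w = (det (g.Bp p'))\<^sup>2 * hat_g A a p' v' w'"
    by (rule g.hat_g_pullback[OF W(3) v W(4) v' \<pi>p \<mu> g.d\<pi>_eqI[OF c'(1) W(1,2) \<pi>p v(1) v'(1) dv(1)]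
          g.d\<pi>_eqI[OF c'(1) W(1,2) \<pi>p v(2) v'(2) dw(1)] dv(2) dw(2)])
  then show ?thesis by (simp add: g.Bp_def top_block_def)
qed

text \<open>For each gauge the squared determinant makes the form descend. Weighting by bump
  functions pulled back from M, which are constant on leaves, and adding up preserves this;
  positivity somewhere in the sum replaces a normalisation.\<close>

lemma global_scale:
  obtains f where "smooth_fun_on P (pts P) f" "\<And>p. p \<in> pts P \<Longrightarrow> f p > 0"
    "\<And>p v w p' v' w'. p \<in> pts P \<Longrightarrow> v \<in> tangent_space P p \<Longrightarrow> w \<in> tangent_space P p \<Longrightarrow>
      p' \<in> pts P \<Longrightarrow> v' \<in> tangent_space P p' \<Longrightarrow> w' \<in> tangent_space P p' \<Longrightarrow>
      q p = q p' \<Longrightarrow> dq p v = dq p' v' \<Longrightarrow> dq p w = dq p' w' \<Longrightarrow>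
      f p * hat_g A a p v w = f p' * hat_g A a p' v' w'"
proof (cases "pts M = {}")
  case True
  then have "pts P = {}" using smooth_map_onD(2)[OF \<pi>] by blast
  then show thesis using that[of "\<lambda>p. 1"] smooth_vec_on_const[of P "pts P" "1 :: real"]
    by (simp add: smooth_fun_on_iff)
next
  case False
  have cov: "\<exists>W. openin (mtop M) W \<and> x \<in> W \<and> (\<exists>b \<theta> X G. gauge M P \<pi> act A W b \<theta> X G)" if x: "x \<in> pts M" for x
  proof -
    obtain U b \<theta> X G where g: "x \<in> U" "gauge M P \<pi> act A U b \<theta> X G" using gauges[OF x] by (elim exE conjE)
    then show ?thesis using gauge.triv_facts(1)[OF g(2)] by blast
  qed
  obtain \<psi> :: "nat \<Rightarrow> 'm \<Rightarrow> real" and W C where \<psi>: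
    "\<And>i. smooth_vec_on M (pts M) (\<psi> i)" "\<And>i x. \<psi> i x \<ge> 0" "\<And>i. openin (mtop M) (W i)"
    "\<And>i. \<exists>b \<theta> X G. gauge M P \<pi> act A (W i) b \<theta> X G"
    "\<And>i. closedin (mtop M) (C i)" "\<And>i. C i \<subseteq> W i" "\<And>i x. x \<notin> C i \<Longrightarrow> \<psi> i x = 0"
    "\<And>x. x \<in> pts M \<Longrightarrow> \<exists>V N. openin (mtop M) V \<and> x \<in> V \<and> (\<forall>i>N. \<forall>y\<in>V. \<psi> i y = 0)"
    "\<And>x. x \<in> pts M \<Longrightarrow> \<exists>i. \<psi> i x > 0"
    by (rule locally_finite_bump_functions[OF M False, of "\<lambda>W. \<exists>b \<theta> X G. gauge M P \<pi> act A W b \<theta> X G"])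
      (rule cov, assumption, rule that)
  have "\<exists>b. \<forall>i. \<exists>\<theta> X G. gauge M P \<pi> act A (W i) (b i) \<theta> X G"
    by (rule choice) (rule allI, rule \<psi>(4))
  then obtain b where b: "\<And>i. \<exists>\<theta> X G. gauge M P \<pi> act A (W i) (b i) \<theta> X G" by blast
  define D where "D i p = (det (top_block (b i p)))\<^sup>2" for i p
  \<comment> \<open>Extended by zero outside the gauge; this is smooth because the weight is
    supported in a closed set \<open>C i\<close> inside \<open>W i\<close>.\<close>
  define H where "H i p = (if p \<in> pts P \<and> \<pi> p \<in> W i then \<psi> i (\<pi> p) * D i p else 0)" for i p
  have Dpos: "D i p > 0" if "p \<in> pts P" "\<pi> p \<in> W i" for i p
  proof -
    obtain \<theta> X G where g: "gauge M P \<pi> act A (W i) (b i) \<theta> X G" using b[of i] by (elim exE)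
    interpret g: gauge M P \<pi> act A a "W i" "b i" \<theta> X G by (rule g)
    show ?thesis using g.b_eq(1)[of p] that by (simp add: D_def g.PU_def g.Bp_def top_block_def)
  qed
  have smooth: "smooth_vec_on P (pts P) (H i)" for i
  proof (rule smooth_vec_on_local[OF P])
    fix p assume p: "p \<in> pts P"
    obtain \<theta> X G where g: "gauge M P \<pi> act A (W i) (b i) \<theta> X G" using b[of i] by (elim exE)
    interpret g: gauge M P \<pi> act A a "W i" "b i" \<theta> X G by (rule g)
    show "\<exists>V. p \<in> V \<and> V \<subseteq> pts P \<and> smooth_vec_on P V (H i)"
    proof (cases "\<pi> p \<in> W i")
      case True
      have "{p \<in> pts P. \<pi> p \<in> pts M} = pts P" using smooth_map_onD(2)[OF \<pi>] by auto
      then have "smooth_vec_on P (pts P) (\<lambda>p. \<psi> i (\<pi> p))"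
        using smooth_map_vec[OF P M \<pi> \<psi>(1)[of i]] by simp
      then have 1: "smooth_vec_on P g.PU (\<lambda>p. \<psi> i (\<pi> p))"
        by (rule smooth_vec_on_subset[OF P _ g.oPU g.PU_pts])
      have "smooth_vec_on P g.PU (\<lambda>p. \<psi> i (\<pi> p) * (det (g.Bp p) * det (g.Bp p)))"
        by (intro smooth_vec_on_mult P 1 g.smooth_det)
      then have "smooth_vec_on P g.PU (H i)"
        by (rule smooth_vec_on_cong[OF P, THEN iffD1, rotated])
          (simp add: H_def D_def g.PU_def g.Bp_def top_block_def power2_eq_square)
      then show ?thesis using True p g.PU_pts by (intro exI[of _ g.PU]) (simp add: g.PU_def)
    next
      case False
      let ?V = "{p \<in> pts P. \<pi> p \<in> pts M - C i}"
      have oV: "openin (mtop P) ?V"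
        by (rule smooth_map_onD(3)[OF \<pi>]) (simp add: openin_diff \<psi>(5))
      have "smooth_vec_on P ?V (H i) \<longleftrightarrow> smooth_vec_on P ?V (\<lambda>p. 0 :: real)"
        by (rule smooth_vec_on_cong[OF P]) (simp add: H_def \<psi>(7))
      then have "smooth_vec_on P ?V (H i)" using smooth_vec_on_const[OF oV] by simp
      moreover have "p \<in> ?V" using False p \<psi>(6)[of i] smooth_map_onD(2)[OF \<pi> p] by blast
      ultimately show ?thesis by (intro exI[of _ ?V]) blast
    qed
  qed
  have fin: "\<exists>V N. openin (mtop P) V \<and> p \<in> V \<and> (\<forall>i>N. \<forall>r\<in>V. H i r = 0)" if p: "p \<in> pts P" for p
  proof -
    obtain V N where V: "openin (mtop M) V" "\<pi> p \<in> V" "\<forall>i>N. \<forall>y\<in>V. \<psi> i y = 0"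
      using \<psi>(8)[OF smooth_map_onD(2)[OF \<pi> p]] by (elim exE conjE)
    show ?thesis
      by (intro exI[of _ "{r \<in> pts P. \<pi> r \<in> V}"] exI[of _ N] conjI smooth_map_onD(3)[OF \<pi> V(1)])
        (use V p in \<open>auto simp: H_def\<close>)
  qed
  define f where "f p = (\<Sum>i | H i p \<noteq> 0. H i p)" for p
  show thesis
  proof (rule that[of f])
    show "smooth_fun_on P (pts P) f"
      unfolding smooth_fun_on_iff f_def[abs_def] by (rule smooth_vec_on_locally_finite_sum[OF P smooth fin])
    show "f p > 0" if p: "p \<in> pts P" for p
    proof -
      obtain i where i: "\<psi> i (\<pi> p) > 0" using \<psi>(9)[OF smooth_map_onD(2)[OF \<pi> p]] by blast
      then have "\<pi> p \<in> C i" using \<psi>(7)[of "\<pi> p" i] by (cases "\<pi> p \<in> C i") auto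
      then have "\<pi> p \<in> W i" using \<psi>(6)[of i] by blast
      then have Hi: "H i p > 0" using i Dpos[OF p] p by (simp add: H_def)
      obtain V N where V: "p \<in> V" "\<forall>i>N. \<forall>r\<in>V. H i r = 0" using fin[OF p] by blast
      have "finite {i. H i p \<noteq> 0}"
      proof (rule finite_subset)
        have "i \<le> N" if "H i p \<noteq> 0" for i using V that by (cases "i > N") auto
        then show "{i. H i p \<noteq> 0} \<subseteq> {..N}" by blast
      qed simp
      moreover have "H j p \<ge> 0" for j using \<psi>(2)[of j] by (simp add: H_def D_def)
      ultimately show ?thesis unfolding f_def using Hi by (intro sum_pos2[of _ i]) auto
    qed
    fix p v w p' v' w'
    assume p: "p \<in> pts P" and v: "v \<in> tangent_space P p" "w \<in> tangent_space P p"
      and p': "p' \<in> pts P" and v': "v' \<in> tangent_space P p'" "w' \<in> tangent_space P p'"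
      and eq: "q p = q p'" "dq p v = dq p' v'" "dq p w = dq p' w'"
    have "(p, p') \<in> R" using q_eq[OF p p'] eq(1) by blast
    then have \<pi>p: "\<pi> p' = \<pi> p" by (rule R_\<pi>)
    \<comment> \<open>The weight depends on the common base point and the squared determinants are
      positive, so both sums run over the same indices.\<close>
    have "H i p \<noteq> 0 \<longleftrightarrow> H i p' \<noteq> 0" for i
      using Dpos[OF p, of i] Dpos[OF p', of i] p p' by (auto simp: H_def \<pi>p)
    then have I: "{i. H i p \<noteq> 0} = {i. H i p' \<noteq> 0}" by blast
    have "H i p * hat_g A a p v w = H i p' * hat_g A a p' v' w'" for i
    proof (cases "\<pi> p \<in> W i")
      case True
      obtain \<theta> X G where g: "gauge M P \<pi> act A (W i) (b i) \<theta> X G" using b[of i] by (elim exE)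
      have "D i p * hat_g A a p v w = D i p' * hat_g A a p' v' w'"
        unfolding D_def by (rule gauge_hat_g_descends[OF g p True v p' v' eq])
      then show ?thesis using True p p' by (simp add: H_def \<pi>p)
    qed (simp add: H_def \<pi>p)
    then show "f p * hat_g A a p v w = f p' * hat_g A a p' v' w'"
      unfolding f_def I sum_distrib_right by (rule sum.cong[OF refl])
  qed
qed

text \<open>The form pairs \<open>\<eta>\<close> with \<open>\<xi>\<close>, so vectors with
  \<open>\<xi>\<close> equal to \<open>\<eta>\<close> have positive square and those with opposite
  components negative square. Scaled unit vectors give the orthonormal basis.\<close>

lemma split_signature_pullback:
  assumes pb: "pulls_back_to_multiple P Q (\<lambda>p. q p) g (hat_g A a)"
  shows "split_signature TYPE('n) Q g"
  unfolding split_signature_def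
proof
  fix y assume "y \<in> pts Q"
  then obtain p where p: "p \<in> pts P" "y = q p" by (auto simp: quotient_def)
  obtain f where f: "\<And>p. p \<in> pts P \<Longrightarrow> f p > 0"
    "\<And>p v w. p \<in> pts P \<Longrightarrow> v \<in> tangent_space P p \<Longrightarrow> w \<in> tangent_space P p \<Longrightarrow>
      g (q p) (dq p v) (dq p w) = f p * hat_g A a p v w"
    using pb unfolding pulls_back_to_multiple_def by blast
  \<comment> \<open>The vector with \<open>\<eta>\<close> = t e_i and \<open>\<xi>\<close> = t e_i
    has square f p * 2 t^2, which this t normalises to 1.\<close>
  define t where "t = 1 / sqrt (2 * f p)"
  have t: "t \<noteq> 0" "f p * (2 * (t * t)) = 1"
    using f(1)[OF p(1)] by (simp_all add: t_def real_sqrt_mult_self[of "2 * f p"] flip: times_divide_times_eq)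
  have "\<exists>v. v \<in> tangent_space P p \<and> \<eta> p v = axis i t \<and> \<xi> p v = axis i (s * t)" for i s
    using \<eta>\<xi>_surj[OF p(1), of "axis i t" "axis i (s * t)"] by blast
  then obtain V where V: "\<And>i s. V i s \<in> tangent_space P p" "\<And>i s. \<eta> p (V i s) = axis i t"
    "\<And>i s. \<xi> p (V i s) = axis i (s * t)" by metis
  define e where "e i = dq p (V i 1)" for i
  define e' where "e' i = dq p (V i (- 1))" for i
  have tQ: "dq p v \<in> tangent_space Q y" if "v \<in> tangent_space P p" for v
    unfolding p(2) by (rule tangent_map_tangent[OF P Q_manifold(1) smooth_map_Q p(1) that])
  have ax: "axis i (x :: real) \<bullet> axis j z = (if i = j then x * z else 0)" for i j :: 'n and x z
    by (simp add: inner_axis_axis)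
  have gV: "g y (dq p (V i s)) (dq p (V j s')) = (if i = j then (s + s') / 2 else 0)" for i j s s'
  proof -
    have "g y (dq p (V i s)) (dq p (V j s')) = f p * (if i = j then t * (s' * t) + s * t * t else 0)"
      unfolding p(2) f(2)[OF p(1) V(1) V(1)] hat_g_inner V(2,3) ax by simp
    also have "\<dots> = (if i = j then (f p * (2 * (t * t))) * (s + s') / 2 else 0)" by (simp add: algebra_simps)
    finally show ?thesis unfolding t(2) by simp
  qed
  have span: "\<exists>r s. u = (\<lambda>c. \<Sum>i\<in>UNIV. r i *\<^sub>R e i c + s i *\<^sub>R e' i c)" if u: "u \<in> tangent_space Q y" for u
  proof -
    obtain v where v: "v \<in> tangent_space P p" "u = dq p v" using dq_surj[OF p(1)] u p(2) by metis
    \<comment> \<open>Solves (r + s) t = \<open>\<eta>\<close> and (r - s) t = \<open>\<xi>\<close>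
      in each coordinate. The combination then differs from v by an element of the kernel of
      dq.\<close>
    define r where "r i = (\<eta> p v $ i + \<xi> p v $ i) / (2 * t)" for i
    define s where "s i = (\<eta> p v $ i - \<xi> p v $ i) / (2 * t)" for i
    let ?x = "\<lambda>c. \<Sum>i\<in>UNIV. r i *\<^sub>R V i 1 c" and ?y = "\<lambda>c. \<Sum>i\<in>UNIV. s i *\<^sub>R V i (- 1) c"
    let ?z = "\<lambda>c. 1 *\<^sub>R ?x c + 1 *\<^sub>R ?y c"
    have x: "?x \<in> tangent_space P p" and y: "?y \<in> tangent_space P p"
      by (rule tangent_sum[OF P p(1) finite V(1)])+
    have z: "?z \<in> tangent_space P p" by (rule tangent_space_lincomb[OF P p(1) x y])
    have rs: "r i * t + s i * t = \<eta> p v $ i" "r i * t - s i * t = \<xi> p v $ i" for i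
      using t(1) by (simp_all add: r_def s_def field_simps)
    have axs: "(\<Sum>i\<in>UNIV. r i *\<^sub>R axis i (z :: real)) = (\<chi> i. r i * z)" for r :: "'n \<Rightarrow> real" and z
      by (simp add: vec_eq_iff axis_def if_distrib cong: if_cong)
    have S\<eta>: "\<eta> p (\<lambda>c. \<Sum>i\<in>UNIV. r i *\<^sub>R V i s c) = (\<Sum>i\<in>UNIV. r i *\<^sub>R axis i t)" for r s
      using linear_tangent_sum[where L = "\<eta> p" and v = "\<lambda>i. V i s",
          OF P p(1) finite_class.finite_UNIV V(1) \<eta>_lincomb[OF p(1)], of r] unfolding V(2) .
    have S\<xi>: "\<xi> p (\<lambda>c. \<Sum>i\<in>UNIV. r i *\<^sub>R V i s c) = (\<Sum>i\<in>UNIV. r i *\<^sub>R axis i (s * t))" for r s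
      using linear_tangent_sum[where L = "\<xi> p" and v = "\<lambda>i. V i s",
          OF P p(1) finite_class.finite_UNIV V(1) \<xi>_lincomb[OF p(1)], of r] unfolding V(3) .
    have \<eta>z: "\<eta> p ?z = \<eta> p v"
      unfolding \<eta>_lincomb[OF p(1) x y] S\<eta> axs
      using rs(1) by (simp add: vec_eq_iff)
    have \<xi>z: "\<xi> p ?z = \<xi> p v"
      unfolding \<xi>_lincomb[OF p(1) x y] S\<xi> axs
      using rs(2) by (simp add: vec_eq_iff)
    let ?d = "\<lambda>c. 1 *\<^sub>R v c + (- 1) *\<^sub>R ?z c"
    have "\<eta> p ?d = 0" "\<xi> p ?d = 0"
      unfolding \<eta>_lincomb[OF p(1) v(1) z] \<xi>_lincomb[OF p(1) v(1) z] \<eta>z \<xi>z by simp_all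
    then have "dq p ?d = (\<lambda>c. 0)" using dq_eq_0[OF p(1) tangent_space_lincomb[OF P p(1) v(1) z]] by blast
    then have "(\<lambda>c. 1 *\<^sub>R dq p v c + (- 1) *\<^sub>R dq p ?z c) = (\<lambda>c. 0)"
      unfolding tangent_map_lincomb[OF P Q_manifold(1) smooth_map_Q p(1) v(1) z] .
    then have "u c = dq p ?z c" for c unfolding v(2) by (auto dest: fun_cong[of _ _ c])
    moreover have "dq p ?z c = (\<Sum>i\<in>UNIV. r i *\<^sub>R e i c) + (\<Sum>i\<in>UNIV. s i *\<^sub>R e' i c)" for c
    proof -
      have L: "dq p (\<lambda>c. r *\<^sub>R u c + s *\<^sub>R w c) c = r *\<^sub>R dq p u c + s *\<^sub>R dq p w c"
        if "u \<in> tangent_space P p" "w \<in> tangent_space P p" for u w r s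
        unfolding tangent_map_lincomb[OF P Q_manifold(1) smooth_map_Q p(1) that] ..
      have "dq p (\<lambda>c. \<Sum>i\<in>UNIV. r i *\<^sub>R V i s c) c = (\<Sum>i\<in>UNIV. r i *\<^sub>R dq p (V i s) c)" for r s
        by (rule linear_tangent_sum[where L = "\<lambda>v. dq p v c" and v = "\<lambda>i. V i s",
          OF P p(1) finite_class.finite_UNIV V(1) L])
      then show ?thesis unfolding L[OF x y] e_def e'_def by simp
    qed
    ultimately have "u = (\<lambda>c. \<Sum>i\<in>UNIV. r i *\<^sub>R e i c + s i *\<^sub>R e' i c)" by (auto simp: sum.distrib)
    then show ?thesis by blast
  qed
  show "\<exists>e e' :: 'n \<Rightarrow> _. range e \<subseteq> tangent_space Q y \<and> range e' \<subseteq> tangent_space Q y \<and>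
      (\<forall>i j. g y (e i) (e j) = (if i = j then 1 else 0) \<and> g y (e' i) (e' j) = (if i = j then -1 else 0) \<and>
        g y (e i) (e' j) = 0) \<and>
      (\<forall>v\<in>tangent_space Q y. \<exists>r s. v = (\<lambda>c. \<Sum>i\<in>UNIV. r i *\<^sub>R e i c + s i *\<^sub>R e' i c))"
  proof (rule exI[of _ e], rule exI[of _ e'], intro conjI allI ballI)
    show "range e \<subseteq> tangent_space Q y" "range e' \<subseteq> tangent_space Q y"
      unfolding e_def e'_def using tQ V(1) by auto
  qed (use span in \<open>simp_all add: e_def e'_def gV\<close>)
qed

lemma pulls_back_trans:
  assumes pb: "pulls_back_to_multiple P Q (\<lambda>p. q p) g (hat_g A a)" and g': "g' \<in> metric_class Q g"
  shows "pulls_back_to_multiple P Q (\<lambda>p. q p) g' (hat_g A a)"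
proof -
  obtain f where f: "smooth_fun_on P (pts P) f" "\<forall>p\<in>pts P. f p > 0"
    "\<forall>p\<in>pts P. \<forall>v\<in>tangent_space P p. \<forall>w\<in>tangent_space P p. g (q p) (dq p v) (dq p w) = f p * hat_g A a p v w"
    using pb unfolding pulls_back_to_multiple_def by blast
  obtain f' where f': "smooth_fun_on Q (pts Q) f'" "\<forall>y\<in>pts Q. f' y > 0"
    "\<forall>y\<in>pts Q. \<forall>v\<in>tangent_space Q y. \<forall>w\<in>tangent_space Q y. g' y v w = f' y * g y v w"
    using g' unfolding metric_class_def by blast
  have qQ: "q p \<in> pts Q" if "p \<in> pts P" for p using q_in[OF that] by simp
  show ?thesis
    unfolding pulls_back_to_multiple_def
  proof (intro exI[of _ "\<lambda>p. f' (q p) * f p"] conjI ballI)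
    have "{p \<in> pts P. q p \<in> pts Q} = pts P" using qQ by blast
    then have "smooth_vec_on P (pts P) (\<lambda>p. f' (q p))"
      using smooth_map_vec[OF P Q_manifold(1) smooth_map_Q f'(1)[unfolded smooth_fun_on_iff]] by simp
    then show "smooth_fun_on P (pts P) (\<lambda>p. f' (q p) * f p)"
      using smooth_vec_on_mult[OF P _ f(1)[unfolded smooth_fun_on_iff]] unfolding smooth_fun_on_iff by blast
    show "f' (q p) * f p > 0" if "p \<in> pts P" for p using f(2) f'(2) qQ that by simp
    fix p v w assume p: "p \<in> pts P" and v: "v \<in> tangent_space P p" "w \<in> tangent_space P p"
    have t: "dq p v \<in> tangent_space Q (q p)" "dq p w \<in> tangent_space Q (q p)"
      using tangent_map_tangent[OF P Q_manifold(1) smooth_map_Q p] v by blast+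
    show "g' (q p) (dq p v) (dq p w) = f' (q p) * f p * hat_g A a p v w"
      using f'(3) f(3) qQ[OF p] p v t by simp
  qed
qed

text \<open>Existence comes from \<open>global_scale\<close> and \<open>descend_metric\<close>. For
  uniqueness, two metrics that both pull back to positive multiples of the form are pointwise
  proportional with positive factor, and that factor is smooth by
  \<open>proportional_metrics\<close>.\<close>

lemma unique_conformal_class:
  "\<exists>!C. conformal_class Q C \<and>
    (\<forall>g\<in>C. split_signature TYPE('n) Q g \<and> pulls_back_to_multiple P Q (\<lambda>p. q p) g (hat_g A a))"
proof -
  obtain f where f: "smooth_fun_on P (pts P) f" "\<And>p. p \<in> pts P \<Longrightarrow> f p > 0"
    "\<And>p v w p' v' w'. p \<in> pts P \<Longrightarrow> v \<in> tangent_space P p \<Longrightarrow> w \<in> tangent_space P p \<Longrightarrow>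
      p' \<in> pts P \<Longrightarrow> v' \<in> tangent_space P p' \<Longrightarrow> w' \<in> tangent_space P p' \<Longrightarrow>
      q p = q p' \<Longrightarrow> dq p v = dq p' v' \<Longrightarrow> dq p w = dq p' w' \<Longrightarrow>
      f p * hat_g A a p v w = f p' * hat_g A a p' v' w'"
    by (rule global_scale) (rule that)
  obtain g where g: "metric Q g" "\<And>p v w. p \<in> pts P \<Longrightarrow> v \<in> tangent_space P p \<Longrightarrow> w \<in> tangent_space P p \<Longrightarrow>
      g (q p) (dq p v) (dq p w) = f p * hat_g A a p v w"
  proof (rule descend_metric[of "\<lambda>p v w. f p * hat_g A a p v w"])
    show "f p * hat_g A a p (\<lambda>c. r *\<^sub>R u c + s *\<^sub>R v c) w = r * (f p * hat_g A a p u w) + s * (f p * hat_g A a p v w)"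
      if "p \<in> pts P" "u \<in> tangent_space P p" "v \<in> tangent_space P p" for p u v w r s
      unfolding hat_g_lincomb[OF that] by (simp add: algebra_simps)
    show "f p * hat_g A a p v w = f p * hat_g A a p w v" for p v w using hat_g_sym by simp
    show "dq p v = (\<lambda>c. 0)" if p: "p \<in> pts P" and v: "v \<in> tangent_space P p"
      and 0: "\<And>w. w \<in> tangent_space P p \<Longrightarrow> f p * hat_g A a p v w = 0" for p v
    proof (rule hat_g_nondegenerate[OF p v])
      show "hat_g A a p v w = 0" if "w \<in> tangent_space P p" for w using 0[OF that] f(2)[OF p] by simp
    qed
    show "smooth_on S (\<lambda>x. f (\<sigma> x) * hat_g A a (\<sigma> x) (push P \<sigma> x e) (push P \<sigma> x e'))"
      if \<sigma>: "smooth_param S P \<sigma>" for S :: "((real^'n) \<times> (real^'n)) set" and \<sigma> e e'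
    proof (rule smooth_on_mult[OF smooth_paramD(1)[OF \<sigma>] _ hat_g_smooth[OF \<sigma>]])
      have "{x \<in> S. \<sigma> x \<in> pts P} = S" using smooth_paramD(2)[OF \<sigma>] by blast
      then show "smooth_on S (\<lambda>x. f (\<sigma> x))"
        using smooth_param_comp_vec[OF P \<sigma> f(1)[unfolded smooth_fun_on_iff]] by simp
    qed
  qed (assumption | rule f(3) that)+
  have pb: "pulls_back_to_multiple P Q (\<lambda>p. q p) g (hat_g A a)"
    unfolding pulls_back_to_multiple_def using f(1,2) g(2) by (intro exI[of _ f]) simp
  have sub: "metric_class Q g2 \<subseteq> metric_class Q g1"
    if m: "metric Q g1" "metric Q g2" and pb: "pulls_back_to_multiple P Q (\<lambda>p. q p) g1 (hat_g A a)"
      "pulls_back_to_multiple P Q (\<lambda>p. q p) g2 (hat_g A a)" for g1 g2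
  proof -
    obtain f1 where f1: "\<forall>p\<in>pts P. f1 p > 0"
      "\<forall>p\<in>pts P. \<forall>v\<in>tangent_space P p. \<forall>w\<in>tangent_space P p. g1 (q p) (dq p v) (dq p w) = f1 p * hat_g A a p v w"
      using pb(1) unfolding pulls_back_to_multiple_def by blast
    obtain f2 where f2: "\<forall>p\<in>pts P. f2 p > 0"
      "\<forall>p\<in>pts P. \<forall>v\<in>tangent_space P p. \<forall>w\<in>tangent_space P p. g2 (q p) (dq p v) (dq p w) = f2 p * hat_g A a p v w"
      using pb(2) unfolding pulls_back_to_multiple_def by blast
    have pr: "\<exists>k>0. \<forall>v\<in>tangent_space Q y. \<forall>w\<in>tangent_space Q y. g2 y v w = k * g1 y v w" if y: "y \<in> pts Q" for y
    proof -
      obtain p where p: "p \<in> pts P" "y = q p" using y by (auto simp: quotient_def)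
      have "g2 y v w = f2 p / f1 p * g1 y v w" if vw: "v \<in> tangent_space Q y" "w \<in> tangent_space Q y" for v w
      proof -
        obtain v' where v': "v' \<in> tangent_space P p" "v = dq p v'" using dq_surj[OF p(1)] vw p(2) by metis
        obtain w' where w': "w' \<in> tangent_space P p" "w = dq p w'" using dq_surj[OF p(1)] vw p(2) by metis
        have "f1 p > 0" using f1(1) p(1) by blast
        then show ?thesis using f1(2) f2(2) p(1) v'(1) w'(1) unfolding v'(2) w'(2) p(2) by simp
      qed
      moreover have "f2 p / f1 p > 0" using f1(1) f2(1) p(1) by simp
      ultimately show ?thesis by blast
    qed
    obtain \<phi> where "smooth_fun_on Q (pts Q) \<phi>" "\<And>y. y \<in> pts Q \<Longrightarrow> \<phi> y > 0"
      "\<And>y v w. y \<in> pts Q \<Longrightarrow> v \<in> tangent_space Q y \<Longrightarrow> w \<in> tangent_space Q y \<Longrightarrow> g2 y v w = \<phi> y * g1 y v w"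
      by (rule proportional_metrics[OF Q_manifold(1) m pr]) (assumption, rule that)
    then have "g2 \<in> metric_class Q g1" unfolding metric_class_def using m(2) by blast
    then show ?thesis using metric_class_trans[OF Q_manifold(1)] by blast
  qed
  show ?thesis
  proof (rule ex1I[of _ "metric_class Q g"])
    show "conformal_class Q (metric_class Q g) \<and> (\<forall>g'\<in>metric_class Q g. split_signature TYPE('n) Q g' \<and>
        pulls_back_to_multiple P Q (\<lambda>p. q p) g' (hat_g A a))"
      unfolding conformal_class_iff using g(1) pulls_back_trans[OF pb] split_signature_pullback by blast
    fix C assume C: "conformal_class Q C \<and> (\<forall>g\<in>C. split_signature TYPE('n) Q g \<and>
        pulls_back_to_multiple P Q (\<lambda>p. q p) g (hat_g A a))"
    then obtain g' where g': "metric Q g'" "C = metric_class Q g'" unfolding conformal_class_iff by blast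
    then have "pulls_back_to_multiple P Q (\<lambda>p. q p) g' (hat_g A a)" using C metric_class_self by blast
    then show "C = metric_class Q g" using sub[OF g(1) g'(1) pb] sub[OF g'(1) g(1) _ pb] g'(2) by blast
  qed
qed

text \<open>Identifies the model space with a space of coordinate vectors indexed by the sum type 'n
  + 'n, as the determinant argument behind \<open>quotient_manifold_unique\<close> requires.\<close>

lemma unique_quotient_manifold: "quotient_manifold P R Q' \<Longrightarrow> Q' = Q"
proof (rule quotient_manifold_unique)
  let ?J = "\<lambda>z :: (real^'n) \<times> (real^'n). (\<chi> i. case i of Inl i \<Rightarrow> fst z $ i | Inr i \<Rightarrow> snd z $ i) :: real^('n + 'n)"
  show "linear ?J" by (rule linearI) (auto simp: vec_eq_iff split: sum.split)
  show "bij ?J"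
  proof (rule bijI)
    show "inj ?J"
    proof (rule injI)
      fix y z assume "?J y = ?J z"
      then have "?J y $ i = ?J z $ i" for i by simp
      from this[of "Inl _"] this[of "Inr _"] show "y = z" by (simp add: prod_eq_iff vec_eq_iff)
    qed
    have "?J (\<chi> i. x $ Inl i, \<chi> i. x $ Inr i) = x" for x by (auto simp: vec_eq_iff split: sum.split)
    then show "surj ?J" by (rule surjI)
  qed
qed

end

theorem theorem1p8:
  fixes M :: "('m, real^'n) mfd"
    and \<PP> :: "('m, real^'n) conn set"
    and P :: "('p, (real^'n) \<times> (real^'n^'n) \<times> (real^'n)) mfd"
    and \<pi> :: "'p \<Rightarrow> 'm"
    and act :: "'p \<Rightarrow> 'n bmat \<Rightarrow> 'p"
    and A :: "'p \<Rightarrow> ('p, (real^'n) \<times> (real^'n^'n) \<times> (real^'n)) tvec \<Rightarrow> 'n bmat"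
    and a :: 'n
  assumes "CARD('n) \<ge> 2"
    and "smooth_manifold M"
    and "projective_structure M \<PP>"
    and "cartan_bundle M \<PP> P \<pi> act A"
  shows "equiv (pts P) (leaf_rel P A a) \<and>
    (\<exists>!P\<^sub>a :: ('p set, (real^'n) \<times> (real^'n)) mfd. quotient_manifold P (leaf_rel P A a) P\<^sub>a) \<and>
    (\<forall>P\<^sub>a :: ('p set, (real^'n) \<times> (real^'n)) mfd. quotient_manifold P (leaf_rel P A a) P\<^sub>a \<longrightarrow>
      (\<exists>!C. conformal_class P\<^sub>a C \<and>
        (\<forall>g\<in>C. split_signature TYPE('n) P\<^sub>a g \<and>
          pulls_back_to_multiple P P\<^sub>a (\<lambda>p. leaf_rel P A a `` {p}) g (hat_g A a))))"
proof -
  have "\<exists>k. k \<noteq> a"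
  proof (rule ccontr)
    assume "\<nexists>k. k \<noteq> a"
    then have "(UNIV :: 'n set) = {a}" by auto
    then have "CARD('n) = card {a}" by (rule arg_cong)
    then show False using assms(1) by simp
  qed
  then obtain k where "k \<noteq> a" by blast
  then have k: "a \<noteq> k" by simp
  have prin: "principal_H_bundle M P \<pi> act" and conn: "cartan_connection P act A"
    and forms: "\<And>x. x \<in> pts M \<Longrightarrow> \<exists>nabla\<in>\<PP>. \<exists>U \<theta> X G b.
        x \<in> U \<and> dual_frames_on M U \<theta> X \<and> connection_coeffs_on M U nabla X G \<and>
        local_trivialization M P \<pi> act U b \<and>
        (\<forall>p\<in>pts P. \<pi> p \<in> U \<longrightarrow> (\<forall>v\<in>tangent_space P p.
           A p v = matrix_inv (b p) ** cartan_gauge M \<theta> X G (\<pi> p) (tangent_map P M \<pi> p v) ** b p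
                 + matrix_inv (b p) ** vec_deriv P b p v))"
    using assms(4) unfolding cartan_bundle_def by blast+
  have P: "smooth_manifold P" and \<pi>: "smooth_map_on P M (pts P) \<pi>"
    using prin unfolding principal_H_bundle_def by blast+
  have A: "one_form_on P (pts P) A" "\<And>p. p \<in> pts P \<Longrightarrow> bij_betw (A p) (tangent_space P p) sl"
    using conn unfolding cartan_connection_def by blast+
  interpret cartan M P \<pi> act A a k
  proof
    fix x assume x: "x \<in> pts M"
    obtain nabla U \<theta> X G b where g: "x \<in> U" "dual_frames_on M U \<theta> X"
      "connection_coeffs_on M U nabla X G" "local_trivialization M P \<pi> act U b"
      "\<forall>p\<in>pts P. \<pi> p \<in> U \<longrightarrow> (\<forall>v\<in>tangent_space P p.
           A p v = matrix_inv (b p) ** cartan_gauge M \<theta> X G (\<pi> p) (tangent_map P M \<pi> p v) ** b p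
                 + matrix_inv (b p) ** vec_deriv P b p v)"
      using forms[OF x] by (elim bexE exE conjE)
    have "gauge M P \<pi> act A U b \<theta> X G"
      by unfold_locales (use assms(2) P \<pi> g bij_betw_apply[OF A(2)] in auto)
    then show "\<exists>U b \<theta> X G. x \<in> U \<and> gauge M P \<pi> act A U b \<theta> X G" using g(1) by blast
  qed (fact assms(2) P \<pi> A k)+
  have "\<exists>!Q' :: ('p set, (real^'n) \<times> (real^'n)) mfd. quotient_manifold P (leaf_rel P A a) Q'"
    using quotient_manifold_Q unique_quotient_manifold by (rule ex1I)
  moreover have "\<exists>!C. conformal_class Q' C \<and>
      (\<forall>g\<in>C. split_signature TYPE('n) Q' g \<and>
        pulls_back_to_multiple P Q' (\<lambda>p. leaf_rel P A a `` {p}) g (hat_g A a))"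
    if "quotient_manifold P (leaf_rel P A a) Q'" for Q' :: "('p set, (real^'n) \<times> (real^'n)) mfd"
    unfolding unique_quotient_manifold[OF that] by (rule unique_conformal_class)
  ultimately show ?thesis using equiv_R by blast
qed

end
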